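(* Let $M$ be a closed oriented surface of genus at least two and let $(h,h^\star)\in\mathcal T\times\mathcal T$. Then the map $q\mapsto P_q(h,h^\star)$ from $\mathbb D^\times=\{q\in\mathbb C:0<|q|<1\}$ to $\mathcal P$ is holomorphic.
   Context: Notation. $\mathcal T$ is the Teichmüller space of hyperbolic metrics on $M$, $\mathcal P$ the space of complex projective structures on $M$ with its standard complex structure (for which the holonomy map to the $\mathrm{PSL}(2,\mathbb C)$-character variety of $\pi_1(M)$ is a local biholomorphism), $\widetilde M$ the universal cover. Write $q=\exp(-s+i\theta)$ with $s=-\log|q|$, $\theta=\arg q\in[0,2\pi)$. Labourie operator. For $(h,h^\star)\in\mathcal T\times\mathcal T$, the Labourie operator is the bundle morphism $b:TM\to TM$ such that: (1) $b$ is self-adjoint with respect to $h$; (2) $\det b=1$; (3) $\nabla_u(bv)-\nabla_v(bu)-b[u,v]=0$ for all vector fields $u,v$, with $\nabla$ the Levi-Civita connection of $h$; (4) $h(b\,\cdot,b\,\cdot)$ is isometric to $h^\star$ by a diffeomorphism isotopic to the identity (representatives are chosen so that $h^\star=h(b\,\cdot,b\,\cdot)$). These properties determine $b$ up to sign; the sign convention is that $b$ is negative definite, so that $-\tanh(s/2)b$ is positive definite for $s>0$. Landslide. Let $J$ be the complex structure on $M$ compatible with $h$ and the orientation, $E$ the identity of $TM$, $\beta_\theta=\cos(\theta/2)E+\sin(\theta/2)Jb$, and $L_\theta(h,h^\star)=\big(h(\beta_\theta\cdot,\beta_\theta\cdot),\,h(\beta_{\theta+\pi}\cdot,\beta_{\theta+\pi}\cdot)\big)\in\mathcal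 T\times\mathcal T$. Hyperbolic space. $\mathbb H^3=\{\xi\in\mathrm{Her}(2,\mathbb C):\det\xi=1,\operatorname{tr}\xi>0\}$ with the metric induced from $\langle\xi,\xi\rangle=-\det\xi$; $\mathrm{SL}(2,\mathbb C)$ acts by $(g,\xi)\mapsto g\xi g^*$. Its ideal boundary is $\mathbb CP^1$, $[v]$ corresponding to the null ray through $vv^*$. $\mathbb H^3$ is oriented so that the complex orientation of $\mathbb CP^1$ is its boundary orientation. For an immersion $f:\widetilde M\to\mathbb H^3$ with unit normal $n$ (where (oriented tangent plane, $n$) is positively oriented): $\mathrm I=\langle \mathrm df,\mathrm df\rangle$, $\mathrm{II}=\langle \mathrm df,\mathrm dn\rangle$, and the shape operator $B$ is defined by $\mathrm{II}(u,v)=\mathrm I(u,Bv)$. Smooth grafting. For $(h,h^\star)$ with Labourie operator $b$ and $s>0$, there is a unique (up to orientation-preserving isometry) immersion $f:\widetilde M\to\mathbb H^3$, equivariant under a representation of $\pi_1(M)$, with first fundamental form $\mathrm I=\cosh^2(s/2)h$ and shape operator $B=-\tanh(s/2)b$; it has constant Gaussian curvature $-1/\cosh^2(s/2)$. Sending $p\in\widetilde M$ to the endpoint in $\partial\mathbb H^3=\mathbb CP^1$ of the geodesic ray starting at $f(p)$ with initial velocity $n(p)$ gives a developing map $\widetilde M\to\mathbb CP^1$ of a complex projective structure on $M$, denoted $SGr_s(h,h^\star)$. Complex landslide flow. $P_q(h,h^\star)=SGr_s(L_\theta(h,h^\star))$ with $s=-\log|q|$, $\theta=\arg q$. *)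

theory Defs
  imports
    "HOL-Analysis.Analysis"
    "HOL-Complex_Analysis.Complex_Analysis"
    "HOL-Homology.Homology"
begin

section \<open>Smooth maps\<close>

fun iter_deriv :: "'a list \<Rightarrow> ('a::real_normed_vector \<Rightarrow> 'b::real_normed_vector) \<Rightarrow> 'a \<Rightarrow> 'b" where
  "iter_deriv [] f = f"
| "iter_deriv (v # vs) f = (\<lambda>x. frechet_derivative (iter_deriv vs f) (at x) v)"

(* C-infinity: all iterated directional derivatives exist and are Frechet differentiable. *)
definition smooth_on :: "'a::real_normed_vector set \<Rightarrow> ('a \<Rightarrow> 'b::real_normed_vector) \<Rightarrow> bool" where
  "smooth_on S f \<longleftrightarrow> open S \<and> (\<forall>vs. iter_deriv vs f differentiable_on S)"

abbreviation smooth :: "('a::real_normed_vector \<Rightarrow> 'b::real_normed_vector) \<Rightarrow> bool" where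
  "smooth \<equiv> smooth_on UNIV"

abbreviation D :: "('a::real_normed_vector \<Rightarrow> 'b::real_normed_vector) \<Rightarrow> 'a \<Rightarrow> 'a \<Rightarrow> 'b" where
  "D f x \<equiv> frechet_derivative f (at x)"

definition diffeo :: "(complex \<Rightarrow> complex) \<Rightarrow> bool" where
  "diffeo f \<longleftrightarrow> bij f \<and> smooth f \<and> smooth (inv_into UNIV f)"

(* Determinant of a real-linear endomorphism of the oriented real plane underlying complex. *)
definition det2 :: "(complex \<Rightarrow> complex) \<Rightarrow> real" where
  "det2 L = Im (cnj (L 1) * L \<i>)"


section \<open>Closed oriented surfaces and their universal covers\<close>

type_synonym 'm chart = "'m set \<times> ('m \<Rightarrow> complex)"

definition oriented_smooth_atlas :: "'m::topological_space chart set \<Rightarrow> bool" where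
  "oriented_smooth_atlas A \<longleftrightarrow>
     (\<Union>(U, \<phi>)\<in>A. U) = UNIV \<and>
     (\<forall>(U, \<phi>)\<in>A. open U \<and> open (\<phi> ` U) \<and> (\<exists>\<psi>. homeomorphism U (\<phi> ` U) \<phi> \<psi>)) \<and>
     (\<forall>(U, \<phi>)\<in>A. \<forall>(V, \<psi>)\<in>A.
        smooth_on (\<phi> ` (U \<inter> V)) (\<psi> \<circ> inv_into U \<phi>) \<and>
        (\<forall>z\<in>\<phi> ` (U \<inter> V). 0 < det2 (D (\<psi> \<circ> inv_into U \<phi>) z)))"

definition closed_oriented_surface :: "'m::t2_space chart set \<Rightarrow> bool" where
  "closed_oriented_surface A \<longleftrightarrow>
     compact (UNIV :: 'm set) \<and> connected (UNIV :: 'm set) \<and> oriented_smooth_atlas A"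

(* The genus of a closed connected oriented surface is half the rank of its first homology. *)
definition surface_genus :: "'m::t2_space itself \<Rightarrow> nat \<Rightarrow> bool" where
  "surface_genus _ g \<longleftrightarrow>
     homology_group 1 (euclidean :: 'm topology) \<cong> free_Abelian_group {..<2 * g}"

(* The universal cover of a closed oriented surface of positive genus is diffeomorphic, preserving
   orientation, to the plane, so the plane serves as the model of the universal cover.  Everything
   below is expressed on it: a tensor on the surface is a tensor on the plane invariant under the
   deck group, and the fundamental group is the deck group. *)
definition universal_cover :: "'m::t2_space chart set \<Rightarrow> (complex \<Rightarrow> 'm) \<Rightarrow> bool" where
  "universal_cover A p \<longleftrightarrow>
     covering_space UNIV p UNIV \<and>
     (\<forall>(U, \<phi>)\<in>A. smooth_on (p -` U) (\<phi> \<circ> p) \<and> (\<forall>z\<in>p -` U. 0 < det2 (D (\<phi> \<circ> p) z)))"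

definition deck :: "(complex \<Rightarrow> 'm) \<Rightarrow> (complex \<Rightarrow> complex) set" where
  "deck p = {\<gamma>. (\<exists>\<gamma>'. homeomorphism UNIV UNIV \<gamma> \<gamma>') \<and> p \<circ> \<gamma> = p}"

(* An isotopy from the identity on the surface lifts uniquely to an isotopy from the identity on the
   universal cover, and the lift commutes with the deck group.  The time parameter may run over all
   reals since an isotopy over [0,1] can be reparametrised. *)
definition isotopic_to_id :: "(complex \<Rightarrow> 'm) \<Rightarrow> (complex \<Rightarrow> complex) \<Rightarrow> bool" where
  "isotopic_to_id p \<phi> \<longleftrightarrow>
     (\<exists>\<Phi> :: real \<times> complex \<Rightarrow> complex.
        smooth \<Phi> \<and> (\<forall>x. \<Phi> (0, x) = x) \<and> (\<forall>x. \<Phi> (1, x) = \<phi> x) \<and>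
        (\<forall>t. diffeo (\<lambda>x. \<Phi> (t, x)) \<and> (\<forall>\<gamma>\<in>deck p. \<forall>x. \<Phi> (t, \<gamma> x) = \<gamma> (\<Phi> (t, x)))))"


section \<open>Hyperbolic metrics and Teichmueller space\<close>

(* h x u v: the inner product at x of tangent vectors u and v *)
type_synonym metric = "complex \<Rightarrow> complex \<Rightarrow> complex \<Rightarrow> real"

(* b x u: the endomorphism of the tangent plane at x, applied to u *)
type_synonym endo = "complex \<Rightarrow> complex \<Rightarrow> complex"

definition riemannian_metric :: "(complex \<Rightarrow> 'm) \<Rightarrow> metric \<Rightarrow> bool" where
  "riemannian_metric p h \<longleftrightarrow>
     (\<forall>x. bilinear (h x) \<and> (\<forall>u v. h x u v = h x v u) \<and> (\<forall>u. u \<noteq> 0 \<longrightarrow> 0 < h x u u)) \<and>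
     (\<forall>u v. smooth (\<lambda>x. h x u v)) \<and>
     (\<forall>\<gamma>\<in>deck p. \<forall>x u v. h (\<gamma> x) (D \<gamma> x u) (D \<gamma> x v) = h x u v)"

(* The covariant derivative of the constant field v along the constant field u (Koszul formula). *)
definition christoffel :: "metric \<Rightarrow> complex \<Rightarrow> complex \<Rightarrow> complex \<Rightarrow> complex" where
  "christoffel h x u v =
     (THE w. \<forall>z. h x w z =
        (D (\<lambda>y. h y v z) x u + D (\<lambda>y. h y u z) x v - D (\<lambda>y. h y u v) x z) / 2)"

(* Levi-Civita connection: the derivative of the field V along the field U *)
definition nabla ::
    "metric \<Rightarrow> (complex \<Rightarrow> complex) \<Rightarrow> (complex \<Rightarrow> complex) \<Rightarrow> complex \<Rightarrow> complex" where
  "nabla h U V x = D V x (U x) + christoffel h x (U x) (V x)"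

definition lie_bracket ::
    "(complex \<Rightarrow> complex) \<Rightarrow> (complex \<Rightarrow> complex) \<Rightarrow> complex \<Rightarrow> complex" where
  "lie_bracket U V x = D V x (U x) - D U x (V x)"

(* R(u,v)w; the bracket term vanishes because u, v are extended to constant fields. *)
definition riemann_curvature ::
    "metric \<Rightarrow> complex \<Rightarrow> complex \<Rightarrow> complex \<Rightarrow> complex \<Rightarrow> complex" where
  "riemann_curvature h x u v w =
     nabla h (\<lambda>_. u) (nabla h (\<lambda>_. v) (\<lambda>_. w)) x - nabla h (\<lambda>_. v) (nabla h (\<lambda>_. u) (\<lambda>_. w)) x"

definition gauss_curvature :: "metric \<Rightarrow> complex \<Rightarrow> real" where
  "gauss_curvature h x =
     h x (riemann_curvature h x 1 \<i> \<i>) 1 / (h x 1 1 * h x \<i> \<i> - (h x 1 \<i>)\<^sup>2)"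

definition hyperbolic_metric :: "(complex \<Rightarrow> 'm) \<Rightarrow> metric \<Rightarrow> bool" where
  "hyperbolic_metric p h \<longleftrightarrow> riemannian_metric p h \<and> (\<forall>x. gauss_curvature h x = -1)"

definition pullback_metric :: "(complex \<Rightarrow> complex) \<Rightarrow> metric \<Rightarrow> metric" where
  "pullback_metric \<phi> h = (\<lambda>x u v. h (\<phi> x) (D \<phi> x u) (D \<phi> x v))"

definition teich_class :: "(complex \<Rightarrow> 'm) \<Rightarrow> metric \<Rightarrow> metric set" where
  "teich_class p h = {pullback_metric \<phi> h | \<phi>. isotopic_to_id p \<phi>}"

definition Teich :: "(complex \<Rightarrow> 'm) \<Rightarrow> metric set set" where
  "Teich p = teich_class p ` {h. hyperbolic_metric p h}"


section \<open>Labourie operator and landslides\<close>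

(* b is the Labourie operator of (h, hs), for representatives chosen so that hs = h(b., b.).
   The Codazzi expression is tensorial, so it may be tested on fields on the universal cover. *)
definition is_labourie :: "(complex \<Rightarrow> 'm) \<Rightarrow> metric \<Rightarrow> metric \<Rightarrow> endo \<Rightarrow> bool" where
  "is_labourie p h hs b \<longleftrightarrow>
     (\<forall>x. linear (b x)) \<and> (\<forall>u. smooth (\<lambda>x. b x u)) \<and>
     (\<forall>\<gamma>\<in>deck p. \<forall>x u. b (\<gamma> x) (D \<gamma> x u) = D \<gamma> x (b x u)) \<and>
     (\<forall>x u v. h x (b x u) v = h x u (b x v)) \<and>
     (\<forall>x. det2 (b x) = 1) \<and>
     (\<forall>U V. smooth U \<and> smooth V \<longrightarrow>
        (\<forall>x. nabla h U (\<lambda>y. b y (V y)) x - nabla h V (\<lambda>y. b y (U y)) x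
               - b x (lie_bracket U V x) = 0)) \<and>
     (\<forall>x u v. hs x u v = h x (b x u) (b x v)) \<and>
     (\<forall>x u. u \<noteq> 0 \<longrightarrow> h x (b x u) u < 0)"

definition labourie :: "(complex \<Rightarrow> 'm) \<Rightarrow> metric \<Rightarrow> metric \<Rightarrow> endo" where
  "labourie p h hs = (THE b. is_labourie p h hs b)"

definition complex_str :: "metric \<Rightarrow> endo" where
  "complex_str h x =
     (THE j. linear j \<and> (\<forall>u. j (j u) = - u) \<and> (\<forall>u v. h x (j u) (j v) = h x u v) \<and>
             (\<forall>u. u \<noteq> 0 \<longrightarrow> 0 < Im (cnj u * j u)))"

definition beta :: "metric \<Rightarrow> endo \<Rightarrow> real \<Rightarrow> endo" where
  "beta h b \<theta> x u = cos (\<theta> / 2) *\<^sub>R u + sin (\<theta> / 2) *\<^sub>R complex_str h x (b x u)"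

definition landslide :: "(complex \<Rightarrow> 'm) \<Rightarrow> real \<Rightarrow> metric \<times> metric \<Rightarrow> metric \<times> metric" where
  "landslide p \<theta> = (\<lambda>(h, hs).
     let \<beta> = beta h (labourie p h hs) in
       (\<lambda>x u v. h x (\<beta> \<theta> x u) (\<beta> \<theta> x v),
        \<lambda>x u v. h x (\<beta> (\<theta> + pi) x u) (\<beta> (\<theta> + pi) x v)))"


section \<open>Hyperbolic space and its ideal boundary\<close>

type_synonym cmat2 = "complex^2^2"

definition hconj :: "cmat2 \<Rightarrow> cmat2" where
  "hconj a = (\<chi> i j. cnj (a $ j $ i))"

definition Her :: "cmat2 set" where
  "Her = {\<xi>. hconj \<xi> = \<xi>}"

(* Polarisation of the quadratic form -det on Her. *)
definition mink :: "cmat2 \<Rightarrow> cmat2 \<Rightarrow> real" where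
  "mink \<xi> \<eta> = - Re (det (\<xi> + \<eta>) - det \<xi> - det \<eta>) / 2"

definition H3 :: "cmat2 set" where
  "H3 = {\<xi>\<in>Her. det \<xi> = 1 \<and> 0 < Re (trace \<xi>)}"

definition act :: "cmat2 \<Rightarrow> cmat2 \<Rightarrow> cmat2" where
  "act g \<xi> = g ** \<xi> ** hconj g"

(* A ray in the future cone is represented by its element of trace one. *)
definition ray :: "cmat2 \<Rightarrow> cmat2" where
  "ray \<xi> = (1 / Re (trace \<xi>)) *\<^sub>R \<xi>"

definition CP1_point :: "complex^2 \<Rightarrow> cmat2" where
  "CP1_point v = ray (\<chi> i j. v $ i * cnj (v $ j))"

(* The complex projective line, as the space of future null rays *)
definition CP1 :: "cmat2 set" where
  "CP1 = CP1_point ` {v. v \<noteq> 0}"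

(* The action of SL(2,C) on null rays; mobius g (CP1_point v) = CP1_point (g *v v). *)
definition mobius :: "cmat2 \<Rightarrow> cmat2 \<Rightarrow> cmat2" where
  "mobius g N = ray (act g N)"

(* Orientation of the tangent space of H3 at xi.  The expression is SL(2,C)-invariant; at the
   identity matrix it says that the Pauli matrices (sigma_x, sigma_y, sigma_z) are positive.  This
   makes the complex orientation of CP1 the boundary orientation: the curve of points [z : 1] has at
   z = 0 the outward direction -sigma_z and the derivatives sigma_x, -sigma_y along 1 and i (up to
   a positive factor). *)
definition positively_oriented :: "cmat2 \<Rightarrow> cmat2 \<Rightarrow> cmat2 \<Rightarrow> cmat2 \<Rightarrow> bool" where
  "positively_oriented \<xi> X Y Z \<longleftrightarrow>
     0 < Im (trace (matrix_inv \<xi> ** X ** matrix_inv \<xi> ** Y ** matrix_inv \<xi> ** Z))"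

definition ideal_endpoint :: "cmat2 \<Rightarrow> cmat2 \<Rightarrow> cmat2" where
  "ideal_endpoint \<xi> \<nu> = Lim at_top (\<lambda>t. ray (cosh t *\<^sub>R \<xi> + sinh t *\<^sub>R \<nu>))"

(* A representation of the fundamental group in PSL(2,C), through matrices chosen up to sign. *)
definition psl_rep :: "(complex \<Rightarrow> 'm) \<Rightarrow> ((complex \<Rightarrow> complex) \<Rightarrow> cmat2) \<Rightarrow> bool" where
  "psl_rep p \<rho> \<longleftrightarrow>
     (\<forall>\<gamma>\<in>deck p. det (\<rho> \<gamma>) = 1) \<and>
     (\<forall>\<gamma>\<in>deck p. \<forall>\<delta>\<in>deck p. \<rho> (\<gamma> \<circ> \<delta>) = \<rho> \<gamma> ** \<rho> \<delta> \<or> \<rho> (\<gamma> \<circ> \<delta>) = - (\<rho> \<gamma> ** \<rho> \<delta>))"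


section \<open>Surfaces in hyperbolic space\<close>

definition immersion_H3 :: "(complex \<Rightarrow> cmat2) \<Rightarrow> bool" where
  "immersion_H3 f \<longleftrightarrow> smooth f \<and> range f \<subseteq> H3 \<and> (\<forall>x. inj (D f x))"

definition unit_normal :: "(complex \<Rightarrow> cmat2) \<Rightarrow> complex \<Rightarrow> cmat2" where
  "unit_normal f x =
     (THE n. n \<in> Her \<and> mink n (f x) = 0 \<and> (\<forall>u. mink n (D f x u) = 0) \<and> mink n n = 1 \<and>
             positively_oriented (f x) (D f x 1) (D f x \<i>) n)"

definition fundamental_form_I :: "(complex \<Rightarrow> cmat2) \<Rightarrow> metric" where
  "fundamental_form_I f x u v = mink (D f x u) (D f x v)"

definition fundamental_form_II :: "(complex \<Rightarrow> cmat2) \<Rightarrow> metric" where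
  "fundamental_form_II f x u v = mink (D f x u) (D (unit_normal f) x v)"

definition shape_operator :: "(complex \<Rightarrow> cmat2) \<Rightarrow> endo" where
  "shape_operator f x v =
     (THE w. \<forall>u. fundamental_form_II f x u v = fundamental_form_I f x u w)"

definition gauss_map :: "(complex \<Rightarrow> cmat2) \<Rightarrow> complex \<Rightarrow> cmat2" where
  "gauss_map f x = ideal_endpoint (f x) (unit_normal f x)"


section \<open>The space of complex projective structures\<close>

definition holonomy ::
    "(complex \<Rightarrow> 'm) \<Rightarrow> (complex \<Rightarrow> cmat2) \<Rightarrow> ((complex \<Rightarrow> complex) \<Rightarrow> cmat2) \<Rightarrow> bool" where
  "holonomy p d \<rho> \<longleftrightarrow>
     psl_rep p \<rho> \<and> (\<forall>\<gamma>\<in>deck p. \<forall>x. d (\<gamma> x) = mobius (\<rho> \<gamma>) (d x))"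

(* The orientation condition: dev is a local diffeomorphism preserving the complex orientation of CP1.
   A point N of CP1 lies in the direction 2N - 1 from the identity matrix 1, and at 1 a pair of
   tangent vectors of CP1 followed by 2N - 1 is positive iff it is so followed by N, because the
   trace of a product of two Hermitian matrices is real. *)
definition developing_map :: "(complex \<Rightarrow> 'm) \<Rightarrow> (complex \<Rightarrow> cmat2) \<Rightarrow> bool" where
  "developing_map p d \<longleftrightarrow>
     smooth d \<and> range d \<subseteq> CP1 \<and>
     (\<forall>x. positively_oriented (mat 1) (D d x 1) (D d x \<i>) (d x)) \<and>
     (\<exists>\<rho>. holonomy p d \<rho>)"

definition proj_class :: "(complex \<Rightarrow> 'm) \<Rightarrow> (complex \<Rightarrow> cmat2) \<Rightarrow> (complex \<Rightarrow> cmat2) set" where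
  "proj_class p d = {\<lambda>x. mobius g (d (\<phi> x)) | g \<phi>. det g = 1 \<and> isotopic_to_id p \<phi>}"

definition Proj :: "(complex \<Rightarrow> 'm) \<Rightarrow> (complex \<Rightarrow> cmat2) set set" where
  "Proj p = proj_class p ` {d. developing_map p d}"

(* Basic neighbourhoods of d for uniform convergence of all derivatives on compact sets *)
definition dev_nbhd ::
    "(complex \<Rightarrow> 'm) \<Rightarrow> (complex \<Rightarrow> cmat2) \<Rightarrow> complex set \<Rightarrow> nat \<Rightarrow> real \<Rightarrow> (complex \<Rightarrow> cmat2) set" where
  "dev_nbhd p d K k e =
     {d'. developing_map p d' \<and>
          (\<forall>vs. length vs \<le> k \<and> set vs \<subseteq> {1, \<i>} \<longrightarrow>
             (\<forall>x\<in>K. norm (iter_deriv vs d' x - iter_deriv vs d x) < e))}"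

definition dev_topology :: "(complex \<Rightarrow> 'm) \<Rightarrow> (complex \<Rightarrow> cmat2) topology" where
  "dev_topology p = topology (\<lambda>W. W \<subseteq> {d. developing_map p d} \<and>
     (\<forall>d\<in>W. \<exists>K k e. compact K \<and> 0 < e \<and> dev_nbhd p d K k e \<subseteq> W))"

(* The quotient topology *)
definition Proj_topology :: "(complex \<Rightarrow> 'm) \<Rightarrow> (complex \<Rightarrow> cmat2) set topology" where
  "Proj_topology p = topology (\<lambda>W. W \<subseteq> Proj p \<and>
     openin (dev_topology p) {d. developing_map p d \<and> proj_class p d \<in> W})"

lemma istopology_dev:
  "istopology (\<lambda>W. W \<subseteq> {d. developing_map p d} \<and>
     (\<forall>d\<in>W. \<exists>K k e. compact K \<and> 0 < e \<and> dev_nbhd p d K k e \<subseteq> W))"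
  unfolding istopology_def
proof (intro conjI allI impI ballI)
  fix S T d
  assume S: "S \<subseteq> {d. developing_map p d} \<and>
     (\<forall>d\<in>S. \<exists>K k e. compact K \<and> 0 < e \<and> dev_nbhd p d K k e \<subseteq> S)"
    and T: "T \<subseteq> {d. developing_map p d} \<and>
     (\<forall>d\<in>T. \<exists>K k e. compact K \<and> 0 < e \<and> dev_nbhd p d K k e \<subseteq> T)"
    and d: "d \<in> S \<inter> T"
  obtain K k e where 1: "compact K" "0 < e" "dev_nbhd p d K k e \<subseteq> S"
    using S d by blast
  obtain L l e' where 2: "compact L" "0 < e'" "dev_nbhd p d L l e' \<subseteq> T"
    using T d by blast
  have "dev_nbhd p d (K \<union> L) (max k l) (min e e') \<subseteq> dev_nbhd p d K k e \<inter> dev_nbhd p d L l e'"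
    by (auto simp: dev_nbhd_def)
  then show "\<exists>K k e. compact K \<and> 0 < e \<and> dev_nbhd p d K k e \<subseteq> S \<inter> T"
    using 1 2 by (intro exI[of _ "K \<union> L"] exI[of _ "max k l"] exI[of _ "min e e'"]) auto
next
  fix S T
  assume "S \<subseteq> {d. developing_map p d} \<and>
     (\<forall>d\<in>S. \<exists>K k e. compact K \<and> 0 < e \<and> dev_nbhd p d K k e \<subseteq> S)"
  then show "S \<inter> T \<subseteq> {d. developing_map p d}" by blast
next
  fix \<K> :: "(complex \<Rightarrow> cmat2) set set"
  assume "\<forall>S\<in>\<K>. S \<subseteq> {d. developing_map p d} \<and>
     (\<forall>d\<in>S. \<exists>K k e. compact K \<and> 0 < e \<and> dev_nbhd p d K k e \<subseteq> S)"
  then show "\<Union>\<K> \<subseteq> {d. developing_map p d}" by blast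
next
  fix \<K> :: "(complex \<Rightarrow> cmat2) set set" and d
  assume *: "\<forall>S\<in>\<K>. S \<subseteq> {d. developing_map p d} \<and>
     (\<forall>d\<in>S. \<exists>K k e. compact K \<and> 0 < e \<and> dev_nbhd p d K k e \<subseteq> S)" and "d \<in> \<Union>\<K>"
  from \<open>d \<in> \<Union>\<K>\<close> obtain S where S: "S \<in> \<K>" "d \<in> S" by (rule UnionE)
  from bspec[OF conjunct2[OF bspec[OF * S(1)]] S(2)]
  obtain K k e where K: "compact K" "0 < e" "dev_nbhd p d K k e \<subseteq> S" by (elim exE conjE)
  have "S \<subseteq> \<Union>\<K>" using S(1) by (rule Union_upper)
  with K show "\<exists>K k e. compact K \<and> 0 < e \<and> dev_nbhd p d K k e \<subseteq> \<Union>\<K>"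
    by (intro exI[of _ K] exI[of _ k] exI[of _ e] conjI subset_trans[OF K(3)])
qed

lemma openin_dev_topology:
  "openin (dev_topology p) W \<longleftrightarrow> W \<subseteq> {d. developing_map p d} \<and>
     (\<forall>d\<in>W. \<exists>K k e. compact K \<and> 0 < e \<and> dev_nbhd p d K k e \<subseteq> W)"
  unfolding dev_topology_def by (simp only: topology_inverse'[OF istopology_dev])

lemma istopology_Proj:
  "istopology (\<lambda>W. W \<subseteq> Proj p \<and>
     openin (dev_topology p) {d. developing_map p d \<and> proj_class p d \<in> W})"
  unfolding istopology_def
proof (intro conjI allI impI)
  fix S T
  assume S: "S \<subseteq> Proj p \<and> openin (dev_topology p) {d. developing_map p d \<and> proj_class p d \<in> S}"
    and T: "T \<subseteq> Proj p \<and> openin (dev_topology p) {d. developing_map p d \<and> proj_class p d \<in> T}"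
  have eq: "{d. developing_map p d \<and> proj_class p d \<in> S \<inter> T} =
      {d. developing_map p d \<and> proj_class p d \<in> S} \<inter> {d. developing_map p d \<and> proj_class p d \<in> T}"
    by blast
  show "openin (dev_topology p) {d. developing_map p d \<and> proj_class p d \<in> S \<inter> T}"
    unfolding eq using S T by (intro openin_Int) auto
  show "S \<inter> T \<subseteq> Proj p" using S by blast
next
  fix \<K> :: "(complex \<Rightarrow> cmat2) set set set"
  assume *: "\<forall>S\<in>\<K>. S \<subseteq> Proj p \<and>
      openin (dev_topology p) {d. developing_map p d \<and> proj_class p d \<in> S}"
  have eq: "{d. developing_map p d \<and> proj_class p d \<in> \<Union>\<K>} =
      (\<Union>S\<in>\<K>. {d. developing_map p d \<and> proj_class p d \<in> S})"
    by blast
  show "openin (dev_topology p) {d. developing_map p d \<and> proj_class p d \<in> \<Union>\<K>}"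
    unfolding eq using * by (intro openin_Union) auto
  show "\<Union>\<K> \<subseteq> Proj p" using * by blast
qed

lemma openin_Proj_topology:
  "openin (Proj_topology p) W \<longleftrightarrow> W \<subseteq> Proj p \<and>
     openin (dev_topology p) {d. developing_map p d \<and> proj_class p d \<in> W}"
  unfolding Proj_topology_def by (simp only: topology_inverse'[OF istopology_Proj])

lemma topspace_Proj_topology: "topspace (Proj_topology p) = Proj p"
proof
  show "topspace (Proj_topology p) \<subseteq> Proj p"
    using openin_Proj_topology openin_topspace by blast
  have eq: "{d. developing_map p d \<and> proj_class p d \<in> Proj p} = {d. developing_map p d}"
    by (auto simp: Proj_def)
  have "openin (dev_topology p) {d. developing_map p d}"
    unfolding openin_dev_topology
  proof (intro conjI ballI)
    fix d
    have "dev_nbhd p d {} 0 1 \<subseteq> {d. developing_map p d}"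
      by (auto simp: dev_nbhd_def)
    then show "\<exists>K k e. compact K \<and> 0 < e \<and> dev_nbhd p d K k e \<subseteq> {d. developing_map p d}"
      by (meson compact_empty zero_less_one)
  qed simp
  then have "openin (Proj_topology p) (Proj p)"
    unfolding openin_Proj_topology eq by simp
  then show "Proj p \<subseteq> topspace (Proj_topology p)"
    by (rule openin_subset)
qed

(* G is complex differentiable at R as a function of the entries of the matrices R(gamma),
   gamma in the finite set S; in particular, the value of G at R depends on these matrices only. *)
definition entrywise_complex_differentiable ::
    "'g set \<Rightarrow> (('g \<Rightarrow> cmat2) \<Rightarrow> complex) \<Rightarrow> ('g \<Rightarrow> cmat2) \<Rightarrow> bool" where
  "entrywise_complex_differentiable S G R \<longleftrightarrow>
     (\<exists>c :: 'g \<Rightarrow> cmat2. \<forall>\<epsilon>>0. \<exists>\<delta>>0. \<forall>R'. (\<forall>\<gamma>\<in>S. norm (R' \<gamma> - R \<gamma>) < \<delta>) \<longrightarrow>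
        norm (G R' - G R - (\<Sum>\<gamma>\<in>S. \<Sum>i\<in>UNIV. \<Sum>j\<in>UNIV. c \<gamma> $ i $ j * (R' \<gamma> - R \<gamma>) $ i $ j))
          \<le> \<epsilon> * (\<Sum>\<gamma>\<in>S. norm (R' \<gamma> - R \<gamma>)))"

(* The structure sheaf of the standard complex structure on the space of projective structures, i.e.
   the one for which the holonomy map to the character variety is a local biholomorphism: a function
   on an open set W is holomorphic iff, near each point, it is a holomorphic function of the holonomy
   representation.  Here a holomorphic function on the representation variety is locally a
   holomorphic function of the matrix entries (with locally chosen signs) of finitely many group
   elements; invariance under conjugation is automatic as phi only depends on the class Z'. *)
definition Proj_holomorphic_function ::
    "(complex \<Rightarrow> 'm) \<Rightarrow> (complex \<Rightarrow> cmat2) set set \<Rightarrow> ((complex \<Rightarrow> cmat2) set \<Rightarrow> complex) \<Rightarrow> bool" where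
  "Proj_holomorphic_function p W \<phi> \<longleftrightarrow>
     (\<forall>Z\<in>W. \<forall>d\<in>Z. \<forall>\<rho>. holonomy p d \<rho> \<longrightarrow>
        (\<exists>S r G W'. finite S \<and> S \<subseteq> deck p \<and> 0 < r \<and>
           openin (Proj_topology p) W' \<and> Z \<in> W' \<and> W' \<subseteq> W \<and>
           (\<forall>R. (\<forall>\<gamma>\<in>S. norm (R \<gamma> - \<rho> \<gamma>) < r) \<longrightarrow> entrywise_complex_differentiable S G R) \<and>
           (\<forall>Z'\<in>W'. \<forall>d'\<in>Z'. \<forall>\<rho>'. holonomy p d' \<rho>' \<and> (\<forall>\<gamma>\<in>S. norm (\<rho>' \<gamma> - \<rho> \<gamma>) < r) \<longrightarrow>
              \<phi> Z' = G \<rho>')))"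

(* Holomorphic maps from an open subset of the complex plane: morphisms of ringed spaces *)
definition holomorphic_into_Proj ::
    "(complex \<Rightarrow> 'm) \<Rightarrow> complex set \<Rightarrow> (complex \<Rightarrow> (complex \<Rightarrow> cmat2) set) \<Rightarrow> bool" where
  "holomorphic_into_Proj p \<Omega> F \<longleftrightarrow>
     continuous_map (top_of_set \<Omega>) (Proj_topology p) F \<and>
     (\<forall>W \<phi>. openin (Proj_topology p) W \<and> Proj_holomorphic_function p W \<phi> \<longrightarrow>
        (\<lambda>q. \<phi> (F q)) holomorphic_on {q\<in>\<Omega>. F q \<in> W})"


section \<open>Smooth grafting and the complex landslide flow\<close>

definition grafting_immersion ::
    "(complex \<Rightarrow> 'm) \<Rightarrow> real \<Rightarrow> metric \<Rightarrow> endo \<Rightarrow> (complex \<Rightarrow> cmat2) \<Rightarrow> bool" where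
  "grafting_immersion p s h b f \<longleftrightarrow>
     immersion_H3 f \<and>
     (\<exists>\<rho>. psl_rep p \<rho> \<and> (\<forall>\<gamma>\<in>deck p. \<forall>x. f (\<gamma> x) = act (\<rho> \<gamma>) (f x))) \<and>
     (\<forall>x u v. fundamental_form_I f x u v = (cosh (s / 2))\<^sup>2 * h x u v) \<and>
     (\<forall>x u. shape_operator f x u = - tanh (s / 2) *\<^sub>R b x u)"

definition SGr ::
    "(complex \<Rightarrow> 'm) \<Rightarrow> real \<Rightarrow> metric \<times> metric \<Rightarrow> (complex \<Rightarrow> cmat2) set" where
  "SGr p s = (\<lambda>(h, hs).
     proj_class p (gauss_map (SOME f. grafting_immersion p s h (labourie p h hs) f)))"

definition complex_landslide ::
    "(complex \<Rightarrow> 'm) \<Rightarrow> complex \<Rightarrow> metric \<times> metric \<Rightarrow> (complex \<Rightarrow> cmat2) set" where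
  "complex_landslide p q x = SGr p (- ln (norm q)) (landslide p (Arg2pi q) x)"

end

(* Write h = |tau|^2 for a complex coframe tau with connection form omega, and put sigma = i tau o b,
   where b is the Labourie operator.  The Gauss equation and the Codazzi equation for b say exactly
   that for every complex zeta the sl(2,C)-valued form
     A_zeta = 1/2 ( i omega, c cnj tau + s cnj sigma ; c tau + s sigma, - i omega ),
   with c = cos (zeta/2) and s = sin (zeta/2), is flat.  Let Psi_zeta solve dPsi = Psi A_zeta with
   Psi_zeta(0) = 1.  The landslide by theta rotates (tau, sigma) by theta/2, which turns A_is into
   A_(theta + is); hence for zeta = theta + is with s > 0 the surface Psi_zeta Psi_zeta^* has the
   fundamental forms of the smooth grafting of the landslide.  By rigidity P_q(h,hs), q = exp(i zeta),
   is therefore represented by the developing map x -> [Psi_zeta(x) e_1], whose holonomy is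
   gamma -> Psi_zeta(gamma 0) diag(cnj k, k), k^2 being the rotation by which gamma changes the frame
   at 0.  As A_zeta is entire in zeta, so is Psi_zeta(x), and the holonomy depends holomorphically on
   zeta; the x-derivatives of the developing map depend continuously on zeta. *)

theory Submission
  imports Defs
begin

section \<open>Parametrised \<open>C\<^sup>k\<close> maps\<close>

text \<open>A point of \<open>Proj\<close> is a class of developing maps, and holomorphy is tested
  by functions that see only the holonomy. So one family of developing maps is wanted whose
  x-derivatives all vary continuously with \<zeta>, with holonomy matrices whose entries are complex
  differentiable. Integration along rays from 0 makes the flat equation a linear equation on [0,1]
  with parameters (\<zeta>, x); flatness solves its variational equation in x in closed form, and
  higher x-derivatives follow from d\<Psi> = \<Psi> A. Hence \<open>Ck\<close>: order k in x, mere
  continuity in the parameter.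

  Since b, the normal and the immersion are given by \<open>THE\<close> and \<open>SOME\<close>,
  uniqueness carries the weight: rigidity replaces the chosen immersion by the explicit surface and,
  applied to its composite with a deck map, yields the holonomy. As q fixes \<zeta> only modulo 2 pi
  while A involves \<zeta>/2, the landslide must be seen to ignore a sign; local logarithms then
  suffice.\<close>

primrec Ck :: "nat \<Rightarrow> 'a::real_normed_vector set \<Rightarrow> ('p::topological_space \<Rightarrow> 'a \<Rightarrow> 'b::real_normed_vector) \<Rightarrow> bool" where
  "Ck 0 S F \<longleftrightarrow> continuous_on (UNIV \<times> S) (\<lambda>(p, x). F p x)"
| "Ck (Suc k) S F \<longleftrightarrow> continuous_on (UNIV \<times> S) (\<lambda>(p, x). F p x) \<and>
     (\<forall>p. \<forall>x\<in>S. F p differentiable at x) \<and> (\<forall>v. Ck k S (\<lambda>p x. D (F p) x v))"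

lemma Ck_imp_continuous: "Ck k S F \<Longrightarrow> continuous_on (UNIV \<times> S) (\<lambda>(p, x). F p x)"
  by (cases k) auto

lemma Ck_Suc_D: "Ck (Suc k) S F \<Longrightarrow> Ck k S F"
proof (induction k arbitrary: F)
  case (Suc k)
  have "Ck k S (\<lambda>p x. D (F p) x v)" for v
    using Suc.prems by (intro Suc.IH) simp
  then show ?case using Suc.prems by simp
qed auto

lemma Ck_has_derivative: "Ck (Suc k) S F \<Longrightarrow> x \<in> S \<Longrightarrow> (F p has_derivative D (F p) x) (at x)"
  by (simp add: frechet_derivative_works[symmetric])

lemma Ck_cong:
  assumes "open S"
  shows "(\<And>p x. x \<in> S \<Longrightarrow> F p x = G p x) \<Longrightarrow> Ck k S F \<longleftrightarrow> Ck k S G"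
proof (induction k arbitrary: F G)
  case 0
  have "continuous_on (UNIV \<times> S) (\<lambda>(p, x). F p x) = continuous_on (UNIV \<times> S) (\<lambda>(p, x). G p x)"
    by (rule continuous_on_cong) (auto simp: 0)
  then show ?case by simp
next
  case (Suc k)
  have c: "continuous_on (UNIV \<times> S) (\<lambda>(p, x). F p x) = continuous_on (UNIV \<times> S) (\<lambda>(p, x). G p x)"
    by (rule continuous_on_cong) (auto simp: Suc)
  have h: "(F p has_derivative f') (at x) \<longleftrightarrow> (G p has_derivative f') (at x)" if "x \<in> S" for p x f'
    using has_derivative_transform_within_open[OF _ assms that, of "F p" f' UNIV "G p"]
      has_derivative_transform_within_open[OF _ assms that, of "G p" f' UNIV "F p"] Suc.prems by auto
  have d: "D (F p) x = D (G p) x" if "x \<in> S" for p x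
    using h[OF that] by (simp add: frechet_derivative_def)
  have e: "F p differentiable at x \<longleftrightarrow> G p differentiable at x" if "x \<in> S" for p x
    using h[OF that] by (simp add: differentiable_def)
  have "Ck k S (\<lambda>p x. D (F p) x v) \<longleftrightarrow> Ck k S (\<lambda>p x. D (G p) x v)" for v
    by (rule Suc.IH) (simp add: d)
  then show ?case using c e by auto
qed

lemma Ck_SucI:
  assumes S: "open S" and "Ck 0 S F" and F': "\<And>p x. x \<in> S \<Longrightarrow> (F p has_derivative F' p x) (at x)"
    and "\<And>v. Ck k S (\<lambda>p x. F' p x v)"
  shows "Ck (Suc k) S F"
proof -
  have "D (F p) x = F' p x" if "x \<in> S" for p x
    using frechet_derivative_at[OF F'[OF that]] by simp
  then have "Ck k S (\<lambda>p x. D (F p) x v) = Ck k S (\<lambda>p x. F' p x v)" for v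
    by (rule_tac Ck_cong[OF S]) metis
  moreover have "F p differentiable at x" if "x \<in> S" for p x
    using F'[OF that] unfolding differentiable_def by blast
  ultimately show ?thesis using assms(2,4) by simp
qed

lemma Ck_param:
  fixes S :: "'a::real_normed_vector set" and c :: "'p::topological_space \<Rightarrow> 'b::real_normed_vector"
  shows "continuous_on UNIV c \<Longrightarrow> open S \<Longrightarrow> Ck k S (\<lambda>p x. c p)"
proof (induction k arbitrary: c)
  case (0 c)
  then show ?case by (auto simp: split_def intro!: continuous_intros continuous_on_compose2[of UNIV c])
next
  case (Suc k c)
  have "Ck k S (\<lambda>(p::'p) x. 0::'b)" by (intro Suc.IH continuous_intros Suc.prems)
  with Suc show ?case
    by (intro Ck_SucI[where F' = "\<lambda>p x v. 0"])
     (auto simp: split_def intro!: continuous_intros continuous_on_compose2[of UNIV c])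
qed

lemma Ck_const: "open S \<Longrightarrow> Ck k S (\<lambda>p x. c)"
  by (rule Ck_param) auto

lemma Ck_bounded_linear:
  assumes "bounded_linear L" "open S" "Ck k S F"
  shows "Ck k S (\<lambda>p x. L (F p x))"
  using assms(3)
proof (induction k arbitrary: F)
  case (0 F)
  then show ?case
    using bounded_linear.continuous_on[OF assms(1), of "UNIV \<times> S" "\<lambda>(p, x). F p x"] by (simp add: split_def)
next
  case (Suc k F)
  show ?case
  proof (rule Ck_SucI[OF assms(2), where F' = "\<lambda>p x v. L (D (F p) x v)"])
    show "Ck 0 S (\<lambda>p x. L (F p x))"
      using bounded_linear.continuous_on[OF assms(1), of "UNIV \<times> S" "\<lambda>(p, x). F p x"] Ck_imp_continuous[OF Suc.prems]
      by (simp add: split_def)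
    show "((\<lambda>x. L (F p x)) has_derivative (\<lambda>v. L (D (F p) x v))) (at x)" if "x \<in> S" for p x
      by (intro bounded_linear.has_derivative[OF assms(1)] Ck_has_derivative[OF Suc.prems that])
    show "Ck k S (\<lambda>p x. L (D (F p) x v))" for v
      using Suc by simp
  qed
qed

lemma Ck_add:
  assumes "open S" "Ck k S F" "Ck k S G"
  shows "Ck k S (\<lambda>p x. F p x + G p x)"
  using assms(2,3)
proof (induction k arbitrary: F G)
  case (0 F G)
  then show ?case by (auto simp: split_def intro!: continuous_intros)
next
  case (Suc k F G)
  show ?case
  proof (rule Ck_SucI[OF assms(1), where F' = "\<lambda>p x v. D (F p) x v + D (G p) x v"])
    show "Ck 0 S (\<lambda>p x. F p x + G p x)"
      using Suc.prems[THEN Ck_imp_continuous] by (auto simp: split_def intro!: continuous_intros)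
    show "((\<lambda>x. F p x + G p x) has_derivative (\<lambda>v. D (F p) x v + D (G p) x v)) (at x)" if "x \<in> S" for p x
      by (intro has_derivative_add Ck_has_derivative[OF Suc.prems(1) that] Ck_has_derivative[OF Suc.prems(2) that])
    show "Ck k S (\<lambda>p x. D (F p) x v + D (G p) x v)" for v
      using Suc by simp
  qed
qed

lemma Ck_bilinear:
  assumes "bounded_bilinear B" "open S" "Ck k S F" "Ck k S G"
  shows "Ck k S (\<lambda>p x. B (F p x) (G p x))"
  using assms(3,4)
proof (induction k arbitrary: F G)
  case (0 F G)
  then show ?case
    using bounded_bilinear.continuous_on[OF assms(1), of "UNIV \<times> S" "\<lambda>(p, x). F p x" "\<lambda>(p, x). G p x"]
    by (simp add: split_def)
next
  case (Suc k F G)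
  show ?case
  proof (rule Ck_SucI[OF assms(2), where F' = "\<lambda>p x v. B (F p x) (D (G p) x v) + B (D (F p) x v) (G p x)"])
    show "Ck 0 S (\<lambda>p x. B (F p x) (G p x))"
      using bounded_bilinear.continuous_on[OF assms(1), of "UNIV \<times> S" "\<lambda>(p, x). F p x" "\<lambda>(p, x). G p x"]
        Suc.prems[THEN Ck_imp_continuous] by (simp add: split_def)
    show "((\<lambda>x. B (F p x) (G p x)) has_derivative (\<lambda>v. B (F p x) (D (G p) x v) + B (D (F p) x v) (G p x))) (at x)"
      if "x \<in> S" for p x
      by (intro bounded_bilinear.FDERIV[OF assms(1)] Ck_has_derivative[OF Suc.prems(1) that] Ck_has_derivative[OF Suc.prems(2) that])
    show "Ck k S (\<lambda>p x. B (F p x) (D (G p) x v) + B (D (F p) x v) (G p x))" for v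
      using Suc Ck_Suc_D[OF Suc.prems(1)] Ck_Suc_D[OF Suc.prems(2)] by (intro Ck_add[OF assms(2)] Suc.IH) auto
  qed
qed

lemma Ck_sum: "open S \<Longrightarrow> (\<And>i. i \<in> I \<Longrightarrow> Ck k S (F i)) \<Longrightarrow> Ck k S (\<lambda>p x. \<Sum>i\<in>I. F i p x)"
  by (induction I rule: infinite_finite_induct) (auto intro!: Ck_add Ck_const)

lemmas Ck_mult = Ck_bilinear[OF bounded_bilinear_mult]
lemmas Ck_scaleR = Ck_bilinear[OF bounded_bilinear_scaleR]
lemmas Ck_inner = Ck_bilinear[OF bounded_bilinear_inner]
lemmas Ck_minus = Ck_bounded_linear[OF bounded_linear_minus[OF bounded_linear_ident]]

lemma Ck_diff: "open S \<Longrightarrow> Ck k S F \<Longrightarrow> Ck k S G \<Longrightarrow> Ck k S (\<lambda>p x. F p x - G p x)"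
  using Ck_add[OF _ _ Ck_minus, of S k F G] by simp

lemma Ck_ident: "open S \<Longrightarrow> Ck k S (\<lambda>p x. x)"
proof (cases k)
  case (Suc l)
  assume "open S"
  then show ?thesis unfolding Suc
    by (intro Ck_SucI[where F' = "\<lambda>p x v. v"] Ck_const) (auto simp: split_def intro!: continuous_intros)
qed (auto simp: split_def intro!: continuous_intros)

text \<open>\<open>Ck\<close> controls derivatives in fixed directions only, whereas the chain rule
  differentiates G in the moving direction \<open>D (F p) x v\<close>. Expanding that direction in
  \<open>Basis\<close> leaves products of real coefficients with \<open>D (G p) y e\<close> for
  fixed e, to which the induction hypothesis applies.\<close>

lemma Ck_compose:
  fixes F :: "'p::topological_space \<Rightarrow> 'a::real_normed_vector \<Rightarrow> 'b::euclidean_space"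
  assumes "open S" "open T" "\<And>p x. x \<in> S \<Longrightarrow> F p x \<in> T" "Ck k T G" "Ck k S F"
  shows "Ck k S (\<lambda>p x. G p (F p x))"
  using assms(4,5)
proof (induction k arbitrary: G)
  have *: "Ck 0 S (\<lambda>p x. G p (F p x))" if "Ck 0 T G" "Ck 0 S F" for G
  proof -
    have "continuous_on (UNIV \<times> T) (\<lambda>x. G (fst x) (snd x))" using that(1) by (simp add: split_def)
    moreover have "continuous_on (UNIV \<times> S) (\<lambda>x. (fst x, F (fst x) (snd x)))"
      using that(2) by (intro continuous_on_Pair continuous_on_fst continuous_on_id) (simp add: split_def)
    moreover have "(\<lambda>x. (fst x, F (fst x) (snd x))) ` (UNIV \<times> S) \<subseteq> UNIV \<times> T" using assms(3) by auto
    ultimately have "continuous_on (UNIV \<times> S) (\<lambda>y. G (fst (fst y, F (fst y) (snd y))) (snd (fst y, F (fst y) (snd y))))"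
      by (rule continuous_on_compose2)
    then show ?thesis by (simp add: split_def)
  qed
  {
    case (0 G)
    then show ?case by (rule *)
  next
    case (Suc k G)
    show ?case
    proof (rule Ck_SucI[OF assms(1), where F' = "\<lambda>p x v. \<Sum>e\<in>Basis. (D (F p) x v \<bullet> e) *\<^sub>R D (G p) (F p x) e"])
      show "Ck 0 S (\<lambda>p x. G p (F p x))"
        using Suc.prems[THEN Ck_imp_continuous] by (intro *[of G]) auto
      show "((\<lambda>x. G p (F p x)) has_derivative (\<lambda>v. \<Sum>e\<in>Basis. (D (F p) x v \<bullet> e) *\<^sub>R D (G p) (F p x) e)) (at x)"
        if "x \<in> S" for p x
      proof -
        have dG: "(G p has_derivative D (G p) (F p x)) (at (F p x))"
          by (rule Ck_has_derivative[OF Suc.prems(1) assms(3)[OF that]])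
        have *: "L w = (\<Sum>e\<in>Basis. (w \<bullet> e) *\<^sub>R L e)" if "linear L" for L :: "'b \<Rightarrow> 'c" and w
          using linear_sum[OF that, of "\<lambda>e. (w \<bullet> e) *\<^sub>R e" Basis]
          by (simp add: euclidean_representation linear_scale[OF that])
        show ?thesis
          by (rule has_derivative_eq_rhs[OF has_derivative_compose[OF Ck_has_derivative[OF Suc.prems(2) that] dG]])
            (rule ext, rule *[OF has_derivative_linear[OF dG]])
      qed
      show "Ck k S (\<lambda>p x. \<Sum>e\<in>Basis. (D (F p) x v \<bullet> e) *\<^sub>R D (G p) (F p x) e)" for v
      proof (rule Ck_sum[OF assms(1)], rule Ck_scaleR[OF assms(1)])
        show "Ck k S (\<lambda>p x. D (F p) x v \<bullet> e)" for e
          using Suc.prems(2) by (intro Ck_inner Ck_const assms(1)) simp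
        show "Ck k S (\<lambda>p x. D (G p) (F p x) e)" for e
          using Suc.prems(1) Ck_Suc_D[OF Suc.prems(2)] by (intro Suc.IH[of "\<lambda>p y. D (G p) y e"]) simp
      qed
    qed
  }
qed

text \<open>The derivative is a product of copies of \<open>inverse\<close> itself, so each order of
  regularity yields the next.\<close>

lemma Ck_const_inverse: "Ck k (- {0}) (\<lambda>p::'p::topological_space. inverse :: 'a::real_normed_field \<Rightarrow> 'a)"
proof (induction k)
  have *: "Ck 0 (- {0}) (\<lambda>p::'p. inverse :: 'a \<Rightarrow> 'a)"
    by (auto simp: split_def intro!: continuous_intros)
  {
    case 0
    show ?case by (rule *)
  next
    case (Suc k)
    show ?case
    proof (rule Ck_SucI[where F' = "\<lambda>p x v. - (inverse x * v * inverse x)"])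
      show "Ck k (- {0}) (\<lambda>(p::'p) x. - (inverse x * v * inverse (x :: 'a)))" for v
        by (intro Ck_minus Ck_mult Ck_const Suc.IH) auto
      show "(inverse has_derivative (\<lambda>v. - (inverse x * v * inverse x))) (at x)" if "x \<in> - {0}" for x :: 'a
        using that by (intro has_derivative_inverse') simp
    qed (use * in auto)
  }
qed

lemma Ck_inverse:
  fixes F :: "'p::topological_space \<Rightarrow> 'a::real_normed_vector \<Rightarrow> 'b::{real_normed_field,euclidean_space}"
  shows "open S \<Longrightarrow> (\<And>p x. x \<in> S \<Longrightarrow> F p x \<noteq> 0) \<Longrightarrow> Ck k S F \<Longrightarrow> Ck k S (\<lambda>p x. inverse (F p x))"
  by (rule Ck_compose[of S "- {0}" F k "\<lambda>_. inverse"]) (auto intro: Ck_const_inverse)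

lemma Ck_divide:
  fixes F :: "'p::topological_space \<Rightarrow> 'a::real_normed_vector \<Rightarrow> 'b::{real_normed_field,euclidean_space}"
  shows "open S \<Longrightarrow> (\<And>p x. x \<in> S \<Longrightarrow> F p x \<noteq> 0) \<Longrightarrow> Ck k S G \<Longrightarrow> Ck k S F \<Longrightarrow> Ck k S (\<lambda>p x. G p x / F p x)"
  unfolding divide_inverse by (intro Ck_mult Ck_inverse)

lemma Ck_const_sqrt: "Ck k {0<..} (\<lambda>p::'p::topological_space. sqrt)"
proof (induction k)
  have *: "Ck 0 {0<..} (\<lambda>p::'p. sqrt)"
    by (auto simp: split_def intro!: continuous_intros)
  {
    case 0
    show ?case by (rule *)
  next
    case (Suc k)
    show ?case
    proof (rule Ck_SucI[where F' = "\<lambda>p x v. v * (inverse (sqrt x) / 2)"])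
      show "Ck k {0<..} (\<lambda>(p::'p) x. v * (inverse (sqrt x) / 2))" for v
        by (intro Ck_mult Ck_divide Ck_inverse Ck_const Suc.IH) auto
      show "(sqrt has_derivative (\<lambda>v. v * (inverse (sqrt x) / 2))) (at x)" if "x \<in> {0<..}" for x
      proof -
        have "(sqrt has_derivative (*) (inverse (sqrt x) / 2)) (at x)"
          using DERIV_real_sqrt[of x] that by (simp add: has_field_derivative_def)
        then show ?thesis by (rule has_derivative_eq_rhs) auto
      qed
    qed (use * in auto)
  }
qed

lemma Ck_sqrt:
  "open S \<Longrightarrow> (\<And>p x. x \<in> S \<Longrightarrow> 0 < F p x) \<Longrightarrow> Ck k S F \<Longrightarrow> Ck k S (\<lambda>p x. sqrt (F p x))"
  by (rule Ck_compose[of S "{0<..}" F k "\<lambda>_. sqrt"]) (auto intro: Ck_const_sqrt)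

text \<open>The last vector of the list differentiates first, as the outermost derivative of
  \<open>Ck\<close> does; inductions relating the two therefore run from the end of the
  list.\<close>

lemma iter_deriv_snoc: "iter_deriv (vs @ [v]) f = iter_deriv vs (\<lambda>x. D f x v)"
  by (induction vs) auto

lemma Ck_iter_deriv:
  "Ck (k + length vs) S F \<Longrightarrow> Ck k S (\<lambda>p. iter_deriv vs (F p))"
proof (induction vs arbitrary: F rule: rev_induct)
  case (snoc v vs)
  then show ?case by (simp add: iter_deriv_snoc)
qed simp

lemma smooth_on_imp_Ck: "smooth_on S f \<Longrightarrow> Ck k S (\<lambda>p. f)"
proof (induction k arbitrary: f)
  have *: "Ck 0 S (\<lambda>p. f)" if "smooth_on S f" for f :: "'a \<Rightarrow> 'b"
  proof -
    have "iter_deriv [] f differentiable_on S" using that unfolding smooth_on_def by blast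
    then have "continuous_on S f" by (simp add: differentiable_imp_continuous_on)
    then show ?thesis by (auto simp: split_def intro!: continuous_on_compose2[of S f] continuous_intros)
  qed
  {
    case (0 f)
    then show ?case by (rule *)
  next
    case (Suc k f)
    have "iter_deriv [] f differentiable_on S" using Suc.prems unfolding smooth_on_def by blast
    moreover have "open S" using Suc.prems unfolding smooth_on_def by blast
    ultimately have "f differentiable at x" if "x \<in> S" for x
      using that unfolding differentiable_on_def iter_deriv.simps by (metis at_within_open)
    moreover have "smooth_on S (\<lambda>x. D f x v)" for v
      using Suc.prems by (simp add: smooth_on_def flip: iter_deriv_snoc)
    ultimately show ?case using Suc.IH *[OF Suc.prems] by simp
  }
qed

lemma Ck_imp_smooth_on:
  assumes "open S" "\<And>k. Ck k S (\<lambda>p::'p::topological_space. f)"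
  shows "smooth_on S f"
  unfolding smooth_on_def
proof (intro conjI allI)
  fix vs
  have "Ck (Suc 0) S (\<lambda>p::'p. iter_deriv vs f)"
    by (rule Ck_iter_deriv) (rule assms)
  then show "iter_deriv vs f differentiable_on S"
    unfolding Ck.simps by (auto simp: differentiable_on_def intro: differentiable_at_withinI)
qed fact

text \<open>Freezing the parameter; a new dummy parameter of any type takes its place.\<close>

lemma Ck_at: "Ck k S F \<Longrightarrow> Ck k S (\<lambda>_::'q::topological_space. F p)"
proof (induction k arbitrary: F)
  have *: "Ck 0 S (\<lambda>_::'q. F p)" if "continuous_on (UNIV \<times> S) (\<lambda>(p, x). F p x)" for F :: "'b \<Rightarrow> 'a \<Rightarrow> 'c"
  proof -
    have "continuous_on (UNIV \<times> S) (\<lambda>y::'q \<times> 'a. case (p, snd y) of (p, x) \<Rightarrow> F p x)"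
      by (rule continuous_on_compose2[OF that]) (auto intro!: continuous_intros)
    then show ?thesis by (simp add: split_def)
  qed
  {
    case (0 F) then show ?case using * by simp
  next
    case (Suc k F)
    then show ?case using *[of F] Suc.IH[of "\<lambda>p x. D (F p) x v" for v] by simp
  }
qed

lemma Ck_D: "Ck (Suc k) S F \<Longrightarrow> Ck k S (\<lambda>p x. D (F p) x v)" by simp

section \<open>Closure properties of smooth maps, with \<open>real\<close> as dummy parameter
  space\<close>

lemma smoothI: "(\<And>k. Ck k UNIV (\<lambda>_::real. f)) \<Longrightarrow> smooth f"
  by (rule Ck_imp_smooth_on[where 'p = real, OF open_UNIV])

lemma smoothD: "smooth f \<Longrightarrow> Ck k UNIV (\<lambda>_. f)"
  by (rule smooth_on_imp_Ck)

lemma smooth_on_has_derivative: "smooth_on S f \<Longrightarrow> x \<in> S \<Longrightarrow> (f has_derivative D f x) (at x)"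
  by (rule Ck_has_derivative[of 0 S "\<lambda>_::real. f", OF smooth_on_imp_Ck])

lemma smooth_has_derivative: "smooth f \<Longrightarrow> (f has_derivative D f x) (at x)"
  by (rule smooth_on_has_derivative) auto

lemma smooth_D: "smooth f \<Longrightarrow> smooth (\<lambda>x. D f x v)"
  by (rule smoothI, rule Ck_D, rule smoothD)

lemma smooth_bounded_linear: "bounded_linear L \<Longrightarrow> smooth f \<Longrightarrow> smooth (\<lambda>x. L (f x))"
  by (rule smoothI, rule Ck_bounded_linear; (rule open_UNIV | erule smoothD | assumption))

lemma smooth_bilinear: "bounded_bilinear B \<Longrightarrow> smooth f \<Longrightarrow> smooth g \<Longrightarrow> smooth (\<lambda>x. B (f x) (g x))"
  by (rule smoothI, rule Ck_bilinear; (rule open_UNIV | erule smoothD | assumption))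

lemma smooth_const: "smooth (\<lambda>x. c)"
  by (rule smoothI, rule Ck_const; (rule open_UNIV | erule smoothD | assumption))

lemma smooth_ident: "smooth (\<lambda>x. x)"
  by (rule smoothI, rule Ck_ident; (rule open_UNIV | erule smoothD | assumption))

lemma smooth_add: "smooth f \<Longrightarrow> smooth g \<Longrightarrow> smooth (\<lambda>x. f x + g x)"
  by (rule smoothI, rule Ck_add; (rule open_UNIV | erule smoothD | assumption))

lemma smooth_diff: "smooth f \<Longrightarrow> smooth g \<Longrightarrow> smooth (\<lambda>x. f x - g x)"
  by (rule smoothI, rule Ck_diff; (rule open_UNIV | erule smoothD | assumption))lemmas smooth_mult = smooth_bilinear[OF bounded_bilinear_mult]
lemmas smooth_scaleR = smooth_bilinear[OF bounded_bilinear_scaleR]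
lemmas smooth_inner = smooth_bilinear[OF bounded_bilinear_inner]
lemmas smooth_Re = smooth_bounded_linear[OF bounded_linear_Re]
lemmas smooth_Im = smooth_bounded_linear[OF bounded_linear_Im]
lemmas smooth_cnj = smooth_bounded_linear[OF bounded_linear_cnj]
lemmas smooth_of_real = smooth_bounded_linear[OF bounded_linear_of_real]

lemma smooth_divide:
  fixes f :: "'a::real_normed_vector \<Rightarrow> 'b::{real_normed_field,euclidean_space}"
  shows "smooth f \<Longrightarrow> smooth g \<Longrightarrow> (\<And>x. g x \<noteq> 0) \<Longrightarrow> smooth (\<lambda>x. f x / g x)"
  by (rule smoothI, rule Ck_divide; (rule open_UNIV | rule smoothD | assumption)+)

lemma smooth_sqrt: "smooth f \<Longrightarrow> (\<And>x. 0 < f x) \<Longrightarrow> smooth (\<lambda>x. sqrt (f x))"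
  by (rule smoothI, rule Ck_sqrt; (rule open_UNIV | rule smoothD | assumption)+)

lemma smooth_compose:
  fixes f :: "'a::real_normed_vector \<Rightarrow> 'b::euclidean_space"
  shows "smooth g \<Longrightarrow> smooth f \<Longrightarrow> smooth (\<lambda>x. g (f x))"
  by (rule smoothI, rule Ck_compose[of UNIV UNIV "\<lambda>_. f" _ "\<lambda>_. g"];
      (rule open_UNIV | erule smoothD | rule UNIV_I))

lemma D_eq: "(f has_derivative f') (at x) \<Longrightarrow> D f x = f'"
  by (rule frechet_derivative_at[symmetric])

lemma smooth_linear_D: "smooth f \<Longrightarrow> linear (D f x)"
  by (rule has_derivative_linear[OF smooth_has_derivative])

lemma smooth_continuous: "smooth f \<Longrightarrow> continuous_on UNIV f"
  by (intro continuous_at_imp_continuous_on ballI has_derivative_continuous[OF smooth_has_derivative])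

lemma smooth_D_compose:
  "smooth g \<Longrightarrow> smooth f \<Longrightarrow> D (\<lambda>x. g (f x)) x v = D g (f x) (D f x v)"
  by (rule fun_cong[OF D_eq[OF has_derivative_compose[OF smooth_has_derivative smooth_has_derivative]]])

lemma linear_complex_decomp:
  assumes "linear (L :: complex \<Rightarrow> 'a::real_vector)"
  shows "L u = Re u *\<^sub>R L 1 + Im u *\<^sub>R L \<i>"
proof -
  have "u = Re u *\<^sub>R 1 + Im u *\<^sub>R \<i>" by (auto simp: complex_eq_iff)
  then have "L u = L (Re u *\<^sub>R 1 + Im u *\<^sub>R \<i>)" by (rule arg_cong)
  also have "\<dots> = Re u *\<^sub>R L 1 + Im u *\<^sub>R L \<i>"
    by (simp only: linear_add[OF assms] linear_scale[OF assms])
  finally show ?thesis .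
qed

subsection \<open>Symmetry of second derivatives\<close>

lemma smooth_line_derivative:
  fixes g :: "'a::real_normed_vector \<Rightarrow> real"
  assumes "smooth g"
  shows "((\<lambda>r. g (c + r *\<^sub>R w)) has_real_derivative D g (c + r *\<^sub>R w) w) (at r)"
proof -
  have "((\<lambda>r. c + r *\<^sub>R w) has_derivative (\<lambda>r. r *\<^sub>R w)) (at r)"
    by (auto intro!: derivative_eq_intros)
  from has_derivative_compose[OF this smooth_has_derivative[OF assms]]
  show ?thesis
    unfolding has_field_derivative_def
    by (rule has_derivative_eq_rhs) (simp add: linear_scale[OF smooth_linear_D[OF assms]] mult.commute fun_eq_iff)
qed

text \<open>The mean value theorem applied twice: to the difference in direction v as a function of
  the displacement along u, and then to the derivative along u as a function of the displacement
  along v.\<close>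

lemma mixed_difference_mean_value:
  fixes f :: "'a::real_normed_vector \<Rightarrow> real"
  assumes "smooth f" "0 < s"
  shows "\<exists>\<xi> \<eta>. 0 \<le> \<xi> \<and> \<xi> \<le> s \<and> 0 \<le> \<eta> \<and> \<eta> \<le> s \<and>
    f (x + s *\<^sub>R u + s *\<^sub>R v) - f (x + s *\<^sub>R u) - f (x + s *\<^sub>R v) + f x
     = s * (s * D (\<lambda>y. D f y u) (x + \<xi> *\<^sub>R u + \<eta> *\<^sub>R v) v)"
proof -
  have "((\<lambda>r. f (x + r *\<^sub>R u + s *\<^sub>R v) - f (x + r *\<^sub>R u)) has_real_derivative
     (D f (x + r *\<^sub>R u + s *\<^sub>R v) u - D f (x + r *\<^sub>R u) u)) (at r)" for r
    using DERIV_diff[OF smooth_line_derivative[OF assms(1), of "x + s *\<^sub>R v" u r]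
      smooth_line_derivative[OF assms(1), of x u r]] by (simp add: algebra_simps)
  from MVT2[OF assms(2) this] obtain \<xi> where \<xi>: "0 < \<xi>" "\<xi> < s"
    "f (x + s *\<^sub>R u + s *\<^sub>R v) - f (x + s *\<^sub>R u) - (f (x + 0 *\<^sub>R u + s *\<^sub>R v) - f (x + 0 *\<^sub>R u))
      = (s - 0) * (D f (x + \<xi> *\<^sub>R u + s *\<^sub>R v) u - D f (x + \<xi> *\<^sub>R u) u)" by blast
  have "((\<lambda>r. D f (x + \<xi> *\<^sub>R u + r *\<^sub>R v) u) has_real_derivative
     (D (\<lambda>y. D f y u) (x + \<xi> *\<^sub>R u + r *\<^sub>R v) v)) (at r)" for r
    by (rule smooth_line_derivative[OF smooth_D[OF assms(1)]])
  from MVT2[OF assms(2) this] obtain \<eta> where \<eta>: "0 < \<eta>" "\<eta> < s"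
    "D f (x + \<xi> *\<^sub>R u + s *\<^sub>R v) u - D f (x + \<xi> *\<^sub>R u + 0 *\<^sub>R v) u
      = (s - 0) * D (\<lambda>y. D f y u) (x + \<xi> *\<^sub>R u + \<eta> *\<^sub>R v) v" by blast
  show ?thesis
    using \<xi> \<eta> by (intro exI[of _ \<xi>] exI[of _ \<eta>]) auto
qed

text \<open>The mixed second difference is symmetric in u and v, so both mixed derivatives agree at
  two points arbitrarily close to x; continuity excludes a gap 2e between their values at x.\<close>

lemma symmetric_second_derivative_real:
  fixes f :: "'a::real_normed_vector \<Rightarrow> real"
  assumes "smooth f"
  shows "D (\<lambda>y. D f y u) x v = D (\<lambda>y. D f y v) x u"
proof (rule ccontr)
  assume ne: "\<not> ?thesis"
  define e where "e = \<bar>D (\<lambda>y. D f y u) x v - D (\<lambda>y. D f y v) x u\<bar> / 2"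
  have e: "e > 0" using ne by (simp add: e_def)
  have "continuous_on UNIV (\<lambda>y. D (\<lambda>y. D f y u) y v)" "continuous_on UNIV (\<lambda>y. D (\<lambda>y. D f y v) y u)"
    using assms by (intro smooth_continuous smooth_D; assumption)+
  then have "isCont (\<lambda>y. D (\<lambda>y. D f y u) y v) x" "isCont (\<lambda>y. D (\<lambda>y. D f y v) y u) x"
    by (auto simp: continuous_on_eq_continuous_at)
  then obtain d1 d2 where d: "d1 > 0" "d2 > 0"
      and d1: "\<And>y. norm (y - x) < d1 \<Longrightarrow> \<bar>D (\<lambda>y. D f y u) y v - D (\<lambda>y. D f y u) x v\<bar> < e"
      and d2: "\<And>y. norm (y - x) < d2 \<Longrightarrow> \<bar>D (\<lambda>y. D f y v) y u - D (\<lambda>y. D f y v) x u\<bar> < e"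
    unfolding continuous_at_eps_delta dist_norm real_norm_def using e by metis
  \<comment> \<open>Small enough that \<open>x + \<xi> u + \<eta> v\<close> stays within both radii
    for \<xi>, \<eta> up to s; the summand 1 covers u = v = 0 and the factor 2 makes the bound
    strict.\<close>
  define s where "s = min d1 d2 / (2 * (norm u + norm v + 1))"
  have np: "norm u + norm v + 1 > 0" by (intro add_nonneg_pos) auto
  have s: "s > 0" using d np by (simp add: s_def)
  have bound: "norm (x + \<xi> *\<^sub>R u + \<eta> *\<^sub>R v - x) < min d1 d2" if "0 \<le> \<xi>" "\<xi> \<le> s" "0 \<le> \<eta>" "\<eta> \<le> s" for \<xi> \<eta>
  proof -
    have "x + \<xi> *\<^sub>R u + \<eta> *\<^sub>R v - x = \<xi> *\<^sub>R u + \<eta> *\<^sub>R v" by simp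
    then have "norm (x + \<xi> *\<^sub>R u + \<eta> *\<^sub>R v - x) \<le> \<xi> * norm u + \<eta> * norm v"
      using norm_triangle_ineq[of "\<xi> *\<^sub>R u" "\<eta> *\<^sub>R v"] that(1,3) by simp
    also have "\<dots> \<le> s * norm u + s * norm v"
      using that by (intro add_mono mult_right_mono norm_ge_zero)
    also have "\<dots> < s * (2 * (norm u + norm v + 1))"
      using mult_pos_pos[OF s np] s by (simp add: algebra_simps)
    also have "\<dots> = min d1 d2" using np by (simp add: s_def)
    finally show ?thesis .
  qed
  obtain \<xi> \<eta> where 1: "0 \<le> \<xi>" "\<xi> \<le> s" "0 \<le> \<eta>" "\<eta> \<le> s"
    "f (x + s *\<^sub>R u + s *\<^sub>R v) - f (x + s *\<^sub>R u) - f (x + s *\<^sub>R v) + f x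
     = s * (s * D (\<lambda>y. D f y u) (x + \<xi> *\<^sub>R u + \<eta> *\<^sub>R v) v)"
    using mixed_difference_mean_value[OF assms s] by blast
  obtain \<xi>' \<eta>' where 2: "0 \<le> \<xi>'" "\<xi>' \<le> s" "0 \<le> \<eta>'" "\<eta>' \<le> s"
    "f (x + s *\<^sub>R v + s *\<^sub>R u) - f (x + s *\<^sub>R v) - f (x + s *\<^sub>R u) + f x
     = s * (s * D (\<lambda>y. D f y v) (x + \<xi>' *\<^sub>R v + \<eta>' *\<^sub>R u) u)"
    using mixed_difference_mean_value[OF assms s] by blast
  have "f (x + s *\<^sub>R v + s *\<^sub>R u) = f (x + s *\<^sub>R u + s *\<^sub>R v)"
    by (rule arg_cong[where f = f]) simp
  then have "s * (s * D (\<lambda>y. D f y u) (x + \<xi> *\<^sub>R u + \<eta> *\<^sub>R v) v) = s * (s * D (\<lambda>y. D f y v) (x + \<xi>' *\<^sub>R v + \<eta>' *\<^sub>R u) u)"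
    using 1(5) 2(5) by linarith
  moreover have "x + \<xi>' *\<^sub>R v + \<eta>' *\<^sub>R u = x + \<eta>' *\<^sub>R u + \<xi>' *\<^sub>R v" by simp
  ultimately have eq: "D (\<lambda>y. D f y u) (x + \<xi> *\<^sub>R u + \<eta> *\<^sub>R v) v = D (\<lambda>y. D f y v) (x + \<eta>' *\<^sub>R u + \<xi>' *\<^sub>R v) u"
    using s by simp
  have "norm (x + \<xi> *\<^sub>R u + \<eta> *\<^sub>R v - x) < d1" "norm (x + \<eta>' *\<^sub>R u + \<xi>' *\<^sub>R v - x) < d2"
    using bound[OF 1(1-4)] bound[OF 2(3,4,1,2)] by simp_all
  from d1[OF this(1)] d2[OF this(2)] show False
    unfolding eq e_def by (simp add: abs_if field_simps split: if_splits)
qed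

lemma symmetric_second_derivative:
  fixes f :: "'a::real_normed_vector \<Rightarrow> 'b::euclidean_space"
  assumes "smooth f"
  shows "D (\<lambda>y. D f y u) x v = D (\<lambda>y. D f y v) x u"
proof (rule euclidean_eqI)
  fix e :: 'b assume "e \<in> Basis"
  have bl: "bounded_linear (\<lambda>y. y \<bullet> e)" by (rule bounded_linear_inner_left)
  have *: "D (\<lambda>y. g y \<bullet> e) x v = D g x v \<bullet> e" if "smooth g" for g :: "'a \<Rightarrow> 'b" and x v
    using D_eq[OF bounded_linear.has_derivative[OF bl smooth_has_derivative[OF that, of x]]] by simp
  have sm: "smooth (\<lambda>y. f y \<bullet> e)" by (rule smooth_bounded_linear[OF bl assms])
  show "D (\<lambda>y. D f y u) x v \<bullet> e = D (\<lambda>y. D f y v) x u \<bullet> e"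
    using symmetric_second_derivative_real[OF sm, of u x v]
    by (simp add: * assms smooth_D)
qed

section \<open>Linear differential equations\<close>

text \<open>\<open>norm (y t)\<close> squared times exp(-ct), minus e squared times t, has
  nonpositive increments. With e = 0 this is uniqueness for linear equations; with e > 0 it
  estimates the error in a linearisation.\<close>

lemma gronwall_zero:
  fixes y :: "real \<Rightarrow> 'e::real_inner"
  assumes y: "\<And>t. t \<in> {0..1} \<Longrightarrow> (y has_vector_derivative y' t) (at t within {0..1})"
    and bound: "\<And>t. t \<in> {0..1} \<Longrightarrow> norm (y' t) \<le> M * norm (y t) + e"
    and "0 \<le> M" "0 \<le> e" "y 0 = 0" and t: "t \<in> {0..1}"
  shows "norm (y t) \<le> e * exp (M + 1)"
proof -
  \<comment> \<open>2M compensates the growth of the squared norm, and the extra 1 absorbs 2 e |y|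
    into e^2 + |y|^2.\<close>
  define c where "c = 2 * M + 1"
  have c: "c > 0" using \<open>0 \<le> M\<close> by (simp add: c_def)
  define g where "g = (\<lambda>t. (y t \<bullet> y t) * exp (- c * t) - e\<^sup>2 * t)"
  define g' where "g' = (\<lambda>t. (2 * (y t \<bullet> y' t) - c * (y t \<bullet> y t)) * exp (- c * t) - e\<^sup>2)"
  have dg: "(g has_derivative (\<lambda>h. h * g' s)) (at s within {0..t})" if "0 \<le> s" "s \<le> t" for s
  proof -
    have "(y has_derivative (\<lambda>h. h *\<^sub>R y' s)) (at s within {0..t})"
      using y[of s] that t by (auto simp: has_vector_derivative_def intro: has_derivative_subset)
    then show ?thesis
      unfolding g_def g'_def
      by (auto intro!: derivative_eq_intros simp: fun_eq_iff inner_commute algebra_simps)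
  qed
  have "\<exists>s\<in>{0..t}. g t - g 0 = (t - 0) * g' s"
    by (rule mvt_very_simple) (use t dg in auto)
  then obtain s where s: "s \<in> {0..t}" "g t - g 0 = t * g' s" by auto
  let ?X = "2 * (y s \<bullet> y' s) - c * (y s \<bullet> y s)"
  have X: "?X \<le> e\<^sup>2"
  proof -
    have "y s \<bullet> y' s \<le> norm (y s) * norm (y' s)" by (rule norm_cauchy_schwarz)
    also have "\<dots> \<le> norm (y s) * (M * norm (y s) + e)"
      using bound[of s] s t by (intro mult_left_mono) auto
    finally have "?X \<le> 2 * e * norm (y s) - (norm (y s))\<^sup>2"
      unfolding c_def power2_norm_eq_inner[symmetric] by (simp add: algebra_simps power2_eq_square)
    also have "\<dots> \<le> e\<^sup>2" using zero_le_power2[of "norm (y s) - e"] by (simp add: power2_diff algebra_simps)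
    finally show ?thesis .
  qed
  have E: "exp (- c * s) \<le> 1" using c s by simp
  \<comment> \<open>For negative \<open>?X\<close> the factor exp(-cs) may only be bounded from
    below, so the sign has to be distinguished.\<close>
  have "?X * exp (- c * s) \<le> e\<^sup>2"
  proof (cases "?X \<le> 0")
    case True
    then have "?X * exp (- c * s) \<le> 0" by (intro mult_nonpos_nonneg) auto
    then show ?thesis using zero_le_power2[of e] by linarith
  next
    case False
    then have "?X * exp (- c * s) \<le> ?X * 1" using E by (intro mult_left_mono) auto
    then show ?thesis using X by (simp only: mult_1_right)
  qed
  then have "g t \<le> 0"
    using s t \<open>y 0 = 0\<close> by (simp add: g_def g'_def mult_nonneg_nonpos)
  then have "(y t \<bullet> y t) * exp (- c * t) \<le> e\<^sup>2 * 1"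
    using mult_left_mono[of t 1 "e\<^sup>2"] t unfolding g_def by simp
  then have "(y t \<bullet> y t) * exp (- c * t) * exp (c * t) \<le> e\<^sup>2 * exp (c * t)"
    by (intro mult_right_mono) auto
  then have "(norm (y t))\<^sup>2 \<le> e\<^sup>2 * exp (c * t)"
    by (simp add: power2_norm_eq_inner mult.assoc flip: exp_add)
  also have "\<dots> \<le> e\<^sup>2 * exp (2 * (M + 1))"
  proof -
    have "c * t \<le> c * 1" using t c by (intro mult_left_mono) auto
    then have "c * t \<le> 2 * (M + 1)" by (simp add: c_def)
    then show ?thesis by (intro mult_left_mono) auto
  qed
  also have "\<dots> = (e * exp (M + 1))\<^sup>2" by (simp add: power_mult_distrib flip: exp_double)
  finally show ?thesis by (rule power2_le_imp_le) (use \<open>0 \<le> e\<close> in simp)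
qed

lemma bounded_bilinear_uniform_bound:
  assumes "bounded_bilinear B" "compact S" "continuous_on S a"
  obtains K where "K > 0" "\<And>x s. s \<in> S \<Longrightarrow> norm (B x (a s)) \<le> K * norm x"
proof -
  interpret bounded_bilinear B by fact
  obtain L where L: "L > 0" "\<And>x z. norm (B x z) \<le> norm x * norm z * L"
    using pos_bounded by blast
  obtain C where C: "\<And>s. s \<in> S \<Longrightarrow> norm (a s) \<le> C"
    using compact_imp_bounded[OF compact_continuous_image[OF assms(3,2)]] by (auto simp: bounded_iff)
  have "norm (B x (a s)) \<le> (L * (\<bar>C\<bar> + 1)) * norm x" if "s \<in> S" for x s
  proof -
    have "norm (B x (a s)) \<le> (norm x * L) * norm (a s)" using L(2)[of x "a s"] by (simp add: mult_ac)
    also have "\<dots> \<le> (norm x * L) * (\<bar>C\<bar> + 1)" using C[OF that] L by (intro mult_left_mono) auto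
    finally show ?thesis by (simp add: mult_ac)
  qed
  then show ?thesis using that[of "L * (\<bar>C\<bar> + 1)"] L by (simp add: add_nonneg_pos)
qed

text \<open>The successive terms of the Picard series, not its partial sums: the solution is their
  sum, and each term is the integral of B applied to the one before.\<close>

fun picard_term :: "('e::real_normed_vector \<Rightarrow> 'b \<Rightarrow> 'e) \<Rightarrow> (real \<Rightarrow> 'b) \<Rightarrow> 'e \<Rightarrow> nat \<Rightarrow> real \<Rightarrow> 'e" where
  "picard_term B a y0 0 = (\<lambda>t. y0)"
| "picard_term B a y0 (Suc n) = (\<lambda>t. integral {0..t} (\<lambda>s. B (picard_term B a y0 n s) (a s)))"

text \<open>The nth term is at most |y0| (K t)^n / n!, so the series converges uniformly on [0,1];
  so do the derivatives, and differentiation term by term gives the equation.\<close>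

lemma linear_ode_exists:
  fixes B :: "'e::banach \<Rightarrow> 'b::real_normed_vector \<Rightarrow> 'e"
  assumes B: "bounded_bilinear B" and a: "continuous_on {0..1} a"
  obtains y where "y 0 = y0" "\<And>t. t \<in> {0..1} \<Longrightarrow> (y has_vector_derivative B (y t) (a t)) (at t within {0..1})"
proof -
  interpret bounded_bilinear B by fact
  obtain K where K: "K > 0" "\<And>x s. s \<in> {0..1} \<Longrightarrow> norm (B x (a s)) \<le> K * norm x"
    using bounded_bilinear_uniform_bound[OF B compact_Icc a] by blast
  define u where "u = picard_term B a y0"
  define v where "v = (\<lambda>n t. case n of 0 \<Rightarrow> 0 | Suc m \<Rightarrow> B (u m t) (a t))"
  have u_deriv: "(u n has_vector_derivative v n t) (at t within {0..1}) \<and> continuous_on {0..1} (u n)"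
    if "t \<in> {0..1}" for n t
    using that
  proof (induction n arbitrary: t)
    case 0
    then show ?case by (auto simp: u_def v_def)
  next
    case (Suc n)
    have c: "continuous_on {0..1} (\<lambda>s. B (u n s) (a s))"
      using Suc.IH[of 0] by (intro continuous_on a) auto
    have "((\<lambda>t. integral {0..t} (\<lambda>s. B (u n s) (a s))) has_vector_derivative B (u n t) (a t)) (at t within {0..1})"
      if "t \<in> {0..1}" for t
      by (rule integral_has_vector_derivative[OF c that])
    then have d: "(u (Suc n) has_vector_derivative v (Suc n) t) (at t within {0..1})" if "t \<in> {0..1}" for t
      using that by (simp add: u_def v_def)
    then have "continuous_on {0..1} (u (Suc n))"
      unfolding continuous_on_eq_continuous_within by (intro ballI has_vector_derivative_continuous)
    then show ?case using d Suc.prems by blast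
  qed
  have u_bound: "norm (u n t) \<le> norm y0 * ((K * t) ^ n / fact n)" if "t \<in> {0..1}" for n t
    using that
  proof (induction n arbitrary: t)
    case 0
    then show ?case by (simp add: u_def)
  next
    case (Suc n)
    let ?g = "\<lambda>s. K * (norm y0 * ((K * s) ^ n / fact n))"
    have "continuous_on {0..1} (\<lambda>s. B (u n s) (a s))"
      using u_deriv[of 0 n] by (intro continuous_on a) auto
    then have 1: "(\<lambda>s. B (u n s) (a s)) integrable_on {0..t}"
      using Suc.prems by (intro integrable_continuous_real) (auto elim: continuous_on_subset)
    have 2: "(?g has_integral norm y0 * ((K * t) ^ Suc n / fact (Suc n)) - norm y0 * ((K * 0) ^ Suc n / fact (Suc n))) {0..t}"
      using Suc.prems
      by (intro fundamental_theorem_of_calculus)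
        (auto intro!: derivative_eq_intros simp: has_real_derivative_iff_has_vector_derivative[symmetric] field_simps
          simp del: power_Suc fact_Suc, auto simp: field_simps)
    have "norm (u (Suc n) t) \<le> integral {0..t} ?g"
      unfolding u_def picard_term.simps
    proof (rule integral_norm_bound_integral)
      fix s assume s: "s \<in> {0..t}"
      then have "norm (B (u n s) (a s)) \<le> K * norm (u n s)" using K(2) Suc.prems by auto
      also have "\<dots> \<le> ?g s" using Suc.IH[of s] s Suc.prems K by (intro mult_left_mono) auto
      finally show "norm (B (picard_term B a y0 n s) (a s)) \<le> ?g s" by (simp add: u_def)
    qed (use 1 2 in \<open>auto simp: u_def has_integral_iff\<close>)
    also have "\<dots> = norm y0 * ((K * t) ^ Suc n / fact (Suc n))" using 2 by (simp add: has_integral_iff)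
    finally show ?case .
  qed
  have summ: "summable (\<lambda>n. norm y0 * (K ^ n / fact n))"
    using summable_exp[of K] by (intro summable_mult) (simp add: field_simps)
  have ub: "norm (u n t) \<le> norm y0 * (K ^ n / fact n)" if "t \<in> {0..1}" for n t
  proof -
    have "(K * t) ^ n \<le> K ^ n" using that K mult_left_mono[of t 1 K] by (intro power_mono) auto
    then show ?thesis using u_bound[OF that, of n]
      by (meson divide_right_mono fact_ge_zero mult_left_mono norm_ge_zero order_trans)
  qed
  define y where "y = (\<lambda>t. suminf (\<lambda>n. u n t))"
  have lim: "uniform_limit {0..1} (\<lambda>n t. \<Sum>i<n. u i t) y sequentially"
    unfolding y_def by (rule Weierstrass_m_test[OF ub summ])
  have sums: "(\<lambda>n. u n t) sums y t" if "t \<in> {0..1}" for t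
    unfolding y_def by (rule summable_sums[OF summable_comparison_test[OF _ summ]]) (use ub[OF that] in auto)
  \<comment> \<open>The derivative of term n comes from term n - 1, and that of term 0 vanishes.
    Hence n + 1 derivatives match n terms, a shift undone at the end by
    \<open>eventually_sequentially_Suc\<close>.\<close>
  have vsum: "(\<Sum>i<Suc n. v i t) = B (\<Sum>i<n. u i t) (a t)" for n t
    by (simp only: sum.lessThan_Suc_shift v_def sum_left) simp
  have "\<exists>g. \<forall>t\<in>{0..1}. (\<lambda>n. u n t) sums g t \<and> (g has_derivative (\<lambda>h. h *\<^sub>R B (y t) (a t))) (at t within {0..1})"
  proof (rule has_derivative_series[where f' = "\<lambda>n t h. h *\<^sub>R v n t"])
    show "(u n has_derivative (\<lambda>h. h *\<^sub>R v n t)) (at t within {0..1})" if "t \<in> {0..1}" for n t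
      using u_deriv[OF that] by (simp add: has_vector_derivative_def)
    show "(\<lambda>n. u n 0) sums y 0" using sums by simp
    show "\<forall>\<^sub>F n in sequentially. \<forall>t\<in>{0..1}. \<forall>h. norm ((\<Sum>i<n. h *\<^sub>R v i t) - h *\<^sub>R B (y t) (a t)) \<le> e * norm h"
      if "e > 0" for e
    proof -
      have "\<forall>\<^sub>F n in sequentially. \<forall>t\<in>{0..1}. dist (\<Sum>i<n. u i t) (y t) < e / K"
        using uniform_limitD[OF lim, of "e / K"] that K by simp
      then have "\<forall>\<^sub>F n in sequentially. \<forall>t\<in>{0..1}. \<forall>h. norm ((\<Sum>i<Suc n. h *\<^sub>R v i t) - h *\<^sub>R B (y t) (a t)) \<le> e * norm h"
      proof (rule eventually_mono, intro ballI allI)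
        fix n t h assume *: "\<forall>t\<in>{0..1}. dist (\<Sum>i<n. u i t) (y t) < e / K" "t \<in> {0..1::real}"
        have "(\<Sum>i<Suc n. h *\<^sub>R v i t) - h *\<^sub>R B (y t) (a t) = h *\<^sub>R B ((\<Sum>i<n. u i t) - y t) (a t)"
          by (simp only: scaleR_sum_right[symmetric] vsum diff_left scaleR_diff_right)
        also have "norm \<dots> \<le> \<bar>h\<bar> * (K * norm ((\<Sum>i<n. u i t) - y t))"
          using K(2)[OF *(2)] by (auto intro!: mult_left_mono)
        also have "\<dots> \<le> \<bar>h\<bar> * (K * (e / K))"
          using * K by (intro mult_left_mono) (auto simp: dist_norm less_imp_le)
        finally show "norm ((\<Sum>i<Suc n. h *\<^sub>R v i t) - h *\<^sub>R B (y t) (a t)) \<le> e * norm h"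
          using K by (simp add: mult.commute)
      qed
      then show ?thesis by (subst (asm) eventually_sequentially_Suc)
    qed
  qed auto
  then obtain g where g: "\<And>t. t \<in> {0..1} \<Longrightarrow> (\<lambda>n. u n t) sums g t"
    "\<And>t. t \<in> {0..1} \<Longrightarrow> (g has_derivative (\<lambda>h. h *\<^sub>R B (y t) (a t))) (at t within {0..1})" by blast
  have gy: "g t = y t" if "t \<in> {0..1}" for t using sums_unique2[OF g(1)[OF that] sums[OF that]] .
  have "u n 0 = 0" if "n > 0" for n using that by (cases n) (auto simp: u_def)
  then have "(\<lambda>n. u n 0) sums u 0 0" using sums_finite[of "{0}" "\<lambda>n. u n 0"] by auto
  then have "g 0 = y0" using sums_unique2[OF g(1)] by (simp add: u_def)
  moreover have "(g has_vector_derivative B (g t) (a t)) (at t within {0..1})" if "t \<in> {0..1}" for t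
    using g(2)[OF that] gy[OF that] by (simp add: has_vector_derivative_def)
  ultimately show ?thesis by (rule that)
qed

section \<open>Differentiable dependence of linear equations on parameters\<close>

lemma uniform_linearization:
  fixes a :: "'p::euclidean_space \<Rightarrow> real \<Rightarrow> 'e::real_normed_vector"
  assumes da: "\<And>p t. t \<in> {0..1} \<Longrightarrow> ((\<lambda>p. a p t) has_derivative a' p t) (at p)"
    and cont: "\<And>v. continuous_on (UNIV \<times> {0..1}) (\<lambda>(p, t). a' p t v)" and "0 < e"
  obtains d where "0 < d" "\<And>p t. norm (p - p0) < d \<Longrightarrow> t \<in> {0..1} \<Longrightarrow>
    norm (a p t - a p0 t - a' p0 t (p - p0)) \<le> e * norm (p - p0)"
proof -
  \<comment> \<open>Continuity of a' is known for each fixed direction; an error e / N on every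
    basis vector adds up to operator norm at most e, uniformly in t.\<close>
  define N where "N = real DIM('p)"
  have N: "N > 0" by (simp add: N_def)
  have "\<exists>d>0. \<forall>p\<in>ball p0 d. \<forall>t\<in>{0..1}. norm (a' p t v - a' p0 t v) \<le> e / N" for v
  proof -
    have "uniformly_continuous_on (cball p0 1 \<times> {0..1::real}) (\<lambda>(p, t). a' p t v)"
      by (intro compact_uniformly_continuous continuous_on_subset[OF cont] compact_Times) auto
    from this obtain d where d: "d > 0" "\<And>q q'. q \<in> cball p0 1 \<times> {0..1} \<Longrightarrow> q' \<in> cball p0 1 \<times> {0..1} \<Longrightarrow> dist q' q < d
        \<Longrightarrow> dist (case q' of (p, t) \<Rightarrow> a' p t v) (case q of (p, t) \<Rightarrow> a' p t v) < e / N"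
      using uniformly_continuous_onE[of _ _ "e / N"] \<open>0 < e\<close> N by (metis divide_pos_pos)
    have "norm (a' p t v - a' p0 t v) \<le> e / N" if "p \<in> ball p0 (min d 1)" "t \<in> {0..1}" for p t
      using d(2)[of "(p0, t)" "(p, t)"] that by (simp add: dist_Pair_Pair dist_commute dist_norm norm_minus_commute)
    then show ?thesis using d(1) by (intro exI[of _ "min d 1"]) auto
  qed
  then obtain d where d: "\<And>v. d v > 0"
    "\<And>v p t. p \<in> ball p0 (d v) \<Longrightarrow> t \<in> {0..1} \<Longrightarrow> norm (a' p t v - a' p0 t v) \<le> e / N" by metis
  define r where "r = Min (d ` Basis)"
  have r: "r > 0" "\<And>b. b \<in> Basis \<Longrightarrow> r \<le> d b" using d(1) by (auto simp: r_def)
  have on: "onorm (a' p t - a' p0 t) \<le> e" if p: "p \<in> ball p0 r" and t: "t \<in> {0..1}" for p t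
  proof (rule onorm_le)
    fix v
    have lin: "linear (\<lambda>v. a' p t v - a' p0 t v)"
      using da[OF t] has_derivative_linear linear_compose_sub by blast
    have "a' p t v - a' p0 t v = (\<Sum>b\<in>Basis. (v \<bullet> b) *\<^sub>R (a' p t b - a' p0 t b))"
      using linear_sum[OF lin, of "\<lambda>b. (v \<bullet> b) *\<^sub>R b" Basis]
      by (simp only: euclidean_representation linear_scale[OF lin])
    also have "norm \<dots> \<le> (\<Sum>b\<in>(Basis::'p set). norm v * (e / N))"
    proof (rule sum_norm_le)
      fix b :: 'p assume b: "b \<in> Basis"
      have "norm (a' p t b - a' p0 t b) \<le> e / N" using d(2)[OF _ t] p r(2)[OF b] by (auto simp: subset_iff)
      then show "norm ((v \<bullet> b) *\<^sub>R (a' p t b - a' p0 t b)) \<le> norm v * (e / N)"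
        unfolding norm_scaleR by (intro mult_mono Basis_le_norm b) auto
    qed
    finally show "norm ((a' p t - a' p0 t) v) \<le> e * norm v"
      using N by (simp add: N_def mult.commute)
  qed
  have "norm (a p t - a p0 t - a' p0 t (p - p0)) \<le> e * norm (p - p0)" if p: "norm (p - p0) < r" and t: "t \<in> {0..1}" for p t
  proof -
    have seg: "p0 + s *\<^sub>R (p - p0) \<in> ball p0 r" if "s \<in> {0..1}" for s
    proof -
      have "s * norm (p - p0) \<le> 1 * norm (p - p0)" using that by (intro mult_right_mono) auto
      then show ?thesis using p that by (simp add: dist_norm)
    qed
    have "norm (a p t - a p0 t - a' p0 t (p - p0)) \<le> norm (p - p0) * e"
      by (rule differentiable_bound_linearization[OF seg])
        (use da[OF t] on[OF _ t] r(1) in \<open>auto intro: has_derivative_at_withinI\<close>)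
    then show ?thesis by (simp add: mult.commute)
  qed
  then show ?thesis using that r(1) by blast
qed

lemma compact_Times_bound:
  assumes "continuous_on (UNIV \<times> {0..1}) (\<lambda>(p::'p::euclidean_space, t::real). g p t :: 'e::real_normed_vector)"
  obtains C where "C > 0" "\<And>p t. norm (p - p0) \<le> 1 \<Longrightarrow> t \<in> {0..1} \<Longrightarrow> norm (g p t) \<le> C"
proof -
  have "compact ((\<lambda>(p, t). g p t) ` (cball p0 1 \<times> {0..1}))"
    by (intro compact_continuous_image continuous_on_subset[OF assms] compact_Times) auto
  then obtain C where C0: "\<And>x. x \<in> (\<lambda>(p, t). g p t) ` (cball p0 1 \<times> {0..1}) \<Longrightarrow> norm x \<le> C"
    using compact_imp_bounded bounded_iff by metis
  then have C: "norm (g p t) \<le> C" if "p \<in> cball p0 1" "t \<in> {0..1}" for p t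
    using that by (intro C0) force
  show ?thesis by (rule that[of "\<bar>C\<bar> + 1"]) (use C in \<open>force simp: dist_norm norm_minus_commute\<close>)+
qed

lemma bounded_on_unit_interval:
  fixes f :: "real \<Rightarrow> 'd::real_normed_vector"
  assumes "continuous_on {0..1} f"
  shows "\<exists>C>0. \<forall>t\<in>{0..1}. norm (f t) \<le> C"
  using compact_imp_bounded[OF compact_continuous_image[OF assms compact_Icc]] by (auto simp: bounded_pos)

lemma bounded_linear_family:
  fixes f :: "'p::euclidean_space \<Rightarrow> real \<Rightarrow> 'd::real_normed_vector"
  assumes "\<And>v. continuous_on {0..1} (f v)" and lin: "\<And>t. t \<in> {0..1} \<Longrightarrow> linear (\<lambda>v. f v t)"
  shows "\<exists>C>0. \<forall>v. \<forall>t\<in>{0..1}. norm (f v t) \<le> C * norm v"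
proof -
  obtain C where C: "\<And>v. C v > 0" "\<And>v t. t \<in> {0..1} \<Longrightarrow> norm (f v t) \<le> C v"
    using bounded_on_unit_interval[OF assms(1)] by metis
  have "norm (f v t) \<le> (\<Sum>b\<in>Basis. C b) * norm v" if t: "t \<in> {0..1}" for v t
  proof -
    have "f v t = (\<Sum>b\<in>Basis. (v \<bullet> b) *\<^sub>R f b t)"
      using linear_sum[OF lin[OF t], of "\<lambda>b. (v \<bullet> b) *\<^sub>R b" Basis]
      by (simp only: euclidean_representation linear_scale[OF lin[OF t]])
    also have "norm \<dots> \<le> (\<Sum>b\<in>Basis. C b * norm v)"
    proof (rule sum_norm_le)
      fix b :: 'p assume b: "b \<in> Basis"
      show "norm ((v \<bullet> b) *\<^sub>R f b t) \<le> C b * norm v"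
        unfolding norm_scaleR using C(1)[of b] C(2)[OF t, of b] Basis_le_norm[OF b, of v]
        by (subst mult.commute) (intro mult_mono; simp)
    qed
    finally show ?thesis by (simp add: sum_distrib_right)
  qed
  moreover have "(\<Sum>b\<in>(Basis::'p set). C b) > 0" using C(1) by (intro sum_pos) auto
  ultimately show ?thesis by blast
qed

text \<open>The difference \<open>y p - y p0 - w (p - p0)\<close> solves a linear equation whose
  inhomogeneity is of smaller order than p - p0, so \<open>gronwall_zero\<close> bounds it at time
  1. The solution w of the variational equation is supplied by the user of the lemma, because
  flatness will provide most of it explicitly.\<close>

lemma ode_parameter_derivative:
  fixes a :: "'p::euclidean_space \<Rightarrow> real \<Rightarrow> 'b::real_normed_vector"
    and B :: "'e::real_inner \<Rightarrow> 'b \<Rightarrow> 'e" and w :: "'p \<Rightarrow> real \<Rightarrow> 'e"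
  assumes B: "bounded_bilinear B"
    and da: "\<And>p t. t \<in> {0..1} \<Longrightarrow> ((\<lambda>p. a p t) has_derivative a' p t) (at p)"
    and cont': "\<And>v. continuous_on (UNIV \<times> {0..1}) (\<lambda>(p, t). a' p t v)"
    and cont: "continuous_on (UNIV \<times> {0..1}) (\<lambda>(p, t). a p t)"
    and y: "\<And>p t. t \<in> {0..1} \<Longrightarrow> (y p has_vector_derivative B (y p t) (a p t)) (at t within {0..1})"
    and y0: "\<And>p. y p 0 = c"
    and w: "\<And>v t. t \<in> {0..1} \<Longrightarrow>
      (w v has_vector_derivative B (w v t) (a p0 t) + B (y p0 t) (a' p0 t v)) (at t within {0..1})"
    and w0: "\<And>v. w v 0 = 0"
    and wlin: "\<And>t. t \<in> {0..1} \<Longrightarrow> linear (\<lambda>v. w v t)"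
  shows "((\<lambda>p. y p 1) has_derivative (\<lambda>v. w v 1)) (at p0)"
proof -
  interpret bounded_bilinear B by fact
  obtain L where L: "L > 0" "\<And>x z. norm (B x z) \<le> norm x * norm z * L"
    using pos_bounded by blast
  obtain Ca where Ca: "Ca > 0" "\<And>p t. norm (p - p0) \<le> 1 \<Longrightarrow> t \<in> {0..1} \<Longrightarrow> norm (a p t) \<le> Ca"
    using compact_Times_bound[OF cont] by blast
  have vc: "continuous_on {0..1} f" if "\<And>t. t \<in> {0..1} \<Longrightarrow> (f has_vector_derivative f' t) (at t within {0..1})"
    for f :: "real \<Rightarrow> 'e" and f'
    unfolding continuous_on_eq_continuous_within using that has_vector_derivative_continuous by blast
  obtain Cy where Cy: "Cy > 0" "\<And>t. t \<in> {0..1} \<Longrightarrow> norm (y p0 t) \<le> Cy"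
    using bounded_on_unit_interval[OF vc[OF y]] by blast
  obtain Cw where Cw: "Cw > 0" "\<And>v t. t \<in> {0..1} \<Longrightarrow> norm (w v t) \<le> Cw * norm v"
    using bounded_linear_family[of w, OF vc[OF w] wlin] by blast
  have c': "continuous_on {0..1} (\<lambda>t. a' p0 t v)" for v
  proof -
    have "continuous_on {0..1} (\<lambda>t. case (p0, t) of (p, t) \<Rightarrow> a' p t v)"
      by (rule continuous_on_compose2[OF cont']) (auto intro!: continuous_intros)
    then show ?thesis by simp
  qed
  obtain C' where C': "C' > 0" "\<And>v t. t \<in> {0..1} \<Longrightarrow> norm (a' p0 t v) \<le> C' * norm v"
    using bounded_linear_family[of "\<lambda>v t. a' p0 t v", OF c' has_derivative_linear[OF da]] by blast
  define M where "M = Ca * L"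
  \<comment> \<open>Bound for the two error terms of the remainder per unit of \<epsilon> and of |p
    - p0|, times the factor from \<open>gronwall_zero\<close>.\<close>
  define K where "K = (Cy * L + Cw * (1 + C') * L) * exp (M + 1)"
  have K: "K > 0" using L Cy Cw C' by (auto simp: K_def intro!: mult_pos_pos add_pos_pos)
  have main: "\<exists>d>0. \<forall>p. norm (p - p0) < d \<longrightarrow> norm (y p 1 - y p0 1 - w (p - p0) 1) \<le> e * norm (p - p0)"
    if "e > 0" for e
  proof -
    define \<epsilon> where "\<epsilon> = min 1 (e / K)"
    have \<epsilon>: "\<epsilon> > 0" "\<epsilon> \<le> 1" "\<epsilon> * K \<le> e" using that K by (auto simp: \<epsilon>_def min_def field_simps)
    obtain d where d: "d > 0" "\<And>p t. norm (p - p0) < d \<Longrightarrow> t \<in> {0..1} \<Longrightarrow>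
        norm (a p t - a p0 t - a' p0 t (p - p0)) \<le> \<epsilon> * norm (p - p0)"
      using uniform_linearization[OF da cont' \<epsilon>(1)] by blast
    have "norm (y p 1 - y p0 1 - w (p - p0) 1) \<le> e * norm (p - p0)" if p: "norm (p - p0) < min d \<epsilon>" for p
    proof -
      let ?v = "p - p0"
      let ?Z = "\<lambda>t. y p t - y p0 t - w ?v t"
      let ?e = "(Cy * L + Cw * (1 + C') * L) * (\<epsilon> * norm ?v)"
      have "norm (?Z 1) \<le> ?e * exp (M + 1)"
      \<comment> \<open>With coefficient \<open>a p\<close>, two error terms remain: the
        linearisation error of a paired with \<open>y p0\<close>, and \<open>a p - a p0\<close>
        paired with w. Each is at most a constant times \<epsilon> |p - p0|.\<close>
      proof (rule gronwall_zero[where y' = "\<lambda>t. B (?Z t) (a p t) +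
            (B (y p0 t) (a p t - a p0 t - a' p0 t ?v) + B (w ?v t) (a p t - a p0 t))"])
        fix t :: real assume t: "t \<in> {0..1}"
        have "(?Z has_vector_derivative (B (y p t) (a p t) - B (y p0 t) (a p0 t) - (B (w ?v t) (a p0 t) + B (y p0 t) (a' p0 t ?v))))
            (at t within {0..1})"
          by (intro has_vector_derivative_diff y w t)
        moreover have "(B (y p t) (a p t) - B (y p0 t) (a p0 t) - (B (w ?v t) (a p0 t) + B (y p0 t) (a' p0 t ?v))) =
            B (?Z t) (a p t) + (B (y p0 t) (a p t - a p0 t - a' p0 t ?v) + B (w ?v t) (a p t - a p0 t))"
          by (simp add: diff_left diff_right)
        ultimately show "(?Z has_vector_derivative B (?Z t) (a p t) +
            (B (y p0 t) (a p t - a p0 t - a' p0 t ?v) + B (w ?v t) (a p t - a p0 t))) (at t within {0..1})" by simp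
        have p1: "norm ?v \<le> 1" "norm ?v \<le> \<epsilon>" "norm ?v < d" using p \<epsilon> by auto
        have 1: "norm (B (?Z t) (a p t)) \<le> M * norm (?Z t)"
        proof -
          have "norm (B (?Z t) (a p t)) \<le> (norm (?Z t) * L) * norm (a p t)" using L(2)[of "?Z t" "a p t"] by (simp add: mult_ac)
          also have "\<dots> \<le> (norm (?Z t) * L) * Ca" using Ca(2)[OF p1(1) t] L by (intro mult_left_mono) auto
          finally show ?thesis by (simp add: M_def mult_ac)
        qed
        have d': "norm (a p t - a p0 t - a' p0 t ?v) \<le> \<epsilon> * norm ?v" by (rule d(2)[OF p1(3) t])
        have 2: "norm (B (y p0 t) (a p t - a p0 t - a' p0 t ?v)) \<le> Cy * (\<epsilon> * norm ?v) * L"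
          using L(1) Cy(1) by (intro order_trans[OF L(2)] mult_right_mono mult_mono Cy(2)[OF t] d') auto
        have "norm (a p t - a p0 t) \<le> norm (a p t - a p0 t - a' p0 t ?v) + norm (a' p0 t ?v)"
          using norm_triangle_sub[of "a p t - a p0 t" "a' p0 t ?v"] by (simp add: add.commute)
        also have "\<dots> \<le> \<epsilon> * norm ?v + C' * norm ?v" by (intro add_mono d' C'(2) t)
        also have "\<dots> \<le> (1 + C') * \<epsilon>"
        proof -
          have "\<epsilon> * norm ?v \<le> \<epsilon> * 1" "C' * norm ?v \<le> C' * \<epsilon>" using p1 \<epsilon> C'(1) by (intro mult_left_mono; simp)+
          then show ?thesis by (simp add: algebra_simps)
        qed
        finally have d'': "norm (a p t - a p0 t) \<le> (1 + C') * \<epsilon>" .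
        have 3: "norm (B (w ?v t) (a p t - a p0 t)) \<le> (Cw * norm ?v) * ((1 + C') * \<epsilon>) * L"
          using L(1) Cw(1) by (intro order_trans[OF L(2)] mult_right_mono mult_mono Cw(2)[OF t] d'') auto
        have "norm (B (?Z t) (a p t) + (B (y p0 t) (a p t - a p0 t - a' p0 t ?v) + B (w ?v t) (a p t - a p0 t)))
            \<le> M * norm (?Z t) + (Cy * (\<epsilon> * norm ?v) * L + (Cw * norm ?v) * ((1 + C') * \<epsilon>) * L)"
          by (intro norm_triangle_mono 1 2 3)
        then show "norm (B (?Z t) (a p t) + (B (y p0 t) (a p t - a p0 t - a' p0 t ?v) + B (w ?v t) (a p t - a p0 t)))
            \<le> M * norm (?Z t) + ?e" by (simp add: algebra_simps)
      qed (use y0 w0 Ca L Cy Cw C' \<epsilon> in \<open>auto simp: M_def intro!: mult_nonneg_nonneg add_nonneg_nonneg\<close>)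
      also have "\<dots> = (\<epsilon> * K) * norm ?v" by (simp add: K_def mult_ac)
      also have "\<dots> \<le> e * norm ?v" using \<epsilon>(3) by (intro mult_right_mono) auto
      finally show ?thesis .
    qed
    then show ?thesis using d(1) \<epsilon>(1) by (intro exI[of _ "min d \<epsilon>"]) auto
  qed
  show ?thesis
    unfolding has_derivative_at_alt
    using main linear_conv_bounded_linear wlin[of 1] by auto
qed

no_notation fps_nth (infixl "$" 75)

section \<open>Two by two matrices\<close>

definition M2 :: "complex \<Rightarrow> complex \<Rightarrow> complex \<Rightarrow> complex \<Rightarrow> cmat2" where
  "M2 a b c d = (\<chi> i j. if i = 1 then (if j = 1 then a else b) else (if j = 1 then c else d))"

lemma M2_nth [simp]: "M2 a b c d $ 1 $ 1 = a" "M2 a b c d $ 1 $ 2 = b" "M2 a b c d $ 2 $ 1 = c" "M2 a b c d $ 2 $ 2 = d"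
  by (simp_all add: M2_def)

lemma cmat2_eq_iff: "(X :: cmat2) = Y \<longleftrightarrow> X $ 1 $ 1 = Y $ 1 $ 1 \<and> X $ 1 $ 2 = Y $ 1 $ 2 \<and> X $ 2 $ 1 = Y $ 2 $ 1 \<and> X $ 2 $ 2 = Y $ 2 $ 2"
  by (auto simp: vec_eq_iff forall_2)

lemma cmat2_mult_nth: "((X :: cmat2) ** Y) $ i $ j = X $ i $ 1 * Y $ 1 $ j + X $ i $ 2 * Y $ 2 $ j"
  by (simp add: matrix_matrix_mult_def sum_2)

lemma cmat2_mat_1: "(mat 1 :: cmat2) = M2 1 0 0 1"
  by (simp add: cmat2_eq_iff mat_def)

lemma hconj_nth [simp]: "hconj X $ i $ j = cnj (X $ j $ i)"
  by (simp add: hconj_def)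

lemma trace_cmat2: "trace (X :: cmat2) = X $ 1 $ 1 + X $ 2 $ 2"
  by (simp add: trace_def sum_2)

lemmas cmat2_simps = cmat2_eq_iff cmat2_mult_nth cmat2_mat_1 trace_cmat2 det_2

lemma bounded_bilinear_cmat2_mult: "bounded_bilinear ((**) :: cmat2 \<Rightarrow> cmat2 \<Rightarrow> cmat2)"
  unfolding bilinear_conv_bounded_bilinear[symmetric] bilinear_def
  by (auto intro!: linearI simp: cmat2_simps algebra_simps)

definition cscale :: "complex \<Rightarrow> cmat2 \<Rightarrow> cmat2" where
  "cscale c X = (\<chi> i j. c * X $ i $ j)"

lemma cscale_nth [simp]: "cscale c X $ i $ j = c * X $ i $ j"
  by (simp add: cscale_def)

lemma bounded_bilinear_cscale: "bounded_bilinear cscale"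
  unfolding bilinear_conv_bounded_bilinear[symmetric] bilinear_def
  by (auto intro!: linearI simp: cmat2_simps algebra_simps)

lemma cscale_mult: "cscale c (X ** Y) = cscale c X ** Y" "X ** cscale c Y = cscale c (X ** Y)"
  by (simp_all add: cmat2_simps algebra_simps)

lemma bounded_linear_Re_trace: "bounded_linear (\<lambda>X::cmat2. Re (trace X))"
  unfolding linear_conv_bounded_linear[symmetric] by (intro linearI) (simp_all add: trace_cmat2 algebra_simps)

lemma linear_entry: "linear (\<lambda>X::cmat2. X $ i $ j)"
  by (intro linearI) simp_all

lemma bounded_linear_entry: "bounded_linear (\<lambda>X::cmat2. X $ i $ j)"
  using linear_entry linear_conv_bounded_linear by blast

lemma linear_hconj: "linear hconj"
  by (intro linearI) (simp_all add: cmat2_simps)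

lemma bounded_linear_hconj: "bounded_linear hconj"
  using linear_hconj linear_conv_bounded_linear by blast

lemma hconj_mult: "hconj (X ** Y) = hconj Y ** hconj X"
  by (simp add: cmat2_simps algebra_simps)

lemma hconj_hconj [simp]: "hconj (hconj X) = X"
  by (simp add: cmat2_simps)

section \<open>Families of flat connections\<close>

text \<open>The equation solved below is \<open>d\<Psi> = \<Psi> A\<^sub>\<zeta>\<close>; the derivative of \<open>A\<^sub>\<zeta>\<close> in \<open>\<zeta>\<close> is complex linear with
  coefficient \<open>Az\<close>.\<close>

locale flat_family =
  fixes A Az :: "complex \<Rightarrow> complex \<Rightarrow> complex \<Rightarrow> cmat2"
  assumes A_linear: "linear (A \<zeta> x)" and Az_linear: "linear (Az \<zeta> x)"
    and A_Ck: "Ck k UNIV (\<lambda>\<zeta> x. A \<zeta> x u)"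
    and A_derivative: "((\<lambda>q. A (fst q) (snd q) u) has_derivative
      (\<lambda>d. cscale (fst d) (Az \<zeta> y u) + D (\<lambda>y. A \<zeta> y u) y (snd d))) (at (\<zeta>, y))"
    and Az_continuous: "continuous_on UNIV (\<lambda>(\<zeta>, x). Az \<zeta> x u)"
    and flat: "D (\<lambda>y. A \<zeta> y v) x u - D (\<lambda>y. A \<zeta> y u) x v + A \<zeta> x u ** A \<zeta> x v - A \<zeta> x v ** A \<zeta> x u = 0"
begin

text \<open>The connection contracted with the velocity of the ray t -> t x. The pair (\<zeta>, x)
  is treated as a single parameter, so that one linear equation yields differentiability in
  both.\<close>

definition ray_conn :: "complex \<times> complex \<Rightarrow> real \<Rightarrow> cmat2" where
  "ray_conn p t = A (fst p) (t *\<^sub>R snd p) (snd p)"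

text \<open>The total derivative of \<open>ray_conn\<close> in (\<zeta>, x): x enters through the
  base point t x, whence the factor t, and through the tangent vector.\<close>

definition ray_conn' :: "complex \<times> complex \<Rightarrow> real \<Rightarrow> complex \<times> complex \<Rightarrow> cmat2" where
  "ray_conn' p t d = cscale (fst d) (Az (fst p) (t *\<^sub>R snd p) (snd p))
     + t *\<^sub>R D (\<lambda>y. A (fst p) y (snd p)) (t *\<^sub>R snd p) (snd d) + A (fst p) (t *\<^sub>R snd p) (snd d)"

lemma A_smooth: "smooth (\<lambda>y. A \<zeta> y u)"
  by (rule smoothI) (rule Ck_at[OF A_Ck])

lemma A_decomp: "A \<zeta> x u = Re u *\<^sub>R A \<zeta> x 1 + Im u *\<^sub>R A \<zeta> x \<i>"
  by (rule linear_complex_decomp[OF A_linear])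

lemma D_A_decomp: "D (\<lambda>y. A \<zeta> y u) x v = Re u *\<^sub>R D (\<lambda>y. A \<zeta> y 1) x v + Im u *\<^sub>R D (\<lambda>y. A \<zeta> y \<i>) x v"
proof -
  have "((\<lambda>y. Re u *\<^sub>R A \<zeta> y 1 + Im u *\<^sub>R A \<zeta> y \<i>) has_derivative
     (\<lambda>v. Re u *\<^sub>R D (\<lambda>y. A \<zeta> y 1) x v + Im u *\<^sub>R D (\<lambda>y. A \<zeta> y \<i>) x v)) (at x)"
    by (intro has_derivative_add has_derivative_scaleR_right smooth_has_derivative A_smooth)
  then have "((\<lambda>y. A \<zeta> y u) has_derivative
     (\<lambda>v. Re u *\<^sub>R D (\<lambda>y. A \<zeta> y 1) x v + Im u *\<^sub>R D (\<lambda>y. A \<zeta> y \<i>) x v)) (at x)"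
    by (simp only: A_decomp[symmetric])
  from D_eq[OF this] show ?thesis by simp
qed

lemma ray_conn_derivative: "((\<lambda>p. ray_conn p t) has_derivative ray_conn' p t) (at p)"
proof -
  have ray: "((\<lambda>p. (fst p, t *\<^sub>R snd p)) has_derivative (\<lambda>d. (fst d, t *\<^sub>R snd d))) (at p)"
    by (auto intro!: derivative_eq_intros)
  have comp: "((\<lambda>p. A (fst p) (t *\<^sub>R snd p) u) has_derivative
      (\<lambda>d. cscale (fst d) (Az (fst p) (t *\<^sub>R snd p) u) + D (\<lambda>y. A (fst p) y u) (t *\<^sub>R snd p) (t *\<^sub>R snd d))) (at p)" for u
    using has_derivative_compose[OF ray A_derivative[of u "fst p" "t *\<^sub>R snd p"]] by simp
  have DA: "D (\<lambda>y. A \<zeta> y u) x (t *\<^sub>R v) = t *\<^sub>R D (\<lambda>y. A \<zeta> y u) x v" for \<zeta> u x v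
    by (rule linear_scale[OF smooth_linear_D[OF A_smooth]])
  have "((\<lambda>p. Re (snd p) *\<^sub>R A (fst p) (t *\<^sub>R snd p) 1 + Im (snd p) *\<^sub>R A (fst p) (t *\<^sub>R snd p) \<i>) has_derivative
    (\<lambda>d. (Re (snd p) *\<^sub>R (cscale (fst d) (Az (fst p) (t *\<^sub>R snd p) 1) + D (\<lambda>y. A (fst p) y 1) (t *\<^sub>R snd p) (t *\<^sub>R snd d))
          + Re (snd d) *\<^sub>R A (fst p) (t *\<^sub>R snd p) 1)
       + (Im (snd p) *\<^sub>R (cscale (fst d) (Az (fst p) (t *\<^sub>R snd p) \<i>) + D (\<lambda>y. A (fst p) y \<i>) (t *\<^sub>R snd p) (t *\<^sub>R snd d))
          + Im (snd d) *\<^sub>R A (fst p) (t *\<^sub>R snd p) \<i>))) (at p)"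
    by (intro has_derivative_add has_derivative_scaleR comp derivative_intros)
  moreover have "(\<lambda>d. (Re (snd p) *\<^sub>R (cscale (fst d) (Az (fst p) (t *\<^sub>R snd p) 1) + D (\<lambda>y. A (fst p) y 1) (t *\<^sub>R snd p) (t *\<^sub>R snd d))
          + Re (snd d) *\<^sub>R A (fst p) (t *\<^sub>R snd p) 1)
       + (Im (snd p) *\<^sub>R (cscale (fst d) (Az (fst p) (t *\<^sub>R snd p) \<i>) + D (\<lambda>y. A (fst p) y \<i>) (t *\<^sub>R snd p) (t *\<^sub>R snd d))
          + Im (snd d) *\<^sub>R A (fst p) (t *\<^sub>R snd p) \<i>)) = ray_conn' p t" (is "?L = _")
  proof
    fix d :: "complex \<times> complex"
    have 1: "cscale (fst d) (Az (fst p) (t *\<^sub>R snd p) (snd p)) =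
        Re (snd p) *\<^sub>R cscale (fst d) (Az (fst p) (t *\<^sub>R snd p) 1) + Im (snd p) *\<^sub>R cscale (fst d) (Az (fst p) (t *\<^sub>R snd p) \<i>)"
      by (subst linear_complex_decomp[OF Az_linear]) (simp add: cmat2_simps algebra_simps)
    show "?L d = ray_conn' p t d"
      unfolding ray_conn'_def 1 DA D_A_decomp[of "fst p" "snd p"] A_decomp[of "fst p" _ "snd d"]
      by (simp add: algebra_simps)
  qed
  moreover have "(\<lambda>p. Re (snd p) *\<^sub>R A (fst p) (t *\<^sub>R snd p) 1 + Im (snd p) *\<^sub>R A (fst p) (t *\<^sub>R snd p) \<i>) = (\<lambda>p. ray_conn p t)"
    by (simp add: ray_conn_def A_decomp[symmetric])
  ultimately show ?thesis by simp
qed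

lemma continuous_ray:
  fixes g :: "complex \<Rightarrow> complex \<Rightarrow> 'c::topological_space"
  assumes "continuous_on UNIV (\<lambda>(\<zeta>, x). g \<zeta> x)"
  shows "continuous_on S (\<lambda>(p, t). g (fst p) (t *\<^sub>R snd p))"
proof -
  have "continuous_on S (\<lambda>y. case (fst (fst y), snd y *\<^sub>R snd (fst y)) of (\<zeta>, x) \<Rightarrow> g \<zeta> x)"
    by (rule continuous_on_compose2[OF assms])
      (auto intro!: continuous_intros)
  then show ?thesis by (simp add: split_def)
qed

lemma A_continuous: "continuous_on UNIV (\<lambda>(\<zeta>, x). A \<zeta> x u)"
  using Ck_imp_continuous[OF A_Ck] by simp

lemma D_A_continuous: "continuous_on UNIV (\<lambda>(\<zeta>, x). D (\<lambda>y. A \<zeta> y u) x v)"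
  using Ck_imp_continuous[OF Ck_D[OF A_Ck]] by simp

lemma ray_conn_continuous: "continuous_on S (\<lambda>(p, t). ray_conn p t)"
proof -
  have "continuous_on S (\<lambda>(p, t). Re (snd p) *\<^sub>R A (fst p) (t *\<^sub>R snd p) 1 + Im (snd p) *\<^sub>R A (fst p) (t *\<^sub>R snd p) \<i>)"
    using continuous_ray[OF A_continuous[of 1], of S] continuous_ray[OF A_continuous[of \<i>], of S]
    unfolding split_def by (intro continuous_intros)
  then show ?thesis by (simp add: ray_conn_def A_decomp[symmetric])
qed

lemma ray_conn'_continuous: "continuous_on S (\<lambda>(p, t). ray_conn' p t d)"
proof -
  have 1: "cscale (fst d) (Az (fst p) (t *\<^sub>R snd p) (snd p)) =
      Re (snd p) *\<^sub>R cscale (fst d) (Az (fst p) (t *\<^sub>R snd p) 1) + Im (snd p) *\<^sub>R cscale (fst d) (Az (fst p) (t *\<^sub>R snd p) \<i>)" for p and t :: real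
    by (subst linear_complex_decomp[OF Az_linear]) (simp add: cmat2_simps algebra_simps)
  have 2: "D (\<lambda>y. A (fst p) y (snd p)) z v = Re (snd p) *\<^sub>R D (\<lambda>y. A (fst p) y 1) z v + Im (snd p) *\<^sub>R D (\<lambda>y. A (fst p) y \<i>) z v" for p z v
    by (rule D_A_decomp)
  have cs: "bounded_linear (cscale (fst d))" by (rule bounded_bilinear.bounded_linear_right[OF bounded_bilinear_cscale])
  show ?thesis
    unfolding ray_conn'_def 1 2
    using continuous_ray[OF Az_continuous[of 1], of S] continuous_ray[OF Az_continuous[of \<i>], of S]
      continuous_ray[OF D_A_continuous[of 1 "snd d"], of S] continuous_ray[OF D_A_continuous[of \<i> "snd d"], of S]
      continuous_ray[OF A_continuous[of "snd d"], of S]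
    unfolding split_def by (intro continuous_intros bounded_linear.continuous_on[OF cs])
qed

lemma ray_solution_exists:
  "\<exists>y. y 0 = mat 1 \<and> (\<forall>t\<in>{0..1}. (y has_vector_derivative y t ** ray_conn p t) (at t within {0..1}))"
proof -
  have c: "continuous_on {0..1} (ray_conn p)"
  proof -
    have "continuous_on {0..1} (\<lambda>t. case (p, t) of (p, t) \<Rightarrow> ray_conn p t)"
      by (rule continuous_on_compose2[OF ray_conn_continuous[of UNIV]]) (auto intro!: continuous_intros)
    then show ?thesis by simp
  qed
  show ?thesis
    using linear_ode_exists[OF bounded_bilinear_cmat2_mult c, of "mat 1"] by metis
qed

definition ray_sol :: "complex \<times> complex \<Rightarrow> real \<Rightarrow> cmat2" where
  "ray_sol p = (SOME y. y 0 = mat 1 \<and> (\<forall>t\<in>{0..1}. (y has_vector_derivative y t ** ray_conn p t) (at t within {0..1})))"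

lemma ray_sol: "ray_sol p 0 = mat 1"
  "t \<in> {0..1} \<Longrightarrow> (ray_sol p has_vector_derivative ray_sol p t ** ray_conn p t) (at t within {0..1})"
  using someI_ex[OF ray_solution_exists[of p]] unfolding ray_sol_def by auto

definition \<Psi> :: "complex \<Rightarrow> complex \<Rightarrow> cmat2" where
  "\<Psi> \<zeta> x = ray_sol (\<zeta>, x) 1"

text \<open>The equation for the \<zeta>-variation is inhomogeneous. Adjoining the solution itself
  as a second unknown makes the pair homogeneous linear, and uniqueness identifies the adjoined
  component with \<open>ray_sol\<close>.\<close>

lemma variation_exists:
  "\<exists>v. v 0 = 0 \<and> (\<forall>t\<in>{0..1}. (v has_vector_derivative v t ** ray_conn p t
      + ray_sol p t ** Az (fst p) (t *\<^sub>R snd p) (snd p)) (at t within {0..1}))"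
proof -
  let ?b = "\<lambda>t. ray_sol p t ** Az (fst p) (t *\<^sub>R snd p) (snd p)"
  let ?B = "\<lambda>(x :: cmat2 \<times> cmat2) (a :: cmat2 \<times> cmat2). (fst x ** fst a, snd x ** fst a + fst x ** snd a)"
  have B: "bounded_bilinear ?B"
    unfolding bilinear_conv_bounded_bilinear[symmetric] bilinear_def
    by (auto intro!: linearI simp: cmat2_simps algebra_simps)
  have Az_decomp: "Az (fst p) (t *\<^sub>R snd p) (snd p) = Re (snd p) *\<^sub>R Az (fst p) (t *\<^sub>R snd p) 1 + Im (snd p) *\<^sub>R Az (fst p) (t *\<^sub>R snd p) \<i>" for t :: real
    by (rule linear_complex_decomp[OF Az_linear])
  have c0: "continuous_on {0..1} (\<lambda>t. g (fst p) (t *\<^sub>R snd p))" if "continuous_on UNIV (\<lambda>(\<zeta>, x). g \<zeta> x)" for g :: "complex \<Rightarrow> complex \<Rightarrow> cmat2"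
  proof -
    have "continuous_on {0..1} (\<lambda>t. case (p, t) of (p, t) \<Rightarrow> g (fst p) (t *\<^sub>R snd p))"
      by (rule continuous_on_compose2[OF continuous_ray[of _ UNIV, OF that]]) (auto intro!: continuous_intros)
    then show ?thesis by simp
  qed
  have c1: "continuous_on {0..1} (\<lambda>t. Az (fst p) (t *\<^sub>R snd p) (snd p))"
    unfolding Az_decomp by (intro continuous_intros c0 Az_continuous)
  have c2: "continuous_on {0..1} (ray_conn p)"
    unfolding ray_conn_def by (intro c0 A_continuous)
  have "continuous_on {0..1} (\<lambda>t. (ray_conn p t, Az (fst p) (t *\<^sub>R snd p) (snd p)))"
    by (intro continuous_on_Pair c1 c2)
  from linear_ode_exists[OF B this, of "(mat 1, 0)"] obtain z where z: "z 0 = (mat 1, 0)"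
    "\<And>t. t \<in> {0..1} \<Longrightarrow> (z has_vector_derivative (fst (z t) ** ray_conn p t,
        snd (z t) ** ray_conn p t + fst (z t) ** Az (fst p) (t *\<^sub>R snd p) (snd p))) (at t within {0..1})"
    by auto
  have z1: "((\<lambda>t. fst (z t)) has_vector_derivative fst (z t) ** ray_conn p t) (at t within {0..1})" if "t \<in> {0..1}" for t
    by (rule has_vector_derivative_eq_rhs[OF bounded_linear.has_vector_derivative[OF bounded_linear_fst z(2)[OF that]]])
      (rule fst_conv)
  have z2: "((\<lambda>t. snd (z t)) has_vector_derivative
        snd (z t) ** ray_conn p t + fst (z t) ** Az (fst p) (t *\<^sub>R snd p) (snd p)) (at t within {0..1})" if "t \<in> {0..1}" for t
    by (rule has_vector_derivative_eq_rhs[OF bounded_linear.has_vector_derivative[OF bounded_linear_snd z(2)[OF that]]])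
      (rule snd_conv)
  interpret bounded_bilinear "(**) :: cmat2 \<Rightarrow> cmat2 \<Rightarrow> cmat2" by (rule bounded_bilinear_cmat2_mult)
  obtain K where K: "K > 0" "\<And>(x :: cmat2) s. s \<in> {0..1} \<Longrightarrow> norm (x ** ray_conn p s) \<le> K * norm x"
    using bounded_bilinear_uniform_bound[OF bounded_bilinear_cmat2_mult compact_Icc c2] by blast
  have eq: "fst (z t) = ray_sol p t" if "t \<in> {0..1}" for t
  proof -
    have "norm (fst (z t) - ray_sol p t) \<le> 0 * exp (K + 1)"
    proof (rule gronwall_zero[where y' = "\<lambda>t. (fst (z t) - ray_sol p t) ** ray_conn p t"])
      show "((\<lambda>t. fst (z t) - ray_sol p t) has_vector_derivative (fst (z t) - ray_sol p t) ** ray_conn p t) (at t within {0..1})"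
        if "t \<in> {0..1}" for t
        unfolding diff_left by (intro has_vector_derivative_diff z1 ray_sol that)
      show "norm ((fst (z t) - ray_sol p t) ** ray_conn p t) \<le> K * norm (fst (z t) - ray_sol p t) + 0"
        if "t \<in> {0..1}" for t using K(2)[OF that, of "fst (z t) - ray_sol p t"] by (simp only: add_0_right)
    qed (use K(1) that z(1) ray_sol(1)[of p] in simp_all)
    then show ?thesis by simp
  qed
  have "((\<lambda>t. snd (z t)) has_vector_derivative snd (z t) ** ray_conn p t + ?b t) (at t within {0..1})" if "t \<in> {0..1}" for t
    using z2[OF that] eq[OF that] by simp
  then show ?thesis using z(1) by (intro exI[of _ "\<lambda>t. snd (z t)"]) auto
qed

text \<open>Flatness is exactly what makes \<open>ray_sol\<close> times A(t x)(t u) a solution of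
  the variational equation in the direction u of x; at t = 1 it becomes \<Psi> A u. The
  \<zeta>-direction contributes a multiple of a fixed matrix V by a complex scalar, which is complex
  differentiability.\<close>

lemma \<Psi>_derivative:
  obtains V where "((\<lambda>p. \<Psi> (fst p) (snd p)) has_derivative
     (\<lambda>d. \<Psi> \<zeta> x ** A \<zeta> x (snd d) + cscale (fst d) V)) (at (\<zeta>, x))"
proof -
  let ?p = "(\<zeta>, x)"
  obtain v where v0: "v 0 = 0" and v: "\<And>t. t \<in> {0..1} \<Longrightarrow> (v has_vector_derivative v t ** ray_conn ?p t
      + ray_sol ?p t ** Az \<zeta> (t *\<^sub>R x) x) (at t within {0..1})"
    using variation_exists[of ?p] by auto
  define w where "w = (\<lambda>d t. ray_sol ?p t ** A \<zeta> (t *\<^sub>R x) (t *\<^sub>R snd d) + cscale (fst d) (v t))"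
  interpret mm: bounded_bilinear "(**) :: cmat2 \<Rightarrow> cmat2 \<Rightarrow> cmat2" by (rule bounded_bilinear_cmat2_mult)
  interpret cs: bounded_bilinear cscale by (rule bounded_bilinear_cscale)
  have scale: "A \<zeta> y (t *\<^sub>R u) = t *\<^sub>R A \<zeta> y u" for y t u by (rule linear_scale[OF A_linear])
  have "((\<lambda>p. ray_sol p 1) has_derivative (\<lambda>d. w d 1)) (at ?p)"
  proof (rule ode_parameter_derivative[OF bounded_bilinear_cmat2_mult ray_conn_derivative ray_conn'_continuous
        ray_conn_continuous ray_sol(2) ray_sol(1)])
    fix d :: "complex \<times> complex" and t :: real assume t: "t \<in> {0..1}"
    let ?u = "snd d" and ?a = "A \<zeta> (t *\<^sub>R x)" and ?r = "ray_sol ?p t"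
    have dA: "((\<lambda>t. A \<zeta> (t *\<^sub>R x) ?u) has_vector_derivative D (\<lambda>y. A \<zeta> y ?u) (t *\<^sub>R x) x) (at t within {0..1})"
    proof -
      have "((\<lambda>t. t *\<^sub>R x) has_derivative (\<lambda>h. h *\<^sub>R x)) (at t within {0..1})"
        by (auto intro!: derivative_eq_intros)
      from has_derivative_compose[OF this smooth_has_derivative[OF A_smooth[of \<zeta> ?u]]]
      show ?thesis
        by (simp add: has_vector_derivative_def linear_scale[OF smooth_linear_D[OF A_smooth]])
    qed
    have "((\<lambda>t. t *\<^sub>R A \<zeta> (t *\<^sub>R x) ?u) has_vector_derivative
        t *\<^sub>R D (\<lambda>y. A \<zeta> y ?u) (t *\<^sub>R x) x + 1 *\<^sub>R ?a ?u) (at t within {0..1})"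
      by (intro has_vector_derivative_scaleR dA) simp
    from mm.has_vector_derivative[OF ray_sol(2)[OF t, of ?p] this]
    have 1: "((\<lambda>t. ray_sol ?p t ** A \<zeta> (t *\<^sub>R x) (t *\<^sub>R ?u)) has_vector_derivative
        ?r ** (t *\<^sub>R D (\<lambda>y. A \<zeta> y ?u) (t *\<^sub>R x) x + ?a ?u) + (?r ** ?a x) ** (t *\<^sub>R ?a ?u)) (at t within {0..1})"
      by (simp add: scale ray_conn_def)
    have 2: "((\<lambda>t. cscale (fst d) (v t)) has_vector_derivative
        cscale (fst d) (v t ** ray_conn ?p t + ?r ** Az \<zeta> (t *\<^sub>R x) x)) (at t within {0..1})"
      by (rule bounded_linear.has_vector_derivative[OF cs.bounded_linear_right v[OF t]])
    \<comment> \<open>Flatness trades the derivative of A(.)u along the ray for that of A(.)x in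
      direction u, at the price of a commutator; the commutator cancels against the derivative of
      \<open>ray_sol\<close>.\<close>
    have "D (\<lambda>y. A \<zeta> y ?u) (t *\<^sub>R x) x = D (\<lambda>y. A \<zeta> y x) (t *\<^sub>R x) ?u + ?a ?u ** ?a x - ?a x ** ?a ?u"
      using flat[of \<zeta> ?u "t *\<^sub>R x" x] by (simp add: algebra_simps add_eq_0_iff)
    then have "?r ** (t *\<^sub>R D (\<lambda>y. A \<zeta> y ?u) (t *\<^sub>R x) x + ?a ?u) + (?r ** ?a x) ** (t *\<^sub>R ?a ?u)
         + cscale (fst d) (v t ** ray_conn ?p t + ?r ** Az \<zeta> (t *\<^sub>R x) x)
       = w d t ** ray_conn ?p t + ?r ** ray_conn' ?p t d"
      by (simp add: w_def scale ray_conn_def ray_conn'_def mm.add_left mm.add_right mm.diff_right cs.add_right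
          mm.scaleR_left mm.scaleR_right cscale_mult matrix_mul_assoc scaleR_add_right scaleR_diff_right)
    then show "(w d has_vector_derivative w d t ** ray_conn ?p t + ?r ** ray_conn' ?p t d) (at t within {0..1})"
      using has_vector_derivative_add[OF 1 2] by (simp add: w_def[abs_def])
  next
    show "w d 0 = 0" for d using linear_0[OF A_linear] v0 by (simp add: w_def mm.zero_right cs.zero_right)
    show "linear (\<lambda>d. w d t)" if "t \<in> {0..1}" for t
      unfolding w_def scale
      by (intro linearI) (simp_all add: linear_add[OF A_linear] scale mm.add_right cs.add_left scaleR_add_right
         mm.scaleR_right cs.scaleR_left mult.commute)
  qed
  then show ?thesis
    by (intro that[of "v 1"]) (simp add: \<Psi>_def w_def)
qed

end

context flat_family
begin

lemma \<Psi>_has_derivative: "(\<Psi> \<zeta> has_derivative (\<lambda>u. \<Psi> \<zeta> x ** A \<zeta> x u)) (at x)"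
proof -
  obtain V where V: "((\<lambda>p. \<Psi> (fst p) (snd p)) has_derivative
     (\<lambda>d. \<Psi> \<zeta> x ** A \<zeta> x (snd d) + cscale (fst d) V)) (at (\<zeta>, x))" by (rule \<Psi>_derivative)
  have "((\<lambda>x. (\<zeta>, x)) has_derivative (\<lambda>u. (0, u))) (at x)" by (auto intro!: derivative_eq_intros)
  from has_derivative_compose[OF this V] show ?thesis
    by (simp add: bounded_bilinear.zero_left[OF bounded_bilinear_cscale])
qed

lemma D_\<Psi>: "D (\<Psi> \<zeta>) x u = \<Psi> \<zeta> x ** A \<zeta> x u"
  using D_eq[OF \<Psi>_has_derivative] by simp

lemma \<Psi>_entry_differentiable: "(\<lambda>\<zeta>. \<Psi> \<zeta> x $ i $ j) field_differentiable (at \<zeta>)"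
proof -
  obtain V where V: "((\<lambda>p. \<Psi> (fst p) (snd p)) has_derivative
     (\<lambda>d. \<Psi> \<zeta> x ** A \<zeta> x (snd d) + cscale (fst d) V)) (at (\<zeta>, x))" by (rule \<Psi>_derivative)
  have "((\<lambda>\<zeta>. (\<zeta>, x)) has_derivative (\<lambda>u. (u, 0))) (at \<zeta>)" by (auto intro!: derivative_eq_intros)
  from has_derivative_compose[OF this V] have "((\<lambda>\<zeta>. \<Psi> \<zeta> x) has_derivative (\<lambda>u. cscale u V)) (at \<zeta>)"
    by (simp add: linear_0[OF A_linear])
  from bounded_linear.has_derivative[OF bounded_linear_entry this, of i j]
  have "((\<lambda>\<zeta>. \<Psi> \<zeta> x $ i $ j) has_field_derivative (V $ i $ j)) (at \<zeta>)"
    unfolding has_field_derivative_def by (rule has_derivative_eq_rhs) (simp add: fun_eq_iff)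
  then show ?thesis unfolding field_differentiable_def by blast
qed

lemma \<Psi>_continuous: "continuous_on UNIV (\<lambda>(\<zeta>, x). \<Psi> \<zeta> x)"
proof -
  have "isCont (\<lambda>p. \<Psi> (fst p) (snd p)) (\<zeta>, x)" for \<zeta> x
  proof -
    obtain V where V: "((\<lambda>p. \<Psi> (fst p) (snd p)) has_derivative
       (\<lambda>d. \<Psi> \<zeta> x ** A \<zeta> x (snd d) + cscale (fst d) V)) (at (\<zeta>, x))" by (rule \<Psi>_derivative)
    show ?thesis by (rule has_derivative_continuous[OF V])
  qed
  then show ?thesis by (auto simp: split_def intro!: continuous_at_imp_continuous_on)
qed

text \<open>Bootstrapping: the x-derivative of \<Psi> is \<Psi> A, hence as regular as \<Psi>
  itself, with joint continuity in \<zeta>.\<close>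

lemma \<Psi>_Ck: "Ck k UNIV \<Psi>"
proof (induction k)
  case 0
  then show ?case using \<Psi>_continuous by simp
next
  case (Suc k)
  show ?case
  proof (rule Ck_SucI[where F' = "\<lambda>\<zeta> x u. \<Psi> \<zeta> x ** A \<zeta> x u"])
    show "Ck 0 UNIV \<Psi>" using \<Psi>_continuous by simp
    show "Ck k UNIV (\<lambda>\<zeta> x. \<Psi> \<zeta> x ** A \<zeta> x u)" for u
      by (rule Ck_bilinear[OF bounded_bilinear_cmat2_mult open_UNIV Suc A_Ck])
  qed (auto intro: \<Psi>_has_derivative)
qed

lemma \<Psi>_0: "\<Psi> \<zeta> 0 = mat 1"
proof -
  have "norm (ray_sol (\<zeta>, 0) 1 - mat 1) \<le> 0 * exp (0 + 1)"
  proof (rule gronwall_zero[where y' = "\<lambda>t. 0"])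
    show "((\<lambda>t. ray_sol (\<zeta>, 0) t - mat 1) has_vector_derivative 0) (at t within {0..1})" if "t \<in> {0..1}" for t
    proof -
      have "ray_conn (\<zeta>, 0) t = 0" by (simp add: ray_conn_def linear_0[OF A_linear])
      then have "(ray_sol (\<zeta>, 0) has_vector_derivative 0) (at t within {0..1})"
        using ray_sol(2)[OF that, of "(\<zeta>, 0)"] bounded_bilinear.zero_right[OF bounded_bilinear_cmat2_mult] by simp
      from has_vector_derivative_diff[OF this has_vector_derivative_const] show ?thesis by simp
    qed
  qed (use ray_sol(1)[of "(\<zeta>, 0)"] in simp_all)
  then show ?thesis by (simp add: \<Psi>_def)
qed

text \<open>The derivative of the determinant is the determinant times the trace of A, hence zero,
  and \<Psi> is the identity at 0.\<close>

lemma det_\<Psi>: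
  assumes "\<And>x u. trace (A \<zeta> x u) = 0"
  shows "det (\<Psi> \<zeta> x) = 1"
proof -
  have e: "((\<lambda>x. \<Psi> \<zeta> x $ i $ j) has_derivative (\<lambda>u. (\<Psi> \<zeta> x ** A \<zeta> x u) $ i $ j)) (at x)" for x i j
    by (rule bounded_linear.has_derivative[OF bounded_linear_entry \<Psi>_has_derivative])
  have "((\<lambda>x. det (\<Psi> \<zeta> x)) has_derivative (\<lambda>u. 0)) (at x within UNIV)" for x
  proof -
    have "((\<lambda>x. \<Psi> \<zeta> x $ 1 $ 1 * \<Psi> \<zeta> x $ 2 $ 2 - \<Psi> \<zeta> x $ 1 $ 2 * \<Psi> \<zeta> x $ 2 $ 1) has_derivative
      (\<lambda>u. (\<Psi> \<zeta> x $ 1 $ 1 * (\<Psi> \<zeta> x ** A \<zeta> x u) $ 2 $ 2 + (\<Psi> \<zeta> x ** A \<zeta> x u) $ 1 $ 1 * \<Psi> \<zeta> x $ 2 $ 2)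
        - (\<Psi> \<zeta> x $ 1 $ 2 * (\<Psi> \<zeta> x ** A \<zeta> x u) $ 2 $ 1 + (\<Psi> \<zeta> x ** A \<zeta> x u) $ 1 $ 2 * \<Psi> \<zeta> x $ 2 $ 1))) (at x)"
      by (intro has_derivative_diff has_derivative_mult e)
    moreover have "(\<Psi> \<zeta> x $ 1 $ 1 * (\<Psi> \<zeta> x ** A \<zeta> x u) $ 2 $ 2 + (\<Psi> \<zeta> x ** A \<zeta> x u) $ 1 $ 1 * \<Psi> \<zeta> x $ 2 $ 2)
        - (\<Psi> \<zeta> x $ 1 $ 2 * (\<Psi> \<zeta> x ** A \<zeta> x u) $ 2 $ 1 + (\<Psi> \<zeta> x ** A \<zeta> x u) $ 1 $ 2 * \<Psi> \<zeta> x $ 2 $ 1) = 0" for u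
    proof -
      have "A \<zeta> x u $ 2 $ 2 = - (A \<zeta> x u $ 1 $ 1)" using assms[of x u] by (simp add: trace_cmat2 add_eq_0_iff)
      then show ?thesis by (simp add: cmat2_mult_nth algebra_simps)
    qed
    ultimately show ?thesis by (simp add: det_2)
  qed
  then obtain c where c: "\<And>x. det (\<Psi> \<zeta> x) = c"
    using has_derivative_zero_constant[of UNIV "\<lambda>x. det (\<Psi> \<zeta> x)"] by auto
  have "c = 1" using c[of 0] by (simp add: \<Psi>_0)
  then show ?thesis using c by simp
qed

end

section \<open>Hyperbolic space\<close>

text \<open>The adjugate is the inverse for determinant one, but linear in X, so derivatives and
  smoothness are immediate.\<close>

definition adj :: "cmat2 \<Rightarrow> cmat2" where
  "adj X = M2 (X $ 2 $ 2) (- X $ 1 $ 2) (- X $ 2 $ 1) (X $ 1 $ 1)"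

lemma adj_nth [simp]: "adj X $ 1 $ 1 = X $ 2 $ 2" "adj X $ 1 $ 2 = - X $ 1 $ 2" "adj X $ 2 $ 1 = - X $ 2 $ 1" "adj X $ 2 $ 2 = X $ 1 $ 1"
  by (simp_all add: adj_def)

lemma adj_mult: "det X = 1 \<Longrightarrow> X ** adj X = mat 1" "det X = 1 \<Longrightarrow> adj X ** X = mat 1"
  by (simp_all add: cmat2_simps algebra_simps)

lemma adj_mult_distrib: "adj (X ** Y) = adj Y ** adj X"
  by (simp add: cmat2_simps algebra_simps)

lemma det_adj: "det (adj X) = det X"
  by (simp add: cmat2_simps algebra_simps)

lemma matrix_inv_adj: "det (X :: cmat2) = 1 \<Longrightarrow> matrix_inv X = adj X"
  unfolding matrix_inv_def
  by (rule some_equality) (metis adj_mult matrix_mul_assoc matrix_mul_lid matrix_mul_rid)+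

text \<open>Identifies the plane with the tangent vectors at the identity that are orthogonal to
  \<sigma>3; \<open>off 1\<close>, \<open>off i\<close> and \<sigma>3 are the Pauli
  matrices.\<close>

definition off :: "complex \<Rightarrow> cmat2" where "off w = M2 0 (cnj w) w 0"

definition \<sigma>3 :: cmat2 where "\<sigma>3 = M2 1 0 0 (-1)"

lemma off_nth [simp]: "off w $ 1 $ 1 = 0" "off w $ 1 $ 2 = cnj w" "off w $ 2 $ 1 = w" "off w $ 2 $ 2 = 0"
  by (simp_all add: off_def)

lemma \<sigma>3_nth [simp]: "\<sigma>3 $ 1 $ 1 = 1" "\<sigma>3 $ 1 $ 2 = 0" "\<sigma>3 $ 2 $ 1 = 0" "\<sigma>3 $ 2 $ 2 = -1"
  by (simp_all add: \<sigma>3_def)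

lemma act_linear: "linear (act g)"
  by (intro linearI) (simp_all add: act_def cmat2_simps algebra_simps)

lemma act_mult: "act (g ** h) X = act g (act h X)"
  by (simp add: act_def hconj_mult matrix_mul_assoc)

lemma act_1 [simp]: "act (mat 1) X = X"
  by (simp add: act_def cmat2_simps)

lemma act_id: "act g (mat 1) = g ** hconj g"
  by (simp add: act_def)

lemma hconj_act: "hconj (act g X) = act g (hconj X)"
  by (simp add: act_def hconj_mult matrix_mul_assoc)

text \<open>These unitary matrices are the rotations about the \<sigma>3 axis. The angle doubles, so
  a square root of the frame rotation is what enters the holonomy.\<close>

lemma diag_unit:
  assumes "cmod k * cmod k = 1"
  shows "det (M2 (cnj k) 0 0 k) = 1" "act (M2 (cnj k) 0 0 k) (mat 1) = mat 1"
    "act (M2 (cnj k) 0 0 k) (off w) = off (k * k * w)"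
proof -
  have ck: "cnj k * k = 1"
    using assms by (simp add: mult.commute[of "cnj k"] complex_norm_square[symmetric] power2_eq_square flip: of_real_mult)
  then show "det (M2 (cnj k) 0 0 k) = 1" "act (M2 (cnj k) 0 0 k) (mat 1) = mat 1"
    "act (M2 (cnj k) 0 0 k) (off w) = off (k * k * w)"
    by (simp_all add: det_2 act_def cmat2_simps mult.commute)
qed

lemma act_Her: "X \<in> Her \<Longrightarrow> act g X \<in> Her"
  by (simp add: Her_def hconj_act)

lemma det_act: "det g = 1 \<Longrightarrow> det (act g X) = det X"
proof -
  have "det (hconj g) = cnj (det g)" by (simp add: det_2)
  then show "det g = 1 \<Longrightarrow> det (act g X) = det X" by (simp add: act_def det_mul)
qed

lemma act_adj: "det g = 1 \<Longrightarrow> act g (act (adj g) X) = X" "det g = 1 \<Longrightarrow> act (adj g) (act g X) = X"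
  by (simp_all add: act_mult[symmetric] adj_mult)

lemma mink_entries: "mink X Y = - Re (X $ 1 $ 1 * Y $ 2 $ 2 + X $ 2 $ 2 * Y $ 1 $ 1 - X $ 1 $ 2 * Y $ 2 $ 1 - X $ 2 $ 1 * Y $ 1 $ 2) / 2"
  by (simp add: mink_def det_2 algebra_simps)

lemma mink_act: "det g = 1 \<Longrightarrow> mink (act g X) (act g Y) = mink X Y"
  by (simp add: mink_def linear_add[OF act_linear, symmetric] det_act)

lemma mink_commute: "mink X Y = mink Y X"
  by (simp add: mink_entries algebra_simps)

lemma bounded_bilinear_mink: "bounded_bilinear mink"
  unfolding bilinear_conv_bounded_bilinear[symmetric] bilinear_def
  by (auto intro!: linearI simp: mink_entries algebra_simps add_divide_distrib diff_divide_distrib)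

lemma mink_off: "mink (off a) (off b) = a \<bullet> b" "mink (mat 1) (off a) = 0" "mink (off a) (mat 1) = 0"
  "mink \<sigma>3 (off a) = 0" "mink (off a) \<sigma>3 = 0" "mink \<sigma>3 \<sigma>3 = 1" "mink (mat 1) \<sigma>3 = 0" "mink \<sigma>3 (mat 1) = 0" "mink (mat 1) (mat 1) = -1"
  by (simp_all add: mink_entries cmat2_mat_1 inner_complex_def)

lemma Her_iff: "X \<in> Her \<longleftrightarrow> Im (X $ 1 $ 1) = 0 \<and> Im (X $ 2 $ 2) = 0 \<and> X $ 1 $ 2 = cnj (X $ 2 $ 1)"
  by (auto simp: Her_def cmat2_eq_iff complex_eq_iff)

lemma Her_simps: "off a \<in> Her" "\<sigma>3 \<in> Her" "mat 1 \<in> Her"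
  by (simp_all add: Her_iff cmat2_mat_1)

text \<open>SL(2,C) acts transitively on \<open>H3\<close>: the lower triangular Cholesky factor of
  \<xi> is a witness.\<close>

lemma H3_iff: "\<xi> \<in> H3 \<longleftrightarrow> (\<exists>a. det a = 1 \<and> \<xi> = a ** hconj a)"
proof
  assume "\<xi> \<in> H3"
  then have H: "\<xi> \<in> Her" "det \<xi> = 1" "0 < Re (trace \<xi>)" by (auto simp: H3_def)
  define p r z where "p = Re (\<xi> $ 1 $ 1)" "r = Re (\<xi> $ 2 $ 2)" "z = \<xi> $ 2 $ 1"
  have \<xi>: "\<xi> = M2 p (cnj z) z r"
    using H(1) by (simp add: p_r_z_def cmat2_eq_iff Her_iff complex_eq_iff)
  have d: "p * r - (cmod z)\<^sup>2 = 1"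
  proof -
    have "complex_of_real (p * r) - z * cnj z = 1" using H(2) by (simp add: \<xi> det_2 mult.commute)
    then have "complex_of_real (p * r - (cmod z)\<^sup>2) = complex_of_real 1"
      by (simp only: complex_norm_square of_real_diff of_real_1)
    then show ?thesis by (simp only: of_real_eq_iff)
  qed
  have p: "p > 0"
  proof (rule ccontr)
    assume "\<not> p > 0"
    have "p * r > 0" using d zero_le_power2[of "cmod z"] by linarith
    then have "p < 0 \<and> r < 0" using \<open>\<not> p > 0\<close> by (auto simp: zero_less_mult_iff)
    then show False using H(3) by (simp add: \<xi> trace_cmat2)
  qed
  define s where "s = sqrt p"
  have s: "s > 0" "p = s * s" using p by (simp_all add: s_def)
  have r: "r = (cmod z)\<^sup>2 / (s * s) + 1 / (s * s)" using d s by (simp add: field_simps)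
  have r': "complex_of_real r = z * cnj z / (of_real s * of_real s) + 1 / (of_real s * of_real s)"
    unfolding r by (simp only: of_real_add of_real_divide complex_norm_square of_real_mult of_real_1)
  have "\<xi> = M2 s 0 (z / s) (1 / s) ** hconj (M2 s 0 (z / s) (1 / s))"
    unfolding \<xi> r' s(2) using s(1) by (simp add: cmat2_simps)
  then show "\<exists>a. det a = 1 \<and> \<xi> = a ** hconj a"
    using s by (intro exI[of _ "M2 s 0 (z / s) (1 / s)"]) (simp add: det_2)
next
  assume "\<exists>a. det a = 1 \<and> \<xi> = a ** hconj a"
  then obtain a where a: "det a = 1" "\<xi> = a ** hconj a" by blast
  have "det \<xi> = 1" using det_act[OF a(1), of "mat 1"] by (simp add: act_id a)
  moreover have "\<xi> \<in> Her" using act_Her[OF Her_simps(3), of a] by (simp add: act_id a)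
  moreover have "0 < Re (trace \<xi>)"
  proof -
    have "Re (trace \<xi>) = (cmod (a $ 1 $ 1))\<^sup>2 + (cmod (a $ 1 $ 2))\<^sup>2 + (cmod (a $ 2 $ 1))\<^sup>2 + (cmod (a $ 2 $ 2))\<^sup>2"
      unfolding cmod_power2 by (simp add: a trace_cmat2 cmat2_mult_nth power2_eq_square)
    moreover have "a $ 1 $ 1 \<noteq> 0 \<or> a $ 1 $ 2 \<noteq> 0" using a(1) by (auto simp: det_2)
    then have "0 < (cmod (a $ 1 $ 1))\<^sup>2 + (cmod (a $ 1 $ 2))\<^sup>2" by (auto intro: add_pos_nonneg add_nonneg_pos)
    moreover have "0 \<le> (cmod (a $ 2 $ 1))\<^sup>2" "0 \<le> (cmod (a $ 2 $ 2))\<^sup>2" by simp_all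
    ultimately show ?thesis by linarith
  qed
  ultimately show "\<xi> \<in> H3" by (simp add: H3_def)
qed

text \<open>The four entries of the product computed in \<open>unitary_diagonalise\<close>, with u
  standing for \<open>cnj v\<close>.\<close>

lemma unitary_identities:
  fixes a u v :: complex
  assumes "a * a = 1 - v * u"
  shows "(a * (1 - 2 * (v * u)) + u * (2 * a * v)) * a + (a * (2 * a * u) + u * (2 * (v * u) - 1)) * v = 1"
    "(a * (2 * a * u) + u * (2 * (v * u) - 1)) * a = (a * (1 - 2 * (v * u)) + u * (2 * a * v)) * u"
    "(a * (2 * a * v) - v * (1 - 2 * (v * u))) * a + (a * (2 * (v * u) - 1) - v * (2 * a * u)) * v = 0"
    "(a * (2 * (v * u) - 1) - v * (2 * a * u)) * a - (a * (2 * a * v) - v * (1 - 2 * (v * u))) * u = - 1"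
proof -
  have "(a * (1 - 2 * (v * u)) + u * (2 * a * v)) * a + (a * (2 * a * u) + u * (2 * (v * u) - 1)) * v
      = a * a + 2 * (a * a) * (v * u) + 2 * (v * u) * (v * u) - v * u" by (simp add: algebra_simps)
  then show "(a * (1 - 2 * (v * u)) + u * (2 * a * v)) * a + (a * (2 * a * u) + u * (2 * (v * u) - 1)) * v = 1"
    unfolding assms by (simp add: algebra_simps)
  have "(a * (2 * a * u) + u * (2 * (v * u) - 1)) * a = (2 * (a * a) + 2 * (v * u) - 1) * u * a" by (simp add: algebra_simps)
  then show "(a * (2 * a * u) + u * (2 * (v * u) - 1)) * a = (a * (1 - 2 * (v * u)) + u * (2 * a * v)) * u"
    unfolding assms by (simp add: algebra_simps)
  have "(a * (2 * a * v) - v * (1 - 2 * (v * u))) * a + (a * (2 * (v * u) - 1) - v * (2 * a * u)) * v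
      = (2 * (a * a) + 2 * (v * u) - 2) * v * a"
    by (simp add: algebra_simps)
  then show "(a * (2 * a * v) - v * (1 - 2 * (v * u))) * a + (a * (2 * (v * u) - 1) - v * (2 * a * u)) * v = 0"
    unfolding assms by (simp add: algebra_simps)
  have "(a * (2 * (v * u) - 1) - v * (2 * a * u)) * a - (a * (2 * a * v) - v * (1 - 2 * (v * u))) * u
      = v * u - 2 * (v * u) * (v * u) - (a * a) - 2 * (a * a) * (v * u)" by (simp add: algebra_simps)
  then show "(a * (2 * (v * u) - 1) - v * (2 * a * u)) * a - (a * (2 * a * v) - v * (1 - 2 * (v * u))) * u = - 1"
    unfolding assms by (simp add: algebra_simps)
qed

text \<open>The traceless Hermitian matrix is a unit vector of Euclidean three-space; k lifts to
  SU(2) a rotation taking it to the third axis. The half-angle formulas degenerate only at the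
  antipode t = -1.\<close>

lemma unitary_diagonalise:
  assumes t: "t\<^sup>2 + (cmod w)\<^sup>2 = 1"
  obtains k where "det k = 1" "k ** hconj k = mat 1" "act k (M2 (of_real t) (cnj w) w (- of_real t)) = \<sigma>3"
proof (cases "t = -1")
  case True
  then have "w = 0" using t by simp
  then show ?thesis
    using True by (intro that[of "M2 0 1 (-1) 0"]) (simp_all add: cmat2_simps act_def)
next
  case False
  have "t\<^sup>2 \<le> 1" using t zero_le_power2[of "cmod w"] by linarith
  then have "\<bar>t\<bar> \<le> 1" by (simp add: abs_square_le_1)
  then have t1: "1 + t > 0" using False by auto
  \<comment> \<open>The cosine of half the angle between the vector and the third axis; v carries
    the corresponding sine and the direction.\<close>
  define c where "c = sqrt ((1 + t) / 2)"
  have c: "c > 0" "t = 2 * c * c - 1" using t1 by (auto simp: c_def field_simps)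
  have ww: "w * cnj w = of_real (4 * c * c * (1 - c * c))"
  proof -
    have "(cmod w)\<^sup>2 = 4 * c * c * (1 - c * c)" using t unfolding c(2) by (simp add: power2_eq_square algebra_simps)
    then show ?thesis by (simp only: complex_norm_square[symmetric])
  qed
  define v where "v = w / of_real (2 * c)"
  have w: "w = of_real (2 * c) * v" using c by (simp add: v_def)
  have vv: "v * cnj v = of_real (1 - c * c)" "cnj v * v = of_real (1 - c * c)"
    using ww c by (auto simp: v_def field_simps)
  let ?k = "M2 (of_real c) (cnj v) (- v) (of_real c)"
  have e: "complex_of_real c * complex_of_real c = 1 - v * cnj v" using vv by simp
  show ?thesis
  proof (rule that[of ?k])
    show "det ?k = 1" by (simp add: det_2 e algebra_simps)
    show "?k ** hconj ?k = mat 1" by (simp add: cmat2_simps e algebra_simps)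
    show "act ?k (M2 (of_real t) (cnj w) w (- of_real t)) = \<sigma>3"
    proof -
      have t': "complex_of_real t = 1 - 2 * (v * cnj v)" unfolding c(2) by (simp add: e mult.assoc)
      show ?thesis
        unfolding t' w using unitary_identities[OF e] by (simp add: cmat2_simps act_def)
    qed
  qed
qed

subsection \<open>Linear maps of the plane\<close>

text \<open>Cramer's rule for the inverse of a plane map; as an explicit quotient it is smooth in
  any data on which T depends smoothly.\<close>

definition linv :: "(complex \<Rightarrow> complex) \<Rightarrow> complex \<Rightarrow> complex" where
  "linv T z = Complex (Im (cnj z * T \<i>) / det2 T) (Im (cnj (T 1) * z) / det2 T)"

lemma linv_right:
  assumes "linear T" "det2 T \<noteq> 0"
  shows "T (linv T z) = z"
proof -
  have d: "det2 T = Re (T 1) * Im (T \<i>) - Im (T 1) * Re (T \<i>)" by (simp add: det2_def)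
  have "T (linv T z) = (Im (cnj z * T \<i>) / det2 T) *\<^sub>R T 1 + (Im (cnj (T 1) * z) / det2 T) *\<^sub>R T \<i>"
    by (subst linear_complex_decomp[OF assms(1)]) (simp add: linv_def)
  also have "\<dots> = (1 / det2 T) *\<^sub>R (Im (cnj z * T \<i>) *\<^sub>R T 1 + Im (cnj (T 1) * z) *\<^sub>R T \<i>)"
    by (simp add: scaleR_add_right)
  also have "Im (cnj z * T \<i>) *\<^sub>R T 1 + Im (cnj (T 1) * z) *\<^sub>R T \<i> = det2 T *\<^sub>R z"
    by (simp add: complex_eq_iff d algebra_simps)
  finally show ?thesis using assms(2) by simp
qed

lemma linv_left:
  assumes "linear T" "det2 T \<noteq> 0"
  shows "linv T (T u) = u"
proof -
  have "T u = Re u *\<^sub>R T 1 + Im u *\<^sub>R T \<i>" by (rule linear_complex_decomp[OF assms(1)])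
  then show ?thesis
    using assms(2) by (simp add: linv_def complex_eq_iff det2_def field_simps)
qed

lemma linear_linv: "linear (linv T)"
  by (intro linearI) (simp_all add: linv_def complex_eq_iff add_divide_distrib diff_divide_distrib algebra_simps)

lemma smooth_linv:
  fixes T :: "complex \<Rightarrow> complex \<Rightarrow> complex"
  assumes "\<And>u. smooth (\<lambda>x. T x u)" "\<And>x. det2 (T x) \<noteq> 0" "smooth z"
  shows "smooth (\<lambda>x. linv (T x) (z x))"
proof -
  have d: "smooth (\<lambda>x. det2 (T x))" unfolding det2_def
    by (rule smooth_Im, rule smooth_mult, rule smooth_cnj, rule assms(1), rule assms(1))
  have 1: "smooth (\<lambda>x. Im (cnj (z x) * T x \<i>) / det2 (T x))"
    by (rule smooth_divide[OF _ d assms(2)], rule smooth_Im, rule smooth_mult, rule smooth_cnj, rule assms(3), rule assms(1))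
  have 2: "smooth (\<lambda>x. Im (cnj (T x 1) * z x) / det2 (T x))"
    by (rule smooth_divide[OF _ d assms(2)], rule smooth_Im, rule smooth_mult, rule smooth_cnj, rule assms(1), rule assms(3))
  have "smooth (\<lambda>x. of_real (Im (cnj (z x) * T x \<i>) / det2 (T x)) + \<i> * of_real (Im (cnj (T x 1) * z x) / det2 (T x)))"
    by (rule smooth_add, rule smooth_of_real, rule 1, rule smooth_mult, rule smooth_const, rule smooth_of_real, rule 2)
  then show ?thesis unfolding linv_def Complex_eq .
qed

lemma linv_rotate:
  assumes "linear T" "det2 T \<noteq> 0"
  shows "u = Re (T u) *\<^sub>R linv T 1 + Im (T u) *\<^sub>R linv T \<i>"
  using linear_complex_decomp[OF linear_linv, of T "T u"] linv_left[OF assms] by simp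

subsection \<open>Frames at a point of hyperbolic space\<close>

lemma traceless_Her: "X \<in> Her \<Longrightarrow> mink (mat 1) X = 0 \<Longrightarrow> X = M2 (of_real (Re (X $ 1 $ 1))) (cnj (X $ 2 $ 1)) (X $ 2 $ 1) (- of_real (Re (X $ 1 $ 1)))"
  by (auto simp: Her_iff mink_entries cmat2_mat_1 cmat2_eq_iff complex_eq_iff)

lemma mink_traceless: "mink (M2 (of_real t) (cnj w) w (- of_real t)) (M2 (of_real s) (cnj v) v (- of_real s)) = t * s + w \<bullet> v"
  by (simp add: mink_entries inner_complex_def)

lemma trace_triple_unitary:
  assumes "det k = 1" "k ** hconj k = mat 1"
  shows "trace (act k X ** act k Y ** act k Z) = trace (X ** Y ** Z)"
proof -
  have "hconj k = adj k" using assms by (metis adj_mult(2) matrix_mul_assoc matrix_mul_lid matrix_mul_rid)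
  then have k: "hconj k ** k = mat 1" using assms by (simp add: adj_mult)
  have "act k X ** act k Y ** act k Z = k ** X ** (hconj k ** k) ** Y ** (hconj k ** k) ** Z ** hconj k"
    by (simp only: act_def matrix_mul_assoc)
  also have "\<dots> = k ** (X ** Y ** Z ** hconj k)"
    by (simp only: k matrix_mul_rid matrix_mul_assoc)
  also have "trace \<dots> = trace (X ** Y ** Z ** (hconj k ** k))"
    by (subst trace_mul_sym) (simp only: matrix_mul_assoc)
  finally show ?thesis by (simp add: k)
qed

text \<open>An orthonormal pair in three-space can be rotated to the first two axes, and the
  rotation lifts to SU(2). The cross product is moved to \<sigma>3, and a rotation about that axis
  finishes.\<close>

lemma normal_form_traceless:
  assumes X: "X1 = M2 (of_real t1) (cnj w1) w1 (- of_real t1)" "X2 = M2 (of_real t2) (cnj w2) w2 (- of_real t2)"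
    and orth: "t1 * t1 + w1 \<bullet> w1 = 1" "t2 * t2 + w2 \<bullet> w2 = 1" "t1 * t2 + w1 \<bullet> w2 = 0"
  obtains k where "det k = 1" "k ** hconj k = mat 1" "act k X1 = off 1" "act k X2 = off \<i>"
proof -
  define x1 y1 x2 y2 where "x1 = Re w1" "y1 = Im w1" "x2 = Re w2" "y2 = Im w2"
  have orth': "t1 * t1 + (x1 * x1 + y1 * y1) = 1" "t2 * t2 + (x2 * x2 + y2 * y2) = 1" "t1 * t2 + (x1 * x2 + y1 * y2) = 0"
    using orth by (simp_all add: inner_complex_def x1_y1_x2_y2_def)
  \<comment> \<open>The cross product of the vectors (x1, y1, t1) and (x2, y2, t2), with third
    coordinate t0; Lagrange's identity shows that it has length one.\<close>
  define t0 where "t0 = x1 * y2 - y1 * x2"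
  define w0 where "w0 = Complex (y1 * t2 - t1 * y2) (t1 * x2 - x1 * t2)"
  have "t0\<^sup>2 + (cmod w0)\<^sup>2 = (t1 * t1 + (x1 * x1 + y1 * y1)) * (t2 * t2 + (x2 * x2 + y2 * y2)) - (t1 * t2 + (x1 * x2 + y1 * y2))\<^sup>2"
    unfolding cmod_power2 by (simp add: t0_def w0_def power2_eq_square algebra_simps)
  also have "\<dots> = 1" by (simp add: orth')
  finally have N1: "t0\<^sup>2 + (cmod w0)\<^sup>2 = 1" .
  let ?N = "M2 (of_real t0) (cnj w0) w0 (- of_real t0)"
  obtain k where k: "det k = 1" "k ** hconj k = mat 1" "act k ?N = \<sigma>3"
    using unitary_diagonalise[OF N1] by blast
  have k1: "act k (mat 1) = mat 1" by (simp add: act_id k)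
  have off_diag: "\<exists>v. act k X = off v" if "X = M2 (of_real t) (cnj w) w (- of_real t)" "t0 * t + w0 \<bullet> w = 0" for X t w
  proof -
    have "X \<in> Her" "mink (mat 1) X = 0" "mink ?N X = 0"
      using that by (auto simp: Her_iff mink_traceless) (simp add: mink_entries cmat2_mat_1)
    then have "act k X \<in> Her" "mink (mat 1) (act k X) = 0" "mink \<sigma>3 (act k X) = 0"
      using mink_act[OF k(1), of "mat 1" X] mink_act[OF k(1), of ?N X] by (auto simp: k1 k(3) act_Her)
    then show ?thesis
      by (intro exI[of _ "act k X $ 2 $ 1"]) (auto simp: Her_iff mink_entries cmat2_mat_1 cmat2_eq_iff complex_eq_iff)
  qed
  have w12: "w1 = Complex x1 y1" "w2 = Complex x2 y2" by (simp_all add: x1_y1_x2_y2_def)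
  have "t0 * t1 + w0 \<bullet> w1 = 0" "t0 * t2 + w0 \<bullet> w2 = 0"
    by (simp_all add: t0_def w0_def w12 inner_complex_def algebra_simps)
  then obtain v1 v2 where v: "act k X1 = off v1" "act k X2 = off v2" using off_diag X by metis
  have vv: "v1 \<bullet> v1 = 1" "v2 \<bullet> v2 = 1" "v1 \<bullet> v2 = 0"
    using mink_act[OF k(1), of X1 X1] mink_act[OF k(1), of X2 X2] mink_act[OF k(1), of X1 X2]
    unfolding v by (simp_all add: mink_off X mink_traceless orth)
  have "trace (off v1 ** off v2 ** \<sigma>3) = trace (X1 ** X2 ** ?N)"
    using trace_triple_unitary[OF k(1,2), of X1 X2 ?N] by (simp add: v k(3))
  moreover have "Im (trace (off v1 ** off v2 ** \<sigma>3)) = 2 * Im (cnj v1 * v2)"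
    by (simp add: cmat2_simps)
  moreover have "Im (trace (X1 ** X2 ** ?N)) = 2 * (t0\<^sup>2 + (cmod w0)\<^sup>2)"
    unfolding cmod_power2 by (simp add: X w12 cmat2_simps) (simp add: t0_def w0_def power2_eq_square algebra_simps)
  ultimately have im: "Im (cnj v1 * v2) = 1" using N1 by simp
  have re: "Re (cnj v1 * v2) = 0" using vv(3) by (simp add: inner_complex_def)
  have "cnj v1 * v2 = \<i>" using im re by (simp add: complex_eq_iff)
  moreover have n1: "v1 * cnj v1 = 1" using vv(1) by (simp add: complex_eq_iff inner_complex_def)
  ultimately have v2: "v2 = \<i> * v1" by (metis mult.assoc mult.commute mult_1)
  \<comment> \<open>The diagonal matrix rotates \<open>off v\<close> by c squared, so c has to be a
    square root of the inverse of the unit number v1.\<close>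
  define c where "c = csqrt (cnj v1)"
  have cc: "c * c = cnj v1" by (simp add: c_def flip: power2_eq_square)
  have "cmod v1 = 1" using vv(1) by (simp add: norm_eq_1)
  then have "cmod c * cmod c = 1" using cc by (metis complex_mod_cnj norm_mult)
  then have c1: "cnj c * c = 1" "c * cnj c = 1"
    by (simp_all add: mult.commute[of "cnj c"] complex_norm_square[symmetric] power2_eq_square flip: of_real_mult)
  let ?r = "M2 (cnj c) 0 0 c"
  have r: "act ?r (off v) = off (c * c * v)" for v
    by (simp add: act_def cmat2_simps algebra_simps)
  show ?thesis
  proof (rule that[of "?r ** k"])
    show "det (?r ** k) = 1" by (simp add: det_mul k(1)) (simp add: det_2 c1)
    show "?r ** k ** hconj (?r ** k) = mat 1"
      by (simp add: act_id[symmetric] act_mult k1) (simp add: act_def cmat2_simps c1)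
    show "act (?r ** k) X1 = off 1" using n1 by (simp add: act_mult v r cc mult.commute)
    show "act (?r ** k) X2 = off \<i>" using n1 by (simp add: act_mult v r cc v2 algebra_simps)
  qed
qed

text \<open>Moving \<xi> to the identity turns the tangent vectors into traceless Hermitian
  matrices, where the images of the T-orthonormal basis can be rotated to \<open>off 1\<close> and
  \<open>off i\<close>.\<close>

lemma normal_form:
  assumes \<xi>: "\<xi> \<in> H3" and T: "linear T" "det2 T \<noteq> 0" and E: "linear E" "\<And>u. E u \<in> Her" "\<And>u. mink \<xi> (E u) = 0"
    and EE: "\<And>u v. mink (E u) (E v) = T u \<bullet> T v"
  obtains g where "det g = 1" "\<xi> = act g (mat 1)" "\<And>u. E u = act g (off (T u))"
proof -
  obtain a where a: "det a = 1" "\<xi> = act a (mat 1)" using \<xi> by (auto simp: H3_iff act_id)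
  have a': "det (adj a) = 1" by (simp add: det_adj a)
  have a1: "act (adj a) \<xi> = mat 1" by (simp add: a act_adj)
  define e1 e2 where "e1 = linv T 1" "e2 = linv T \<i>"
  have Te: "T e1 = 1" "T e2 = \<i>" by (simp_all add: e1_e2_def linv_right T)
  define X1 X2 where "X1 = act (adj a) (E e1)" "X2 = act (adj a) (E e2)"
  have tr: "mink (mat 1) (act (adj a) (E u)) = 0" for u
    using mink_act[OF a', of \<xi> "E u"] by (simp add: a1 E)
  define t1 w1 t2 w2 where "t1 = Re (X1 $ 1 $ 1)" "w1 = X1 $ 2 $ 1" "t2 = Re (X2 $ 1 $ 1)" "w2 = X2 $ 2 $ 1"
  note X1 = traceless_Her[OF act_Her[OF E(2)] tr, of e1, folded X1_X2_def, folded t1_w1_t2_w2_def]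
  note X2 = traceless_Her[OF act_Her[OF E(2)] tr, of e2, folded X1_X2_def, folded t1_w1_t2_w2_def]
  have "mink (M2 (of_real t1) (cnj w1) w1 (- of_real t1)) (M2 (of_real t1) (cnj w1) w1 (- of_real t1)) = 1"
    "mink (M2 (of_real t2) (cnj w2) w2 (- of_real t2)) (M2 (of_real t2) (cnj w2) w2 (- of_real t2)) = 1"
    "mink (M2 (of_real t1) (cnj w1) w1 (- of_real t1)) (M2 (of_real t2) (cnj w2) w2 (- of_real t2)) = 0"
    unfolding X1[symmetric] X2[symmetric] by (simp_all add: X1_X2_def mink_act[OF a'] EE Te inner_complex_def)
  note m = this[unfolded mink_traceless]

  obtain k where k: "det k = 1" "k ** hconj k = mat 1" "act k X1 = off 1" "act k X2 = off \<i>"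
    by (rule normal_form_traceless[OF X1 X2 m])
  define h where "h = k ** adj a"
  have h: "det h = 1" "act h \<xi> = mat 1" by (simp_all add: h_def det_mul k a' act_mult a1 act_id)
  have he: "act h (E e1) = off 1" "act h (E e2) = off \<i>" using k by (simp_all add: h_def act_mult X1_X2_def)
  show ?thesis
  proof (rule that[of "adj h"])
    show "det (adj h) = 1" by (simp add: det_adj h)
    show "\<xi> = act (adj h) (mat 1)" using act_adj(2)[OF h(1), of \<xi>] by (simp add: h)
    show "E u = act (adj h) (off (T u))" for u
    proof -
      have "E u = Re (T u) *\<^sub>R E e1 + Im (T u) *\<^sub>R E e2"
        using linv_rotate[OF T, of u] by (simp add: e1_e2_def linear_add[OF E(1), symmetric] linear_scale[OF E(1), symmetric])
      then have "act h (E u) = off (T u)"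
        by (simp add: linear_add[OF act_linear] linear_scale[OF act_linear] he) (simp add: cmat2_eq_iff complex_eq_iff)
      then show ?thesis using act_adj(2)[OF h(1), of "E u"] by simp
    qed
  qed
qed

lemma det_hconj: "det (hconj g) = cnj (det g)"
  by (simp add: det_2 mult.commute)

lemma act_mult_adj:
  assumes "det g = 1"
  shows "act g a ** adj (act g (mat 1)) ** act g b = act g (a ** b)"
proof -
  have h: "det (hconj g) = 1" using assms by (simp add: det_hconj)
  have "act g a ** adj (act g (mat 1)) ** act g b = g ** a ** (hconj g ** adj (hconj g)) ** (adj g ** g) ** b ** hconj g"
    by (simp add: act_id adj_mult_distrib) (simp only: act_def matrix_mul_assoc)
  also have "\<dots> = act g (a ** b)" by (simp add: adj_mult assms h act_def matrix_mul_assoc)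
  finally show ?thesis .
qed

lemma positively_oriented_act:
  assumes "det g = 1"
  shows "positively_oriented (act g (mat 1)) (act g a) (act g b) (act g c) \<longleftrightarrow> 0 < Im (trace (a ** b ** c))"
proof -
  have h: "det (hconj g) = 1" using assms by (simp add: det_hconj)
  have d: "det (act g (mat 1)) = 1" using det_act[OF assms, of "mat 1"] by simp
  let ?i = "adj (act g (mat 1))"
  have "?i ** act g a ** ?i ** act g b ** ?i ** act g c = ?i ** (act g a ** ?i ** act g b ** ?i ** act g c)"
    by (simp only: matrix_mul_assoc)
  also have "\<dots> = ?i ** act g (a ** b ** c)" by (simp only: act_mult_adj[OF assms])
  also have "\<dots> = adj (hconj g) ** (adj g ** g) ** (a ** b ** c) ** hconj g"
    by (simp add: act_id adj_mult_distrib) (simp only: act_def matrix_mul_assoc)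
  also have "\<dots> = adj (hconj g) ** ((a ** b ** c) ** hconj g)"
    by (simp add: adj_mult assms matrix_mul_assoc)
  also have "trace \<dots> = trace ((a ** b ** c) ** (hconj g ** adj (hconj g)))"
    by (subst trace_mul_sym) (simp only: matrix_mul_assoc)
  finally show ?thesis unfolding positively_oriented_def matrix_inv_adj[OF d] by (simp add: adj_mult h)
qed

text \<open>Orthogonality to the point and the tangent plane leaves only multiples of \<sigma>3 in
  the moved picture; the length fixes the multiple up to sign, and the orientation fixes the
  sign.\<close>

lemma unit_normal_eq:
  assumes g: "det g = 1" "f x = act g (mat 1)" "\<And>u. D f x u = act g (off (T u))"
    and T: "linear T" "det2 T > 0"
  shows "unit_normal f x = act g \<sigma>3"
  unfolding unit_normal_def
proof (rule the_equality)
  have or: "positively_oriented (f x) (D f x 1) (D f x \<i>) (act g n) \<longleftrightarrow> 0 < Im (trace (off (T 1) ** off (T \<i>) ** n))" for n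
    unfolding g by (rule positively_oriented_act[OF g(1)])
  have tr: "Im (trace (off (T 1) ** off (T \<i>) ** M2 (of_real t) 0 0 (- of_real t))) = 2 * (t * det2 T)" for t
    by (simp add: cmat2_simps det2_def algebra_simps)
  have s3: "\<sigma>3 = M2 (of_real 1) 0 0 (- of_real 1)" by (simp add: cmat2_eq_iff)
  show "act g \<sigma>3 \<in> Her \<and> mink (act g \<sigma>3) (f x) = 0 \<and> (\<forall>u. mink (act g \<sigma>3) (D f x u) = 0) \<and>
      mink (act g \<sigma>3) (act g \<sigma>3) = 1 \<and> positively_oriented (f x) (D f x 1) (D f x \<i>) (act g \<sigma>3)"
  proof -
    have "0 < Im (trace (off (T 1) ** off (T \<i>) ** \<sigma>3))" unfolding s3 tr using T(2) by simp
    then show ?thesis unfolding or by (simp add: g mink_act[OF g(1)] mink_off act_Her Her_simps)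
  qed
  fix n
  assume n: "n \<in> Her \<and> mink n (f x) = 0 \<and> (\<forall>u. mink n (D f x u) = 0) \<and> mink n n = 1 \<and>
      positively_oriented (f x) (D f x 1) (D f x \<i>) n"
  define m where "m = act (adj g) n"
  have nm: "n = act g m" by (simp add: m_def act_adj g)
  have m: "m \<in> Her" "mink m (mat 1) = 0" "mink m m = 1" "0 < Im (trace (off (T 1) ** off (T \<i>) ** m))"
    using n unfolding nm or by (auto simp: m_def act_Her act_adj g(1)) (simp_all add: g nm[symmetric] mink_act[OF g(1)] m_def[symmetric] flip: mink_act[OF g(1), of m])
  have mo: "mink m (off w) = 0" for w
    using n unfolding nm by (metis g(1,3) linv_right T less_irrefl mink_act)
  define t where "t = Re (m $ 1 $ 1)"
  have mt: "m = M2 (of_real t) 0 0 (- of_real t)"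
    using traceless_Her[OF m(1)] m(2) mo[of 1] mo[of \<i>]
    by (auto simp: t_def mink_commute[of m] Her_iff mink_entries cmat2_mat_1 cmat2_eq_iff complex_eq_iff)
  have "t * t = 1" using m(3) by (simp add: mt mink_entries)
  moreover have "t > 0" using m(4) T(2) unfolding mt tr by (simp add: zero_less_mult_iff)
  ultimately have "t = 1" using square_eq_1_iff[of t] by simp
  then have "m = \<sigma>3" using mt s3 by simp
  then show "n = act g \<sigma>3" using nm by simp
qed

text \<open>The cross product of the tangent vectors, as a commutator twisted by the inverse of f.
  The constant -i/2 inverts the 2i in [\<open>off a\<close>, \<open>off b\<close>] = 2i Im(cnj a b)
  \<sigma>3.\<close>

lemma unit_normal_formula:
  assumes g: "det g = 1" "f x = act g (mat 1)" "\<And>u. D f x u = act g (off (T u))"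
    and T: "linear T" "det2 T > 0"
  shows "unit_normal f x = (1 / det2 T) *\<^sub>R cscale (- \<i> / 2)
    (D f x 1 ** adj (f x) ** D f x \<i> - D f x \<i> ** adj (f x) ** D f x 1)"
proof -
  have "D f x 1 ** adj (f x) ** D f x \<i> - D f x \<i> ** adj (f x) ** D f x 1 = act g (off (T 1) ** off (T \<i>) - off (T \<i>) ** off (T 1))"
    by (simp add: g act_mult_adj linear_diff[OF act_linear])
  also have "off (T 1) ** off (T \<i>) - off (T \<i>) ** off (T 1) = cscale (2 * \<i>) (det2 T *\<^sub>R \<sigma>3)"
    by (simp add: cmat2_simps det2_def complex_eq_iff)
  also have "act g (cscale (2 * \<i>) (det2 T *\<^sub>R \<sigma>3)) = cscale (2 * \<i>) (det2 T *\<^sub>R act g \<sigma>3)"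
    by (simp add: act_def cmat2_simps algebra_simps)
  finally have "D f x 1 ** adj (f x) ** D f x \<i> - D f x \<i> ** adj (f x) ** D f x 1 = cscale (2 * \<i>) (det2 T *\<^sub>R act g \<sigma>3)" .
  then have "(1 / det2 T) *\<^sub>R cscale (- \<i> / 2)
    (D f x 1 ** adj (f x) ** D f x \<i> - D f x \<i> ** adj (f x) ** D f x 1) = act g \<sigma>3"
    using T(2) by (simp add: cmat2_eq_iff)
  then show ?thesis using unit_normal_eq[OF assms] by simp
qed

lemma frame_nondegenerate:
  assumes "det g = 1" "Z \<in> Her" "mink Z (act g (mat 1)) = 0" "\<And>u. mink Z (act g (off (T u))) = 0" "mink Z (act g \<sigma>3) = 0"
    and T: "linear T" "det2 T \<noteq> 0"
  shows "Z = 0"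
proof -
  define m where "m = act (adj g) Z"
  have Z: "Z = act g m" by (simp add: m_def act_adj assms)
  have m: "m \<in> Her" "mink m (mat 1) = 0" "mink m \<sigma>3 = 0"
    using assms(1,2,3,5) by (auto simp: m_def[symmetric] Z mink_act act_Her) (simp add: m_def act_Her assms)
  have mo: "mink m (off w) = 0" for w
    using assms(4)[of "linv T w"] by (simp add: linv_right T Z mink_act assms(1))
  have "m = 0" using m mo[of 1] mo[of \<i>]
    by (auto simp: Her_iff mink_entries cmat2_mat_1 cmat2_eq_iff complex_eq_iff)
  then show ?thesis by (simp add: Z linear_0[OF act_linear])
qed

section \<open>Coframes and their Levi-Civita connection\<close>

lemma D_form_field:
  fixes \<alpha> :: "complex \<Rightarrow> complex \<Rightarrow> 'b::real_normed_vector"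
  assumes lin: "\<And>x. linear (\<alpha> x)" and smooth: "\<And>u. smooth (\<lambda>x. \<alpha> x u)" and "V differentiable at x"
  shows "D (\<lambda>y. \<alpha> y (V y)) x u = D (\<lambda>y. \<alpha> y (V x)) x u + \<alpha> x (D V x u)"
proof -
  have V: "(V has_derivative D V x) (at x)" using assms by (simp add: frechet_derivative_works)
  have d: "((\<lambda>y. \<alpha> y v) has_derivative D (\<lambda>y. \<alpha> y v) x) (at x)" for v
    by (rule smooth_has_derivative[OF smooth])
  have dec: "\<alpha> y v = Re v *\<^sub>R \<alpha> y 1 + Im v *\<^sub>R \<alpha> y \<i>" for y v
    by (rule linear_complex_decomp[OF lin])
  have "((\<lambda>y. Re (V y) *\<^sub>R \<alpha> y 1 + Im (V y) *\<^sub>R \<alpha> y \<i>) has_derivative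
    (\<lambda>u. (Re (V x) *\<^sub>R D (\<lambda>y. \<alpha> y 1) x u + Re (D V x u) *\<^sub>R \<alpha> x 1)
        + (Im (V x) *\<^sub>R D (\<lambda>y. \<alpha> y \<i>) x u + Im (D V x u) *\<^sub>R \<alpha> x \<i>))) (at x)"
    by (intro has_derivative_add has_derivative_scaleR d has_derivative_Re has_derivative_Im V)
  then have "((\<lambda>y. \<alpha> y (V y)) has_derivative
    (\<lambda>u. (Re (V x) *\<^sub>R D (\<lambda>y. \<alpha> y 1) x u + Re (D V x u) *\<^sub>R \<alpha> x 1)
        + (Im (V x) *\<^sub>R D (\<lambda>y. \<alpha> y \<i>) x u + Im (D V x u) *\<^sub>R \<alpha> x \<i>))) (at x)"
    by (simp only: dec[symmetric])
  from D_eq[OF this] have 1: "D (\<lambda>y. \<alpha> y (V y)) x u = (Re (V x) *\<^sub>R D (\<lambda>y. \<alpha> y 1) x u + Re (D V x u) *\<^sub>R \<alpha> x 1)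
        + (Im (V x) *\<^sub>R D (\<lambda>y. \<alpha> y \<i>) x u + Im (D V x u) *\<^sub>R \<alpha> x \<i>)" by simp
  have "((\<lambda>y. Re (V x) *\<^sub>R \<alpha> y 1 + Im (V x) *\<^sub>R \<alpha> y \<i>) has_derivative
    (\<lambda>u. Re (V x) *\<^sub>R D (\<lambda>y. \<alpha> y 1) x u + Im (V x) *\<^sub>R D (\<lambda>y. \<alpha> y \<i>) x u)) (at x)"
    by (intro has_derivative_add has_derivative_scaleR_right d)
  then have "((\<lambda>y. \<alpha> y (V x)) has_derivative
    (\<lambda>u. Re (V x) *\<^sub>R D (\<lambda>y. \<alpha> y 1) x u + Im (V x) *\<^sub>R D (\<lambda>y. \<alpha> y \<i>) x u)) (at x)"
    by (simp only: dec[symmetric])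
  from D_eq[OF this] have 2: "D (\<lambda>y. \<alpha> y (V x)) x u = Re (V x) *\<^sub>R D (\<lambda>y. \<alpha> y 1) x u + Im (V x) *\<^sub>R D (\<lambda>y. \<alpha> y \<i>) x u" by simp
  show ?thesis unfolding 1 2 dec[of x "D V x u"] by simp
qed

lemma smooth_form_field:
  fixes \<alpha> :: "'a::real_normed_vector \<Rightarrow> complex \<Rightarrow> 'b::real_normed_vector"
  assumes "\<And>x. linear (\<alpha> x)" "\<And>u. smooth (\<lambda>x. \<alpha> x u)" "smooth V"
  shows "smooth (\<lambda>x. \<alpha> x (V x))"
proof -
  have "smooth (\<lambda>x. Re (V x) *\<^sub>R \<alpha> x 1 + Im (V x) *\<^sub>R \<alpha> x \<i>)"
    by (rule smooth_add[OF smooth_scaleR[OF smooth_Re[OF assms(3)] assms(2)] smooth_scaleR[OF smooth_Im[OF assms(3)] assms(2)]])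
  then show ?thesis by (simp only: linear_complex_decomp[OF assms(1), symmetric])
qed

lemma linear_D_form:
  fixes \<alpha> :: "complex \<Rightarrow> complex \<Rightarrow> 'b::real_normed_vector"
  assumes lin: "\<And>x. linear (\<alpha> x)" and smooth: "\<And>u. smooth (\<lambda>x. \<alpha> x u)"
  shows "linear (\<lambda>v. D (\<lambda>y. \<alpha> y v) x u)"
proof -
  have d: "((\<lambda>y. \<alpha> y v) has_derivative D (\<lambda>y. \<alpha> y v) x) (at x)" for v
    by (rule smooth_has_derivative[OF smooth])
  have "D (\<lambda>y. \<alpha> y (v + w)) x u = D (\<lambda>y. \<alpha> y v) x u + D (\<lambda>y. \<alpha> y w) x u" for v w
    using D_eq[OF has_derivative_add[OF d[of v] d[of w]]] by (simp add: linear_add[OF lin])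
  moreover have "D (\<lambda>y. \<alpha> y (r *\<^sub>R v)) x u = r *\<^sub>R D (\<lambda>y. \<alpha> y v) x u" for v r
    using D_eq[OF has_derivative_scaleR_right[OF d[of v], of r]] by (simp add: linear_scale[OF lin])
  ultimately show ?thesis by (intro linearI) simp_all
qed

text \<open>A positive orthonormal coframe \<open>(\<theta>\<^sub>1, \<theta>\<^sub>2)\<close> is written as the complex form \<open>\<tau> = \<theta>\<^sub>1 + i \<theta>\<^sub>2\<close>, so that
  the metric is \<open>\<tau> u \<bullet> \<tau> v\<close> and the complex structure becomes multiplication by \<open>i\<close>; \<open>\<omega>\<close> is the
  connection form, determined by \<open>d\<tau> = i \<omega> \<and> \<tau>\<close>.\<close>

locale coframe =
  fixes \<tau> :: endo and \<omega> :: "complex \<Rightarrow> complex \<Rightarrow> real"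
  assumes \<tau>_linear: "linear (\<tau> x)" and \<tau>_smooth: "smooth (\<lambda>x. \<tau> x u)" and \<tau>_pos: "0 < det2 (\<tau> x)"
    and \<omega>_linear: "linear (\<omega> x)" and \<omega>_smooth: "smooth (\<lambda>x. \<omega> x u)"
    and torsion: "D (\<lambda>y. \<tau> y v) x u - D (\<lambda>y. \<tau> y u) x v = \<i> * (\<omega> x u * \<tau> x v - \<omega> x v * \<tau> x u)"
begin

text \<open>The image under \<tau> of the Levi-Civita derivative of the constant field v along u.
  Its symmetry is the torsion equation, and \<open>D_\<tau>_inner\<close> is its compatibility with
  the metric.\<close>

definition lc :: "complex \<Rightarrow> complex \<Rightarrow> complex \<Rightarrow> complex" where
  "lc x u v = D (\<lambda>y. \<tau> y v) x u - \<i> * \<omega> x u * \<tau> x v"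

lemma \<tau>_nz: "det2 (\<tau> x) \<noteq> 0" using \<tau>_pos[of x] by simp

lemmas \<tau>_linv = linv_right[OF \<tau>_linear \<tau>_nz] linv_left[OF \<tau>_linear \<tau>_nz]

lemma \<tau>_eqI: "\<tau> x u = \<tau> x v \<Longrightarrow> u = v"
  using \<tau>_linv(2) by metis

lemma \<tau>_eq_0_iff [simp]: "\<tau> x u = 0 \<longleftrightarrow> u = 0"
  using \<tau>_eqI[of x u 0] linear_0[OF \<tau>_linear] by auto

lemma \<tau>_inner_eqI: "(\<And>z. \<tau> x u \<bullet> \<tau> x z = \<tau> x v \<bullet> \<tau> x z) \<Longrightarrow> u = v"
proof (rule \<tau>_eqI)
  assume *: "\<And>z. \<tau> x u \<bullet> \<tau> x z = \<tau> x v \<bullet> \<tau> x z"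
  show "\<tau> x u = \<tau> x v"
    using *[of "linv (\<tau> x) 1"] *[of "linv (\<tau> x) \<i>"] by (simp add: \<tau>_linv inner_complex_def complex_eq_iff)
qed

lemma lc_commute: "lc x u v = lc x v u"
  using torsion[of v x u] by (simp add: lc_def algebra_simps)

lemma D_\<tau>_inner: "D (\<lambda>y. \<tau> y a \<bullet> \<tau> y b) x u = lc x u a \<bullet> \<tau> x b + \<tau> x a \<bullet> lc x u b"
proof -
  have "((\<lambda>y. \<tau> y a \<bullet> \<tau> y b) has_derivative (\<lambda>u. \<tau> x a \<bullet> D (\<lambda>y. \<tau> y b) x u + D (\<lambda>y. \<tau> y a) x u \<bullet> \<tau> x b)) (at x)"
    by (intro has_derivative_inner smooth_has_derivative \<tau>_smooth)
  from D_eq[OF this] show ?thesis by (simp add: lc_def inner_complex_def algebra_simps)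
qed

lemma koszul:
  "lc x u v \<bullet> \<tau> x z = (D (\<lambda>y. \<tau> y v \<bullet> \<tau> y z) x u + D (\<lambda>y. \<tau> y u \<bullet> \<tau> y z) x v - D (\<lambda>y. \<tau> y u \<bullet> \<tau> y v) x z) / 2"
  unfolding D_\<tau>_inner lc_commute[of x v u] lc_commute[of x z] by (simp add: inner_commute)

lemma christoffel_eq: "christoffel (\<lambda>x u v. \<tau> x u \<bullet> \<tau> x v) x u v = linv (\<tau> x) (lc x u v)"
  unfolding christoffel_def
proof (rule the_equality)
  show "\<forall>z. \<tau> x (linv (\<tau> x) (lc x u v)) \<bullet> \<tau> x z =
      (D (\<lambda>y. \<tau> y v \<bullet> \<tau> y z) x u + D (\<lambda>y. \<tau> y u \<bullet> \<tau> y z) x v - D (\<lambda>y. \<tau> y u \<bullet> \<tau> y v) x z) / 2"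
    by (simp add: \<tau>_linv koszul)
  fix w assume "\<forall>z. \<tau> x w \<bullet> \<tau> x z =
      (D (\<lambda>y. \<tau> y v \<bullet> \<tau> y z) x u + D (\<lambda>y. \<tau> y u \<bullet> \<tau> y z) x v - D (\<lambda>y. \<tau> y u \<bullet> \<tau> y v) x z) / 2"
  then show "w = linv (\<tau> x) (lc x u v)"
    by (intro \<tau>_inner_eqI[of x]) (simp add: \<tau>_linv koszul)
qed

lemma \<tau>_nabla:
  assumes "V differentiable at x"
  shows "\<tau> x (nabla (\<lambda>x u v. \<tau> x u \<bullet> \<tau> x v) U V x) = D (\<lambda>y. \<tau> y (V y)) x (U x) - \<i> * \<omega> x (U x) * \<tau> x (V x)"
  by (simp add: nabla_def christoffel_eq linear_add[OF \<tau>_linear] \<tau>_linv D_form_field[OF \<tau>_linear \<tau>_smooth assms] lc_def)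

end

section \<open>Rigidity of immersed surfaces in hyperbolic space\<close>

text \<open>The statements on \<open>D f\<close> come from differentiating
  \<open>hconj (f x) = f x\<close> and \<open>mink (f x) (f x) = -1\<close>.\<close>

lemma immersion_H3_props:
  assumes "immersion_H3 f"
  shows "smooth f" "f x \<in> H3" "D f x u \<in> Her" "mink (f x) (D f x u) = 0" "mink (f x) (f x) = -1" "linear (D f x)"
proof -
  show s: "smooth f" and H: "f x \<in> H3" for x using assms by (auto simp: immersion_H3_def)
  have d: "(f has_derivative D f x) (at x)" by (rule smooth_has_derivative[OF s])
  show "linear (D f x)" by (rule smooth_linear_D[OF s])
  have "((\<lambda>x. hconj (f x)) has_derivative (\<lambda>u. hconj (D f x u))) (at x)"
    by (rule bounded_linear.has_derivative[OF bounded_linear_hconj d])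
  moreover have "(\<lambda>x. hconj (f x)) = f" using H by (auto simp: H3_def Her_def)
  ultimately show "D f x u \<in> Her" using frechet_derivative_at[of f "\<lambda>u. hconj (D f x u)" x]
    by (simp add: Her_def fun_eq_iff)
  have m: "mink (f x) (f x) = -1" for x
    using H[of x] by (auto simp: H3_iff act_id[symmetric] mink_act mink_off)
  then show "mink (f x) (f x) = -1" .
  have "((\<lambda>x. mink (f x) (f x)) has_derivative (\<lambda>u. mink (f x) (D f x u) + mink (D f x u) (f x))) (at x)"
    by (rule bounded_bilinear.FDERIV[OF bounded_bilinear_mink d d])
  moreover have "((\<lambda>x. mink (f x) (f x)) has_derivative (\<lambda>u. 0)) (at x)" by (simp add: m)
  ultimately have "(\<lambda>u. mink (f x) (D f x u) + mink (D f x u) (f x)) = (\<lambda>u. 0)" by (rule has_derivative_unique)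
  then show "mink (f x) (D f x u) = 0" by (simp add: fun_eq_iff mink_commute[of "D f x _"])
qed

text \<open>The induced metric is a constant multiple of the coframe metric. A constant factor does
  not change the Levi-Civita connection, so \<open>lc\<close> of the unscaled coframe serves for
  f.\<close>

locale coframe_immersion = coframe +
  fixes f :: "complex \<Rightarrow> cmat2" and c :: real
  assumes f_imm: "immersion_H3 f" and c_pos: "0 < c"
    and f_I: "fundamental_form_I f x u v = c\<^sup>2 * (\<tau> x u \<bullet> \<tau> x v)"
begin

lemma frame:
  obtains g where "det g = 1" "f x = act g (mat 1)" "\<And>u. D f x u = act g (off (c *\<^sub>R \<tau> x u))"
    "linear (\<lambda>u. c *\<^sub>R \<tau> x u)" "0 < det2 (\<lambda>u. c *\<^sub>R \<tau> x u)" "unit_normal f x = act g \<sigma>3"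
proof -
  have T: "linear (\<lambda>u. c *\<^sub>R \<tau> x u)" by (rule linear_compose_scale_right[OF \<tau>_linear])
  have d: "det2 (\<lambda>u. c *\<^sub>R \<tau> x u) = c * c * det2 (\<tau> x)" by (simp add: det2_def algebra_simps)
  then have d: "0 < det2 (\<lambda>u. c *\<^sub>R \<tau> x u)" using c_pos \<tau>_pos by simp
  have I: "mink (D f x u) (D f x v) = (c *\<^sub>R \<tau> x u) \<bullet> (c *\<^sub>R \<tau> x v)" for u v
    using f_I[of x u v] by (simp add: fundamental_form_I_def power2_eq_square)
  note p = immersion_H3_props[OF f_imm]
  obtain g where "det g = 1" "f x = act g (mat 1)" "\<And>u. D f x u = act g (off (c *\<^sub>R \<tau> x u))"
    using normal_form[OF p(2) T _ p(6) p(3) p(4) I] d by (metis less_irrefl)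
  then show ?thesis using that T d unit_normal_eq[of g f x] by metis
qed

abbreviation n :: "complex \<Rightarrow> cmat2" where "n \<equiv> unit_normal f"

lemma n_props: "n x \<in> Her" "mink (n x) (f x) = 0" "mink (n x) (D f x u) = 0" "mink (n x) (n x) = 1"
proof -
  obtain g where g: "det g = 1" "f x = act g (mat 1)" "\<And>u. D f x u = act g (off (c *\<^sub>R \<tau> x u))"
    "unit_normal f x = act g \<sigma>3" by (rule frame[of x]) (rule that)
  show "n x \<in> Her" "mink (n x) (f x) = 0" "mink (n x) (D f x u) = 0" "mink (n x) (n x) = 1"
    unfolding g by (simp_all add: mink_act[OF g(1)] mink_off act_Her Her_simps)
qed

lemma nondegenerate:
  assumes "Z \<in> Her" "mink Z (f x) = 0" "\<And>u. mink Z (D f x u) = 0" "mink Z (n x) = 0"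
  shows "Z = 0"
proof -
  obtain g where g: "det g = 1" "f x = act g (mat 1)" "\<And>u. D f x u = act g (off (c *\<^sub>R \<tau> x u))"
    "linear (\<lambda>u. c *\<^sub>R \<tau> x u)" "0 < det2 (\<lambda>u. c *\<^sub>R \<tau> x u)" "unit_normal f x = act g \<sigma>3" by (rule frame[of x]) (rule that)
  show ?thesis
    by (rule frame_nondegenerate[OF g(1) assms(1), of "\<lambda>u. c *\<^sub>R \<tau> x u"]) (use assms(2-4) g in auto)
qed

lemma smooth_f: "smooth f" by (rule immersion_H3_props[OF f_imm])

text \<open>The normal is a definite description at each point; the polynomial cross product formula
  shows that it varies smoothly.\<close>

lemma smooth_n: "smooth n"
proof -
  have 1: "n = (\<lambda>x. (1 / (c * c * det2 (\<tau> x))) *\<^sub>R cscale (- \<i> / 2)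
    (D f x 1 ** adj (f x) ** D f x \<i> - D f x \<i> ** adj (f x) ** D f x 1))"
  proof
    fix x
    obtain g where g: "det g = 1" "f x = act g (mat 1)" "\<And>u. D f x u = act g (off (c *\<^sub>R \<tau> x u))"
      "linear (\<lambda>u. c *\<^sub>R \<tau> x u)" "0 < det2 (\<lambda>u. c *\<^sub>R \<tau> x u)" "unit_normal f x = act g \<sigma>3" by (rule frame[of x]) (rule that)
    have d: "det2 (\<lambda>u. c *\<^sub>R \<tau> x u) = c * c * det2 (\<tau> x)" by (simp add: det2_def algebra_simps)
    show "n x = (1 / (c * c * det2 (\<tau> x))) *\<^sub>R cscale (- \<i> / 2)
      (D f x 1 ** adj (f x) ** D f x \<i> - D f x \<i> ** adj (f x) ** D f x 1)"
      using unit_normal_formula[OF g(1-5)] unfolding d .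
  qed
  have adj: "bounded_linear adj"
    unfolding linear_conv_bounded_linear[symmetric] by (intro linearI) (simp_all add: cmat2_eq_iff)
  have sa: "smooth (\<lambda>x. adj (f x))" by (rule smooth_bounded_linear[OF adj smooth_f])
  have sd: "smooth (\<lambda>x. D f x u)" for u by (rule smooth_D[OF smooth_f])
  note mm = smooth_bilinear[OF bounded_bilinear_cmat2_mult]
  have s2: "smooth (\<lambda>x. D f x 1 ** adj (f x) ** D f x \<i> - D f x \<i> ** adj (f x) ** D f x 1)"
    by (rule smooth_diff[OF mm[OF mm[OF sd sa] sd] mm[OF mm[OF sd sa] sd]])
  have s3: "smooth (\<lambda>x. det2 (\<tau> x))" unfolding det2_def
    by (rule smooth_Im, rule smooth_mult, rule smooth_cnj, rule \<tau>_smooth, rule \<tau>_smooth)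
  have s4: "smooth (\<lambda>x. 1 / (c * c * det2 (\<tau> x)))"
    by (rule smooth_divide[OF smooth_const smooth_mult[OF smooth_const s3]]) (use c_pos \<tau>_nz in auto)
  show ?thesis unfolding 1
    by (rule smooth_scaleR[OF s4 smooth_bounded_linear[OF bounded_bilinear.bounded_linear_right[OF bounded_bilinear_cscale] s2]])
qed

lemma D_mink:
  assumes "smooth a" "smooth b"
  shows "D (\<lambda>x. mink (a x) (b x)) x u = mink (a x) (D b x u) + mink (D a x u) (b x)"
  using D_eq[OF bounded_bilinear.FDERIV[OF bounded_bilinear_mink smooth_has_derivative[OF assms(1)] smooth_has_derivative[OF assms(2)]]]
  by simp

lemma D_Her:
  assumes "smooth a" "\<And>x. a x \<in> Her"
  shows "D a x u \<in> Her"
proof -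
  have "((\<lambda>x. hconj (a x)) has_derivative (\<lambda>u. hconj (D a x u))) (at x)"
    by (rule bounded_linear.has_derivative[OF bounded_linear_hconj smooth_has_derivative[OF assms(1)]])
  moreover have "(\<lambda>x. hconj (a x)) = a" using assms(2) by (auto simp: Her_def)
  ultimately have "D a x = (\<lambda>u. hconj (D a x u))" using D_eq[of a "\<lambda>u. hconj (D a x u)" x] by simp
  then show ?thesis by (simp add: Her_def fun_eq_iff)
qed

lemma D_const_zero: "(\<And>x. a x = k) \<Longrightarrow> D a x u = 0"
proof -
  assume "\<And>x. a x = k"
  then have "a = (\<lambda>x. k)" by auto
  then show ?thesis using D_eq[of a "\<lambda>u. 0" x] by simp
qed

abbreviation S :: "complex \<Rightarrow> complex \<Rightarrow> complex" where "S \<equiv> shape_operator f"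

text \<open>The description in \<open>shape_operator\<close> is resolved by representing the linear
  form u -> II(u, v) through the inner product pulled back by \<tau>.\<close>

lemma II_shape: "fundamental_form_II f x u v = c\<^sup>2 * (\<tau> x u \<bullet> \<tau> x (S x v))"
proof -
  let ?L = "\<lambda>u. fundamental_form_II f x u v"
  have L: "linear ?L" unfolding fundamental_form_II_def
    by (intro linearI)
      (simp_all add: linear_add[OF immersion_H3_props(6)[OF f_imm]] linear_scale[OF immersion_H3_props(6)[OF f_imm]]
        bounded_bilinear.add_left[OF bounded_bilinear_mink] bounded_bilinear.scaleR_left[OF bounded_bilinear_mink])
  let ?w = "linv (\<tau> x) (Complex (?L (linv (\<tau> x) 1) / c\<^sup>2) (?L (linv (\<tau> x) \<i>) / c\<^sup>2))"
  have L_dec: "?L u = Re (\<tau> x u) * ?L (linv (\<tau> x) 1) + Im (\<tau> x u) * ?L (linv (\<tau> x) \<i>)" for u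
  proof -
    have "?L u = ?L (Re (\<tau> x u) *\<^sub>R linv (\<tau> x) 1 + Im (\<tau> x u) *\<^sub>R linv (\<tau> x) \<i>)"
      by (rule arg_cong[OF linv_rotate[OF \<tau>_linear \<tau>_nz]])
    also have "\<dots> = Re (\<tau> x u) *\<^sub>R ?L (linv (\<tau> x) 1) + Im (\<tau> x u) *\<^sub>R ?L (linv (\<tau> x) \<i>)"
      by (rule trans[OF linear_add[OF L] arg_cong2[where f = "(+)", OF linear_scale[OF L] linear_scale[OF L]]])
    finally show ?thesis by (simp only: real_scaleR_def)
  qed
  have w: "?L u = c\<^sup>2 * (\<tau> x u \<bullet> \<tau> x ?w)" for u
    unfolding L_dec[of u] \<tau>_linv using c_pos by (simp add: inner_complex_def field_simps)
  have "\<forall>u. ?L u = fundamental_form_I f x u (S x v)"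
    unfolding shape_operator_def
  proof (rule theI[where a = ?w])
    show "\<forall>u. ?L u = fundamental_form_I f x u ?w" by (intro allI) (rule trans[OF w f_I[symmetric]])
    fix w' assume "\<forall>u. ?L u = fundamental_form_I f x u w'"
    then have "\<tau> x w' \<bullet> \<tau> x u = \<tau> x ?w \<bullet> \<tau> x u" for u
      using w[of u] c_pos by (simp add: f_I inner_commute)
    then show "w' = ?w" by (rule \<tau>_inner_eqI)
  qed
  then show ?thesis by (simp add: f_I)
qed

text \<open>The Weingarten equation: the difference of both sides is orthogonal to f, n and the
  tangent plane, as one sees by differentiating \<open>mink n f = 0\<close> and
  \<open>mink n n = 1\<close> and by the definition of II.\<close>

lemma D_n: "D n x v = D f x (S x v)"
proof -
  note mm = bounded_bilinear_mink
  let ?Z = "D n x v - D f x (S x v)"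
  have "?Z = 0"
  proof (rule nondegenerate[of _ x])
    have "D n x v \<in> Her" "D f x (S x v) \<in> Her" by (auto intro: D_Her smooth_n smooth_f n_props immersion_H3_props[OF f_imm])
    then show "?Z \<in> Her" by (simp add: Her_def linear_diff[OF linear_hconj])
    have "mink (n x) (D f x v) + mink (D n x v) (f x) = 0"
      using D_mink[OF smooth_n smooth_f, of x v] D_const_zero[of "\<lambda>x. mink (n x) (f x)" 0 x v] n_props(2) by simp
    then show "mink ?Z (f x) = 0"
      using immersion_H3_props(4)[OF f_imm, of x] by (simp add: n_props bounded_bilinear.diff_left[OF mm] mink_commute[of "D f x _"])
    have "mink (n x) (D n x v) + mink (D n x v) (n x) = 0"
      using D_mink[OF smooth_n smooth_n, of x v] D_const_zero[of "\<lambda>x. mink (n x) (n x)" 1 x v] n_props(4) by simp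
    then show "mink ?Z (n x) = 0"
      by (simp add: n_props bounded_bilinear.diff_right[OF mm] mink_commute[of _ "n x"])
    show "mink ?Z (D f x u) = 0" for u
      using II_shape[of x u v] f_I[of x u "S x v"]
      by (simp add: fundamental_form_II_def fundamental_form_I_def bounded_bilinear.diff_right[OF mm] mink_commute[of "D n x v - D f x (S x v)"])
  qed
  then show ?thesis by simp
qed

definition \<Gamma> :: "complex \<Rightarrow> complex \<Rightarrow> complex \<Rightarrow> complex" where "\<Gamma> x u v = linv (\<tau> x) (lc x u v)"

text \<open>The Gauss formula in the ambient Minkowski space. The tangential part follows from the
  Koszul identity; the f-term comes from the hyperboloid, with the sign of
  \<open>mink f f = -1\<close>, and the n-term from the shape operator.\<close>

lemma D_D_f:
  "D (\<lambda>y. D f y v) x u = D f x (\<Gamma> x u v) + (c\<^sup>2 * (\<tau> x u \<bullet> \<tau> x v)) *\<^sub>R f x - (c\<^sup>2 * (\<tau> x v \<bullet> \<tau> x (S x u))) *\<^sub>R n x"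
proof -
  note mm = bounded_bilinear_mink
  note simps = bounded_bilinear.diff_left[OF mm] bounded_bilinear.add_left[OF mm] bounded_bilinear.scaleR_left[OF mm]
  note p = immersion_H3_props[OF f_imm]
  let ?H = "\<lambda>u v. D (\<lambda>y. D f y v) x u"
  have sym: "?H u v = ?H v u" for u v by (rule symmetric_second_derivative[OF smooth_f])
  have sd: "smooth (\<lambda>x. D f x v)" for v by (rule smooth_D[OF smooth_f])
  let ?P = "\<lambda>u v z. mink (?H u v) (D f x z)"
  have I: "mink (D f x u) (D f x v) = c\<^sup>2 * (\<tau> x u \<bullet> \<tau> x v)" for x u v
    using f_I[of x u v] by (simp add: fundamental_form_I_def)
  have dI: "?P u a b + ?P u b a = c\<^sup>2 * D (\<lambda>y. \<tau> y a \<bullet> \<tau> y b) x u" for u a b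
  proof -
    have s: "smooth (\<lambda>y. \<tau> y a \<bullet> \<tau> y b)" by (rule smooth_inner[OF \<tau>_smooth \<tau>_smooth])
    have "D (\<lambda>y. mink (D f y a) (D f y b)) x u = c\<^sup>2 * D (\<lambda>y. \<tau> y a \<bullet> \<tau> y b) x u"
      unfolding I using D_eq[OF has_derivative_mult_right[OF smooth_has_derivative[OF s], of "c\<^sup>2" x]] by simp
    then show ?thesis by (simp add: D_mink[OF sd sd] mink_commute[of "D f x a"])
  qed
  have P: "?P u v z = c\<^sup>2 * (lc x u v \<bullet> \<tau> x z)" for u v z
    using dI[where u = u and a = v and b = z] dI[where u = v and a = u and b = z] dI[where u = z and a = u and b = v]
    unfolding koszul sym[where u = v and v = u] sym[where u = z and v = u] sym[where u = z and v = v]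
    by (simp add: algebra_simps)
  let ?Z = "?H u v - (D f x (\<Gamma> x u v) + (c\<^sup>2 * (\<tau> x u \<bullet> \<tau> x v)) *\<^sub>R f x - (c\<^sup>2 * (\<tau> x v \<bullet> \<tau> x (S x u))) *\<^sub>R n x)"
  have nf: "mink (f x) (n x) = 0" "mink (D f x w) (n x) = 0" "mink (D f x w) (f x) = 0" for w
    using n_props(2,3)[of x] p(4)[of x] by (simp_all add: mink_commute)
  have "?Z = 0"
  proof (rule nondegenerate[of _ x])
    have "?H u v \<in> Her" by (rule D_Her[OF sd p(3)])
    moreover have "f x \<in> Her" using p(2)[of x] by (simp add: H3_def)
    ultimately show "?Z \<in> Her" using p(3)[of x] n_props(1)[of x]
      by (simp add: Her_def linear_diff[OF linear_hconj] linear_add[OF linear_hconj] linear_scale[OF linear_hconj])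
    have "mink (D f x v) (D f x u) + mink (?H u v) (f x) = 0"
      using D_mink[OF sd smooth_f, of v x u] D_const_zero[of "\<lambda>x. mink (D f x v) (f x)" 0 x u] p(4) by (simp add: mink_commute[of _ "f _"])
    then show "mink ?Z (f x) = 0" by (simp add: simps nf n_props p(5) I inner_commute)
    have "mink (D f x v) (D n x u) + mink (?H u v) (n x) = 0"
      using D_mink[OF sd smooth_n, of v x u] D_const_zero[of "\<lambda>x. mink (D f x v) (n x)" 0 x u] n_props(3) by (simp add: mink_commute[of _ "n _"])
    then show "mink ?Z (n x) = 0" by (simp add: simps nf n_props D_n I)
    show "mink ?Z (D f x z) = 0" for z
      by (simp add: simps P I p(4) n_props \<Gamma>_def \<tau>_linv)
  qed
  then show ?thesis by simp
qed

end

section \<open>The moving frame equation along rays and uniqueness\<close>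

lemma smooth_ray:
  assumes "smooth G"
  shows "((\<lambda>t. G (t *\<^sub>R x)) has_vector_derivative D G (t *\<^sub>R x) x) (at t within T)"
proof -
  have "((\<lambda>t. t *\<^sub>R x) has_derivative (\<lambda>h. h *\<^sub>R x)) (at t within T)"
    by (auto intro!: derivative_eq_intros)
  from has_derivative_compose[OF this smooth_has_derivative[OF assms]]
  show ?thesis
    by (simp add: has_vector_derivative_def linear_scale[OF smooth_linear_D[OF assms]])
qed

lemma (in coframe) smooth_lc: "smooth (\<lambda>x. lc x u v)"
  unfolding lc_def
  by (rule smooth_diff[OF smooth_D[OF \<tau>_smooth] smooth_mult[OF smooth_mult[OF smooth_const smooth_of_real[OF \<omega>_smooth]] \<tau>_smooth]])

text \<open>The right-hand side of the linear equation satisfied by the moving frame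
  \<open>(f, D f 1, D f \<i>, n)\<close> along a ray.\<close>

definition frame_rhs :: "cmat2 \<times> cmat2 \<times> cmat2 \<times> cmat2 \<Rightarrow>
    complex \<times> complex \<times> complex \<times> complex \<times> real \<times> real \<times> real \<times> real \<Rightarrow> cmat2 \<times> cmat2 \<times> cmat2 \<times> cmat2" where
  "frame_rhs = (\<lambda>(F, F1, F2, N) (a, g1, g2, s, i1, i2, k1, k2).
     (Re a *\<^sub>R F1 + Im a *\<^sub>R F2,
      Re g1 *\<^sub>R F1 + Im g1 *\<^sub>R F2 + i1 *\<^sub>R F - k1 *\<^sub>R N,
      Re g2 *\<^sub>R F1 + Im g2 *\<^sub>R F2 + i2 *\<^sub>R F - k2 *\<^sub>R N,
      Re s *\<^sub>R F1 + Im s *\<^sub>R F2))"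

lemma bounded_bilinear_frame_rhs: "bounded_bilinear frame_rhs"
  unfolding bilinear_conv_bounded_bilinear[symmetric] bilinear_def
  by (auto intro!: linearI simp: frame_rhs_def split_beta prod_eq_iff algebra_simps)

lemma frame_rhs_ray:
  assumes "coframe_immersion \<tau> \<omega> f c"
  shows "((\<lambda>t. (f (t *\<^sub>R x), D f (t *\<^sub>R x) 1, D f (t *\<^sub>R x) \<i>, unit_normal f (t *\<^sub>R x))) has_vector_derivative
    frame_rhs (f (t *\<^sub>R x), D f (t *\<^sub>R x) 1, D f (t *\<^sub>R x) \<i>, unit_normal f (t *\<^sub>R x))
      (x, linv (\<tau> (t *\<^sub>R x)) (coframe.lc \<tau> \<omega> (t *\<^sub>R x) x 1), linv (\<tau> (t *\<^sub>R x)) (coframe.lc \<tau> \<omega> (t *\<^sub>R x) x \<i>),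
       shape_operator f (t *\<^sub>R x) x,
       c\<^sup>2 * (\<tau> (t *\<^sub>R x) x \<bullet> \<tau> (t *\<^sub>R x) 1), c\<^sup>2 * (\<tau> (t *\<^sub>R x) x \<bullet> \<tau> (t *\<^sub>R x) \<i>),
       c\<^sup>2 * (\<tau> (t *\<^sub>R x) 1 \<bullet> \<tau> (t *\<^sub>R x) (shape_operator f (t *\<^sub>R x) x)),
       c\<^sup>2 * (\<tau> (t *\<^sub>R x) \<i> \<bullet> \<tau> (t *\<^sub>R x) (shape_operator f (t *\<^sub>R x) x)))) (at t within T)"
proof -
  interpret coframe_immersion \<tau> \<omega> f c by fact
  have dec: "D f y u = Re u *\<^sub>R D f y 1 + Im u *\<^sub>R D f y \<i>" for y u
    by (rule linear_complex_decomp[OF immersion_H3_props(6)[OF f_imm]])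
  have sd: "smooth (\<lambda>y. D f y u)" for u by (rule smooth_D[OF smooth_f])
  have "((\<lambda>t. (f (t *\<^sub>R x), D f (t *\<^sub>R x) 1, D f (t *\<^sub>R x) \<i>, unit_normal f (t *\<^sub>R x))) has_vector_derivative
    (D f (t *\<^sub>R x) x, D (\<lambda>y. D f y 1) (t *\<^sub>R x) x, D (\<lambda>y. D f y \<i>) (t *\<^sub>R x) x, D (unit_normal f) (t *\<^sub>R x) x)) (at t within T)"
    by (intro has_vector_derivative_Pair smooth_ray smooth_f sd smooth_n)
  then show ?thesis
    by (rule has_vector_derivative_eq_rhs)
      (simp only: frame_rhs_def prod.case D_n D_D_f dec[of _ x] dec[of _ "shape_operator f _ _"] dec[of _ "\<Gamma> _ _ _"] \<Gamma>_def[symmetric])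
qed

text \<open>The uniqueness half of the fundamental theorem of surfaces. Along each ray from 0 the
  moving frame solves a linear equation whose coefficients involve only the coframe, c and B, so
  equal initial frames stay equal; the initial normal is determined by f and its derivative at
  0.\<close>

lemma rigidity:
  assumes f: "coframe_immersion \<tau> \<omega> f c" and f': "coframe_immersion \<tau> \<omega> f' c"
    and S: "\<And>x u. shape_operator f x u = B x u" "\<And>x u. shape_operator f' x u = B x u"
    and B: "\<And>u. continuous_on UNIV (\<lambda>x. B x u)"
    and init: "f 0 = f' 0" "\<And>u. D f 0 u = D f' 0 u"
  shows "f = f'"
proof
  fix x
  interpret coframe_immersion \<tau> \<omega> f c by fact
  interpret bounded_bilinear frame_rhs by (rule bounded_bilinear_frame_rhs)
  define Y where "Y = (\<lambda>f t. (f (t *\<^sub>R x), D f (t *\<^sub>R x) 1, D f (t *\<^sub>R x) \<i>, unit_normal f (t *\<^sub>R x)))"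
  define C where "C = (\<lambda>y. (x, linv (\<tau> y) (lc y x 1), linv (\<tau> y) (lc y x \<i>), B y x,
       c\<^sup>2 * (\<tau> y x \<bullet> \<tau> y 1), c\<^sup>2 * (\<tau> y x \<bullet> \<tau> y \<i>),
       c\<^sup>2 * (\<tau> y 1 \<bullet> \<tau> y (B y x)), c\<^sup>2 * (\<tau> y \<i> \<bullet> \<tau> y (B y x))))"
  have "continuous_on UNIV (\<lambda>y. Re (B y x) *\<^sub>R \<tau> y 1 + Im (B y x) *\<^sub>R \<tau> y \<i>)"
    by (intro continuous_intros B smooth_continuous[OF \<tau>_smooth])
  then have tB: "continuous_on UNIV (\<lambda>y. \<tau> y (B y x))"
    by (simp only: linear_complex_decomp[OF \<tau>_linear, symmetric])
  have C: "continuous_on UNIV C" unfolding C_def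
    by (intro continuous_on_Pair continuous_on_const continuous_on_mult continuous_on_inner B tB
        smooth_continuous[OF \<tau>_smooth] smooth_continuous[OF smooth_linv[OF \<tau>_smooth \<tau>_nz smooth_lc]])
  have "continuous_on {0..1} (\<lambda>t. C (t *\<^sub>R x))"
    by (rule continuous_on_compose2[OF C]) (auto intro!: continuous_intros)
  then obtain K where K: "K > 0" "\<And>y t. t \<in> {0..1::real} \<Longrightarrow> norm (frame_rhs y (C (t *\<^sub>R x))) \<le> K * norm y"
    using bounded_bilinear_uniform_bound[OF bounded_bilinear_frame_rhs compact_Icc] by blast
  have d: "((\<lambda>t. Y f t) has_vector_derivative frame_rhs (Y f t) (C (t *\<^sub>R x))) (at t within {0..1})"
    "((\<lambda>t. Y f' t) has_vector_derivative frame_rhs (Y f' t) (C (t *\<^sub>R x))) (at t within {0..1})" for t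
    using frame_rhs_ray[OF f, of x t "{0..1}"] frame_rhs_ray[OF f', of x t "{0..1}"] unfolding S Y_def C_def by blast+
  have "norm (Y f 1 - Y f' 1) \<le> 0 * exp (K + 1)"
  proof (rule gronwall_zero[where y' = "\<lambda>t. frame_rhs (Y f t - Y f' t) (C (t *\<^sub>R x))"])
    show "((\<lambda>t. Y f t - Y f' t) has_vector_derivative frame_rhs (Y f t - Y f' t) (C (t *\<^sub>R x))) (at t within {0..1})" for t
      unfolding diff_left by (rule has_vector_derivative_diff[OF d])
    show "norm (frame_rhs (Y f t - Y f' t) (C (t *\<^sub>R x))) \<le> K * norm (Y f t - Y f' t) + 0" if "t \<in> {0..1}" for t
      using K(2)[OF that, of "Y f t - Y f' t"] by (simp only: add_0_right)
    have "D f 0 = D f' 0" using init(2) by auto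
    then have "unit_normal f 0 = unit_normal f' 0" unfolding unit_normal_def init by simp
    then show "Y f 0 - Y f' 0 = 0" by (simp add: Y_def init)
  qed (use K(1) in simp_all)
  then have "Y f 1 = Y f' 1" by simp
  then show "f x = f' x" by (simp add: Y_def)
qed

section \<open>The flat connections of a Codazzi pair\<close>

text \<open>Here \<open>\<sigma> = i \<tau> \<circ> b\<close> for the Labourie operator \<open>b\<close>.  The last three conditions say that \<open>b\<close> is self-adjoint,
  of determinant one, and negative definite.\<close>

locale codazzi_frame = coframe +
  fixes \<sigma> :: endo
  assumes \<sigma>_linear: "linear (\<sigma> x)" and \<sigma>_smooth: "smooth (\<lambda>x. \<sigma> x u)"
    and codazzi: "D (\<lambda>y. \<sigma> y v) x u - D (\<lambda>y. \<sigma> y u) x v = \<i> * (\<omega> x u * \<sigma> x v - \<omega> x v * \<sigma> x u)"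
    and curvature: "D (\<lambda>y. \<omega> y v) x u - D (\<lambda>y. \<omega> y u) x v = - Im (cnj (\<tau> x u) * \<tau> x v)"
    and \<sigma>_sym: "Im (cnj (\<tau> x u) * \<sigma> x v) = Im (cnj (\<tau> x v) * \<sigma> x u)"
    and \<sigma>_det: "Im (cnj (\<sigma> x u) * \<sigma> x v) = Im (cnj (\<tau> x u) * \<tau> x v)"
    and \<sigma>_pos: "u \<noteq> 0 \<Longrightarrow> 0 < Im (cnj (\<sigma> x u) * \<tau> x u)"
begin

definition conn :: "complex \<Rightarrow> complex \<Rightarrow> complex \<Rightarrow> cmat2" where
  "conn \<zeta> x u = cscale (\<i> * \<omega> x u / 2) \<sigma>3 + cscale (cos (\<zeta> / 2) / 2) (off (\<tau> x u)) + cscale (sin (\<zeta> / 2) / 2) (off (\<sigma> x u))"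

definition connz :: "complex \<Rightarrow> complex \<Rightarrow> complex \<Rightarrow> cmat2" where
  "connz \<zeta> x u = cscale (- sin (\<zeta> / 2) / 4) (off (\<tau> x u)) + cscale (cos (\<zeta> / 2) / 4) (off (\<sigma> x u))"

lemma linear_off: "linear off"
  by (intro linearI) (simp_all add: cmat2_eq_iff)

lemma bounded_linear_off: "bounded_linear off"
  using linear_off linear_conv_bounded_linear by blast

lemma conn_entries:
  "conn \<zeta> x u $ 1 $ 1 = \<i> * \<omega> x u / 2" "conn \<zeta> x u $ 2 $ 2 = - (\<i> * \<omega> x u / 2)"
  "conn \<zeta> x u $ 2 $ 1 = (cos (\<zeta> / 2) * \<tau> x u + sin (\<zeta> / 2) * \<sigma> x u) / 2"
  "conn \<zeta> x u $ 1 $ 2 = (cos (\<zeta> / 2) * cnj (\<tau> x u) + sin (\<zeta> / 2) * cnj (\<sigma> x u)) / 2"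
  by (simp_all add: conn_def field_simps)

lemma trace_conn: "trace (conn \<zeta> x u) = 0"
  by (simp add: trace_cmat2 conn_entries)

lemma D_conn:
  "D (\<lambda>y. conn \<zeta> y v) x u = cscale (\<i> * D (\<lambda>y. \<omega> y v) x u / 2) \<sigma>3
     + cscale (cos (\<zeta> / 2) / 2) (off (D (\<lambda>y. \<tau> y v) x u)) + cscale (sin (\<zeta> / 2) / 2) (off (D (\<lambda>y. \<sigma> y v) x u))"
proof -
  have w: "((\<lambda>y. \<i> * complex_of_real (\<omega> y v) / 2) has_derivative (\<lambda>u. \<i> * complex_of_real (D (\<lambda>y. \<omega> y v) x u) / 2)) (at x)"
    by (rule has_derivative_divide[OF has_derivative_mult[OF has_derivative_const has_derivative_of_real[OF smooth_has_derivative[OF \<omega>_smooth]]] has_derivative_const, THEN has_derivative_eq_rhs])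
      auto
  note cr = bounded_linear.has_derivative[OF bounded_bilinear.bounded_linear_right[OF bounded_bilinear_cscale]]
  note cl = bounded_linear.has_derivative[OF bounded_bilinear.bounded_linear_left[OF bounded_bilinear_cscale]]
  note o = bounded_linear.has_derivative[OF bounded_linear_off smooth_has_derivative]
  have "((\<lambda>y. conn \<zeta> y v) has_derivative (\<lambda>u. cscale (\<i> * D (\<lambda>y. \<omega> y v) x u / 2) \<sigma>3
     + cscale (cos (\<zeta> / 2) / 2) (off (D (\<lambda>y. \<tau> y v) x u)) + cscale (sin (\<zeta> / 2) / 2) (off (D (\<lambda>y. \<sigma> y v) x u)))) (at x)"
    unfolding conn_def
    by (rule has_derivative_add[OF has_derivative_add[OF cl[OF w] cr[OF o[OF \<tau>_smooth]]] cr[OF o[OF \<sigma>_smooth]]])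
  from D_eq[OF this] show ?thesis by simp
qed

text \<open>The off-diagonal entries are the torsion and Codazzi equations. On the diagonal, the
  symmetry of b kills the mixed term, det b = 1 makes the \<tau> and \<sigma> areas equal, and c^2 +
  s^2 = 1, valid for complex angles too, leaves the Gauss equation.\<close>

lemma conn_flat:
  "D (\<lambda>y. conn \<zeta> y v) x u - D (\<lambda>y. conn \<zeta> y u) x v + conn \<zeta> x u ** conn \<zeta> x v - conn \<zeta> x v ** conn \<zeta> x u = 0"
proof -
  let ?c = "cos (\<zeta> / 2)" and ?s = "sin (\<zeta> / 2)"
  have cs: "?c * ?c + ?s * ?s = 1" using sin_cos_squared_add[of "\<zeta> / 2"] by (simp add: power2_eq_square add.commute)
  have t: "D (\<lambda>y. \<tau> y v) x u = D (\<lambda>y. \<tau> y u) x v + \<i> * (\<omega> x u * \<tau> x v - \<omega> x v * \<tau> x u)"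
    and s: "D (\<lambda>y. \<sigma> y v) x u = D (\<lambda>y. \<sigma> y u) x v + \<i> * (\<omega> x u * \<sigma> x v - \<omega> x v * \<sigma> x u)"
    and w: "D (\<lambda>y. \<omega> y v) x u = D (\<lambda>y. \<omega> y u) x v - Im (cnj (\<tau> x u) * \<tau> x v)"
    using torsion[of v x u] codazzi[of v x u] curvature[of v x u] by (simp_all add: algebra_simps)
  have im: "a - cnj a = 2 * \<i> * Im a" for a by (simp add: complex_eq_iff)
  define T where "T = Im (cnj (\<tau> x u) * \<tau> x v)"
  have 1: "cnj (\<tau> x u) * \<tau> x v - cnj (\<tau> x v) * \<tau> x u = 2 * \<i> * T"
    using im[of "cnj (\<tau> x u) * \<tau> x v"] by (simp add: T_def mult.commute)
  have 2: "cnj (\<sigma> x u) * \<sigma> x v - cnj (\<sigma> x v) * \<sigma> x u = 2 * \<i> * T"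
    using im[of "cnj (\<sigma> x u) * \<sigma> x v"] unfolding T_def \<sigma>_det[symmetric] by (simp add: mult.commute)
  have 3: "cnj (\<tau> x u) * \<sigma> x v - cnj (\<sigma> x v) * \<tau> x u = cnj (\<tau> x v) * \<sigma> x u - cnj (\<sigma> x u) * \<tau> x v"
    using im[of "cnj (\<tau> x u) * \<sigma> x v"] im[of "cnj (\<tau> x v) * \<sigma> x u"] unfolding \<sigma>_sym[of x u v] by (simp add: mult.commute)
  have key: "(?c * cnj (\<tau> x u) + ?s * cnj (\<sigma> x u)) * (?c * \<tau> x v + ?s * \<sigma> x v)
      - (?c * cnj (\<tau> x v) + ?s * cnj (\<sigma> x v)) * (?c * \<tau> x u + ?s * \<sigma> x u) = 2 * \<i> * T"
  proof -
    have "(?c * cnj (\<tau> x u) + ?s * cnj (\<sigma> x u)) * (?c * \<tau> x v + ?s * \<sigma> x v)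
      - (?c * cnj (\<tau> x v) + ?s * cnj (\<sigma> x v)) * (?c * \<tau> x u + ?s * \<sigma> x u)
      = ?c * ?c * (cnj (\<tau> x u) * \<tau> x v - cnj (\<tau> x v) * \<tau> x u) + ?s * ?s * (cnj (\<sigma> x u) * \<sigma> x v - cnj (\<sigma> x v) * \<sigma> x u)
        + ?c * ?s * ((cnj (\<tau> x u) * \<sigma> x v - cnj (\<sigma> x v) * \<tau> x u) - (cnj (\<tau> x v) * \<sigma> x u - cnj (\<sigma> x u) * \<tau> x v))"
      by (simp add: algebra_simps)
    also have "\<dots> = (?c * ?c + ?s * ?s) * (2 * \<i> * T)" unfolding 1 2 3
      by (simp only: diff_self mult_zero_right add_0_right distrib_right)
    finally show ?thesis by (simp only: cs mult_1)
  qed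
  have kk: "conn \<zeta> x u $ 1 $ 2 * conn \<zeta> x v $ 2 $ 1 - conn \<zeta> x v $ 1 $ 2 * conn \<zeta> x u $ 2 $ 1 = \<i> * T / 2"
    unfolding conn_entries times_divide_times_eq diff_divide_distrib[symmetric] key by simp
  have w': "D (\<lambda>y. \<omega> y v) x u = D (\<lambda>y. \<omega> y u) x v - T" by (simp add: w T_def)
  have kk1: "conn \<zeta> x u $ 1 $ 2 * conn \<zeta> x v $ 2 $ 1 = \<i> * T / 2 + conn \<zeta> x v $ 1 $ 2 * conn \<zeta> x u $ 2 $ 1"
    using kk by (simp only: diff_eq_eq)
  have kk2: "conn \<zeta> x u $ 2 $ 1 * conn \<zeta> x v $ 1 $ 2 = conn \<zeta> x v $ 2 $ 1 * conn \<zeta> x u $ 1 $ 2 - \<i> * T / 2"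
    by (simp add: kk[symmetric] mult.commute)
  have "(D (\<lambda>y. conn \<zeta> y v) x u - D (\<lambda>y. conn \<zeta> y u) x v + conn \<zeta> x u ** conn \<zeta> x v - conn \<zeta> x v ** conn \<zeta> x u) $ 1 $ 1 = 0"
    "(D (\<lambda>y. conn \<zeta> y v) x u - D (\<lambda>y. conn \<zeta> y u) x v + conn \<zeta> x u ** conn \<zeta> x v - conn \<zeta> x v ** conn \<zeta> x u) $ 2 $ 2 = 0"
    by (simp_all add: D_conn w' cmat2_mult_nth kk1 kk2) (simp_all add: conn_entries(1,2) field_simps)
  moreover have "(D (\<lambda>y. conn \<zeta> y v) x u - D (\<lambda>y. conn \<zeta> y u) x v + conn \<zeta> x u ** conn \<zeta> x v - conn \<zeta> x v ** conn \<zeta> x u) $ 1 $ 2 = 0"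
    "(D (\<lambda>y. conn \<zeta> y v) x u - D (\<lambda>y. conn \<zeta> y u) x v + conn \<zeta> x u ** conn \<zeta> x v - conn \<zeta> x v ** conn \<zeta> x u) $ 2 $ 1 = 0"
    by (simp_all add: D_conn t s cmat2_mult_nth conn_entries field_simps)
  ultimately show ?thesis by (simp only: cmat2_eq_iff zero_index)
qed

lemma conn_flat_family: "flat_family conn connz"
proof (rule flat_family.intro)
  interpret cs: bounded_bilinear cscale by (rule bounded_bilinear_cscale)
  note lin = linear_add[OF \<tau>_linear] linear_add[OF \<sigma>_linear] linear_add[OF linear_off] cs.add_left cs.add_right
    linear_scale[OF \<tau>_linear] linear_scale[OF \<sigma>_linear] linear_scale[OF linear_off] cs.scaleR_left cs.scaleR_right scaleR_add_right
  show "linear (conn \<zeta> x)" for \<zeta> x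
  proof -
    have w: "\<i> * complex_of_real (\<omega> x (u + v)) / 2 = \<i> * complex_of_real (\<omega> x u) / 2 + \<i> * complex_of_real (\<omega> x v) / 2"
      "\<i> * complex_of_real (\<omega> x (r *\<^sub>R u)) / 2 = r *\<^sub>R (\<i> * complex_of_real (\<omega> x u) / 2)" for u v r
      by (simp_all only: linear_add[OF \<omega>_linear] linear_scale[OF \<omega>_linear]) (simp_all add: scaleR_conv_of_real field_simps)
    show ?thesis unfolding conn_def by (intro linearI) (simp_all only: w lin ac_simps)
  qed
  show "linear (connz \<zeta> x)" for \<zeta> x
    unfolding connz_def by (intro linearI) (simp_all only: lin ac_simps)
  note cs = Ck_bilinear[OF bounded_bilinear_cscale open_UNIV]
  have par: "Ck k UNIV (\<lambda>\<zeta> x. g \<zeta>)" if "continuous_on UNIV g" for k and g :: "complex \<Rightarrow> complex"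
    by (rule Ck_param[OF that open_UNIV])
  have off: "Ck k UNIV (\<lambda>\<zeta>::complex. \<lambda>x. off (\<tau> x u))" "Ck k UNIV (\<lambda>\<zeta>::complex. \<lambda>x. off (\<sigma> x u))" for k u
    by (rule smoothD[OF smooth_bounded_linear[OF bounded_linear_off \<tau>_smooth]], rule smoothD[OF smooth_bounded_linear[OF bounded_linear_off \<sigma>_smooth]])
  have om: "Ck k UNIV (\<lambda>\<zeta>::complex. \<lambda>x. \<i> * complex_of_real (\<omega> x u) / 2)" for k u
  proof -
    have "smooth (\<lambda>x. \<i> * complex_of_real (\<omega> x u) * (1 / 2))"
      by (rule smooth_mult[OF smooth_mult[OF smooth_const smooth_of_real[OF \<omega>_smooth]] smooth_const])
    then show ?thesis using smoothD by fastforce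
  qed
  show "Ck k UNIV (\<lambda>\<zeta> x. conn \<zeta> x u)" for k u
    unfolding conn_def
    by (rule Ck_add[OF open_UNIV Ck_add[OF open_UNIV cs[OF om Ck_const[OF open_UNIV]] cs[OF par off(1)]] cs[OF par off(2)]])
      (auto intro!: continuous_intros)
  show "continuous_on UNIV (\<lambda>(\<zeta>, x). connz \<zeta> x u)" for u
  proof -
    have "Ck 0 UNIV (\<lambda>\<zeta> x. connz \<zeta> x u)"
      unfolding connz_def by (rule Ck_add[OF open_UNIV cs[OF par off(1)] cs[OF par off(2)]]) (auto intro!: continuous_intros)
    then show ?thesis by simp
  qed
  show "D (\<lambda>y. conn \<zeta> y v) x u - D (\<lambda>y. conn \<zeta> y u) x v + conn \<zeta> x u ** conn \<zeta> x v - conn \<zeta> x v ** conn \<zeta> x u = 0" for \<zeta> v x u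
    by (rule conn_flat)
  fix u \<zeta> y :: complex
  have snd: "((\<lambda>q. G (snd q)) has_derivative (\<lambda>d. D G y (snd d))) (at (\<zeta>, y))" if "smooth G" for G :: "complex \<Rightarrow> 'c::real_normed_vector"
    using has_derivative_compose[OF has_derivative_snd[OF has_derivative_ident] smooth_has_derivative[OF that], of "(\<zeta>, y)" UNIV] by simp
  have fst: "((\<lambda>q. G (fst q)) has_derivative (\<lambda>d. G' * fst d)) (at (\<zeta>, y))" if "(G has_field_derivative G') (at \<zeta>)" for G :: "complex \<Rightarrow> complex" and G'
    using has_derivative_compose[OF has_derivative_fst[OF has_derivative_ident], of G "(*) G'" "(\<zeta>, y)" UNIV] that by (simp add: has_field_derivative_def)
  have dc: "((\<lambda>\<zeta>. cos (\<zeta> / 2) / 2) has_field_derivative (- sin (\<zeta> / 2) / 4)) (at \<zeta>)"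
    and ds: "((\<lambda>\<zeta>. sin (\<zeta> / 2) / 2) has_field_derivative (cos (\<zeta> / 2) / 4)) (at \<zeta>)"
    by (auto intro!: derivative_eq_intros)
  have so: "smooth (\<lambda>x. off (\<tau> x u))" "smooth (\<lambda>x. off (\<sigma> x u))"
    by (rule smooth_bounded_linear[OF bounded_linear_off \<tau>_smooth], rule smooth_bounded_linear[OF bounded_linear_off \<sigma>_smooth])
  have D_off: "D (\<lambda>x. off (g x)) y v = off (D g y v)" if "smooth g" for g v
    using D_eq[OF bounded_linear.has_derivative[OF bounded_linear_off smooth_has_derivative[OF that]]] by simp
  have som: "smooth (\<lambda>x. cscale (\<i> * complex_of_real (\<omega> x u) / 2) \<sigma>3)"
    by (rule smooth_bounded_linear[OF bounded_bilinear.bounded_linear_left[OF bounded_bilinear_cscale]]) (rule Ck_imp_smooth_on[OF open_UNIV om])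
  have "((\<lambda>x. \<i> * complex_of_real (\<omega> x u) / 2) has_derivative (\<lambda>v. \<i> * complex_of_real (D (\<lambda>x. \<omega> x u) y v) / 2)) (at y)"
    by (rule has_derivative_divide[OF has_derivative_mult[OF has_derivative_const has_derivative_of_real[OF smooth_has_derivative[OF \<omega>_smooth]]] has_derivative_const, THEN has_derivative_eq_rhs])
      auto
  from D_eq[OF bounded_linear.has_derivative[OF bounded_bilinear.bounded_linear_left[OF bounded_bilinear_cscale] this]]
  have D_om: "D (\<lambda>x. cscale (\<i> * complex_of_real (\<omega> x u) / 2) \<sigma>3) y v = cscale (\<i> * complex_of_real (D (\<lambda>x. \<omega> x u) y v) / 2) \<sigma>3" for v by simp
  have c: "(\<lambda>q. conn (fst q) (snd q) u) = (\<lambda>q. cscale (\<i> * \<omega> (snd q) u / 2) \<sigma>3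
      + cscale (cos (fst q / 2) / 2) (off (\<tau> (snd q) u)) + cscale (sin (fst q / 2) / 2) (off (\<sigma> (snd q) u)))"
    by (simp add: conn_def)
  show "((\<lambda>q. conn (fst q) (snd q) u) has_derivative
      (\<lambda>d. cscale (fst d) (connz \<zeta> y u) + D (\<lambda>y. conn \<zeta> y u) y (snd d))) (at (\<zeta>, y))"
    unfolding c
    by (rule has_derivative_add[OF has_derivative_add[OF snd[OF som] bounded_bilinear.FDERIV[OF bounded_bilinear_cscale fst[OF dc] snd[OF so(1)]]]
          bounded_bilinear.FDERIV[OF bounded_bilinear_cscale fst[OF ds] snd[OF so(2)]], THEN has_derivative_eq_rhs])
      (simp only: D_conn D_om D_off[OF \<tau>_smooth] D_off[OF \<sigma>_smooth], simp add: fun_eq_iff connz_def cmat2_eq_iff field_simps)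
qed

sublocale fl: flat_family conn connz by (rule conn_flat_family)

end

section \<open>Grafted surfaces\<close>

lemma D_act:
  assumes "smooth P" "D P x u = P x ** M"
  shows "D (\<lambda>y. act (P y) X) x u = act (P x) (M ** X + X ** hconj M)"
proof -
  have d: "(P has_derivative D P x) (at x)" by (rule smooth_has_derivative[OF assms(1)])
  have h: "((\<lambda>y. hconj (P y)) has_derivative (\<lambda>u. hconj (D P x u))) (at x)"
    by (rule bounded_linear.has_derivative[OF bounded_linear_hconj d])
  note m = bounded_bilinear.FDERIV[OF bounded_bilinear_cmat2_mult]
  have "((\<lambda>y. P y ** X ** hconj (P y)) has_derivative
    (\<lambda>u. P x ** X ** hconj (D P x u) + (P x ** 0 + D P x u ** X) ** hconj (P x))) (at x)"
    by (rule m[OF m[OF d has_derivative_const] h])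
  from D_eq[OF this] have "D (\<lambda>y. act (P y) X) x u = P x ** X ** hconj (P x ** M) + (P x ** 0 + P x ** M ** X) ** hconj (P x)"
    unfolding act_def by (simp add: assms(2))
  also have "\<dots> = act (P x) (M ** X + X ** hconj M)"
    by (simp add: act_def hconj_mult matrix_mul_assoc bounded_bilinear.zero_right[OF bounded_bilinear_cmat2_mult]
        bounded_bilinear.add_left[OF bounded_bilinear_cmat2_mult] bounded_bilinear.add_right[OF bounded_bilinear_cmat2_mult])
  finally show ?thesis .
qed

lemma smooth_act: "smooth P \<Longrightarrow> smooth (\<lambda>x. act (P x) X)"
  unfolding act_def
  by (rule smooth_bilinear[OF bounded_bilinear_cmat2_mult smooth_bilinear[OF bounded_bilinear_cmat2_mult _ smooth_const]
      smooth_bounded_linear[OF bounded_linear_hconj]])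

definition column1 :: "cmat2 \<Rightarrow> complex^2" where "column1 g = (\<chi> i. g $ i $ 1)"

lemma column1_nth [simp]: "column1 g $ i = g $ i $ 1" by (simp add: column1_def)

lemma ray_scale: "0 < r \<Longrightarrow> ray (r *\<^sub>R X) = ray X"
proof -
  have "Re (trace (r *\<^sub>R X)) = r * Re (trace X)" by (simp add: trace_cmat2 algebra_simps)
  then show "0 < r \<Longrightarrow> ray (r *\<^sub>R X) = ray X" by (simp add: ray_def)
qed

lemma act_projection: "act g (M2 1 0 0 0) = (\<chi> i j. column1 g $ i * cnj (column1 g $ j))"
  by (simp add: act_def cmat2_simps)

lemma CP1_point_column1: "CP1_point (column1 g) = ray (act g (M2 1 0 0 0))"
  by (simp add: CP1_point_def act_projection)

lemma trace_act_projection: "Re (trace (act g (M2 1 0 0 0))) = (cmod (g $ 1 $ 1))\<^sup>2 + (cmod (g $ 2 $ 1))\<^sup>2"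
  unfolding cmod_power2 by (simp add: act_def cmat2_simps power2_eq_square)

lemma trace_act_projection_pos:
  assumes "det g = 1"
  shows "0 < Re (trace (act g (M2 1 0 0 0)))"
proof -
  have "g $ 1 $ 1 \<noteq> 0 \<or> g $ 2 $ 1 \<noteq> 0" using assms by (auto simp: det_2)
  then show ?thesis unfolding trace_act_projection by (auto intro: add_pos_nonneg add_nonneg_pos)
qed

lemma mobius_CP1_point: "det h = 1 \<Longrightarrow> det g = 1 \<Longrightarrow> mobius h (CP1_point (column1 g)) = CP1_point (column1 (h ** g))"
proof -
  assume "det g = 1"
  then have "0 < 1 / Re (trace (act g (M2 1 0 0 0)))" using trace_act_projection_pos by simp
  then show "mobius h (CP1_point (column1 g)) = CP1_point (column1 (h ** g))"
    unfolding mobius_def CP1_point_column1 ray_def[of "act g _"]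
    by (simp add: linear_scale[OF act_linear] ray_scale act_mult del: zero_less_divide_1_iff)
qed

text \<open>A factor exp(t), invisible to \<open>ray\<close>, comes out of the geodesic and leaves
  diag(1, exp(-2t)), which tends to the projection onto the first basis vector.\<close>

lemma ideal_endpoint_act:
  assumes "det g = 1"
  shows "ideal_endpoint (act g (mat 1)) (act g \<sigma>3) = CP1_point (column1 g)"
proof -
  have eq: "ray (cosh t *\<^sub>R act g (mat 1) + sinh t *\<^sub>R act g \<sigma>3) = ray (act g (M2 1 0 0 (of_real (exp (- (2 * t))))))" for t :: real
  proof -
    have e: "cosh t + sinh t = exp t" "cosh t - sinh t = exp (- t)"
      by (simp_all add: cosh_plus_sinh cosh_minus_sinh)
    have "cosh t *\<^sub>R act g (mat 1) + sinh t *\<^sub>R act g \<sigma>3 = act g (cosh t *\<^sub>R mat 1 + sinh t *\<^sub>R \<sigma>3)"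
      by (simp add: linear_add[OF act_linear] linear_scale[OF act_linear])
    also have "cosh t *\<^sub>R mat 1 + sinh t *\<^sub>R \<sigma>3 = M2 (of_real (cosh t + sinh t)) 0 0 (of_real (cosh t - sinh t))"
      by (simp add: cmat2_simps complex_eq_iff)
    also have "\<dots> = exp t *\<^sub>R M2 1 0 0 (of_real (exp (- (2 * t))))"
    proof -
      have "exp (- t) = exp t * exp (- (2 * t))" by (simp flip: exp_add)
      then show ?thesis unfolding e by (simp add: cmat2_eq_iff complex_eq_iff)
    qed
    finally show ?thesis by (simp add: linear_scale[OF act_linear] ray_scale)
  qed
  have lim: "((\<lambda>t. act g (M2 1 0 0 (complex_of_real (exp (- (2 * t)))))) \<longlongrightarrow> act g (M2 1 0 0 0)) at_top"
  proof -
    have e0: "((\<lambda>t. exp (- (2 * t)) :: real) \<longlongrightarrow> 0) at_top"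
      by (intro filterlim_compose[OF exp_at_bot] filterlim_uminus_at_bot[THEN iffD2])
        (simp add: filterlim_tendsto_pos_mult_at_top[OF tendsto_const] filterlim_ident)
    have "((\<lambda>t. act g (M2 1 0 0 0) + exp (- (2 * t)) *\<^sub>R act g (M2 0 0 0 1)) \<longlongrightarrow> act g (M2 1 0 0 0) + 0 *\<^sub>R act g (M2 0 0 0 1)) at_top"
      by (intro tendsto_add tendsto_const tendsto_scaleR e0)
    moreover have "act g (M2 1 0 0 0) + r *\<^sub>R act g (M2 0 0 0 1) = act g (M2 1 0 0 (of_real r))" for r
      unfolding linear_add[OF act_linear, symmetric] linear_scale[OF act_linear, symmetric]
      by (rule arg_cong[where f = "act g"]) (simp add: cmat2_eq_iff complex_eq_iff)
    ultimately show ?thesis by simp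
  qed
  have "((\<lambda>t. ray (act g (M2 1 0 0 (complex_of_real (exp (- (2 * t))))))) \<longlongrightarrow> ray (act g (M2 1 0 0 0))) at_top"
    unfolding ray_def
    by (intro tendsto_scaleR tendsto_divide tendsto_const bounded_linear.tendsto[OF bounded_linear_Re_trace] lim)
      (use trace_act_projection_pos[OF assms] in auto)
  then show ?thesis
    unfolding ideal_endpoint_def eq CP1_point_column1 by (intro tendsto_Lim) auto
qed

lemma (in coframe_immersion) shape_eqI:
  assumes "\<And>u. fundamental_form_II f x u v = c\<^sup>2 * (\<tau> x u \<bullet> \<tau> x w)"
  shows "shape_operator f x v = w"
proof (rule \<tau>_inner_eqI[of x])
  fix u
  have "c\<^sup>2 * (\<tau> x u \<bullet> \<tau> x (shape_operator f x v)) = c\<^sup>2 * (\<tau> x u \<bullet> \<tau> x w)"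
    using assms[of u] II_shape[of x u v] by simp
  then show "\<tau> x (shape_operator f x v) \<bullet> \<tau> x u = \<tau> x w \<bullet> \<tau> x u"
    using c_pos by (simp add: inner_commute)
qed

context codazzi_frame
begin

definition lab :: endo where "lab x u = linv (\<tau> x) (- \<i> * \<sigma> x u)"

lemma \<tau>_lab: "\<tau> x (lab x u) = - \<i> * \<sigma> x u"
  by (simp add: lab_def \<tau>_linv)

lemma smooth_lab: "smooth (\<lambda>x. lab x u)"
  unfolding lab_def by (rule smooth_linv[OF \<tau>_smooth \<tau>_nz smooth_mult[OF smooth_const \<sigma>_smooth]])

lemma linear_lab: "linear (lab x)"
proof -
  have "linear (\<lambda>u. - \<i> * \<sigma> x u)"
    by (intro linearI) (simp_all add: linear_add[OF \<sigma>_linear] linear_scale[OF \<sigma>_linear] algebra_simps)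
  from linear_compose[OF this linear_linv[of "\<tau> x"]] show ?thesis by (simp add: lab_def[abs_def] o_def)
qed

end

text \<open>A solution \<open>P\<close> of \<open>dP = P A\<^bsub>is\<^esub>\<close> is an adapted moving frame of the grafted surface.\<close>

locale grafting_frame = codazzi_frame +
  fixes s :: real and P :: "complex \<Rightarrow> cmat2"
  assumes s_pos: "0 < s" and P_smooth: "smooth P" and det_P: "det (P x) = 1"
    and D_P: "D P x u = P x ** conn (\<i> * s) x u"
begin

definition surf :: "complex \<Rightarrow> cmat2" where "surf x = act (P x) (mat 1)"

lemma trig: "cos (\<i> * complex_of_real s / 2) = of_real (cosh (s / 2))" "sin (\<i> * complex_of_real s / 2) = \<i> * of_real (sinh (s / 2))"
proof -
  have e: "\<i> * complex_of_real s / 2 = \<i> * of_real (s / 2)" by simp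
  have i: "\<i> * (\<i> * complex_of_real (s / 2)) = of_real (- (s / 2))" "- complex_of_real (- (s / 2)) = of_real (s / 2)" by simp_all
  show "cos (\<i> * complex_of_real s / 2) = of_real (cosh (s / 2))"
    unfolding e cos_exp_eq i cosh_def exp_of_real
    by (simp only: of_real_add[symmetric]) (simp add: add.commute scaleR_conv_of_real)
  show "sin (\<i> * complex_of_real s / 2) = \<i> * of_real (sinh (s / 2))"
    unfolding e sin_exp_eq i sinh_def exp_of_real
    by (simp only: of_real_diff[symmetric]) (simp add: complex_eq_iff scaleR_conv_of_real Re_divide Im_divide field_simps)
qed

text \<open>At \<zeta> = is the sine is imaginary, so the \<tau>-part of the connection is
  Hermitian, and the \<sigma>-part and the \<omega>-part are skew. The derivative of the surface
  thus sees only cosh \<tau>, while insertion of \<sigma>3 selects sinh i\<sigma> for the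
  normal.\<close>

lemma conn_is: "conn (\<i> * s) x u ** mat 1 + mat 1 ** hconj (conn (\<i> * s) x u) = off (cosh (s / 2) *\<^sub>R \<tau> x u)"
  "conn (\<i> * s) x u ** \<sigma>3 + \<sigma>3 ** hconj (conn (\<i> * s) x u) = off (sinh (s / 2) *\<^sub>R (\<i> * \<sigma> x u))"
  by (simp_all add: cmat2_eq_iff cmat2_mult_nth cmat2_mat_1 conn_entries trig scaleR_conv_of_real field_simps)

lemma D_surf: "D surf x u = act (P x) (off (cosh (s / 2) *\<^sub>R \<tau> x u))"
  using D_act[OF P_smooth D_P] by (simp only: surf_def[abs_def] conn_is)

lemma surf_coframe_immersion: "coframe_immersion \<tau> \<omega> surf (cosh (s / 2))"
proof (rule coframe_immersion.intro[OF coframe_axioms coframe_immersion_axioms.intro])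
  have "inj (D surf x)" for x
  proof (rule injI)
    fix u v assume "D surf x u = D surf x v"
    then have "off (cosh (s / 2) *\<^sub>R \<tau> x u) = off (cosh (s / 2) *\<^sub>R \<tau> x v)"
      unfolding D_surf using act_adj(2)[OF det_P[of x]] by metis
    then have "cosh (s / 2) *\<^sub>R \<tau> x u = cosh (s / 2) *\<^sub>R \<tau> x v" by (metis off_nth(3))
    then show "u = v" using \<tau>_eqI by simp
  qed
  moreover have "surf x \<in> H3" for x unfolding H3_iff surf_def act_id using det_P by blast
  ultimately show "immersion_H3 surf"
    unfolding immersion_H3_def using smooth_act[OF P_smooth] by (auto simp: surf_def[abs_def])
  show "fundamental_form_I surf x u v = (cosh (s / 2))\<^sup>2 * (\<tau> x u \<bullet> \<tau> x v)" for x u v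
    by (simp add: fundamental_form_I_def D_surf mink_act det_P mink_off power2_eq_square)
qed simp

lemma normal_surf: "unit_normal surf x = act (P x) \<sigma>3"
proof (rule unit_normal_eq[OF det_P _ D_surf])
  show "linear (\<lambda>u. cosh (s / 2) *\<^sub>R \<tau> x u)" by (rule linear_compose_scale_right[OF \<tau>_linear])
  have "det2 (\<lambda>u. cosh (s / 2) *\<^sub>R \<tau> x u) = cosh (s / 2) * cosh (s / 2) * det2 (\<tau> x)" by (simp add: det2_def algebra_simps)
  then show "0 < det2 (\<lambda>u. cosh (s / 2) *\<^sub>R \<tau> x u)" using \<tau>_pos by simp
qed (simp add: surf_def)

lemma D_normal_surf: "D (unit_normal surf) x u = act (P x) (off (sinh (s / 2) *\<^sub>R (\<i> * \<sigma> x u)))"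
proof -
  have "unit_normal surf = (\<lambda>x. act (P x) \<sigma>3)" using normal_surf by blast
  then show ?thesis using D_act[OF P_smooth D_P] by (simp only: conn_is)
qed

text \<open>Since i \<sigma> = - \<tau> b, the quotient of the sinh-derivative of the normal by the
  cosh-derivative of the surface is -tanh(s/2) b, the sign demanded of a grafting.\<close>

lemma shape_surf: "shape_operator surf x u = - tanh (s / 2) *\<^sub>R lab x u"
proof (rule coframe_immersion.shape_eqI[OF surf_coframe_immersion])
  fix v
  have "\<tau> x (- tanh (s / 2) *\<^sub>R lab x u) = tanh (s / 2) *\<^sub>R (\<i> * \<sigma> x u)"
    by (simp only: linear_scale[OF \<tau>_linear] \<tau>_lab) simp
  moreover have "(cosh (s / 2))\<^sup>2 * tanh (s / 2) = cosh (s / 2) * sinh (s / 2)"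
    by (simp add: tanh_def power2_eq_square)
  ultimately show "fundamental_form_II surf x v u = (cosh (s / 2))\<^sup>2 * (\<tau> x v \<bullet> \<tau> x (- tanh (s / 2) *\<^sub>R lab x u))"
    by (simp add: fundamental_form_II_def D_surf D_normal_surf mink_act det_P mink_off)
qed

lemma gauss_map_surf: "gauss_map surf x = CP1_point (column1 (P x))"
  unfolding gauss_map_def normal_surf surf_def by (rule ideal_endpoint_act[OF det_P])

section \<open>Uniqueness and equivariance of the grafted surface\<close>

lemma left_translate:
  assumes "det g = 1"
  shows "grafting_frame \<tau> \<omega> \<sigma> s (\<lambda>x. g ** P x)"
proof (rule grafting_frame.intro[OF codazzi_frame_axioms grafting_frame_axioms.intro[OF s_pos]])
  have bl: "bounded_linear (\<lambda>X::cmat2. g ** X)" by (rule bounded_bilinear.bounded_linear_right[OF bounded_bilinear_cmat2_mult])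
  show "smooth (\<lambda>x. g ** P x)" by (rule smooth_bounded_linear[OF bl P_smooth])
  show "det (g ** P x) = 1" for x by (simp add: det_mul assms det_P)
  show "D (\<lambda>x. g ** P x) x u = g ** P x ** conn (\<i> * complex_of_real s) x u" for x u
    using D_eq[OF bounded_linear.has_derivative[OF bl smooth_has_derivative[OF P_smooth]]]
    by (simp add: D_P matrix_mul_assoc)
qed

text \<open>Left translation preserves the frame equation, so the frame P can be made to start at g;
  rigidity then identifies f with the translated surface.\<close>

lemma surf_unique:
  assumes f: "coframe_immersion \<tau> \<omega> f (cosh (s / 2))" "\<And>x u. shape_operator f x u = - tanh (s / 2) *\<^sub>R lab x u"
    and g: "det g = 1" "f 0 = act g (mat 1)" "\<And>u. D f 0 u = act g (off (cosh (s / 2) *\<^sub>R \<tau> 0 u))"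
  shows "f x = act (g ** adj (P 0) ** P x) (mat 1)" "gauss_map f x = CP1_point (column1 (g ** adj (P 0) ** P x))"
    "det (g ** adj (P 0)) = 1"
proof -
  let ?h = "g ** adj (P 0)"
  show h: "det ?h = 1" by (simp add: det_mul det_adj g det_P)
  interpret t: grafting_frame \<tau> \<omega> \<sigma> s "\<lambda>x. ?h ** P x" by (rule left_translate[OF h])
  have 0: "?h ** P 0 = g" by (simp add: adj_mult det_P flip: matrix_mul_assoc)
  have "f = t.surf"
  proof (rule rigidity[OF f(1) t.surf_coframe_immersion f(2) t.shape_surf])
    show "continuous_on UNIV (\<lambda>x. - tanh (s / 2) *\<^sub>R lab x u)" for u
      by (intro continuous_intros smooth_continuous[OF smooth_lab])
    show "f 0 = t.surf 0" by (simp add: t.surf_def 0 g)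
    show "D f 0 u = D t.surf 0 u" for u by (simp add: t.D_surf 0 g)
  qed
  then show "f x = act (?h ** P x) (mat 1)" "gauss_map f x = CP1_point (column1 (?h ** P x))"
    by (simp_all only: t.gauss_map_surf) (simp add: t.surf_def)
qed

lemma surf_unique_ex:
  assumes f: "immersion_H3 f" "\<And>x u v. fundamental_form_I f x u v = (cosh (s / 2))\<^sup>2 * (\<tau> x u \<bullet> \<tau> x v)"
     "\<And>x u. shape_operator f x u = - tanh (s / 2) *\<^sub>R lab x u"
  obtains h where "det h = 1" "\<And>x. gauss_map f x = mobius h (CP1_point (column1 (P x)))"
proof -
  have c: "coframe_immersion \<tau> \<omega> f (cosh (s / 2))"
    by (rule coframe_immersion.intro[OF coframe_axioms coframe_immersion_axioms.intro[OF f(1) _ f(2)]]) simp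
  obtain g where g: "det g = 1" "f 0 = act g (mat 1)" "\<And>u. D f 0 u = act g (off (cosh (s / 2) *\<^sub>R \<tau> 0 u))"
    by (rule coframe_immersion.frame[OF c, of 0]) (rule that)
  show ?thesis
    using that[of "g ** adj (P 0)"] surf_unique[OF c f(3) g] by (simp add: mobius_CP1_point det_P)
qed

text \<open>The composite of \<open>surf\<close> with \<gamma> has the same first form and shape
  operator, since the unit factor \<kappa> cancels. At 0 it has the adapted frame
  \<open>P (\<gamma> 0)\<close> times diag(cnj k, k), the diagonal factor absorbing the rotation k *
  k; \<open>surf_unique\<close> started there gives \<rho>.\<close>

lemma surf_equivariant:
  assumes \<gamma>: "smooth \<gamma>" and \<kappa>: "\<And>x. cmod (\<kappa> x) = 1"
    and \<tau>\<gamma>: "\<And>x u. \<tau> (\<gamma> x) (D \<gamma> x u) = \<kappa> x * \<tau> x u" and \<sigma>\<gamma>: "\<And>x u. \<sigma> (\<gamma> x) (D \<gamma> x u) = \<kappa> x * \<sigma> x u"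
    and k: "k * k = \<kappa> 0"
  defines "\<rho> \<equiv> P (\<gamma> 0) ** M2 (cnj k) 0 0 k ** adj (P 0)"
  shows "surf (\<gamma> x) = act \<rho> (surf x)" "CP1_point (column1 (P (\<gamma> x))) = mobius \<rho> (CP1_point (column1 (P x)))"
    "det \<rho> = 1"
proof -
  let ?c = "cosh (s / 2)"
  interpret S: coframe_immersion \<tau> \<omega> surf ?c by (rule surf_coframe_immersion)
  let ?f = "\<lambda>x. surf (\<gamma> x)"
  have Df: "D ?f x u = D surf (\<gamma> x) (D \<gamma> x u)" for x u
    by (rule smooth_D_compose[OF S.smooth_f \<gamma>])
  have inner: "(\<kappa> x * a) \<bullet> (\<kappa> x * b) = a \<bullet> b" for x a b
  proof -
    have "(\<kappa> x * a) \<bullet> (\<kappa> x * b) = ((Re (\<kappa> x))\<^sup>2 + (Im (\<kappa> x))\<^sup>2) * (a \<bullet> b)"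
      by (simp add: inner_complex_def power2_eq_square algebra_simps)
    then show ?thesis using \<kappa>[of x] by (simp add: cmod_power2[symmetric])
  qed
  have f: "coframe_immersion \<tau> \<omega> ?f ?c"
  proof (rule coframe_immersion.intro[OF coframe_axioms coframe_immersion_axioms.intro])
    have "inj (D ?f x)" for x
    proof (rule injI)
      fix u v assume "D ?f x u = D ?f x v"
      then have "D \<gamma> x u = D \<gamma> x v" unfolding Df using S.f_imm by (auto simp: immersion_H3_def dest: injD)
      then have "\<kappa> x * \<tau> x u = \<kappa> x * \<tau> x v" by (metis \<tau>\<gamma>)
      then show "u = v" using \<tau>_eqI \<kappa>[of x] by auto
    qed
    then show "immersion_H3 ?f"
      using S.f_imm smooth_compose[OF S.smooth_f \<gamma>] by (auto simp: immersion_H3_def)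
    show "fundamental_form_I ?f x u v = ?c\<^sup>2 * (\<tau> x u \<bullet> \<tau> x v)" for x u v
      using S.f_I[of "\<gamma> x" "D \<gamma> x u" "D \<gamma> x v"] by (simp add: fundamental_form_I_def Df \<tau>\<gamma> inner)
  qed simp
  have nf: "unit_normal ?f x = unit_normal surf (\<gamma> x)" for x
  proof -
    have lin: "linear (\<lambda>u. ?c *\<^sub>R (\<kappa> x * \<tau> x u))"
      by (intro linearI) (simp_all add: linear_add[OF \<tau>_linear] linear_scale[OF \<tau>_linear] algebra_simps)
    have "det2 (\<lambda>u. ?c *\<^sub>R (\<kappa> x * \<tau> x u)) = ?c * ?c * ((Re (\<kappa> x))\<^sup>2 + (Im (\<kappa> x))\<^sup>2) * det2 (\<tau> x)"
      by (simp add: det2_def power2_eq_square algebra_simps)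
    then have d: "0 < det2 (\<lambda>u. ?c *\<^sub>R (\<kappa> x * \<tau> x u))" using \<tau>_pos[of x] \<kappa>[of x] by (simp add: cmod_power2[symmetric])
    show ?thesis unfolding normal_surf
      by (rule unit_normal_eq[OF det_P _ _ lin d]) (simp add: surf_def, simp add: Df D_surf \<tau>\<gamma>)
  qed
  have shape: "shape_operator ?f x u = - tanh (s / 2) *\<^sub>R lab x u" for x u
  proof (rule coframe_immersion.shape_eqI[OF f])
    fix v
    have "unit_normal ?f = (\<lambda>x. unit_normal surf (\<gamma> x))" using nf by blast
    then have Dn: "D (unit_normal ?f) x u = D (unit_normal surf) (\<gamma> x) (D \<gamma> x u)"
      using smooth_D_compose[OF S.smooth_n \<gamma>] by simp
    have "\<tau> x (- tanh (s / 2) *\<^sub>R lab x u) = tanh (s / 2) *\<^sub>R (\<i> * \<sigma> x u)"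
      by (simp only: linear_scale[OF \<tau>_linear] \<tau>_lab) simp
    moreover have "(cosh (s / 2))\<^sup>2 * tanh (s / 2) = cosh (s / 2) * sinh (s / 2)"
      by (simp add: tanh_def power2_eq_square)
    moreover have "(\<kappa> x * \<tau> x v) \<bullet> (\<i> * (\<kappa> x * \<sigma> x u)) = \<tau> x v \<bullet> (\<i> * \<sigma> x u)"
      using inner[of x "\<tau> x v" "\<i> * \<sigma> x u"] by (simp only: mult.left_commute)
    ultimately show "fundamental_form_II ?f x v u = ?c\<^sup>2 * (\<tau> x v \<bullet> \<tau> x (- tanh (s / 2) *\<^sub>R lab x u))"
      by (simp add: fundamental_form_II_def Df Dn D_surf D_normal_surf mink_act det_P mink_off \<tau>\<gamma> \<sigma>\<gamma>)
  qed
  have k1: "cmod k * cmod k = 1" using \<kappa>[of 0] k by (metis norm_mult)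
  let ?K = "M2 (cnj k) 0 0 k" and ?g = "P (\<gamma> 0) ** M2 (cnj k) 0 0 k"
  note K = diag_unit[OF k1, unfolded k]
  have g: "det ?g = 1" by (simp add: det_mul det_P K)
  have g0: "?f 0 = act ?g (mat 1)" by (simp add: act_mult K surf_def)
  have g1: "D ?f 0 u = act ?g (off (?c *\<^sub>R \<tau> 0 u))" for u
    by (simp add: act_mult K Df D_surf \<tau>\<gamma>)
  note u = surf_unique[OF f shape g g0 g1, folded \<rho>_def]
  show "surf (\<gamma> x) = act \<rho> (surf x)" using u(1)[of x] by (simp add: surf_def[of x] act_mult)
  show "det \<rho> = 1" by (rule u(3))
  have "gauss_map ?f x = gauss_map surf (\<gamma> x)" by (simp add: gauss_map_def nf)
  then show "CP1_point (column1 (P (\<gamma> x))) = mobius \<rho> (CP1_point (column1 (P x)))"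
    using u(2)[of x] by (simp add: gauss_map_surf mobius_CP1_point[OF u(3) det_P])
qed

end

section \<open>Deck transformations and isotopies\<close>

text \<open>Continuity of g and F o g = F suffices when the derivative of F at g x has a left
  inverse. The equation first gives a Lipschitz bound for g at x, and this bound then controls the
  error of its linearisation.\<close>

lemma lift_has_derivative:
  fixes F :: "'b::real_normed_vector \<Rightarrow> 'c::real_normed_vector" and g :: "'b \<Rightarrow> 'b"
  assumes F1: "(F has_derivative F1) (at x)" and F2: "(F has_derivative F2) (at (g x))"
    and cont: "isCont g x" and S: "open S" "x \<in> S" "\<And>z. z \<in> S \<Longrightarrow> F (g z) = F z"
    and L: "bounded_linear L" "\<And>v. L (F2 v) = v"
  shows "(g has_derivative (\<lambda>u. L (F1 u))) (at x)"
proof -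
  interpret L: bounded_linear L by fact
  interpret F1: bounded_linear F1 using F1 by (rule has_derivative_bounded_linear)
  obtain K where K: "K > 0" "\<And>v. norm (L v) \<le> norm v * K" using L.pos_bounded by blast
  obtain B where B: "B > 0" "\<And>v. norm (F1 v) \<le> norm v * B" using F1.pos_bounded by blast
  have main: "\<exists>d>0. \<forall>z. norm (z - x) < d \<longrightarrow> norm (g z - g x - L (F1 (z - x))) \<le> e * norm (z - x)" if "e > 0" for e
  proof -
    define e1 where "e1 = min 1 (e / (2 * K))"
    \<comment> \<open>The first bound lets half of |g z - g x| be absorbed on the left, giving the
      Lipschitz constant 2 K (B + 1); the second makes the same error term at most e/2 |z -
      x|.\<close>
    define e2 where "e2 = min (1 / (2 * K)) (e / (4 * K * K * (B + 1)))"
    have e1: "e1 > 0" "e1 \<le> 1" "K * e1 \<le> e / 2" using that K by (auto simp: e1_def min_def field_simps)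
    have "e2 \<le> 1 / (2 * K)" by (simp add: e2_def)
    then have "K * e2 \<le> K * (1 / (2 * K))" using K(1) by (intro mult_left_mono) auto
    then have e2: "e2 > 0" "K * e2 \<le> 1 / 2"
      using that K(1) B(1) by (auto intro!: divide_pos_pos mult_pos_pos add_pos_pos simp: e2_def)
    have e2': "K * e2 * (2 * K * (B + 1)) \<le> e / 2"
    proof -
      have "e2 \<le> e / (4 * K * K * (B + 1))" by (simp add: e2_def)
      then have "K * (2 * K * (B + 1)) * e2 \<le> K * (2 * K * (B + 1)) * (e / (4 * K * K * (B + 1)))"
        using K B by (intro mult_left_mono) auto
      also have "\<dots> = e / 2"
      proof -
        have "4 * K * K * (B + 1) = 2 * (K * (2 * K * (B + 1)))" by simp
        moreover have "K * (2 * K * (B + 1)) \<noteq> 0" using K B by simp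
        ultimately show ?thesis by (simp add: field_simps)
      qed
      finally show ?thesis by (simp add: mult_ac)
    qed
    obtain d1 where d1: "d1 > 0" "\<And>z. norm (z - x) < d1 \<Longrightarrow> norm (F z - F x - F1 (z - x)) \<le> e1 * norm (z - x)"
      using F1 e1(1) unfolding has_derivative_at_alt by meson
    obtain d2 where d2: "d2 > 0" "\<And>y. norm (y - g x) < d2 \<Longrightarrow> norm (F y - F (g x) - F2 (y - g x)) \<le> e2 * norm (y - g x)"
      using F2 e2(1) unfolding has_derivative_at_alt by meson
    obtain d3 where d3: "d3 > 0" "\<And>z. norm (z - x) < d3 \<Longrightarrow> norm (g z - g x) < d2"
      using cont d2(1) unfolding continuous_at_eps_delta dist_norm by meson
    obtain d4 where d4: "d4 > 0" "ball x d4 \<subseteq> S" using S openE by blast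
    have "norm (g z - g x - L (F1 (z - x))) \<le> e * norm (z - x)" if z: "norm (z - x) < min (min d1 d3) d4" for z
    proof -
      let ?w = "g z - g x" and ?h = "z - x"
      define r1 where "r1 = F z - F x - F1 ?h"
      define r2 where "r2 = F (g z) - F (g x) - F2 ?w"
      have "z \<in> S" using z d4(2) by (auto simp: dist_norm norm_minus_commute)
      then have FF: "F (g z) = F z" "F (g x) = F x" using S by auto
      have r1: "norm r1 \<le> e1 * norm ?h" unfolding r1_def using d1(2) z by simp
      have r2: "norm r2 \<le> e2 * norm ?w" unfolding r2_def using d2(2) d3(2) z by simp
      have "F2 ?w = F1 ?h + r1 - r2" by (simp add: r1_def r2_def FF)
      then have w: "?w = L (F1 ?h) + L r1 - L r2" using L(2)[of ?w] by (simp add: L.add L.diff)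
      have Lr1: "norm (L r1) \<le> K * e1 * norm ?h"
        using order_trans[OF K(2) mult_right_mono[OF r1 less_imp_le[OF K(1)]]] by (simp add: mult_ac)
      have Lr2: "norm (L r2) \<le> K * e2 * norm ?w"
        using order_trans[OF K(2) mult_right_mono[OF r2 less_imp_le[OF K(1)]]] by (simp add: mult_ac)
      have "norm ?w \<le> norm (L (F1 ?h) + L r1) + norm (L r2)" by (subst w) (rule norm_triangle_ineq4)
      also have "\<dots> \<le> norm (L (F1 ?h)) + norm (L r1) + norm (L r2)" by (simp add: norm_triangle_ineq)
      also have "norm (L (F1 ?h)) \<le> K * B * norm ?h"
        using order_trans[OF K(2) mult_right_mono[OF B(2)[of ?h] less_imp_le[OF K(1)]]] by (simp add: mult_ac)
      also have "norm (L r1) \<le> K * 1 * norm ?h"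
      proof (rule order_trans[OF Lr1 mult_right_mono])
        show "K * e1 \<le> K * 1" using e1 K(1) by (intro mult_left_mono) auto
      qed simp
      also have "norm (L r2) \<le> (1 / 2) * norm ?w"
        by (rule order_trans[OF Lr2 mult_right_mono[OF e2(2)]]) simp
      finally have ww: "norm ?w \<le> 2 * K * (B + 1) * norm ?h" by (simp add: algebra_simps)
      have "?w - L (F1 ?h) = L r1 - L r2" by (subst w) simp
      then have "norm (?w - L (F1 ?h)) \<le> norm (L r1) + norm (L r2)" by (simp add: norm_triangle_ineq4)
      also have "\<dots> \<le> K * e1 * norm ?h + K * e2 * norm ?w" using Lr1 Lr2 by simp
      also have "\<dots> \<le> (e / 2) * norm ?h + K * e2 * (2 * K * (B + 1) * norm ?h)"
        using K(1) e2(1) by (intro add_mono mult_right_mono[OF e1(3)] mult_left_mono[OF ww]) auto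
      also have "\<dots> \<le> (e / 2) * norm ?h + (e / 2) * norm ?h"
        using mult_right_mono[OF e2', of "norm ?h"] unfolding mult.assoc by simp
      finally show ?thesis by simp
    qed
    then show ?thesis using d1(1) d3(1) d4(1) by (intro exI[of _ "min (min d1 d3) d4"]) auto
  qed
  show ?thesis
    unfolding has_derivative_at_alt using main bounded_linear_compose[OF L(1) F1.bounded_linear] by blast
qed

lemma det2_compose:
  assumes "linear A" "linear B"
  shows "det2 (\<lambda>u. A (B u)) = det2 A * det2 B"
proof -
  have "A (B u) = Re (B u) *\<^sub>R A 1 + Im (B u) *\<^sub>R A \<i>" for u by (rule linear_complex_decomp[OF assms(1)])
  then show ?thesis by (simp add: det2_def algebra_simps)
qed

lemma smooth_local:
  assumes "\<And>x. \<exists>S. x \<in> S \<and> smooth_on S f"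
  shows "smooth f"
  unfolding smooth_on_def
proof (intro conjI allI open_UNIV)
  fix vs
  have "iter_deriv vs f differentiable at x" for x
  proof -
    obtain S where "x \<in> S" "smooth_on S f" using assms by blast
    then show ?thesis unfolding smooth_on_def differentiable_on_def using at_within_open by metis
  qed
  then show "iter_deriv vs f differentiable_on UNIV" by (simp add: differentiable_on_def)
qed

lemma Ck_linv:
  fixes T :: "'p::topological_space \<Rightarrow> complex \<Rightarrow> complex \<Rightarrow> complex"
  assumes S: "open S" and T: "\<And>u. Ck k S (\<lambda>p x. T p x u)" and nz: "\<And>p x. x \<in> S \<Longrightarrow> det2 (T p x) \<noteq> 0"
    and z: "Ck k S z"
  shows "Ck k S (\<lambda>p x. linv (T p x) (z p x))"
proof -
  note cnj = Ck_bounded_linear[OF bounded_linear_cnj S] and Im = Ck_bounded_linear[OF bounded_linear_Im S]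
  have d: "Ck k S (\<lambda>p x. det2 (T p x))" unfolding det2_def by (rule Im[OF Ck_mult[OF S cnj[OF T] T]])
  have 1: "Ck k S (\<lambda>p x. Im (cnj (z p x) * T p x \<i>) / det2 (T p x))"
    by (rule Ck_divide[OF S nz Im[OF Ck_mult[OF S cnj[OF z] T]] d])
  have 2: "Ck k S (\<lambda>p x. Im (cnj (T p x 1) * z p x) / det2 (T p x))"
    by (rule Ck_divide[OF S nz Im[OF Ck_mult[OF S cnj[OF T] z]] d])
  have "Ck k S (\<lambda>p x. of_real (Im (cnj (z p x) * T p x \<i>) / det2 (T p x)) + \<i> * of_real (Im (cnj (T p x 1) * z p x) / det2 (T p x)))"
    by (rule Ck_add[OF S Ck_bounded_linear[OF bounded_linear_of_real S 1]
          Ck_mult[OF S Ck_const[OF S] Ck_bounded_linear[OF bounded_linear_of_real S 2]]])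
  then show ?thesis unfolding linv_def Complex_eq .
qed

text \<open>Deck maps are only homeomorphisms by definition. In a chart composed with p they satisfy
  F o \<gamma> = F, so D\<gamma> = (DF o \<gamma>)^{-1} DF; this formula raises the regularity of
  \<gamma> one order at a time and shows positivity of the determinant.\<close>

lemma deck_smooth:
  assumes A: "oriented_smooth_atlas A" and p: "universal_cover A p" and \<gamma>: "\<gamma> \<in> deck p"
  shows "smooth \<gamma>" "0 < det2 (D \<gamma> x)"
proof -
  have cont: "continuous_on UNIV \<gamma>" and p\<gamma>: "p (\<gamma> z) = p z" for z
    using \<gamma> by (auto simp: deck_def homeomorphism_def o_def fun_eq_iff)
  have loc: "\<exists>S. x \<in> S \<and> smooth_on S \<gamma> \<and> 0 < det2 (D \<gamma> x)" for x
  proof -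
    have "(\<Union>(U, \<phi>)\<in>A. U) = UNIV" using A by (simp add: oriented_smooth_atlas_def)
    then have "p x \<in> (\<Union>(U, \<phi>)\<in>A. U)" by simp
    then obtain U \<phi> where U: "(U, \<phi>) \<in> A" "p x \<in> U" by blast
    define S where "S = p -` U"
    define F where "F = \<phi> \<circ> p"
    have F: "smooth_on S F" "\<And>z. z \<in> S \<Longrightarrow> 0 < det2 (D F z)"
      using p U unfolding universal_cover_def S_def F_def by blast+
    have S: "open S" using F(1) by (simp add: smooth_on_def)
    have xS: "x \<in> S" and \<gamma>S: "\<And>z. z \<in> S \<Longrightarrow> \<gamma> z \<in> S" and F\<gamma>: "\<And>z. F (\<gamma> z) = F z"
      using U p\<gamma> by (auto simp: S_def F_def)
    have lin: "linear (D F z)" if "z \<in> S" for z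
      using has_derivative_linear[OF smooth_on_has_derivative[OF F(1) that]] .
    have nz: "det2 (D F z) \<noteq> 0" if "z \<in> S" for z using F(2)[OF that] by simp
    have der: "(\<gamma> has_derivative (\<lambda>u. linv (D F (\<gamma> z)) (D F z u))) (at z)" if z: "z \<in> S" for z
    proof (rule lift_has_derivative[OF smooth_on_has_derivative[OF F(1) z] smooth_on_has_derivative[OF F(1) \<gamma>S[OF z]] _ S z F\<gamma>])
      show "isCont \<gamma> z" using cont by (simp add: continuous_on_eq_continuous_at)
      show "bounded_linear (linv (D F (\<gamma> z)))" using linear_linv linear_conv_bounded_linear by blast
      show "linv (D F (\<gamma> z)) (D F (\<gamma> z) v) = v" for v by (rule linv_left[OF lin[OF \<gamma>S[OF z]] nz[OF \<gamma>S[OF z]]])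
    qed
    have Ck: "Ck k S (\<lambda>_::real. \<gamma>)" for k
    proof (induction k)
      have c0: "Ck 0 S (\<lambda>_::real. \<gamma>)"
        by (auto simp: split_def intro!: continuous_on_compose2[OF cont] continuous_intros)
      {
        case 0 show ?case by (rule c0)
      next
        case (Suc k)
        have DF: "Ck k S (\<lambda>_::real. \<lambda>y. D F y u)" for u
          by (rule Ck_D[OF smooth_on_imp_Ck[OF F(1)]])
        have DF\<gamma>: "Ck k S (\<lambda>_::real. \<lambda>y. D F (\<gamma> y) u)" for u
          by (rule Ck_compose[of S S "\<lambda>_. \<gamma>" k "\<lambda>_ y. D F y u", OF S S \<gamma>S DF Suc])
        show ?case
        proof (rule Ck_SucI[OF S c0 der])
          show "Ck k S (\<lambda>_::real. \<lambda>x. linv (D F (\<gamma> x)) (D F x u))" for u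
            by (rule Ck_linv[of S k "\<lambda>_ x. D F (\<gamma> x)" "\<lambda>_ x. D F x u", OF S DF\<gamma> nz[OF \<gamma>S] DF])
        qed
      }
    qed
    have "D \<gamma> x = (\<lambda>u. linv (D F (\<gamma> x)) (D F x u))" using D_eq[OF der[OF xS]] .
    then have "D F (\<gamma> x) (D \<gamma> x u) = D F x u" for u
      using linv_right[OF lin nz, OF \<gamma>S \<gamma>S, OF xS xS] by simp
    then have "det2 (D F x) = det2 (D F (\<gamma> x)) * det2 (D \<gamma> x)"
      using det2_compose[OF lin[OF \<gamma>S[OF xS]] has_derivative_linear[OF der[OF xS]]] D_eq[OF der[OF xS]]
      by simp
    then have "0 < det2 (D \<gamma> x)" using F(2)[OF xS] F(2)[OF \<gamma>S[OF xS]] by (simp add: zero_less_mult_iff)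
    then show ?thesis using xS Ck_imp_smooth_on[OF S Ck] by blast
  qed
  show "smooth \<gamma>" using loc by (intro smooth_local) blast
  show "0 < det2 (D \<gamma> x)" using loc by blast
qed

lemma deck_comp: "\<gamma> \<in> deck p \<Longrightarrow> \<delta> \<in> deck p \<Longrightarrow> \<gamma> \<circ> \<delta> \<in> deck p"
proof -
  assume "\<gamma> \<in> deck p" "\<delta> \<in> deck p"
  then obtain \<gamma>' \<delta>' where h: "homeomorphism UNIV UNIV \<gamma> \<gamma>'" "homeomorphism UNIV UNIV \<delta> \<delta>'" and "p \<circ> \<gamma> = p" "p \<circ> \<delta> = p"
    by (auto simp: deck_def)
  then have "p \<circ> (\<gamma> \<circ> \<delta>) = p" by (simp add: fun_eq_iff)
  then show "\<gamma> \<circ> \<delta> \<in> deck p" using homeomorphism_compose[OF h(2,1)] by (auto simp: deck_def)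
qed

text \<open>Along the isotopy the Jacobian determinant never vanishes and starts at 1, so it is
  positive at time 1 by the intermediate value theorem.\<close>

lemma isotopic_to_id_props:
  assumes "isotopic_to_id p \<phi>"
  shows "smooth \<phi>" "0 < det2 (D \<phi> x)" "\<gamma> \<in> deck p \<Longrightarrow> \<phi> (\<gamma> x) = \<gamma> (\<phi> x)"
proof -
  obtain \<Phi> :: "real \<times> complex \<Rightarrow> complex" where \<Phi>: "smooth \<Phi>" "\<And>x. \<Phi> (0, x) = x" "\<And>x. \<Phi> (1, x) = \<phi> x"
    "\<And>t. diffeo (\<lambda>x. \<Phi> (t, x))" "\<And>t \<gamma> x. \<gamma> \<in> deck p \<Longrightarrow> \<Phi> (t, \<gamma> x) = \<gamma> (\<Phi> (t, x))"
    using assms unfolding isotopic_to_id_def by metis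
  show "\<phi> (\<gamma> x) = \<gamma> (\<phi> x)" if "\<gamma> \<in> deck p" for \<gamma> x using \<Phi>(5)[OF that, of 1 x] by (simp add: \<Phi>(3))
  have \<phi>: "\<phi> = (\<lambda>x. \<Phi> (1, x))" using \<Phi>(3) by auto
  show "smooth \<phi>" using \<Phi>(4)[of 1] by (simp add: diffeo_def \<phi>)
  have s: "smooth (\<lambda>x. \<Phi> (t, x))" for t using \<Phi>(4)[of t] by (simp add: diffeo_def)
  have D1: "D (\<lambda>x. \<Phi> (t, x)) x u = D \<Phi> (t, x) (0, u)" for t x u
  proof -
    have "((\<lambda>x. (t, x)) has_derivative (\<lambda>u. (0, u))) (at x)" by (auto intro!: derivative_eq_intros)
    from D_eq[OF has_derivative_compose[OF this smooth_has_derivative[OF \<Phi>(1)]]] show ?thesis by simp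
  qed
  have nz: "det2 (D (\<lambda>x. \<Phi> (t, x)) x) \<noteq> 0" for t x
  proof -
    let ?f = "\<lambda>x. \<Phi> (t, x)"
    let ?g = "inv_into UNIV ?f"
    have g: "smooth ?g" "\<And>x. ?g (?f x) = x"
      using \<Phi>(4)[of t] inv_f_f[of ?f] unfolding diffeo_def bij_def by blast+
    have "D ?g (?f x) (D ?f x u) = u" for u
    proof -
      have "D (\<lambda>x. ?g (?f x)) x u = u" unfolding g(2) using D_eq[OF has_derivative_ident, of x] by simp
      then show ?thesis by (simp add: smooth_D_compose[OF g(1) s])
    qed
    then have "det2 (D ?g (?f x)) * det2 (D ?f x) = det2 (\<lambda>u. u)"
      using det2_compose[OF smooth_linear_D[OF g(1), of "?f x"] smooth_linear_D[OF s, of t x]] by simp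
    then show ?thesis by (auto simp: det2_def)
  qed
  let ?d = "\<lambda>t. det2 (D (\<lambda>x. \<Phi> (t, x)) x)"
  have "continuous_on UNIV ?d"
  proof -
    have c: "continuous_on UNIV (\<lambda>t. D \<Phi> (t, x) (0, u))" for u
      by (rule continuous_on_compose2[OF smooth_continuous[OF smooth_D[OF \<Phi>(1)]]]) (auto intro!: continuous_intros)
    show ?thesis unfolding det2_def D1 by (intro continuous_intros c)
  qed
  then have c: "continuous_on {0..1} ?d" by (rule continuous_on_subset) auto
  have d0: "?d 0 = 1"
    unfolding \<Phi>(2) using D_eq[OF has_derivative_ident, of x] by (simp add: det2_def)
  have "0 < ?d 1"
  proof (rule ccontr)
    assume "\<not> 0 < ?d 1"
    then have "?d 1 \<le> 0" "0 \<le> ?d 0" using d0 by auto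
    from IVT2'[OF this _ c] obtain t where "?d t = 0" by auto
    then show False using nz by blast
  qed
  then show "0 < det2 (D \<phi> x)" by (simp add: \<phi>)
qed

section \<open>Alternating forms and pullback\<close>

text \<open>An alternating form on the plane is its value on (1, i) times the area form, so equality
  of two-forms need only be checked on one pair.\<close>

lemma alternating_eq:
  fixes B :: "complex \<Rightarrow> complex \<Rightarrow> 'a::real_vector"
  assumes 1: "\<And>v. linear (\<lambda>u. B u v)" and 2: "\<And>u v. B v u = - B u v"
  shows "B u v = Im (cnj u * v) *\<^sub>R B 1 \<i>"
proof -
  have z: "B w w = 0" for w
  proof -
    have "B w w + B w w = 0" using 2[of w w] by (rule eq_neg_iff_add_eq_0[THEN iffD1])
    then have "(2::real) *\<^sub>R B w w = 0" unfolding scaleR_2 .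
    then show ?thesis unfolding scaleR_eq_0_iff by simp
  qed
  have 3: "linear (\<lambda>v. B u v)" for u
  proof -
    have eq: "(\<lambda>v. B u v) = (\<lambda>v. - B v u)" by (rule ext) (rule 2)
    show ?thesis unfolding eq by (rule linear_compose_neg[OF 1])
  qed
  have "B u v = Re u *\<^sub>R B 1 v + Im u *\<^sub>R B \<i> v" by (rule linear_complex_decomp[OF 1])
  also have "B 1 v = Im v *\<^sub>R B 1 \<i>" using linear_complex_decomp[OF 3, of 1 v] by (simp add: z)
  also have "B \<i> v = - (Re v *\<^sub>R B 1 \<i>)" using linear_complex_decomp[OF 3, of \<i> v] 2[of 1 \<i>] by (simp add: z)
  finally show ?thesis by (simp add: scaleR_diff_left mult.commute)
qed

text \<open>Exterior differentiation commutes with pullback: the second derivatives of \<phi> are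
  symmetric and cancel in the antisymmetrised expression.\<close>

lemma pullback_form:
  fixes \<alpha> :: "complex \<Rightarrow> complex \<Rightarrow> 'b::real_normed_vector"
  assumes lin: "\<And>x. linear (\<alpha> x)" and smooth: "\<And>u. smooth (\<lambda>x. \<alpha> x u)" and \<phi>: "smooth (\<phi> :: complex \<Rightarrow> complex)"
  shows "smooth (\<lambda>x. \<alpha> (\<phi> x) (D \<phi> x u))"
    "D (\<lambda>y. \<alpha> (\<phi> y) (D \<phi> y v)) x u - D (\<lambda>y. \<alpha> (\<phi> y) (D \<phi> y u)) x v
     = D (\<lambda>z. \<alpha> z (D \<phi> x v)) (\<phi> x) (D \<phi> x u) - D (\<lambda>z. \<alpha> z (D \<phi> x u)) (\<phi> x) (D \<phi> x v)"
proof -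
  have s: "smooth (\<lambda>x. \<alpha> (\<phi> x) u)" for u by (rule smooth_compose[OF smooth \<phi>])
  have sD: "smooth (\<lambda>x. D \<phi> x u)" for u by (rule smooth_D[OF \<phi>])
  show "smooth (\<lambda>x. \<alpha> (\<phi> x) (D \<phi> x u))" by (rule smooth_form_field[of "\<lambda>x. \<alpha> (\<phi> x)", OF lin s sD])
  have "D (\<lambda>y. \<alpha> (\<phi> y) (D \<phi> y v)) x u = D (\<lambda>z. \<alpha> z (D \<phi> x v)) (\<phi> x) (D \<phi> x u) + \<alpha> (\<phi> x) (D (\<lambda>y. D \<phi> y v) x u)" for u v
    using D_form_field[of "\<lambda>x. \<alpha> (\<phi> x)" "\<lambda>y. D \<phi> y v" x u, OF lin s differentiableI[OF smooth_has_derivative[OF sD]]]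
    by (simp add: smooth_D_compose[OF smooth \<phi>])
  then show "D (\<lambda>y. \<alpha> (\<phi> y) (D \<phi> y v)) x u - D (\<lambda>y. \<alpha> (\<phi> y) (D \<phi> y u)) x v
     = D (\<lambda>z. \<alpha> z (D \<phi> x v)) (\<phi> x) (D \<phi> x u) - D (\<lambda>z. \<alpha> z (D \<phi> x u)) (\<phi> x) (D \<phi> x v)"
    by (simp add: symmetric_second_derivative[OF \<phi>, of u x v])
qed

section \<open>Coframes of hyperbolic metrics\<close>

text \<open>Gram-Schmidt applied to the global fields 1 and i of the plane gives \<tau> by an
  explicit smooth formula; \<omega> is then found by solving d\<tau> = i \<omega> \<and> \<tau> with
  Cramer's rule.\<close>

lemma coframe_exists:
  assumes h: "riemannian_metric p h"
  obtains \<tau> \<omega> where "coframe \<tau> \<omega>" "h = (\<lambda>x u v. \<tau> x u \<bullet> \<tau> x v)"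
proof -
  have bil: "bilinear (h x)" and sym: "h x u v = h x v u" and pos: "u \<noteq> 0 \<Longrightarrow> 0 < h x u u" and sm: "smooth (\<lambda>x. h x u v)" for x u v
    using h unfolding riemannian_metric_def by blast+
  have dec: "h x u v = Re u * (Re v * h x 1 1 + Im v * h x 1 \<i>) + Im u * (Re v * h x 1 \<i> + Im v * h x \<i> \<i>)" for x u v
  proof -
    have l: "linear (\<lambda>u. h x u v)" and r: "linear (\<lambda>v. h x w v)" for w using bil[of x] by (auto simp: bilinear_def)
    show ?thesis
      using linear_complex_decomp[OF l, of u] linear_complex_decomp[OF r, of 1 v] linear_complex_decomp[OF r, of \<i> v] sym[of x \<i> 1]
      by simp
  qed
  define E where "E x = h x 1 1" for x
  define F where "F x = h x 1 \<i>" for x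
  define \<Delta> where "\<Delta> x = h x 1 1 * h x \<i> \<i> - h x 1 \<i> * h x 1 \<i>" for x
  have E: "E x > 0" for x using pos[of 1 x] by (simp add: E_def)
  have \<Delta>: "\<Delta> x > 0" for x
  proof -
    \<comment> \<open>This vector is h-orthogonal to 1 and has squared length E \<Delta>, so
      positivity of h yields \<Delta> > 0.\<close>
    have "Complex (- F x) (E x) \<noteq> 0" using E[of x] by (simp add: complex_eq_iff)
    from pos[OF this, of x] have "0 < E x * \<Delta> x"
      unfolding dec[of x "Complex _ _"] by (simp add: E_def F_def \<Delta>_def algebra_simps)
    then show ?thesis using E[of x] by (simp add: zero_less_mult_iff)
  qed
  have sE: "smooth E" and sF: "smooth F" and s\<Delta>: "smooth \<Delta>"
    unfolding E_def[abs_def] F_def[abs_def] \<Delta>_def[abs_def]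
    by (rule sm, rule sm, rule smooth_diff[OF smooth_mult[OF sm sm] smooth_mult[OF sm sm]])
  define \<tau> where "\<tau> = (\<lambda>x u. of_real ((Re u * E x + Im u * F x) / sqrt (E x)) + \<i> * of_real (sqrt (\<Delta> x) / sqrt (E x) * Im u))"
  have rE: "smooth (\<lambda>x. sqrt (E x))" by (rule smooth_sqrt[OF sE E])
  have \<tau>_smooth: "smooth (\<lambda>x. \<tau> x u)" for u
  proof -
    have nz: "sqrt (E x) \<noteq> 0" for x using E[of x] by simp
    have 1: "smooth (\<lambda>x. (Re u * E x + Im u * F x) / sqrt (E x))"
      by (rule smooth_divide[OF smooth_add[OF smooth_mult[OF smooth_const sE] smooth_mult[OF smooth_const sF]] rE nz])
    have 2: "smooth (\<lambda>x. sqrt (\<Delta> x) / sqrt (E x) * Im u)"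
      by (rule smooth_mult[OF smooth_divide[OF smooth_sqrt[OF s\<Delta> \<Delta>] rE nz] smooth_const])
    show ?thesis unfolding \<tau>_def
      by (rule smooth_add[OF smooth_of_real[OF 1] smooth_mult[OF smooth_const smooth_of_real[OF 2]]])
  qed
  have \<tau>_linear: "linear (\<tau> x)" for x
    by (intro linearI) (simp_all add: \<tau>_def complex_eq_iff add_divide_distrib algebra_simps)
  have rr: "sqrt (E x) * sqrt (E x) = E x" "sqrt (\<Delta> x) * sqrt (\<Delta> x) = \<Delta> x" for x
    using E[of x] \<Delta>[of x] by simp_all
  have \<tau>_det: "det2 (\<tau> x) = sqrt (\<Delta> x)" for x
  proof -
    have "det2 (\<tau> x) = E x * sqrt (\<Delta> x) / (sqrt (E x) * sqrt (E x))" by (simp add: det2_def \<tau>_def)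
    then show ?thesis using E[of x] by (simp add: rr)
  qed
  have nz: "det2 (\<tau> x) \<noteq> 0" for x using \<tau>_det \<Delta>[of x] by simp
  have h\<tau>: "h x u v = \<tau> x u \<bullet> \<tau> x v" for x u v
  proof -
    define r where "r = sqrt (E x)"
    have r: "r * r = E x" "r \<noteq> 0" using rr[of x] E[of x] by (auto simp: r_def)
    have re: "\<tau> x u \<bullet> \<tau> x v = (Re u * E x + Im u * F x) / r * ((Re v * E x + Im v * F x) / r) + (sqrt (\<Delta> x) / r * Im u) * (sqrt (\<Delta> x) / r * Im v)"
      by (simp add: inner_complex_def \<tau>_def r_def)
    also have "\<dots> = ((Re u * E x + Im u * F x) * (Re v * E x + Im v * F x) + sqrt (\<Delta> x) * sqrt (\<Delta> x) * Im u * Im v) / (r * r)"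
      using r(2) by (simp add: field_simps)
    also have "\<dots> = h x u v"
      unfolding rr r dec[of x u v] using E[of x] by (simp add: \<Delta>_def E_def F_def field_simps)
    finally show ?thesis by simp
  qed
  define T where "T x = D (\<lambda>y. \<tau> y \<i>) x 1 - D (\<lambda>y. \<tau> y 1) x \<i>" for x
  have sT: "smooth T" unfolding T_def[abs_def] by (rule smooth_diff[OF smooth_D[OF \<tau>_smooth] smooth_D[OF \<tau>_smooth]])
  define \<omega> where "\<omega> = (\<lambda>x u. Im (cnj (\<tau> x u) * (- \<i> * T x)) / det2 (\<tau> x))"
  have \<omega>_linear: "linear (\<omega> x)" for x
    by (intro linearI) (simp_all add: \<omega>_def linear_add[OF \<tau>_linear] linear_scale[OF \<tau>_linear] algebra_simps add_divide_distrib diff_divide_distrib)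
  have s_det: "smooth (\<lambda>x. det2 (\<tau> x))"
    unfolding det2_def by (rule smooth_Im[OF smooth_mult[OF smooth_cnj[OF \<tau>_smooth] \<tau>_smooth]])
  have \<omega>_smooth: "smooth (\<lambda>x. \<omega> x u)" for u
    unfolding \<omega>_def by (rule smooth_divide[OF smooth_Im[OF smooth_mult[OF smooth_cnj[OF \<tau>_smooth] smooth_mult[OF smooth_const sT]]] s_det nz])
  have tor1: "T x = \<i> * (\<omega> x 1 * \<tau> x \<i> - \<omega> x \<i> * \<tau> x 1)" for x
  proof -
    let ?R = "- \<i> * T x"
    have "\<tau> x (linv (\<tau> x) ?R) = ?R" by (rule linv_right[OF \<tau>_linear nz])
    moreover have "\<tau> x (linv (\<tau> x) ?R) = - \<omega> x \<i> *\<^sub>R \<tau> x 1 + \<omega> x 1 *\<^sub>R \<tau> x \<i>"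
    proof -
      have "linv (\<tau> x) ?R = Complex (- \<omega> x \<i>) (\<omega> x 1)"
        using nz[of x] by (simp add: linv_def \<omega>_def complex_eq_iff field_simps)
      then show ?thesis using linear_complex_decomp[OF \<tau>_linear, of x "linv (\<tau> x) ?R"] by simp
    qed
    ultimately have "?R = - \<omega> x \<i> *\<^sub>R \<tau> x 1 + \<omega> x 1 *\<^sub>R \<tau> x \<i>" by simp
    then have "\<i> * ?R = \<i> * (- \<omega> x \<i> *\<^sub>R \<tau> x 1 + \<omega> x 1 *\<^sub>R \<tau> x \<i>)" by simp
    then show ?thesis by (simp add: scaleR_conv_of_real algebra_simps)
  qed
  have "coframe \<tau> \<omega>"
  proof (rule coframe.intro)
    show "linear (\<tau> x)" "smooth (\<lambda>x. \<tau> x u)" "0 < det2 (\<tau> x)" "linear (\<omega> x)" "smooth (\<lambda>x. \<omega> x u)" for x u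
      using \<tau>_linear \<tau>_smooth \<tau>_det \<Delta> \<omega>_linear \<omega>_smooth by simp_all
    fix v x u
    let ?B = "\<lambda>u v. D (\<lambda>y. \<tau> y v) x u - D (\<lambda>y. \<tau> y u) x v"
    let ?C = "\<lambda>u v. \<i> * (\<omega> x u * \<tau> x v - \<omega> x v * \<tau> x u)"
    have B: "?B u v = Im (cnj u * v) *\<^sub>R ?B 1 \<i>"
    proof (rule alternating_eq[of ?B])
      show "linear (\<lambda>u. ?B u v)" for v
        by (rule linear_compose_sub[OF smooth_linear_D[OF \<tau>_smooth] linear_D_form[OF \<tau>_linear \<tau>_smooth]])
    qed simp
    have C: "?C u v = Im (cnj u * v) *\<^sub>R ?C 1 \<i>"
    proof (rule alternating_eq[of ?C])
      show "linear (\<lambda>u. ?C u v)" for v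
        by (intro linearI; simp only: linear_add[OF \<tau>_linear] linear_scale[OF \<tau>_linear] linear_add[OF \<omega>_linear] linear_scale[OF \<omega>_linear])
          (simp_all add: scaleR_conv_of_real algebra_simps)
    qed (simp add: algebra_simps)
    show "?B u v = ?C u v" unfolding B C using tor1[of x] by (simp add: T_def)
  qed
  moreover have "h = (\<lambda>x u v. \<tau> x u \<bullet> \<tau> x v)" using h\<tau> by (intro ext)
  ultimately show ?thesis by (rule that)
qed

text \<open>In the coframe the connection is the scalar form -i \<omega>, so the second derivatives
  of \<tau> and the quadratic terms cancel in the curvature, leaving d\<omega> over the
  area.\<close>

lemma (in coframe) gauss_curvature_eq:
  "gauss_curvature (\<lambda>x u v. \<tau> x u \<bullet> \<tau> x v) x = (D (\<lambda>y. \<omega> y \<i>) x 1 - D (\<lambda>y. \<omega> y 1) x \<i>) / det2 (\<tau> x)"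
proof -
  let ?h = "\<lambda>x u v. \<tau> x u \<bullet> \<tau> x v"
  define W where "W = D (\<lambda>y. \<omega> y \<i>) x 1 - D (\<lambda>y. \<omega> y 1) x \<i>"
  have V: "nabla ?h (\<lambda>_. v) (\<lambda>_. w) = (\<lambda>y. linv (\<tau> y) (lc y v w))" for v w
  proof
    fix y
    have "D (\<lambda>_. w) y v = 0" using D_eq[OF has_derivative_const, of w y] by simp
    then show "nabla ?h (\<lambda>_. v) (\<lambda>_. w) y = linv (\<tau> y) (lc y v w)"
      by (simp add: nabla_def christoffel_eq)
  qed
  have sV: "smooth (\<lambda>y. linv (\<tau> y) (lc y v w))" for v w
  proof -
    have "smooth (\<lambda>x. lc x v w)" by (rule smooth_lc)
    then show ?thesis by (rule smooth_linv[OF \<tau>_smooth \<tau>_nz])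
  qed
  have D_lc: "D (\<lambda>y. lc y v w) x u = D (\<lambda>y. D (\<lambda>z. \<tau> z w) y v) x u
      - \<i> * (D (\<lambda>y. \<omega> y v) x u * \<tau> x w + \<omega> x v * D (\<lambda>y. \<tau> y w) x u)" for u v w
  proof -
    have "((\<lambda>y. D (\<lambda>z. \<tau> z w) y v - \<i> * of_real (\<omega> y v) * \<tau> y w) has_derivative
       (\<lambda>u. D (\<lambda>y. D (\<lambda>z. \<tau> z w) y v) x u - (\<i> * of_real (\<omega> x v) * D (\<lambda>y. \<tau> y w) x u + (\<i> * of_real (D (\<lambda>y. \<omega> y v) x u)) * \<tau> x w))) (at x)"
      by (rule has_derivative_diff[OF smooth_has_derivative[OF smooth_D[OF \<tau>_smooth]]
           has_derivative_mult[OF has_derivative_mult_right[OF has_derivative_of_real[OF smooth_has_derivative[OF \<omega>_smooth]]] smooth_has_derivative[OF \<tau>_smooth]]])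
    from D_eq[OF this] show ?thesis unfolding lc_def by (simp add: algebra_simps)
  qed
  have N: "\<tau> x (nabla ?h (\<lambda>_. u) (nabla ?h (\<lambda>_. v) (\<lambda>_. w)) x) = D (\<lambda>y. lc y v w) x u - \<i> * \<omega> x u * lc x v w" for u v w
    unfolding V using \<tau>_nabla[OF differentiableI[OF smooth_has_derivative[OF sV[of v w]]], of x "\<lambda>_. u"] by (simp add: \<tau>_linv)
  have R: "\<tau> x (riemann_curvature ?h x 1 \<i> \<i>) = - \<i> * of_real W * \<tau> x \<i>"
    unfolding riemann_curvature_def linear_diff[OF \<tau>_linear] N D_lc
    using symmetric_second_derivative[OF \<tau>_smooth[of \<i>], of 1 x \<i>]
    by (simp add: lc_def W_def algebra_simps)
  have A: "det2 (\<tau> x) = Re (\<tau> x 1) * Im (\<tau> x \<i>) - Im (\<tau> x 1) * Re (\<tau> x \<i>)" by (simp add: det2_def)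
  have "\<tau> x (riemann_curvature ?h x 1 \<i> \<i>) \<bullet> \<tau> x 1 = W * det2 (\<tau> x)"
    unfolding R A by (simp add: inner_complex_def algebra_simps)
  moreover have "(\<tau> x 1 \<bullet> \<tau> x 1) * (\<tau> x \<i> \<bullet> \<tau> x \<i>) - (\<tau> x 1 \<bullet> \<tau> x \<i>)\<^sup>2 = det2 (\<tau> x) * det2 (\<tau> x)"
    unfolding A by (simp add: inner_complex_def power2_eq_square algebra_simps)
  ultimately show ?thesis
    unfolding gauss_curvature_def W_def using \<tau>_nz[of x] by simp
qed

lemma Im_cnj_linear:
  assumes "linear T"
  shows "Im (cnj (T u) * T v) = Im (cnj u * v) * det2 T"
proof -
  have "Im (cnj (T u) * T v) = Im (cnj (Re u *\<^sub>R T 1 + Im u *\<^sub>R T \<i>) * (Re v *\<^sub>R T 1 + Im v *\<^sub>R T \<i>))"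
    by (simp only: linear_complex_decomp[OF assms, symmetric])
  then show ?thesis by (simp add: det2_def algebra_simps)
qed

lemma (in coframe) curvature_form:
  assumes "gauss_curvature (\<lambda>x u v. \<tau> x u \<bullet> \<tau> x v) x = -1"
  shows "D (\<lambda>y. \<omega> y v) x u - D (\<lambda>y. \<omega> y u) x v = - Im (cnj (\<tau> x u) * \<tau> x v)"
proof -
  let ?B = "\<lambda>u v. D (\<lambda>y. \<omega> y v) x u - D (\<lambda>y. \<omega> y u) x v"
  have B: "?B u v = Im (cnj u * v) *\<^sub>R ?B 1 \<i>"
  proof (rule alternating_eq[of ?B])
    show "linear (\<lambda>u. ?B u v)" for v
      by (rule linear_compose_sub[OF smooth_linear_D[OF \<omega>_smooth] linear_D_form[OF \<omega>_linear \<omega>_smooth]])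
  qed simp
  have "?B 1 \<i> = - det2 (\<tau> x)" using assms \<tau>_nz[of x] unfolding gauss_curvature_eq by (simp add: field_simps)
  then show ?thesis unfolding B Im_cnj_linear[OF \<tau>_linear] by simp
qed

lemma coframe_pullback:
  assumes "coframe \<tau> \<omega>" and \<phi>: "smooth \<phi>" "\<And>x. 0 < det2 (D \<phi> x)"
    and curv: "\<And>x u v. D (\<lambda>y. \<omega> y v) x u - D (\<lambda>y. \<omega> y u) x v = - Im (cnj (\<tau> x u) * \<tau> x v)"
  defines "\<tau>' \<equiv> \<lambda>x u. \<tau> (\<phi> x) (D \<phi> x u)" and "\<omega>' \<equiv> \<lambda>x u. \<omega> (\<phi> x) (D \<phi> x u)"
  shows "coframe \<tau>' \<omega>'" "D (\<lambda>y. \<omega>' y v) x u - D (\<lambda>y. \<omega>' y u) x v = - Im (cnj (\<tau>' x u) * \<tau>' x v)"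
proof -
  interpret coframe \<tau> \<omega> by fact
  note l = smooth_linear_D[OF \<phi>(1)]
  show "coframe \<tau>' \<omega>'"
  proof (rule coframe.intro)
    show "linear (\<tau>' x)" "linear (\<omega>' x)" for x
      using linear_compose[OF l \<tau>_linear] linear_compose[OF l \<omega>_linear] by (simp_all add: \<tau>'_def \<omega>'_def o_def)
    show "smooth (\<lambda>x. \<tau>' x u)" "smooth (\<lambda>x. \<omega>' x u)" for u
      unfolding \<tau>'_def \<omega>'_def using pullback_form(1)[OF \<tau>_linear \<tau>_smooth \<phi>(1)] pullback_form(1)[OF \<omega>_linear \<omega>_smooth \<phi>(1)] by blast+
    show "0 < det2 (\<tau>' x)" for x
      unfolding \<tau>'_def det2_compose[OF \<tau>_linear l] using \<tau>_pos \<phi>(2) by simp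
    show "D (\<lambda>y. \<tau>' y v) x u - D (\<lambda>y. \<tau>' y u) x v = \<i> * (\<omega>' x u * \<tau>' x v - \<omega>' x v * \<tau>' x u)" for v x u
      unfolding \<tau>'_def \<omega>'_def pullback_form(2)[OF \<tau>_linear \<tau>_smooth \<phi>(1)] by (rule torsion)
  qed
  show "D (\<lambda>y. \<omega>' y v) x u - D (\<lambda>y. \<omega>' y u) x v = - Im (cnj (\<tau>' x u) * \<tau>' x v)"
    unfolding \<tau>'_def \<omega>'_def pullback_form(2)[OF \<omega>_linear \<omega>_smooth \<phi>(1)] by (rule curv)
qed

text \<open>A representative h is only known as the pullback of a hyperbolic metric by an isotopy
  map, so the structure equations are pulled back with the coframe. Invariance under deck maps holds
  because the isotopy map commutes with them.\<close>

lemma teich_coframe: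
  assumes A: "oriented_smooth_atlas A" "universal_cover A p" and X: "X \<in> Teich p" "h \<in> X"
  obtains \<tau> \<omega> where "coframe \<tau> \<omega>" "h = (\<lambda>x u v. \<tau> x u \<bullet> \<tau> x v)"
    "\<And>x u v. D (\<lambda>y. \<omega> y v) x u - D (\<lambda>y. \<omega> y u) x v = - Im (cnj (\<tau> x u) * \<tau> x v)"
    "\<And>\<gamma> x u v. \<gamma> \<in> deck p \<Longrightarrow> h (\<gamma> x) (D \<gamma> x u) (D \<gamma> x v) = h x u v"
proof -
  obtain h0 \<phi> where h0: "hyperbolic_metric p h0" and \<phi>: "isotopic_to_id p \<phi>" and h: "h = pullback_metric \<phi> h0"
    using X by (auto simp: Teich_def teich_class_def)
  have rm: "riemannian_metric p h0" and K: "gauss_curvature h0 x = -1" for x using h0 by (auto simp: hyperbolic_metric_def)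
  obtain \<tau> \<omega> where c: "coframe \<tau> \<omega>" and h0\<tau>: "h0 = (\<lambda>x u v. \<tau> x u \<bullet> \<tau> x v)" by (rule coframe_exists[OF rm])
  note i = isotopic_to_id_props[OF \<phi>]
  note pb = coframe_pullback[OF c i(1,2) coframe.curvature_form[OF c K[unfolded h0\<tau>]]]
  show ?thesis
  proof (rule that[OF pb(1) _ pb(2)])
    show "h = (\<lambda>x u v. \<tau> (\<phi> x) (D \<phi> x u) \<bullet> \<tau> (\<phi> x) (D \<phi> x v))" by (simp add: h pullback_metric_def h0\<tau>)
    fix \<gamma> x u v assume \<gamma>: "\<gamma> \<in> deck p"
    have s: "smooth \<gamma>" by (rule deck_smooth[OF A \<gamma>])
    have "(\<lambda>x. \<phi> (\<gamma> x)) = (\<lambda>x. \<gamma> (\<phi> x))" using i(3)[OF \<gamma>] by auto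
    then have "D \<phi> (\<gamma> x) (D \<gamma> x u) = D \<gamma> (\<phi> x) (D \<phi> x u)" for u
      using smooth_D_compose[OF i(1) s, of x u] smooth_D_compose[OF s i(1), of x u] by simp
    moreover have "h0 (\<gamma> y) (D \<gamma> y u) (D \<gamma> y v) = h0 y u v" for y u v
      using rm \<gamma> by (simp add: riemannian_metric_def)
    ultimately show "h (\<gamma> x) (D \<gamma> x u) (D \<gamma> x v) = h x u v"
      by (simp add: h pullback_metric_def i(3)[OF \<gamma>])
  qed
qed

text \<open>Two positive orthonormal coframes of one inner product differ by a rotation; in complex
  notation that is a unit factor.\<close>

lemma rotation_exists:
  assumes T: "linear T" "0 < det2 T" and A: "linear A" "0 < det2 A" and eq: "\<And>u v. A u \<bullet> A v = T u \<bullet> T v"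
  obtains k where "cmod k = 1" "\<And>u. A u = k * T u"
proof -
  have nz: "det2 T \<noteq> 0" using T by simp
  define a c where "a = A (linv T 1)" "c = A (linv T \<i>)"
  have ac: "a \<bullet> a = 1" "c \<bullet> c = 1" "a \<bullet> c = 0"
    unfolding a_c_def eq linv_right[OF T(1) nz] by (simp_all add: inner_complex_def)
  have "det2 (\<lambda>z. T (linv T z)) = 1" by (simp add: linv_right[OF T(1) nz] det2_def)
  then have "det2 T * det2 (linv T) = 1" by (simp add: det2_compose[OF T(1) linear_linv])
  then have "0 < det2 (linv T)" using T(2) by (metis zero_less_mult_pos zero_less_one)
  then have "0 < det2 (\<lambda>z. A (linv T z))" using A(2) by (simp add: det2_compose[OF A(1) linear_linv])
  then have pos: "0 < Re a * Im c - Im a * Re c" by (simp add: det2_def a_c_def)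
  have "(Re a * Im c - Im a * Re c)\<^sup>2 = (a \<bullet> a) * (c \<bullet> c) - (a \<bullet> c)\<^sup>2"
    by (simp add: inner_complex_def power2_eq_square algebra_simps)
  then have "Re a * Im c - Im a * Re c = 1" using pos ac by (simp add: power2_eq_1_iff)
  then have "cnj a * c = \<i>" using ac(3) by (simp add: complex_eq_iff inner_complex_def)
  moreover have "a * cnj a = 1" using ac(1) by (simp add: complex_eq_iff inner_complex_def)
  ultimately have c: "c = \<i> * a" by (metis mult.assoc mult.commute mult_1)
  show ?thesis
  proof (rule that[of a])
    show "cmod a = 1" using ac(1) by (simp add: norm_eq_1)
    fix u
    have "A u = A (Re (T u) *\<^sub>R linv T 1 + Im (T u) *\<^sub>R linv T \<i>)" by (rule arg_cong[OF linv_rotate[OF T(1) nz]])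
    also have "\<dots> = Re (T u) *\<^sub>R a + Im (T u) *\<^sub>R c" by (simp add: a_c_def linear_add[OF A(1)] linear_scale[OF A(1)])
    also have "\<dots> = a * T u" by (simp add: c complex_eq_iff algebra_simps)
    finally show "A u = a * T u" .
  qed
qed

section \<open>The Labourie operator and landslides in a moving frame\<close>

lemma cayley_hamilton_complex:
  assumes "linear L"
  shows "L (L u) = (Re (L 1) + Im (L \<i>)) *\<^sub>R L u - det2 L *\<^sub>R u"
proof -
  note d = linear_complex_decomp[OF assms]
  have "L (L u) = Re (L u) *\<^sub>R L 1 + Im (L u) *\<^sub>R L \<i>" by (rule d)
  then show ?thesis unfolding d[of u] by (simp add: complex_eq_iff det2_def algebra_simps)
qed

lemma is_labourieD:
  assumes "is_labourie p h hs b"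
  shows "linear (b x)" "smooth (\<lambda>x. b x u)" "\<gamma> \<in> deck p \<Longrightarrow> b (\<gamma> x) (D \<gamma> x u) = D \<gamma> x (b x u)"
    "h x (b x u) v = h x u (b x v)" "det2 (b x) = 1" "hs x u v = h x (b x u) (b x v)" "u \<noteq> 0 \<Longrightarrow> h x (b x u) u < 0"
    "smooth U \<Longrightarrow> smooth V \<Longrightarrow>
       nabla h U (\<lambda>y. b y (V y)) x - nabla h V (\<lambda>y. b y (U y)) x - b x (lie_bracket U V x) = 0"
  using assms unfolding is_labourie_def by blast+

text \<open>Self-adjointness makes b^2 the endomorphism representing hs by h, so b and b' have equal
  squares. Cayley-Hamilton with det = 1 gives tr(b) b = tr(b') b'; comparing determinants and using
  that both traces are negative yields equality.\<close>

lemma (in coframe) is_labourie_unique: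
  assumes "is_labourie p (\<lambda>x u v. \<tau> x u \<bullet> \<tau> x v) hs b" "is_labourie p (\<lambda>x u v. \<tau> x u \<bullet> \<tau> x v) hs b'"
  shows "b = b'"
proof (intro ext)
  fix x u
  have lin: "linear (b x)" "linear (b' x)" and det: "det2 (b x) = 1" "det2 (b' x) = 1"
    and neg: "\<And>u. u \<noteq> 0 \<Longrightarrow> \<tau> x (b x u) \<bullet> \<tau> x u < 0" "\<And>u. u \<noteq> 0 \<Longrightarrow> \<tau> x (b' x u) \<bullet> \<tau> x u < 0"
    and adj: "\<And>u v. \<tau> x (b x u) \<bullet> \<tau> x v = \<tau> x u \<bullet> \<tau> x (b x v)" "\<And>u v. \<tau> x (b' x u) \<bullet> \<tau> x v = \<tau> x u \<bullet> \<tau> x (b' x v)"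
    and hs: "\<And>u v. hs x u v = \<tau> x (b x u) \<bullet> \<tau> x (b x v)" "\<And>u v. hs x u v = \<tau> x (b' x u) \<bullet> \<tau> x (b' x v)"
    using is_labourieD(1,5)[OF assms(1), of x] is_labourieD(1,5)[OF assms(2), of x]
      is_labourieD(4,6,7)[OF assms(1), of _ x] is_labourieD(4,6,7)[OF assms(2), of _ x]
      is_labourieD(4,6,7)[OF assms(1), of x] is_labourieD(4,6,7)[OF assms(2), of x] by blast+
  have sq: "b x (b x u) = b' x (b' x u)" for u
    by (rule \<tau>_inner_eqI[of x]) (metis adj hs)
  let ?t = "\<lambda>b. Re (b x 1) + Im (b x \<i>)"
  have t: "?t c < 0" if "linear (c x)" "det2 (c x) = 1" "\<And>u. u \<noteq> 0 \<Longrightarrow> \<tau> x (c x u) \<bullet> \<tau> x u < 0"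
    "\<And>u v. \<tau> x (c x u) \<bullet> \<tau> x v = \<tau> x u \<bullet> \<tau> x (c x v)" for c :: endo
  proof -
    \<comment> \<open>Pairing Cayley-Hamilton with the vector 1 gives |c 1|^2 + |1|^2 = tr(c) <c 1,
      1>. The left side is positive and <c 1, 1> negative, hence so is the trace.\<close>
    have "\<tau> x (c x (c x 1)) = ?t c *\<^sub>R \<tau> x (c x 1) - \<tau> x 1"
      using cayley_hamilton_complex[OF that(1), of 1] by (simp only: that(2) linear_diff[OF \<tau>_linear] linear_scale[OF \<tau>_linear] scaleR_one)
    then have "\<tau> x (c x (c x 1)) \<bullet> \<tau> x 1 = ?t c * (\<tau> x (c x 1) \<bullet> \<tau> x 1) - \<tau> x 1 \<bullet> \<tau> x 1"
      by (simp only: inner_diff_left inner_scaleR_left)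
    moreover have "\<tau> x (c x (c x 1)) \<bullet> \<tau> x 1 = \<tau> x (c x 1) \<bullet> \<tau> x (c x 1)" by (rule that(4))
    moreover have "\<tau> x 1 \<bullet> \<tau> x 1 > 0" by simp
    ultimately have "0 < ?t c * (\<tau> x (c x 1) \<bullet> \<tau> x 1)" using inner_ge_zero[of "\<tau> x (c x 1)"] by linarith
    moreover have "\<tau> x (c x 1) \<bullet> \<tau> x 1 < 0" using that(3)[of 1] by simp
    ultimately show ?thesis by (simp add: zero_less_mult_iff not_less[symmetric])
  qed
  have tb: "?t b < 0" "?t b' < 0" using t[of b] t[of b'] lin det neg adj by blast+
  have e: "?t b *\<^sub>R b x u = ?t b' *\<^sub>R b' x u" for u
    using sq[of u] unfolding cayley_hamilton_complex[OF lin(1)] cayley_hamilton_complex[OF lin(2)] det by simp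
  have "det2 (\<lambda>u. ?t b *\<^sub>R b x u) = det2 (\<lambda>u. ?t b' *\<^sub>R b' x u)" unfolding e ..
  moreover have "det2 (\<lambda>u. r *\<^sub>R L u) = r * r * det2 L" for r L by (simp add: det2_def algebra_simps)
  ultimately have "?t b * ?t b = ?t b' * ?t b'" by (simp only: det)
  then have "?t b = ?t b'" using tb by (simp only: square_eq_iff) linarith
  then show "b x u = b' x u" using e[of u] tb by simp
qed

text \<open>In the coframe an admissible j sends w to a vector v of the same length, orthogonal to
  it and on its positive side, which forces v = i w.\<close>

lemma (in coframe) complex_str_eq: "complex_str (\<lambda>x u v. \<tau> x u \<bullet> \<tau> x v) x = (\<lambda>u. linv (\<tau> x) (\<i> * \<tau> x u))"
  unfolding complex_str_def
proof (rule the_equality)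
  let ?J = "\<lambda>u. linv (\<tau> x) (\<i> * \<tau> x u)"
  note im = Im_cnj_linear[OF \<tau>_linear, of x]
  have sq: "Im (cnj w * (\<i> * w)) = (cmod w)\<^sup>2" for w unfolding cmod_power2 by (simp add: power2_eq_square)
  show "linear ?J \<and> (\<forall>u. ?J (?J u) = - u) \<and> (\<forall>u v. \<tau> x (?J u) \<bullet> \<tau> x (?J v) = \<tau> x u \<bullet> \<tau> x v) \<and>
    (\<forall>u. u \<noteq> 0 \<longrightarrow> 0 < Im (cnj u * ?J u))"
  proof (intro conjI allI impI)
    have "linear (\<lambda>u. \<i> * \<tau> x u)"
      by (intro linearI) (simp_all add: linear_add[OF \<tau>_linear] linear_scale[OF \<tau>_linear] algebra_simps)
    from linear_compose[OF this linear_linv[of "\<tau> x"]] show "linear ?J" by (simp add: o_def)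
    show "?J (?J u) = - u" for u by (rule \<tau>_eqI[of x]) (simp add: \<tau>_linv linear_neg[OF \<tau>_linear])
    show "\<tau> x (?J u) \<bullet> \<tau> x (?J v) = \<tau> x u \<bullet> \<tau> x v" for u v by (simp add: \<tau>_linv inner_complex_def)
    fix u :: complex assume "u \<noteq> 0"
    then have "0 < Im (cnj (\<tau> x u) * \<tau> x (?J u))" unfolding \<tau>_linv sq by simp
    then show "0 < Im (cnj u * ?J u)" unfolding im using \<tau>_pos[of x] by (simp only: zero_less_mult_pos2)
  qed
  fix j
  assume j: "linear j \<and> (\<forall>u. j (j u) = - u) \<and> (\<forall>u v. \<tau> x (j u) \<bullet> \<tau> x (j v) = \<tau> x u \<bullet> \<tau> x v) \<and>
    (\<forall>u. u \<noteq> 0 \<longrightarrow> 0 < Im (cnj u * j u))"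
  show "j = ?J"
  proof
    fix u
    show "j u = ?J u"
    proof (cases "u = 0")
      case True
      then show ?thesis using linear_0[of j] j by (simp add: linear_0[OF \<tau>_linear] linear_0[OF linear_linv])
    next
      case False
      define w v where "w = \<tau> x u" "v = \<tau> x (j u)"
      have "v \<bullet> \<tau> x (j (j u)) = w \<bullet> v" using j unfolding w_v_def by blast
      then have "w \<bullet> v = 0" using j by (simp add: linear_neg[OF \<tau>_linear] w_v_def inner_commute)
      then have re: "Re (cnj w * v) = 0" by (simp add: inner_complex_def)
      have "v \<bullet> v = w \<bullet> w" using j unfolding w_v_def by blast
      then have "cmod v = cmod w" by (simp add: norm_eq_sqrt_inner)
      then have n: "cmod (cnj w * v) = (cmod w)\<^sup>2" by (simp add: norm_mult power2_eq_square)
      have "0 < Im (cnj w * v)" unfolding w_v_def im using j False \<tau>_pos[of x] by simp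
      then have "cnj w * v = cnj w * (\<i> * w)"
        using re n cmod_eq_Im[OF re] sq[of w] by (simp only: complex_eq_iff) simp
      then have "v = \<i> * w" using False by (simp add: w_v_def(1))
      show ?thesis by (rule \<tau>_eqI[of x]) (use \<open>v = \<i> * w\<close> in \<open>simp add: \<tau>_linv w_v_def\<close>)
    qed
  qed
qed

text \<open>\<kappa> measures how a deck map rotates the coframe. The same factor serves \<sigma>,
  since the Labourie operator commutes with the derivatives of deck maps; this lets one matrix
  correct the whole moving frame.\<close>

locale deck_frame = codazzi_frame +
  fixes p :: "complex \<Rightarrow> 'm" and \<kappa> :: "(complex \<Rightarrow> complex) \<Rightarrow> complex \<Rightarrow> complex"
  assumes smooth_deck: "\<gamma> \<in> deck p \<Longrightarrow> smooth \<gamma>" and cmod_\<kappa>: "\<gamma> \<in> deck p \<Longrightarrow> cmod (\<kappa> \<gamma> x) = 1"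
    and \<tau>_deck: "\<gamma> \<in> deck p \<Longrightarrow> \<tau> (\<gamma> x) (D \<gamma> x u) = \<kappa> \<gamma> x * \<tau> x u"
    and \<sigma>_deck: "\<gamma> \<in> deck p \<Longrightarrow> \<sigma> (\<gamma> x) (D \<gamma> x u) = \<kappa> \<gamma> x * \<sigma> x u"
begin

lemma is_labourie_lab: "is_labourie p (\<lambda>x u v. \<tau> x u \<bullet> \<tau> x v) (\<lambda>x u v. \<sigma> x u \<bullet> \<sigma> x v) lab"
  unfolding is_labourie_def
proof (intro conjI allI ballI impI)
  show "linear (lab x)" "smooth (\<lambda>x. lab x u)" for x u by (rule linear_lab, rule smooth_lab)
  show "lab (\<gamma> x) (D \<gamma> x u) = D \<gamma> x (lab x u)" if "\<gamma> \<in> deck p" for \<gamma> x u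
    by (rule \<tau>_eqI[of "\<gamma> x"]) (simp add: \<tau>_lab \<tau>_deck \<sigma>_deck that)
  show "\<tau> x (lab x u) \<bullet> \<tau> x v = \<tau> x u \<bullet> \<tau> x (lab x v)" for x u v
    using \<sigma>_sym[of x u v] by (simp add: \<tau>_lab inner_complex_def)
  show "\<sigma> x u \<bullet> \<sigma> x v = \<tau> x (lab x u) \<bullet> \<tau> x (lab x v)" for x u v
    by (simp add: \<tau>_lab inner_complex_def)
  show "\<tau> x (lab x u) \<bullet> \<tau> x u < 0" if "u \<noteq> 0" for x u
    using \<sigma>_pos[OF that, of x] by (simp add: \<tau>_lab inner_complex_def)
  show "det2 (lab x) = 1" for x
  proof -
    have "det2 (\<tau> x) * det2 (lab x) = det2 (\<lambda>u. - \<i> * \<sigma> x u)"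
      using det2_compose[OF \<tau>_linear linear_lab, of x x] by (simp add: \<tau>_lab)
    also have "\<dots> = det2 (\<tau> x)" using \<sigma>_det[of x 1 \<i>] by (simp add: det2_def)
    finally show ?thesis using \<tau>_nz by simp
  qed
  fix U V :: "complex \<Rightarrow> complex" and x assume "smooth U \<and> smooth V"
  then have UV: "smooth U" "smooth V" by auto
  note sm = smooth_form_field[OF linear_lab smooth_lab]
  have n: "\<tau> x (nabla (\<lambda>x u v. \<tau> x u \<bullet> \<tau> x v) U (\<lambda>y. lab y (V y)) x)
      = - \<i> * (D (\<lambda>y. \<sigma> y (V x)) x (U x) + \<sigma> x (D V x (U x))) - \<i> * \<omega> x (U x) * (- \<i> * \<sigma> x (V x))"
    if "smooth U" "smooth V" for U V
  proof -
    have "(\<lambda>y. \<sigma> y (V y)) differentiable at x"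
      by (rule differentiableI[OF smooth_has_derivative[OF smooth_form_field[OF \<sigma>_linear \<sigma>_smooth that(2)]]])
    then have "D (\<lambda>y. - \<i> * \<sigma> y (V y)) x (U x) = - \<i> * D (\<lambda>y. \<sigma> y (V y)) x (U x)"
      using D_eq[OF has_derivative_mult_right[of "\<lambda>y. \<sigma> y (V y)" "D (\<lambda>y. \<sigma> y (V y)) x" "at x" "- \<i>"]]
      by (simp add: frechet_derivative_works)
    then show ?thesis
      unfolding \<tau>_nabla[OF differentiableI[OF smooth_has_derivative[OF sm[OF that(2)]]]] \<tau>_lab
      by (simp only: D_form_field[OF \<sigma>_linear \<sigma>_smooth differentiableI[OF smooth_has_derivative[OF that(2)]]])
  qed
  have "\<tau> x (nabla (\<lambda>x u v. \<tau> x u \<bullet> \<tau> x v) U (\<lambda>y. lab y (V y)) x - nabla (\<lambda>x u v. \<tau> x u \<bullet> \<tau> x v) V (\<lambda>y. lab y (U y)) x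
      - lab x (lie_bracket U V x)) = \<tau> x 0"
  proof -
    have c: "D (\<lambda>y. \<sigma> y (V x)) x (U x) = D (\<lambda>y. \<sigma> y (U x)) x (V x) + \<i> * (\<omega> x (U x) * \<sigma> x (V x) - \<omega> x (V x) * \<sigma> x (U x))"
      using codazzi[of "V x" x "U x"] by (simp add: algebra_simps)
    show ?thesis
      unfolding linear_diff[OF \<tau>_linear] n[OF UV] n[OF UV(2,1)] \<tau>_lab lie_bracket_def linear_diff[OF \<sigma>_linear] c
      by (simp add: linear_0[OF \<tau>_linear] algebra_simps)
  qed
  then show "nabla (\<lambda>x u v. \<tau> x u \<bullet> \<tau> x v) U (\<lambda>y. lab y (V y)) x - nabla (\<lambda>x u v. \<tau> x u \<bullet> \<tau> x v) V (\<lambda>y. lab y (U y)) x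
      - lab x (lie_bracket U V x) = 0"
    by (rule \<tau>_eqI)
qed

lemma labourie_eq: "labourie p (\<lambda>x u v. \<tau> x u \<bullet> \<tau> x v) (\<lambda>x u v. \<sigma> x u \<bullet> \<sigma> x v) = lab"
  unfolding labourie_def
  by (rule the_equality[where P = "is_labourie p _ _", OF is_labourie_lab]) (erule is_labourie_unique[OF _ is_labourie_lab])

text \<open>J becomes multiplication by i under \<tau>, so \<tau> J b = \<sigma>, which is the
  reason for the factor i in \<sigma>. The shift of \<theta> by pi gives the orthogonal
  combination.\<close>

lemma landslide_eq:
  "landslide p \<theta> (\<lambda>x u v. \<tau> x u \<bullet> \<tau> x v, \<lambda>x u v. \<sigma> x u \<bullet> \<sigma> x v) =
    (\<lambda>x u v. (cos (\<theta> / 2) *\<^sub>R \<tau> x u + sin (\<theta> / 2) *\<^sub>R \<sigma> x u) \<bullet> (cos (\<theta> / 2) *\<^sub>R \<tau> x v + sin (\<theta> / 2) *\<^sub>R \<sigma> x v),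
     \<lambda>x u v. (- sin (\<theta> / 2) *\<^sub>R \<tau> x u + cos (\<theta> / 2) *\<^sub>R \<sigma> x u) \<bullet> (- sin (\<theta> / 2) *\<^sub>R \<tau> x v + cos (\<theta> / 2) *\<^sub>R \<sigma> x v))"
proof -
  have b: "\<tau> x (beta (\<lambda>x u v. \<tau> x u \<bullet> \<tau> x v) lab \<theta> x u) = cos (\<theta> / 2) *\<^sub>R \<tau> x u + sin (\<theta> / 2) *\<^sub>R \<sigma> x u" for x u \<theta>
    unfolding beta_def complex_str_eq linear_add[OF \<tau>_linear] linear_scale[OF \<tau>_linear] by (simp add: \<tau>_linv \<tau>_lab)
  have h: "(\<theta> + pi) / 2 = \<theta> / 2 + pi / 2" by simp
  have "cos ((\<theta> + pi) / 2) = - sin (\<theta> / 2)" "sin ((\<theta> + pi) / 2) = cos (\<theta> / 2)"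
    unfolding h cos_add sin_add by simp_all
  then show ?thesis unfolding landslide_def Let_def prod.case labourie_eq b by simp
qed

end

text \<open>The structure equations are linear in (\<tau>, \<sigma>) with the same \<omega>. By the
  symmetry and determinant conditions the area form is preserved, hence so are the curvature
  equation and the positivity of the mixed term.\<close>

lemma (in codazzi_frame) rotate:
  fixes C S :: real
  assumes CS: "C * C + S * S = 1"
  defines "\<tau>' \<equiv> \<lambda>x u. C *\<^sub>R \<tau> x u + S *\<^sub>R \<sigma> x u" and "\<sigma>' \<equiv> \<lambda>x u. - S *\<^sub>R \<tau> x u + C *\<^sub>R \<sigma> x u"
  shows "codazzi_frame \<tau>' \<omega> \<sigma>'"
proof -
  have lin: "linear (\<lambda>u. a *\<^sub>R \<tau> x u + b *\<^sub>R \<sigma> x u)" for a b x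
    by (rule linear_compose_add[OF linear_compose_scale_right[OF \<tau>_linear] linear_compose_scale_right[OF \<sigma>_linear]])
  have sm: "smooth (\<lambda>x. a *\<^sub>R \<tau> x u + b *\<^sub>R \<sigma> x u)" for a b u
    by (rule smooth_add[OF smooth_scaleR[OF smooth_const \<tau>_smooth] smooth_scaleR[OF smooth_const \<sigma>_smooth]])
  have D: "D (\<lambda>y. a *\<^sub>R \<tau> y v + b *\<^sub>R \<sigma> y v) x u = a *\<^sub>R D (\<lambda>y. \<tau> y v) x u + b *\<^sub>R D (\<lambda>y. \<sigma> y v) x u" for a b x u v
  proof -
    have "((\<lambda>y. a *\<^sub>R \<tau> y v + b *\<^sub>R \<sigma> y v) has_derivative (\<lambda>u. a *\<^sub>R D (\<lambda>y. \<tau> y v) x u + b *\<^sub>R D (\<lambda>y. \<sigma> y v) x u)) (at x)"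
      by (rule has_derivative_add[OF has_derivative_scaleR_right[OF smooth_has_derivative[OF \<tau>_smooth]]
        has_derivative_scaleR_right[OF smooth_has_derivative[OF \<sigma>_smooth]]])
    from D_eq[OF this] show ?thesis by simp
  qed
  have tor: "D (\<lambda>y. a *\<^sub>R \<tau> y v + b *\<^sub>R \<sigma> y v) x u - D (\<lambda>y. a *\<^sub>R \<tau> y u + b *\<^sub>R \<sigma> y u) x v
      = \<i> * (\<omega> x u * (a *\<^sub>R \<tau> x v + b *\<^sub>R \<sigma> x v) - \<omega> x v * (a *\<^sub>R \<tau> x u + b *\<^sub>R \<sigma> x u))" for a b x u v
  proof -
    have "a *\<^sub>R (D (\<lambda>y. \<tau> y v) x u - D (\<lambda>y. \<tau> y u) x v) + b *\<^sub>R (D (\<lambda>y. \<sigma> y v) x u - D (\<lambda>y. \<sigma> y u) x v)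
       = \<i> * (\<omega> x u * (a *\<^sub>R \<tau> x v + b *\<^sub>R \<sigma> x v) - \<omega> x v * (a *\<^sub>R \<tau> x u + b *\<^sub>R \<sigma> x u))"
      unfolding torsion codazzi by (simp add: scaleR_conv_of_real algebra_simps)
    then show ?thesis unfolding D by (simp add: algebra_simps)
  qed
  have area: "Im (cnj (a *\<^sub>R \<tau> x u + b *\<^sub>R \<sigma> x u) * (c *\<^sub>R \<tau> x v + d *\<^sub>R \<sigma> x v))
      = (a * c + b * d) * Im (cnj (\<tau> x u) * \<tau> x v) + (a * d - b * c) * Im (cnj (\<tau> x u) * \<sigma> x v)" for a b c d x u v
  proof -
    have "Im (cnj (a *\<^sub>R \<tau> x u + b *\<^sub>R \<sigma> x u) * (c *\<^sub>R \<tau> x v + d *\<^sub>R \<sigma> x v))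
      = a * c * Im (cnj (\<tau> x u) * \<tau> x v) + a * d * Im (cnj (\<tau> x u) * \<sigma> x v) - b * c * Im (cnj (\<tau> x v) * \<sigma> x u) + b * d * Im (cnj (\<sigma> x u) * \<sigma> x v)"
      by (simp add: algebra_simps)
    also have "\<dots> = (a * c + b * d) * Im (cnj (\<tau> x u) * \<tau> x v) + (a * d - b * c) * Im (cnj (\<tau> x u) * \<sigma> x v)"
      by (simp only: \<sigma>_det \<sigma>_sym[of x v u] distrib_right left_diff_distrib)
    finally show ?thesis .
  qed
  have area1: "Im (cnj (\<tau>' x u) * \<tau>' x v) = Im (cnj (\<tau> x u) * \<tau> x v)" for x u v
    unfolding \<tau>'_def area CS by simp
  have c: "C * C - S * - S = 1" "- S * S - C * C = -1" "- S * C + C * S = 0" using CS by simp_all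
  show ?thesis
  proof (rule codazzi_frame.intro[OF coframe.intro codazzi_frame_axioms.intro])
    show "linear (\<tau>' x)" "linear (\<sigma>' x)" "smooth (\<lambda>x. \<tau>' x u)" "smooth (\<lambda>x. \<sigma>' x u)" "linear (\<omega> x)" "smooth (\<lambda>x. \<omega> x u)" for x u
      unfolding \<tau>'_def \<sigma>'_def by (rule lin, rule lin, rule sm, rule sm, rule \<omega>_linear, rule \<omega>_smooth)
    show "0 < det2 (\<tau>' x)" for x unfolding det2_def area1 using \<tau>_pos[of x] by (simp add: det2_def)
    show "D (\<lambda>y. \<tau>' y v) x u - D (\<lambda>y. \<tau>' y u) x v = \<i> * (\<omega> x u * \<tau>' x v - \<omega> x v * \<tau>' x u)"
      "D (\<lambda>y. \<sigma>' y v) x u - D (\<lambda>y. \<sigma>' y u) x v = \<i> * (\<omega> x u * \<sigma>' x v - \<omega> x v * \<sigma>' x u)" for x u v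
      unfolding \<tau>'_def \<sigma>'_def by (rule tor)+
    show "D (\<lambda>y. \<omega> y v) x u - D (\<lambda>y. \<omega> y u) x v = - Im (cnj (\<tau>' x u) * \<tau>' x v)" for x u v
      unfolding area1 by (rule curvature)
    show "Im (cnj (\<tau>' x u) * \<sigma>' x v) = Im (cnj (\<tau>' x v) * \<sigma>' x u)" for x u v
      unfolding \<tau>'_def \<sigma>'_def area c using \<sigma>_sym[of x u v] by simp
    show "Im (cnj (\<sigma>' x u) * \<sigma>' x v) = Im (cnj (\<tau>' x u) * \<tau>' x v)" for x u v
      unfolding area1 unfolding \<sigma>'_def area using CS by (simp add: add.commute)
    show "0 < Im (cnj (\<sigma>' x u) * \<tau>' x u)" if "u \<noteq> 0" for x u
      unfolding \<tau>'_def \<sigma>'_def area c using \<sigma>_pos[OF that, of x] by (simp add: algebra_simps)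
  qed
qed

lemma (in deck_frame) rotate_deck:
  fixes C S :: real
  assumes CS: "C * C + S * S = 1"
  shows "deck_frame (\<lambda>x u. C *\<^sub>R \<tau> x u + S *\<^sub>R \<sigma> x u) \<omega> (\<lambda>x u. - S *\<^sub>R \<tau> x u + C *\<^sub>R \<sigma> x u) p \<kappa>"
  by (rule deck_frame.intro[OF rotate[OF CS] deck_frame_axioms.intro])
    (simp_all add: smooth_deck cmod_\<kappa> \<tau>_deck \<sigma>_deck algebra_simps)

lemma (in codazzi_frame) conn_rotate:
  fixes \<theta> :: real and \<zeta> :: complex
  shows "codazzi_frame.conn (\<lambda>x u. cos (\<theta> / 2) *\<^sub>R \<tau> x u + sin (\<theta> / 2) *\<^sub>R \<sigma> x u) \<omega>
     (\<lambda>x u. - sin (\<theta> / 2) *\<^sub>R \<tau> x u + cos (\<theta> / 2) *\<^sub>R \<sigma> x u) \<zeta> x u = conn (\<theta> + \<zeta>) x u"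
proof -
  have cs: "cos (\<theta> / 2) * cos (\<theta> / 2) + sin (\<theta> / 2) * sin (\<theta> / 2) = 1"
    using sin_cos_squared_add2[of "\<theta> / 2"] by (simp add: power2_eq_square)
  interpret R: codazzi_frame "\<lambda>x u. cos (\<theta> / 2) *\<^sub>R \<tau> x u + sin (\<theta> / 2) *\<^sub>R \<sigma> x u" \<omega>
    "\<lambda>x u. - sin (\<theta> / 2) *\<^sub>R \<tau> x u + cos (\<theta> / 2) *\<^sub>R \<sigma> x u" by (rule rotate[OF cs])
  have e: "(complex_of_real \<theta> + \<zeta>) / 2 = of_real (\<theta> / 2) + \<zeta> / 2" by (simp add: add_divide_distrib)
  show ?thesis
    unfolding cmat2_eq_iff conn_entries R.conn_entries e cos_add sin_add cos_of_real sin_of_real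
    by (simp add: scaleR_conv_of_real algebra_simps)
qed

section \<open>Holonomy and developing maps of grafted surfaces\<close>

lemma deck_frame_exists:
  assumes A: "oriented_smooth_atlas A" "universal_cover A p" and X: "X \<in> Teich p" "h \<in> X" and b: "is_labourie p h hs b"
  obtains \<tau> \<omega> \<sigma> \<kappa> where "deck_frame \<tau> \<omega> \<sigma> p \<kappa>" "h = (\<lambda>x u v. \<tau> x u \<bullet> \<tau> x v)" "hs = (\<lambda>x u v. \<sigma> x u \<bullet> \<sigma> x v)"
proof -
  obtain \<tau> \<omega> where c: "coframe \<tau> \<omega>" and h: "h = (\<lambda>x u v. \<tau> x u \<bullet> \<tau> x v)"
    and curv: "\<And>x u v. D (\<lambda>y. \<omega> y v) x u - D (\<lambda>y. \<omega> y u) x v = - Im (cnj (\<tau> x u) * \<tau> x v)"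
    and inv: "\<And>\<gamma> x u v. \<gamma> \<in> deck p \<Longrightarrow> h (\<gamma> x) (D \<gamma> x u) (D \<gamma> x v) = h x u v"
    by (rule teich_coframe[OF A X]) (rule that)
  interpret coframe \<tau> \<omega> by fact
  note l = is_labourieD[OF b[unfolded h]]
  note ds = deck_smooth[OF A]
  define \<sigma> where "\<sigma> x u = \<i> * \<tau> x (b x u)" for x u
  have "\<exists>k. cmod k = 1 \<and> (\<forall>u. \<tau> (\<gamma> x) (D \<gamma> x u) = k * \<tau> x u)" if \<gamma>: "\<gamma> \<in> deck p" for \<gamma> x
  proof -
    have lin: "linear (\<lambda>u. \<tau> (\<gamma> x) (D \<gamma> x u))"
      using linear_compose[OF smooth_linear_D[OF ds(1)[OF \<gamma>]] \<tau>_linear] by (simp add: o_def)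
    have pos: "0 < det2 (\<lambda>u. \<tau> (\<gamma> x) (D \<gamma> x u))"
      unfolding det2_compose[OF \<tau>_linear smooth_linear_D[OF ds(1)[OF \<gamma>]]] using \<tau>_pos ds(2)[OF \<gamma>] by simp
    have eq: "\<tau> (\<gamma> x) (D \<gamma> x u) \<bullet> \<tau> (\<gamma> x) (D \<gamma> x v) = \<tau> x u \<bullet> \<tau> x v" for u v
      using inv[OF \<gamma>] unfolding h by blast
    show ?thesis by (rule rotation_exists[OF \<tau>_linear \<tau>_pos lin pos eq]) blast
  qed
  then obtain \<kappa> where \<kappa>: "\<And>\<gamma> x. \<gamma> \<in> deck p \<Longrightarrow> cmod (\<kappa> \<gamma> x) = 1"
    "\<And>\<gamma> x u. \<gamma> \<in> deck p \<Longrightarrow> \<tau> (\<gamma> x) (D \<gamma> x u) = \<kappa> \<gamma> x * \<tau> x u" by metis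
  have lin: "linear (\<sigma> x)" for x
    unfolding \<sigma>_def
    by (intro linearI) (simp_all add: linear_add[OF \<tau>_linear] linear_scale[OF \<tau>_linear] linear_add[OF l(1)] linear_scale[OF l(1)] algebra_simps)
  note stb = smooth_form_field[OF \<tau>_linear \<tau>_smooth l(2)]
  have ss: "smooth (\<lambda>x. \<sigma> x u)" for u unfolding \<sigma>_def by (rule smooth_mult[OF smooth_const stb])
  have D\<sigma>: "D (\<lambda>y. \<sigma> y v) x u = \<i> * D (\<lambda>y. \<tau> y (b y v)) x u" for x u v
    unfolding \<sigma>_def using D_eq[OF has_derivative_mult_right[OF smooth_has_derivative[OF stb]]] by simp
  have cod: "D (\<lambda>y. \<sigma> y v) x u - D (\<lambda>y. \<sigma> y u) x v = \<i> * (\<omega> x u * \<sigma> x v - \<omega> x v * \<sigma> x u)" for x u v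
  proof -
    have n: "\<tau> x (nabla (\<lambda>x u v. \<tau> x u \<bullet> \<tau> x v) (\<lambda>_. u) (\<lambda>y. b y v) x) = D (\<lambda>y. \<tau> y (b y v)) x u - \<i> * \<omega> x u * \<tau> x (b x v)" for u v
      by (rule \<tau>_nabla[OF differentiableI[OF smooth_has_derivative[OF l(2)]]])
    have D0: "D (\<lambda>_. w) x z = 0" for w z :: complex using D_eq[OF has_derivative_const, of w x] by simp
    \<comment> \<open>For constant fields the bracket vanishes, so the Codazzi identity is the
      antisymmetrised covariant derivative of b alone.\<close>
    have "nabla (\<lambda>x u v. \<tau> x u \<bullet> \<tau> x v) (\<lambda>_. u) (\<lambda>y. b y v) x - nabla (\<lambda>x u v. \<tau> x u \<bullet> \<tau> x v) (\<lambda>_. v) (\<lambda>y. b y u) x = 0"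
      using l(8)[OF smooth_const smooth_const, of u v x] by (simp add: lie_bracket_def D0 linear_0[OF l(1)])
    from arg_cong[OF this, of "\<tau> x"]
    have "D (\<lambda>y. \<tau> y (b y v)) x u - D (\<lambda>y. \<tau> y (b y u)) x v = \<i> * \<omega> x u * \<tau> x (b x v) - \<i> * \<omega> x v * \<tau> x (b x u)"
      by (simp add: linear_diff[OF \<tau>_linear] linear_0[OF \<tau>_linear] n algebra_simps)
    from arg_cong[OF this, of "\<lambda>z. \<i> * z"] show ?thesis unfolding D\<sigma> by (simp add: \<sigma>_def algebra_simps)
  qed
  have "deck_frame \<tau> \<omega> \<sigma> p \<kappa>"
  proof (rule deck_frame.intro[OF codazzi_frame.intro[OF c codazzi_frame_axioms.intro] deck_frame_axioms.intro])
    show "Im (cnj (\<tau> x u) * \<sigma> x v) = Im (cnj (\<tau> x v) * \<sigma> x u)" for x u v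
      using l(4)[of x u v] by (simp add: \<sigma>_def inner_complex_def algebra_simps)
    show "0 < Im (cnj (\<sigma> x u) * \<tau> x u)" if "u \<noteq> 0" for x u
      using l(7)[OF that, of x] by (simp add: \<sigma>_def inner_complex_def algebra_simps)
    show "Im (cnj (\<sigma> x u) * \<sigma> x v) = Im (cnj (\<tau> x u) * \<tau> x v)" for x u v
    proof -
      have "Im (cnj (\<sigma> x u) * \<sigma> x v) = Im (cnj (\<tau> x (b x u)) * \<tau> x (b x v))" by (simp add: \<sigma>_def)
      then show ?thesis unfolding Im_cnj_linear[OF \<tau>_linear] Im_cnj_linear[OF l(1)] l(5) by simp
    qed
    show "\<sigma> (\<gamma> x) (D \<gamma> x u) = \<kappa> \<gamma> x * \<sigma> x u" if "\<gamma> \<in> deck p" for \<gamma> x u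
      by (simp add: \<sigma>_def l(3)[OF that] \<kappa>(2)[OF that])
  qed (fact lin ss cod curv ds(1) \<kappa>)+
  moreover have "hs = (\<lambda>x u v. \<sigma> x u \<bullet> \<sigma> x v)"
    by (intro ext) (simp add: \<sigma>_def l(6) inner_complex_def)
  ultimately show ?thesis using that h by blast
qed

text \<open>The quotient m of the two frames fixes the identity, hence is unitary, and fixes every
  \<open>off w\<close>, hence commutes with all of them. It is then scalar, and determinant one
  leaves only a sign.\<close>

lemma frame_sign:
  assumes d: "det a = 1" "det b = 1" and 1: "act a (mat 1) = act b (mat 1)" and off: "\<And>w. act a (off w) = act b (off w)"
  shows "a = b \<or> a = - b"
proof -
  define m where "m = adj b ** a"
  have m: "act m X = X" if "act a X = act b X" for X
    unfolding m_def act_mult that act_adj(2)[OF d(2)] ..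
  have dm: "det m = 1" by (simp add: m_def det_mul det_adj d)
  have hm: "hconj m = adj m"
  proof -
    have "m ** hconj m = mat 1" using m[OF 1] by (simp add: act_def)
    then have "adj m ** (m ** hconj m) = adj m" by simp
    then show ?thesis by (simp add: matrix_mul_assoc adj_mult dm)
  qed
  have com: "m ** off w = off w ** m" for w
  proof -
    have "m ** off w ** adj m = off w" using m[OF off[of w]] by (simp add: act_def hm)
    then have "m ** off w ** adj m ** m = off w ** m" by simp
    then show ?thesis by (simp add: adj_mult dm flip: matrix_mul_assoc)
  qed
  have c: "(m ** off w) $ i $ j = (off w ** m) $ i $ j" for w i j by (simp only: com)
  have "m $ 1 $ 2 = m $ 2 $ 1" using c[of 1 1 1] by (simp add: cmat2_mult_nth)
  moreover have "m $ 1 $ 2 = - m $ 2 $ 1" using c[of \<i> 1 1] by (simp add: cmat2_mult_nth complex_eq_iff)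
  moreover have "m $ 2 $ 2 = m $ 1 $ 1" using c[of 1 1 2] by (simp add: cmat2_mult_nth)
  ultimately have e: "m $ 2 $ 2 = m $ 1 $ 1" "m $ 1 $ 2 = 0" "m $ 2 $ 1 = 0" by simp_all
  then have "m $ 1 $ 1 * m $ 1 $ 1 = 1" using dm by (simp add: det_2)
  then have "m $ 1 $ 1 = 1 \<or> m $ 1 $ 1 = -1" by (simp add: square_eq_1_iff)
  then have "m = mat 1 \<or> m = - mat 1" using e by (auto simp: cmat2_eq_iff cmat2_mat_1)
  moreover have "a = b ** m" by (simp add: m_def matrix_mul_assoc adj_mult d)
  ultimately show ?thesis by (auto simp: linear_neg[OF bounded_linear.linear[OF bounded_bilinear.bounded_linear_right[OF bounded_bilinear_cmat2_mult]]])
qed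

locale deck_grafting = grafting_frame \<tau> \<omega> \<sigma> s P + deck_frame \<tau> \<omega> \<sigma> p \<kappa>
  for \<tau> :: endo and \<omega> \<sigma> s P p \<kappa> +
  assumes P_0: "P 0 = mat 1"
begin

text \<open>The square root of the frame rotation is taken once for each \<gamma>, at the base
  point, and does not involve P or s. The arbitrary branch affects only the sign of the
  matrix.\<close>

definition rep :: "(complex \<Rightarrow> complex) \<Rightarrow> cmat2" where
  "rep \<gamma> = P (\<gamma> 0) ** M2 (cnj (csqrt (\<kappa> \<gamma> 0))) 0 0 (csqrt (\<kappa> \<gamma> 0))"

lemma rep:
  assumes \<gamma>: "\<gamma> \<in> deck p"
  shows "surf (\<gamma> x) = act (rep \<gamma>) (surf x)" "CP1_point (column1 (P (\<gamma> x))) = mobius (rep \<gamma>) (CP1_point (column1 (P x)))"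
    "det (rep \<gamma>) = 1"
proof -
  have k: "csqrt (\<kappa> \<gamma> 0) * csqrt (\<kappa> \<gamma> 0) = \<kappa> \<gamma> 0" by (metis power2_csqrt power2_eq_square)
  have "adj (mat 1) = mat 1" by (simp add: cmat2_eq_iff adj_def cmat2_mat_1)
  then have "rep \<gamma> = P (\<gamma> 0) ** M2 (cnj (csqrt (\<kappa> \<gamma> 0))) 0 0 (csqrt (\<kappa> \<gamma> 0)) ** adj (P 0)" by (simp add: rep_def P_0)
  note e = surf_equivariant[OF smooth_deck[OF \<gamma>] cmod_\<kappa>[OF \<gamma>] \<tau>_deck[OF \<gamma>] \<sigma>_deck[OF \<gamma>] k, folded this]
  show "surf (\<gamma> x) = act (rep \<gamma>) (surf x)" "CP1_point (column1 (P (\<gamma> x))) = mobius (rep \<gamma>) (CP1_point (column1 (P x)))"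
    "det (rep \<gamma>) = 1" by (rule e)+
qed

text \<open>Both products are frames over the same point with the same images of all
  \<open>off w\<close>, so they agree up to sign. Unlike equivariance of the surface, this concerns
  the full frame at any x; at x = \<delta> 0 it gives multiplicativity of \<open>rep\<close> up to
  sign.\<close>

lemma P_deck:
  assumes \<gamma>: "\<gamma> \<in> deck p" and k: "k * k = \<kappa> \<gamma> x"
  shows "P (\<gamma> x) ** M2 (cnj k) 0 0 k = rep \<gamma> ** P x \<or> P (\<gamma> x) ** M2 (cnj k) 0 0 k = - (rep \<gamma> ** P x)"
proof (rule frame_sign)
  let ?K = "M2 (cnj k) 0 0 k"
  have "cmod k * cmod k = 1" using cmod_\<kappa>[OF \<gamma>, of x] k by (metis norm_mult)
  note K = diag_unit[OF this, unfolded k]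
  show "det (P (\<gamma> x) ** ?K) = 1" "det (rep \<gamma> ** P x) = 1" by (simp_all add: det_mul det_P K rep(3)[OF \<gamma>])
  show "act (P (\<gamma> x) ** ?K) (mat 1) = act (rep \<gamma> ** P x) (mat 1)"
    using rep(1)[OF \<gamma>, of x] by (simp add: act_mult K surf_def)
  have "smooth surf" by (rule coframe_immersion.smooth_f[OF surf_coframe_immersion])
  have "(\<lambda>x. surf (\<gamma> x)) = (\<lambda>x. act (rep \<gamma>) (surf x))" using rep(1)[OF \<gamma>] by blast
  then have "D (\<lambda>x. surf (\<gamma> x)) x u = D (\<lambda>x. act (rep \<gamma>) (surf x)) x u" for u by simp
  moreover have "D (\<lambda>x. act (rep \<gamma>) (surf x)) x u = act (rep \<gamma>) (D surf x u)" for u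
  proof -
    have "bounded_linear (act (rep \<gamma>))" using act_linear linear_conv_bounded_linear by blast
    from D_eq[OF bounded_linear.has_derivative[OF this smooth_has_derivative[OF \<open>smooth surf\<close>]]] show ?thesis by simp
  qed
  ultimately have eq: "D surf (\<gamma> x) (D \<gamma> x u) = act (rep \<gamma>) (D surf x u)" for u
    by (simp add: smooth_D_compose[OF \<open>smooth surf\<close> smooth_deck[OF \<gamma>]])
  fix w
  define u where "u = linv (\<tau> x) ((1 / cosh (s / 2)) *\<^sub>R w)"
  have "cosh (s / 2) *\<^sub>R \<tau> x u = w" by (simp add: u_def \<tau>_linv)
  moreover have "cosh (s / 2) *\<^sub>R (\<kappa> \<gamma> x * \<tau> x u) = \<kappa> \<gamma> x * (cosh (s / 2) *\<^sub>R \<tau> x u)" by simp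
  ultimately show "act (P (\<gamma> x) ** ?K) (off w) = act (rep \<gamma> ** P x) (off w)"
    using eq[of u] unfolding D_surf \<tau>_deck[OF \<gamma>] by (simp only: act_mult K)
qed

lemma psl_rep_rep: "psl_rep p rep"
  unfolding psl_rep_def
proof (intro conjI ballI)
  show "det (rep \<gamma>) = 1" if "\<gamma> \<in> deck p" for \<gamma> by (rule rep(3)[OF that])
  fix \<gamma> \<delta> assume \<gamma>: "\<gamma> \<in> deck p" and \<delta>: "\<delta> \<in> deck p"
  have \<gamma>\<delta>: "\<gamma> \<circ> \<delta> \<in> deck p" by (rule deck_comp[OF \<gamma> \<delta>])
  have sq: "csqrt z * csqrt z = z" for z by (metis power2_csqrt power2_eq_square)
  define k l m where "k = csqrt (\<kappa> \<gamma> (\<delta> 0))" "l = csqrt (\<kappa> \<delta> 0)" "m = csqrt (\<kappa> (\<gamma> \<circ> \<delta>) 0)"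
  \<comment> \<open>By the chain rule \<kappa> is a cocycle, so the square roots satisfy m = k l up
    to sign.\<close>
  have "\<kappa> (\<gamma> \<circ> \<delta>) 0 * \<tau> 0 1 = \<kappa> \<gamma> (\<delta> 0) * (\<kappa> \<delta> 0 * \<tau> 0 1)"
  proof -
    have "\<kappa> (\<gamma> \<circ> \<delta>) 0 * \<tau> 0 1 = \<tau> (\<gamma> (\<delta> 0)) (D (\<gamma> \<circ> \<delta>) 0 1)" using \<tau>_deck[OF \<gamma>\<delta>, of 0 1] by simp
    also have "D (\<gamma> \<circ> \<delta>) 0 1 = D \<gamma> (\<delta> 0) (D \<delta> 0 1)"
      unfolding o_def by (rule smooth_D_compose[OF smooth_deck[OF \<gamma>] smooth_deck[OF \<delta>]])
    finally show ?thesis by (simp only: \<tau>_deck[OF \<gamma>] \<tau>_deck[OF \<delta>])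
  qed
  then have "\<kappa> (\<gamma> \<circ> \<delta>) 0 = \<kappa> \<gamma> (\<delta> 0) * \<kappa> \<delta> 0" by simp
  then have "m * m = (k * k) * (l * l)" unfolding k_l_m_def sq .
  then have "m * m = (k * l) * (k * l)" by (simp only: mult_ac)
  then have m: "m = k * l \<or> m = - (k * l)" by (simp add: square_eq_iff)
  let ?K = "\<lambda>k. M2 (cnj k) 0 0 k"
  have K: "?K k ** ?K l = ?K m \<or> ?K k ** ?K l = - ?K m" using m by (auto simp: cmat2_simps)
  note bm = bounded_bilinear_cmat2_mult
  have neg: "a ** - b = - (a ** b)" "- a ** b = - (a ** b)" for a b :: cmat2
    by (rule bounded_bilinear.minus_right[OF bm], rule bounded_bilinear.minus_left[OF bm])
  have "P (\<gamma> (\<delta> 0)) ** ?K k = rep \<gamma> ** P (\<delta> 0) \<or> P (\<gamma> (\<delta> 0)) ** ?K k = - (rep \<gamma> ** P (\<delta> 0))"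
    by (rule P_deck[OF \<gamma>]) (simp add: k_l_m_def sq)
  then have "P (\<gamma> (\<delta> 0)) ** ?K k ** ?K l = rep \<gamma> ** (P (\<delta> 0) ** ?K l) \<or> P (\<gamma> (\<delta> 0)) ** ?K k ** ?K l = - (rep \<gamma> ** (P (\<delta> 0) ** ?K l))"
    by (auto simp: neg matrix_mul_assoc)
  then have "P (\<gamma> (\<delta> 0)) ** (?K k ** ?K l) = rep \<gamma> ** rep \<delta> \<or> P (\<gamma> (\<delta> 0)) ** (?K k ** ?K l) = - (rep \<gamma> ** rep \<delta>)"
    by (simp add: rep_def[of \<delta>] k_l_m_def(2) matrix_mul_assoc)
  then have "P (\<gamma> (\<delta> 0)) ** ?K m = rep \<gamma> ** rep \<delta> \<or> P (\<gamma> (\<delta> 0)) ** ?K m = - (rep \<gamma> ** rep \<delta>)"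
    using K by (auto simp: neg equation_minus_iff)
  then show "rep (\<gamma> \<circ> \<delta>) = rep \<gamma> ** rep \<delta> \<or> rep (\<gamma> \<circ> \<delta>) = - (rep \<gamma> ** rep \<delta>)"
    by (simp add: rep_def[of "\<gamma> \<circ> \<delta>"] k_l_m_def(3))
qed

abbreviation dev :: "complex \<Rightarrow> cmat2" where "dev x \<equiv> CP1_point (column1 (P x))"

lemma holonomy_dev: "holonomy p dev rep"
  unfolding holonomy_def using psl_rep_rep rep(2) by blast

lemma grafting_immersion_surf: "grafting_immersion p s (\<lambda>x u v. \<tau> x u \<bullet> \<tau> x v) lab surf"
  unfolding grafting_immersion_def
  using coframe_immersion.f_imm[OF surf_coframe_immersion] coframe_immersion.f_I[OF surf_coframe_immersion]
    shape_surf psl_rep_rep rep(1) by blast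

lemma proj_class_mobius:
  assumes "det h = 1"
  shows "proj_class p (\<lambda>x. mobius h (dev x)) = proj_class p dev"
proof -
  have e: "mobius g (mobius h (dev x)) = mobius (g ** h) (dev x)" if "det g = 1" for g x
    by (simp add: mobius_CP1_point that assms det_P det_mul matrix_mul_assoc)
  have 1: "mobius g (dev x) = mobius (g ** adj h) (mobius h (dev x))" if "det g = 1" for g x
    using that assms by (simp add: e det_mul det_adj adj_mult flip: matrix_mul_assoc)
  show ?thesis
  proof (intro equalityI subsetI)
    fix d assume "d \<in> proj_class p (\<lambda>x. mobius h (dev x))"
    then obtain g \<phi> where g: "det g = 1" "isotopic_to_id p \<phi>" "d = (\<lambda>x. mobius g (mobius h (dev (\<phi> x))))"
      by (auto simp: proj_class_def)
    then have "d = (\<lambda>x. mobius (g ** h) (dev (\<phi> x)))" "det (g ** h) = 1" by (simp_all add: e det_mul assms)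
    then show "d \<in> proj_class p dev" using g(2) unfolding proj_class_def by blast
  next
    fix d assume "d \<in> proj_class p dev"
    then obtain g \<phi> where g: "det g = 1" "isotopic_to_id p \<phi>" "d = (\<lambda>x. mobius g (dev (\<phi> x)))"
      by (auto simp: proj_class_def)
    then have "d = (\<lambda>x. mobius (g ** adj h) (mobius h (dev (\<phi> x))))" "det (g ** adj h) = 1"
      using 1[OF g(1)] by (simp_all add: det_mul det_adj assms)
    then show "d \<in> proj_class p (\<lambda>x. mobius h (dev x))" using g(2) unfolding proj_class_def by blast
  qed
qed

text \<open>\<open>surf\<close> shows that the choice is from a nonempty set; by uniqueness every
  candidate has the same Gauss map up to a Moebius transformation, which the class ignores.\<close>

lemma SGr_eq: "SGr p s (\<lambda>x u v. \<tau> x u \<bullet> \<tau> x v, \<lambda>x u v. \<sigma> x u \<bullet> \<sigma> x v) = proj_class p dev"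
proof -
  define f where "f = (SOME f. grafting_immersion p s (\<lambda>x u v. \<tau> x u \<bullet> \<tau> x v) lab f)"
  have "grafting_immersion p s (\<lambda>x u v. \<tau> x u \<bullet> \<tau> x v) lab f"
    unfolding f_def by (rule someI[where P = "grafting_immersion p s (\<lambda>x u v. \<tau> x u \<bullet> \<tau> x v) lab" and x = surf, OF grafting_immersion_surf])
  then have "immersion_H3 f" "\<And>x u v. fundamental_form_I f x u v = (cosh (s / 2))\<^sup>2 * (\<tau> x u \<bullet> \<tau> x v)"
     "\<And>x u. shape_operator f x u = - tanh (s / 2) *\<^sub>R lab x u" by (simp_all add: grafting_immersion_def)
  then obtain h where h: "det h = 1" "\<And>x. gauss_map f x = mobius h (dev x)"
    by (rule surf_unique_ex) (rule that)
  then have "gauss_map f = (\<lambda>x. mobius h (dev x))" by blast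
  then show ?thesis unfolding SGr_def prod.case labourie_eq f_def[symmetric] by (simp add: proj_class_mobius[OF h(1)])
qed

end

section \<open>Smoothness and orientation of the developing maps\<close>

lemma Ck_CP1_point_column1:
  fixes P :: "'p::topological_space \<Rightarrow> 'a::real_normed_vector \<Rightarrow> cmat2"
  assumes S: "open S" and P: "Ck k S P" and d: "\<And>p x. x \<in> S \<Longrightarrow> det (P p x) = 1"
  shows "Ck k S (\<lambda>p x. CP1_point (column1 (P p x)))"
proof -
  note m = Ck_bilinear[OF bounded_bilinear_cmat2_mult S]
  have A: "Ck k S (\<lambda>p x. act (P p x) (M2 1 0 0 0))"
    unfolding act_def by (rule m[OF m[OF P Ck_const[OF S]] Ck_bounded_linear[OF bounded_linear_hconj S P]])
  have "Ck k S (\<lambda>p x. 1 / Re (trace (act (P p x) (M2 1 0 0 0))))"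
    by (rule Ck_divide[OF S _ Ck_const[OF S] Ck_bounded_linear[OF bounded_linear_Re_trace S A]])
      (use trace_act_projection_pos[OF d] in \<open>simp add: less_imp_neq[symmetric]\<close>)
  from Ck_scaleR[OF S this A] show ?thesis unfolding CP1_point_column1 ray_def[abs_def] .
qed

lemma Im_trace_Her:
  assumes "X \<in> Her" "Y \<in> Her"
  shows "Im (trace (X ** Y ** Y)) = 0" "Im (trace (Y ** X ** Y)) = 0" "Im (trace (Y ** Y ** Y)) = 0"
  using assms unfolding Her_iff trace_cmat2 cmat2_mult_nth by (auto simp: algebra_simps)

text \<open>Cyclicity turns the trace into an expression in H = g^* g, a Hermitian matrix of
  determinant one; its imaginary part is p det H times the area of (a, b), with p the squared length
  of the first column of g.\<close>

lemma trace_projection_triple: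
  assumes "det g = 1"
  shows "Im (trace (act g (off a) ** act g (off b) ** act g (M2 1 0 0 0))) = Re (trace (act g (M2 1 0 0 0))) * Im (cnj a * b)"
proof -
  define H where "H = hconj g ** g"
  have Her: "H \<in> Her" by (simp add: Her_def H_def hconj_mult)
  have det: "det H = 1" by (simp add: H_def det_mul det_hconj assms)
  define p q w where "p = Re (H $ 1 $ 1)" "q = Re (H $ 2 $ 2)" "w = H $ 2 $ 1"
  have H: "H $ 1 $ 1 = of_real p" "H $ 2 $ 2 = of_real q" "H $ 2 $ 1 = w" "H $ 1 $ 2 = cnj w"
    using Her by (simp_all add: Her_iff p_q_w_def complex_eq_iff)
  have d: "p * q - (Re w * Re w + Im w * Im w) = 1" using arg_cong[OF det, of Re] by (simp add: det_2 H)
  have "act g (off a) ** act g (off b) ** act g (M2 1 0 0 0) = g ** (off a ** H ** off b ** H ** M2 1 0 0 0 ** hconj g)"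
    by (simp add: act_def H_def matrix_mul_assoc)
  then have "trace (act g (off a) ** act g (off b) ** act g (M2 1 0 0 0)) = trace (off a ** H ** off b ** H ** M2 1 0 0 0 ** H)"
    using trace_mul_sym[of g "off a ** H ** off b ** H ** M2 1 0 0 0 ** hconj g"] by (simp add: H_def matrix_mul_assoc)
  also have "Im \<dots> = p * (p * q - (Re w * Re w + Im w * Im w)) * Im (cnj a * b)"
    by (simp add: trace_cmat2 cmat2_mult_nth H algebra_simps)
  also have "\<dots> = p * Im (cnj a * b)" unfolding d by simp
  also have "p = Re (trace (act g (M2 1 0 0 0)))"
    unfolding trace_act_projection cmod_power2 by (simp add: p_q_w_def H_def cmat2_mult_nth power2_eq_square)
  finally show ?thesis .
qed

text \<open>Normalising a null ray adds multiples of the ray itself to the derivatives. They do not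
  matter, since a trace of three Hermitian factors with a repetition is real.\<close>

lemma positively_oriented_projection:
  assumes g: "det g = 1" and r: "0 < r" and ab: "0 < Im (cnj a * b)"
  shows "positively_oriented (mat 1) (r *\<^sub>R act g (off a) + s *\<^sub>R act g (M2 1 0 0 0))
    (r *\<^sub>R act g (off b) + t *\<^sub>R act g (M2 1 0 0 0)) (r *\<^sub>R act g (M2 1 0 0 0))"
proof -
  let ?A = "act g (M2 1 0 0 0)" and ?X = "act g (off a)" and ?Y = "act g (off b)"
  have A: "?A \<in> Her" "?X \<in> Her" "?Y \<in> Her" by (rule act_Her, simp add: Her_iff)+
  note bm = bounded_bilinear_cmat2_mult
  have l: "linear (\<lambda>X::cmat2. Im (trace X))"
    by (intro linearI) (simp_all add: trace_cmat2 algebra_simps)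
  have "Im (trace ((r *\<^sub>R ?X + s *\<^sub>R ?A) ** (r *\<^sub>R ?Y + t *\<^sub>R ?A) ** (r *\<^sub>R ?A)))
      = r * (r * (r * Im (trace (?X ** ?Y ** ?A))))"
    by (simp add: bounded_bilinear.add_left[OF bm] bounded_bilinear.add_right[OF bm] bounded_bilinear.scaleR_left[OF bm]
        bounded_bilinear.scaleR_right[OF bm] linear_add[OF l] linear_scale[OF l] Im_trace_Her[OF A(2,1)] Im_trace_Her[OF A(3,1)])
  moreover have "0 < Im (trace (?X ** ?Y ** ?A))"
    unfolding trace_projection_triple[OF g] using trace_act_projection_pos[OF g] ab by (rule mult_pos_pos)
  moreover have "matrix_inv (mat 1) = (mat 1 :: cmat2)"
  proof -
    have "adj (mat 1) = mat 1" by (simp add: adj_def cmat2_eq_iff cmat2_mat_1)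
    then show ?thesis by (simp add: matrix_inv_adj)
  qed
  ultimately show ?thesis unfolding positively_oriented_def using r by simp
qed

text \<open>The mixed expression is alternating, and on a \<tau>-orthonormal basis it is minus the
  trace of b, positive by negative definiteness.\<close>

lemma (in codazzi_frame) \<tau>_\<sigma>_pos: "0 < Re (cnj (\<tau> x 1) * \<sigma> x \<i>) - Re (cnj (\<sigma> x 1) * \<tau> x \<i>)"
proof -
  let ?B = "\<lambda>u v. Re (cnj (\<tau> x u) * \<sigma> x v) - Re (cnj (\<sigma> x u) * \<tau> x v)"
  define u v where "u = linv (\<tau> x) 1" "v = linv (\<tau> x) \<i>"
  have uv: "\<tau> x u = 1" "\<tau> x v = \<i>" by (simp_all add: u_v_def \<tau>_linv)
  have nz: "u \<noteq> 0" "v \<noteq> 0" using uv \<tau>_eq_0_iff by (metis one_neq_zero, metis complex_i_not_zero)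
  have "?B u v = Im (cnj u * v) *\<^sub>R ?B 1 \<i>"
  proof (rule alternating_eq[of ?B])
    show "linear (\<lambda>u. ?B u v)" for v
      by (intro linearI) (simp_all add: linear_add[OF \<tau>_linear] linear_scale[OF \<tau>_linear] linear_add[OF \<sigma>_linear] linear_scale[OF \<sigma>_linear] algebra_simps)
  qed (simp add: algebra_simps)
  moreover have "0 < ?B u v" using \<sigma>_pos[OF nz(1), of x] \<sigma>_pos[OF nz(2), of x] by (simp add: uv)
  moreover have "0 < Im (cnj u * v)"
  proof -
    have "0 < Im (cnj u * v) * det2 (\<tau> x)" using Im_cnj_linear[OF \<tau>_linear, of x u v] by (simp add: uv)
    then show ?thesis using \<tau>_pos by (rule zero_less_mult_pos2)
  qed
  ultimately show ?thesis by (simp add: zero_less_mult_iff)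
qed

context grafting_frame
begin

text \<open>The lower left entry is half of cosh \<tau> + i sinh \<sigma>. Its area is a sum of
  cosh^2 and sinh^2 multiples of the area and cosh sinh times the mixed term, all positive for s >
  0.\<close>

lemma conn_area: "0 < Im (cnj (conn (\<i> * s) x 1 $ 2 $ 1) * conn (\<i> * s) x \<i> $ 2 $ 1)"
proof -
  let ?c = "cosh (s / 2)" and ?s = "sinh (s / 2)"
  have e: "conn (\<i> * s) x u $ 2 $ 1 = (1 / 2) *\<^sub>R (?c *\<^sub>R \<tau> x u + ?s *\<^sub>R (\<i> * \<sigma> x u))" for u
    by (simp add: conn_entries trig scaleR_conv_of_real algebra_simps add_divide_distrib)
  have "Im (cnj (?c *\<^sub>R \<tau> x 1 + ?s *\<^sub>R (\<i> * \<sigma> x 1)) * (?c *\<^sub>R \<tau> x \<i> + ?s *\<^sub>R (\<i> * \<sigma> x \<i>)))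
     = ?c * ?c * Im (cnj (\<tau> x 1) * \<tau> x \<i>) + ?s * ?s * Im (cnj (\<sigma> x 1) * \<sigma> x \<i>)
       + ?c * ?s * (Re (cnj (\<tau> x 1) * \<sigma> x \<i>) - Re (cnj (\<sigma> x 1) * \<tau> x \<i>))"
    by (simp add: algebra_simps)
  moreover have "0 < \<dots>"
  proof (intro add_nonneg_pos mult_pos_pos \<tau>_\<sigma>_pos add_nonneg_nonneg)
    have "0 < Im (cnj (\<tau> x 1) * \<tau> x \<i>)" using \<tau>_pos[of x] by (simp add: det2_def)
    then have "0 \<le> r * r * Im (cnj (\<tau> x 1) * \<tau> x \<i>)" for r
      by (rule mult_nonneg_nonneg[OF zero_le_square less_imp_le])
    then show "0 \<le> ?c * ?c * Im (cnj (\<tau> x 1) * \<tau> x \<i>)" "0 \<le> ?s * ?s * Im (cnj (\<sigma> x 1) * \<sigma> x \<i>)"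
      unfolding \<sigma>_det by blast+
  qed (use s_pos in simp_all)
  ultimately show ?thesis unfolding e by (simp add: algebra_simps)
qed

text \<open>The diagonal of the connection is imaginary and drops out when the projection onto the
  first basis vector is differentiated, so only the lower left entry moves the point of
  \<open>CP1\<close>.\<close>

lemma dev_oriented:
  fixes x :: complex
  defines "d \<equiv> \<lambda>x. CP1_point (column1 (P x))"
  shows "positively_oriented (mat 1) (D d x 1) (D d x \<i>) (d x)"
proof -
  let ?E = "M2 1 0 0 0"
  define r where "r x = 1 / Re (trace (act (P x) ?E))" for x
  have d: "d = (\<lambda>x. r x *\<^sub>R act (P x) ?E)" by (simp add: d_def CP1_point_column1 ray_def r_def)
  have sA: "smooth (\<lambda>x. act (P x) ?E)" by (rule smooth_act[OF P_smooth])
  have pos: "0 < Re (trace (act (P x) ?E))" for x by (rule trace_act_projection_pos[OF det_P])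
  have sr: "smooth r" unfolding r_def[abs_def]
    by (rule smooth_divide[OF smooth_const smooth_bounded_linear[OF bounded_linear_Re_trace sA] less_imp_neq[OF pos, symmetric]])
  have M: "conn (\<i> * s) x u ** ?E + ?E ** hconj (conn (\<i> * s) x u) = off (conn (\<i> * s) x u $ 2 $ 1)" for u
    unfolding cmat2_eq_iff by (simp add: cmat2_mult_nth) (simp add: conn_entries)
  have Dd: "D d x u = r x *\<^sub>R act (P x) (off (conn (\<i> * s) x u $ 2 $ 1)) + D r x u *\<^sub>R act (P x) ?E" for u
    using D_eq[OF has_derivative_scaleR[OF smooth_has_derivative[OF sr] smooth_has_derivative[OF sA]], of x]
    unfolding d by (simp add: D_act[OF P_smooth D_P] M)
  show ?thesis unfolding Dd unfolding d
    by (rule positively_oriented_projection[OF det_P _ conn_area]) (use pos in \<open>simp add: r_def\<close>)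
qed

end

lemma (in deck_grafting) developing_map_dev: "developing_map p dev"
  unfolding developing_map_def
proof (intro conjI allI)
  show "smooth dev" by (rule smoothI, rule Ck_CP1_point_column1[OF open_UNIV smoothD[OF P_smooth] det_P])
  have "column1 (P x) \<noteq> 0" for x
    using det_P[of x] by (auto simp: vec_eq_iff forall_2 det_2)
  then show "range dev \<subseteq> CP1" by (auto simp: CP1_def)
  show "positively_oriented (mat 1) (D dev x 1) (D dev x \<i>) (dev x)" for x by (rule dev_oriented)
  show "\<exists>\<rho>. holonomy p dev \<rho>" using holonomy_dev by blast
qed

section \<open>Holomorphic dependence on the parameter\<close>

lemma norm_cmat2_le: "norm (X :: cmat2) \<le> (\<Sum>i\<in>UNIV. \<Sum>j\<in>UNIV. norm (X $ i $ j))"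
proof -
  have "norm X \<le> (\<Sum>i\<in>UNIV. norm (X $ i))" unfolding norm_vec_def by (rule L2_set_le_sum) simp
  also have "\<dots> \<le> (\<Sum>i\<in>UNIV. \<Sum>j\<in>UNIV. norm (X $ i $ j))"
    by (intro sum_mono) (simp only: norm_vec_def[of "X $ _"], rule L2_set_le_sum, simp)
  finally show ?thesis .
qed

text \<open>The chain rule through finitely many matrix entries: differentiable entries are
  Lipschitz at z, which turns the approximation error of G into one of smaller order than w -
  z.\<close>

lemma entrywise_field_differentiable:
  fixes R :: "complex \<Rightarrow> 'g \<Rightarrow> cmat2"
  assumes G: "entrywise_complex_differentiable S G (R z)" and S: "finite S"
    and R: "\<And>\<gamma> i j. \<gamma> \<in> S \<Longrightarrow> (\<lambda>w. R w \<gamma> $ i $ j) field_differentiable at z"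
  shows "(\<lambda>w. G (R w)) field_differentiable at z"
proof -
  obtain R' where R': "((\<lambda>w. R w \<gamma> $ i $ j) has_field_derivative R' \<gamma> i j) (at z)" if "\<gamma> \<in> S" for \<gamma> i j
    using R unfolding field_differentiable_def by metis
  obtain c :: "'g \<Rightarrow> cmat2" where c: "\<And>\<epsilon>. \<epsilon> > 0 \<Longrightarrow> \<exists>\<delta>>0. \<forall>Q. (\<forall>\<gamma>\<in>S. norm (Q \<gamma> - R z \<gamma>) < \<delta>) \<longrightarrow>
        norm (G Q - G (R z) - (\<Sum>\<gamma>\<in>S. \<Sum>i\<in>UNIV. \<Sum>j\<in>UNIV. c \<gamma> $ i $ j * (Q \<gamma> - R z \<gamma>) $ i $ j))
          \<le> \<epsilon> * (\<Sum>\<gamma>\<in>S. norm (Q \<gamma> - R z \<gamma>))"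
    using G unfolding entrywise_complex_differentiable_def by auto
  define L where "L w = (\<Sum>\<gamma>\<in>S. \<Sum>i\<in>UNIV. \<Sum>j\<in>UNIV. c \<gamma> $ i $ j * (R w \<gamma> - R z \<gamma>) $ i $ j)" for w
  define M where "M = (\<Sum>\<gamma>\<in>S. \<Sum>i\<in>UNIV. \<Sum>j\<in>UNIV. norm (R' \<gamma> i j) + 1)"
  have M: "M \<ge> 0" unfolding M_def by (intro sum_nonneg) simp
  have lip1: "\<forall>\<^sub>F w in at z. norm (R w \<gamma> $ i $ j - R z \<gamma> $ i $ j) \<le> (norm (R' \<gamma> i j) + 1) * norm (w - z)" if "\<gamma> \<in> S" for \<gamma> i j
  proof -
    have "\<forall>\<^sub>F w in at z. norm (R w \<gamma> $ i $ j - R z \<gamma> $ i $ j - R' \<gamma> i j * (w - z)) \<le> 1 * norm (w - z)"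
      by (rule conjunct2[OF R'[OF that, unfolded has_field_derivative_def has_derivative_within_alt2], rule_format, OF zero_less_one])
    then show ?thesis
    proof eventually_elim
      case (elim w)
      have "norm (R w \<gamma> $ i $ j - R z \<gamma> $ i $ j) \<le> norm (R w \<gamma> $ i $ j - R z \<gamma> $ i $ j - R' \<gamma> i j * (w - z)) + norm (R' \<gamma> i j * (w - z))"
        using norm_triangle_ineq[of "R w \<gamma> $ i $ j - R z \<gamma> $ i $ j - R' \<gamma> i j * (w - z)" "R' \<gamma> i j * (w - z)"] by simp
      then show ?case using elim by (simp add: norm_mult distrib_right)
    qed
  qed
  have "\<forall>\<^sub>F w in at z. \<forall>\<gamma>\<in>S. \<forall>i\<in>UNIV. \<forall>j\<in>UNIV. norm (R w \<gamma> $ i $ j - R z \<gamma> $ i $ j) \<le> (norm (R' \<gamma> i j) + 1) * norm (w - z)"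
    by (intro eventually_ball_finite S finite ballI lip1)
  then have lip: "\<forall>\<^sub>F w in at z. (\<Sum>\<gamma>\<in>S. norm (R w \<gamma> - R z \<gamma>)) \<le> M * norm (w - z)"
  proof eventually_elim
    case (elim w)
    have "(\<Sum>\<gamma>\<in>S. norm (R w \<gamma> - R z \<gamma>)) \<le> (\<Sum>\<gamma>\<in>S. \<Sum>i\<in>UNIV. \<Sum>j\<in>UNIV. norm ((R w \<gamma> - R z \<gamma>) $ i $ j))"
      by (intro sum_mono norm_cmat2_le)
    also have "\<dots> \<le> (\<Sum>\<gamma>\<in>S. \<Sum>i\<in>UNIV. \<Sum>j\<in>UNIV. (norm (R' \<gamma> i j) + 1) * norm (w - z))"
      using elim by (intro sum_mono) simp
    also have "\<dots> = M * norm (w - z)" unfolding M_def sum_distrib_right ..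
    finally show ?case .
  qed
  have "((\<lambda>w. L w) has_field_derivative (\<Sum>\<gamma>\<in>S. \<Sum>i\<in>UNIV. \<Sum>j\<in>UNIV. c \<gamma> $ i $ j * R' \<gamma> i j)) (at z)"
    unfolding L_def vector_minus_component
    by (intro DERIV_sum DERIV_cmult) (auto intro!: derivative_eq_intros R')
  moreover have "((\<lambda>w. G (R w) - G (R z) - L w) has_field_derivative 0) (at z)"
    unfolding has_field_derivative_def has_derivative_within_alt2
  proof (intro conjI allI impI)
    show "bounded_linear ((*) (0::complex))" by (rule bounded_linear_mult_right)
    fix e :: real assume e: "e > 0"
    define \<epsilon> where "\<epsilon> = e / (M + 1)"
    have \<epsilon>: "\<epsilon> > 0" "\<epsilon> * M \<le> e" using e M by (simp_all add: \<epsilon>_def field_simps)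
    obtain \<delta> where \<delta>: "\<delta> > 0" "\<And>Q. (\<And>\<gamma>. \<gamma> \<in> S \<Longrightarrow> norm (Q \<gamma> - R z \<gamma>) < \<delta>) \<Longrightarrow>
        norm (G Q - G (R z) - (\<Sum>\<gamma>\<in>S. \<Sum>i\<in>UNIV. \<Sum>j\<in>UNIV. c \<gamma> $ i $ j * (Q \<gamma> - R z \<gamma>) $ i $ j))
          \<le> \<epsilon> * (\<Sum>\<gamma>\<in>S. norm (Q \<gamma> - R z \<gamma>))"
      using c[OF \<epsilon>(1)] by blast
    have "((\<lambda>w. M * norm (w - z)) \<longlongrightarrow> M * norm (z - z)) (at z)" by (intro tendsto_intros)
    then have "\<forall>\<^sub>F w in at z. M * norm (w - z) < \<delta>" using \<delta>(1) by (intro order_tendstoD(2)[of _ "M * norm (z - z)"]) auto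
    with lip show "\<forall>\<^sub>F w in at z. norm (G (R w) - G (R z) - L w - (G (R z) - G (R z) - L z) - 0 * (w - z)) \<le> e * norm (w - z)"
    proof eventually_elim
      case (elim w)
      have "norm (R w \<gamma> - R z \<gamma>) < \<delta>" if "\<gamma> \<in> S" for \<gamma>
        using member_le_sum[OF that, of "\<lambda>\<gamma>. norm (R w \<gamma> - R z \<gamma>)"] S elim by simp
      from \<delta>(2)[OF this] have "norm (G (R w) - G (R z) - L w) \<le> \<epsilon> * (\<Sum>\<gamma>\<in>S. norm (R w \<gamma> - R z \<gamma>))"
        unfolding L_def .
      also have "\<dots> \<le> \<epsilon> * (M * norm (w - z))" using elim \<epsilon>(1) by (intro mult_left_mono) simp_all
      also have "\<dots> \<le> e * norm (w - z)" using mult_right_mono[OF \<epsilon>(2), of "norm (w - z)"] by (simp add: mult.assoc)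
      finally show ?case by (simp add: L_def)
    qed
  qed
  ultimately have "((\<lambda>w. G (R z) + (L w + (G (R w) - G (R z) - L w))) has_field_derivative
     0 + ((\<Sum>\<gamma>\<in>S. \<Sum>i\<in>UNIV. \<Sum>j\<in>UNIV. c \<gamma> $ i $ j * R' \<gamma> i j) + 0)) (at z)"
    by (intro DERIV_add DERIV_const)
  then show ?thesis unfolding field_differentiable_def by (auto simp: algebra_simps)
qed

lemma eventually_uniform_on_compact:
  fixes F :: "'a::heine_borel \<Rightarrow> 'b::metric_space \<Rightarrow> 'c::real_normed_vector"
  assumes F: "continuous_on UNIV (\<lambda>(z, x). F z x)" and K: "compact K" and "e > 0"
  shows "\<forall>\<^sub>F z in nhds a. \<forall>x\<in>K. norm (F z x - F a x) < e"
proof -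
  have "uniformly_continuous_on (cball a 1 \<times> K) (\<lambda>(z, x). F z x)"
    by (intro compact_uniformly_continuous continuous_on_subset[OF F] compact_Times compact_cball K) auto
  then obtain d where d: "d > 0" "\<And>y y'. y \<in> cball a 1 \<times> K \<Longrightarrow> y' \<in> cball a 1 \<times> K \<Longrightarrow> dist y' y < d \<Longrightarrow>
      dist (case y' of (z, x) \<Rightarrow> F z x) (case y of (z, x) \<Rightarrow> F z x) < e"
    unfolding uniformly_continuous_on_def using \<open>e > 0\<close> by metis
  have "norm (F z x - F a x) < e" if "dist z a < min d 1" "x \<in> K" for z x
    using d(2)[of "(a, x)" "(z, x)"] that by (simp add: dist_Pair_Pair dist_commute dist_norm norm_minus_commute)
  then show ?thesis using d(1) unfolding eventually_nhds_metric by (intro exI[of _ "min d 1"]) auto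
qed

lemma eventually_nhds_compose:
  "isCont f a \<Longrightarrow> eventually P (nhds (f a)) \<Longrightarrow> eventually (\<lambda>x. P (f x)) (nhds a)"
  unfolding continuous_at tendsto_at_iff_tendsto_nhds by (rule eventually_compose_filterlim)

lemma proj_class_self:
  assumes "\<And>x. mobius (mat 1) (d x) = d x"
  shows "d \<in> proj_class p d"
proof -
  have "isotopic_to_id p (\<lambda>x. x)"
    unfolding isotopic_to_id_def
    by (rule exI[of _ snd])
      (auto simp: diffeo_def smooth_ident inv_id[unfolded id_def] bij_id[unfolded id_def]
        intro: smooth_bounded_linear[OF bounded_linear_snd smooth_ident])
  moreover have "d = (\<lambda>x. mobius (mat 1) (d x))" using assms by simp
  moreover have "det (mat 1 :: cmat2) = 1" by simp
  ultimately show ?thesis unfolding proj_class_def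
    by (intro CollectI exI[of _ "mat 1"] exI[of _ "\<lambda>x. x"] conjI)
qed

section \<open>The holomorphic family over the upper half-plane\<close>

context deck_frame
begin

text \<open>Defined for every complex \<zeta>, so that continuity and differentiability need no
  domain; it is shown to be a developing map where Im \<zeta> > 0.\<close>

definition develop :: "complex \<Rightarrow> complex \<Rightarrow> cmat2" where
  "develop \<zeta> x = CP1_point (column1 (fl.\<Psi> \<zeta> x))"

definition hol :: "complex \<Rightarrow> (complex \<Rightarrow> complex) \<Rightarrow> cmat2" where
  "hol \<zeta> \<gamma> = fl.\<Psi> \<zeta> (\<gamma> 0) ** M2 (cnj (csqrt (\<kappa> \<gamma> 0))) 0 0 (csqrt (\<kappa> \<gamma> 0))"

lemma det_\<Psi>_1: "det (fl.\<Psi> \<zeta> x) = 1"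
  by (rule fl.det_\<Psi>) (rule trace_conn)

lemma deck_grafting_\<Psi>:
  fixes \<theta> :: real
  assumes "0 < s"
  shows "deck_grafting (\<lambda>x u. cos (\<theta> / 2) *\<^sub>R \<tau> x u + sin (\<theta> / 2) *\<^sub>R \<sigma> x u) \<omega>
     (\<lambda>x u. - sin (\<theta> / 2) *\<^sub>R \<tau> x u + cos (\<theta> / 2) *\<^sub>R \<sigma> x u) s (fl.\<Psi> (Complex \<theta> s)) p \<kappa>"
proof -
  have cs: "cos (\<theta> / 2) * cos (\<theta> / 2) + sin (\<theta> / 2) * sin (\<theta> / 2) = 1"
    using sin_cos_squared_add2[of "\<theta> / 2"] by (simp add: power2_eq_square)
  show ?thesis
  proof (intro deck_grafting.intro deck_grafting_axioms.intro grafting_frame.intro grafting_frame_axioms.intro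
      rotate[OF cs] rotate_deck[OF cs] assms det_\<Psi>_1 fl.\<Psi>_0)
    show "smooth (fl.\<Psi> (Complex \<theta> s))" by (rule smoothI, rule Ck_at, rule fl.\<Psi>_Ck)
    show "D (fl.\<Psi> (Complex \<theta> s)) x u = fl.\<Psi> (Complex \<theta> s) x **
      codazzi_frame.conn (\<lambda>x u. cos (\<theta> / 2) *\<^sub>R \<tau> x u + sin (\<theta> / 2) *\<^sub>R \<sigma> x u) \<omega>
        (\<lambda>x u. - sin (\<theta> / 2) *\<^sub>R \<tau> x u + cos (\<theta> / 2) *\<^sub>R \<sigma> x u) (\<i> * s) x u" for x u
      unfolding conn_rotate fl.D_\<Psi> Complex_eq ..
  qed
qed

lemma develop_props:
  assumes "0 < Im \<zeta>"
  shows "developing_map p (develop \<zeta>)" "holonomy p (develop \<zeta>) (hol \<zeta>)"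
    "SGr p (Im \<zeta>) (landslide p (Re \<zeta>) (\<lambda>x u v. \<tau> x u \<bullet> \<tau> x v, \<lambda>x u v. \<sigma> x u \<bullet> \<sigma> x v)) = proj_class p (develop \<zeta>)"
proof -
  interpret dg: deck_grafting "\<lambda>x u. cos (Re \<zeta> / 2) *\<^sub>R \<tau> x u + sin (Re \<zeta> / 2) *\<^sub>R \<sigma> x u" \<omega>
    "\<lambda>x u. - sin (Re \<zeta> / 2) *\<^sub>R \<tau> x u + cos (Re \<zeta> / 2) *\<^sub>R \<sigma> x u" "Im \<zeta>" "fl.\<Psi> \<zeta>" p \<kappa>
    using deck_grafting_\<Psi>[OF assms, of "Re \<zeta>"] by simp
  show "developing_map p (develop \<zeta>)" using dg.developing_map_dev by (simp add: develop_def[abs_def])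
  show "holonomy p (develop \<zeta>) (hol \<zeta>)" using dg.holonomy_dev by (simp add: develop_def[abs_def] hol_def[abs_def] dg.rep_def[abs_def])
  show "SGr p (Im \<zeta>) (landslide p (Re \<zeta>) (\<lambda>x u v. \<tau> x u \<bullet> \<tau> x v, \<lambda>x u v. \<sigma> x u \<bullet> \<sigma> x v)) = proj_class p (develop \<zeta>)"
    using dg.SGr_eq unfolding landslide_eq by (simp add: develop_def[abs_def])
qed

text \<open>A change of \<theta> by 2 pi reverses the signs of the cosine and sine of \<theta>/2,
  hence of both rotated forms, and the metrics are quadratic in these.\<close>

lemma landslide_cong:
  assumes "cis \<theta> = cis \<theta>'"
  shows "landslide p \<theta> (\<lambda>x u v. \<tau> x u \<bullet> \<tau> x v, \<lambda>x u v. \<sigma> x u \<bullet> \<sigma> x v) = landslide p \<theta>' (\<lambda>x u v. \<tau> x u \<bullet> \<tau> x v, \<lambda>x u v. \<sigma> x u \<bullet> \<sigma> x v)"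
proof -
  have "(cis (\<theta> / 2))\<^sup>2 = (cis (\<theta>' / 2))\<^sup>2" using assms by (simp add: power2_eq_square cis_mult)
  then have "cis (\<theta> / 2) = cis (\<theta>' / 2) \<or> cis (\<theta> / 2) = - cis (\<theta>' / 2)" by (simp add: power2_eq_iff)
  then consider "cos (\<theta> / 2) = cos (\<theta>' / 2)" "sin (\<theta> / 2) = sin (\<theta>' / 2)" |
    "cos (\<theta> / 2) = - cos (\<theta>' / 2)" "sin (\<theta> / 2) = - sin (\<theta>' / 2)"
    by (auto simp: complex_eq_iff)
  then show ?thesis
  proof cases
    case 2
    have "(- a) \<bullet> (- b) = a \<bullet> b" for a b :: complex by simp
    moreover have "- c *\<^sub>R z + - d *\<^sub>R w = - (c *\<^sub>R z + d *\<^sub>R w)" "- (- d) *\<^sub>R z + - c *\<^sub>R w = - (- d *\<^sub>R z + c *\<^sub>R w)"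
      for c d and z w :: complex by simp_all
    ultimately show ?thesis unfolding landslide_eq 2 by (simp only:)
  qed (simp add: landslide_eq)
qed

text \<open>\<open>Arg2pi q\<close> and Re \<zeta> agree only modulo 2 pi. As the landslide depends
  on \<open>cis \<theta>\<close> alone, the jump of the argument has no effect and any logarithm may
  be used.\<close>

lemma complex_landslide_eq:
  assumes "0 < Im \<zeta>"
  shows "complex_landslide p (exp (\<i> * \<zeta>)) (\<lambda>x u v. \<tau> x u \<bullet> \<tau> x v, \<lambda>x u v. \<sigma> x u \<bullet> \<sigma> x v) = proj_class p (develop \<zeta>)"
proof -
  let ?q = "exp (\<i> * \<zeta>)"
  have n: "norm ?q = exp (- Im \<zeta>)" by simp
  have "?q = of_real (exp (- Im \<zeta>)) * cis (Re \<zeta>)"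
    by (simp add: exp_eq_polar)
  moreover have "?q = of_real (norm ?q) * cis (Arg2pi ?q)"
    using conjunct2[OF conjunct2[OF Arg2pi[of ?q]]] by (simp only: is_Arg_def cis_conv_exp)
  ultimately have "cis (Arg2pi ?q) = cis (Re \<zeta>)" unfolding n by simp
  then show ?thesis unfolding complex_landslide_def landslide_cong[OF \<open>cis _ = _\<close>] n using develop_props(3)[OF assms] by simp
qed

lemma develop_Ck: "Ck k UNIV develop"
  using Ck_CP1_point_column1[OF open_UNIV fl.\<Psi>_Ck det_\<Psi>_1] by (simp add: develop_def[abs_def])

text \<open>A basic neighbourhood restricts finitely many derivatives on a compact set, and each of
  them is jointly continuous in (\<zeta>, x), hence uniformly close for nearby parameters.\<close>

lemma eventually_proj_class:
  assumes W: "openin (Proj_topology p) W" and \<zeta>: "0 < Im \<zeta>" "proj_class p (develop \<zeta>) \<in> W"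
  shows "\<forall>\<^sub>F z in nhds \<zeta>. 0 < Im z \<and> proj_class p (develop z) \<in> W"
proof -
  have "openin (dev_topology p) {d. developing_map p d \<and> proj_class p d \<in> W}"
    using W by (simp add: openin_Proj_topology)
  moreover have "develop \<zeta> \<in> {d. developing_map p d \<and> proj_class p d \<in> W}" using \<zeta> develop_props(1) by simp
  ultimately obtain K k e where K: "compact K" "0 < e"
    and nb: "dev_nbhd p (develop \<zeta>) K k e \<subseteq> {d. developing_map p d \<and> proj_class p d \<in> W}"
    unfolding openin_dev_topology by blast
  have fin: "finite {vs. set vs \<subseteq> {1, \<i>} \<and> length vs \<le> k}" by (rule finite_lists_length_le) simp
  have "\<forall>\<^sub>F z in nhds \<zeta>. \<forall>vs\<in>{vs. set vs \<subseteq> {1, \<i>} \<and> length vs \<le> k}.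
      \<forall>x\<in>K. norm (iter_deriv vs (develop z) x - iter_deriv vs (develop \<zeta>) x) < e"
  proof (rule eventually_ball_finite[OF fin], rule ballI)
    fix vs :: "complex list"
    have "Ck 0 UNIV (\<lambda>z. iter_deriv vs (develop z))" by (rule Ck_iter_deriv) (rule develop_Ck)
    then have "continuous_on UNIV (\<lambda>(z, x). iter_deriv vs (develop z) x)" by simp
    from eventually_uniform_on_compact[OF this K]
    show "\<forall>\<^sub>F z in nhds \<zeta>. \<forall>x\<in>K. norm (iter_deriv vs (develop z) x - iter_deriv vs (develop \<zeta>) x) < e" .
  qed
  moreover have "\<forall>\<^sub>F z in nhds \<zeta>. 0 < Im z"
    using \<zeta>(1) by (intro eventually_nhds_in_open[of "{z. 0 < Im z}", simplified] open_halfspace_Im_gt) auto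
  ultimately show ?thesis
  proof eventually_elim
    case (elim z)
    then have "develop z \<in> dev_nbhd p (develop \<zeta>) K k e" using develop_props(1) unfolding dev_nbhd_def by auto
    then show ?case using elim nb by auto
  qed
qed

lemma hol_differentiable: "(\<lambda>\<zeta>. hol \<zeta> \<gamma> $ i $ j) field_differentiable at z"
  unfolding hol_def cmat2_mult_nth
  by (intro field_differentiable_add field_differentiable_mult field_differentiable_const fl.\<Psi>_entry_differentiable)

text \<open>For z near \<zeta> the class stays in W' and \<open>hol z\<close> stays within r of
  \<open>hol \<zeta>\<close>, so continuity keeps the lifts in the range of the local formula and
  \<phi> becomes G of \<open>hol z\<close>.\<close>

lemma proj_function_differentiable:
  assumes W: "openin (Proj_topology p) W" and \<phi>: "Proj_holomorphic_function p W \<phi>"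
    and \<zeta>: "0 < Im \<zeta>" "proj_class p (develop \<zeta>) \<in> W"
  shows "(\<lambda>z. \<phi> (proj_class p (develop z))) field_differentiable at \<zeta>"
proof -
  have self: "develop z \<in> proj_class p (develop z)" for z
    by (rule proj_class_self) (simp add: develop_def mobius_CP1_point det_\<Psi>_1)
  obtain S r G W' where S: "finite S" "S \<subseteq> deck p" "0 < r" and W': "openin (Proj_topology p) W'" "proj_class p (develop \<zeta>) \<in> W'"
    and G: "\<And>R. (\<forall>\<gamma>\<in>S. norm (R \<gamma> - hol \<zeta> \<gamma>) < r) \<Longrightarrow> entrywise_complex_differentiable S G R"
    and eq: "\<And>Z' d' \<rho>'. Z' \<in> W' \<Longrightarrow> d' \<in> Z' \<Longrightarrow> holonomy p d' \<rho>' \<Longrightarrow> \<forall>\<gamma>\<in>S. norm (\<rho>' \<gamma> - hol \<zeta> \<gamma>) < r \<Longrightarrow> \<phi> Z' = G \<rho>'"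
    using \<phi>[unfolded Proj_holomorphic_function_def, rule_format, OF \<zeta>(2) self develop_props(2)[OF \<zeta>(1)]] by metis
  have "(\<lambda>z. G (hol z)) field_differentiable at \<zeta>"
    by (rule entrywise_field_differentiable[OF G S(1) hol_differentiable]) (simp add: S)
  then obtain D where D: "((\<lambda>z. G (hol z)) has_field_derivative D) (at \<zeta>)" unfolding field_differentiable_def by blast
  have "\<forall>\<^sub>F z in nhds \<zeta>. \<forall>\<gamma>\<in>S. norm (hol z \<gamma> - hol \<zeta> \<gamma>) < r"
  proof (intro eventually_ball_finite S(1) ballI)
    fix \<gamma> assume "\<gamma> \<in> S"
    have "isCont (\<lambda>z. hol z \<gamma>) \<zeta>"
      unfolding continuous_at by (intro vec_tendstoI) (use field_differentiable_imp_continuous_at[OF hol_differentiable] in \<open>simp add: continuous_at\<close>)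
    moreover have "\<forall>\<^sub>F X in nhds (hol \<zeta> \<gamma>). norm (X - hol \<zeta> \<gamma>) < r"
      using S(3) by (auto simp: eventually_nhds_metric dist_norm)
    ultimately show "\<forall>\<^sub>F z in nhds \<zeta>. norm (hol z \<gamma> - hol \<zeta> \<gamma>) < r" by (rule eventually_nhds_compose)
  qed
  with eventually_proj_class[OF W'(1) \<zeta>(1) W'(2)] have "\<forall>\<^sub>F z in nhds \<zeta>. \<phi> (proj_class p (develop z)) = G (hol z)"
  proof eventually_elim
    case (elim z)
    then show ?case using eq[of "proj_class p (develop z)" "develop z" "hol z"] self develop_props(2) by blast
  qed
  then show ?thesis
    using D unfolding field_differentiable_def by (subst DERIV_cong_ev[OF refl _ refl]) auto
qed

lemma holomorphic_into_Proj_landslide: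
  "holomorphic_into_Proj p {q. 0 < norm q \<and> norm q < 1}
     (\<lambda>q. complex_landslide p q (\<lambda>x u v. \<tau> x u \<bullet> \<tau> x v, \<lambda>x u v. \<sigma> x u \<bullet> \<sigma> x v))"
  (is "holomorphic_into_Proj p ?\<Omega> ?F")
proof -
  have loc: "\<exists>\<zeta>. (\<zeta> field_differentiable at q) \<and> 0 < Im (\<zeta> q) \<and> (\<forall>\<^sub>F w in nhds q. 0 < Im (\<zeta> w) \<longrightarrow> ?F w = proj_class p (develop (\<zeta> w)))"
    if "q \<in> ?\<Omega>" for q
  proof (intro exI conjI)
    \<comment> \<open>A logarithm of w divided by i, in a form holomorphic near any q: w / q is
      close to 1, away from the branch cut, and \<open>Ln q\<close> is constant.\<close>
    let ?\<zeta> = "\<lambda>w. - \<i> * (Ln (w / q) + Ln q)"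
    have q: "q \<noteq> 0" "norm q < 1" using that by auto
    show "?\<zeta> field_differentiable at q"
      using q by (intro field_differentiable_mult field_differentiable_add field_differentiable_const
          field_differentiable_compose[of "\<lambda>w. w / q" q Ln, unfolded o_def] field_differentiable_divide field_differentiable_ident
          field_differentiable_at_Ln) auto
    show "0 < Im (?\<zeta> q)" using q by simp
    have "\<forall>\<^sub>F w in nhds q. w \<noteq> 0" using q(1) by (intro t1_space_nhds)
    then show "\<forall>\<^sub>F w in nhds q. 0 < Im (?\<zeta> w) \<longrightarrow> ?F w = proj_class p (develop (?\<zeta> w))"
    proof eventually_elim
      case (elim w)
      have "exp (\<i> * ?\<zeta> w) = w" using elim q by (simp add: exp_add flip: mult.assoc)
      then show ?case using complex_landslide_eq[of "?\<zeta> w"] by simp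
    qed
  qed
  have ev: "\<forall>\<^sub>F w in nhds q. w \<in> ?\<Omega> \<and> ?F w \<in> W" if W: "openin (Proj_topology p) W" and q: "q \<in> ?\<Omega>" "?F q \<in> W" for q W
  proof -
    obtain \<zeta> where \<zeta>: "\<zeta> field_differentiable at q" "0 < Im (\<zeta> q)" "\<forall>\<^sub>F w in nhds q. 0 < Im (\<zeta> w) \<longrightarrow> ?F w = proj_class p (develop (\<zeta> w))"
      using loc[OF q(1)] by blast
    have "proj_class p (develop (\<zeta> q)) \<in> W" using eventually_nhds_x_imp_x[OF \<zeta>(3)] \<zeta>(2) q(2) by simp
    from eventually_nhds_compose[OF field_differentiable_imp_continuous_at[OF \<zeta>(1)] eventually_proj_class[OF W \<zeta>(2) this]]
    have "\<forall>\<^sub>F w in nhds q. 0 < Im (\<zeta> w) \<and> proj_class p (develop (\<zeta> w)) \<in> W" .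
    moreover have "open ?\<Omega>"
      by (intro open_Collect_conj open_Collect_less continuous_intros)
    then have "\<forall>\<^sub>F w in nhds q. w \<in> ?\<Omega>" using q(1) by (rule eventually_nhds_in_open)
    ultimately show ?thesis using \<zeta>(3) by eventually_elim simp
  qed
  have op: "open {q \<in> ?\<Omega>. ?F q \<in> W}" if "openin (Proj_topology p) W" for W
    unfolding open_subopen[of "{q \<in> ?\<Omega>. ?F q \<in> W}"]
  proof
    fix q assume "q \<in> {q \<in> ?\<Omega>. ?F q \<in> W}"
    then have "\<forall>\<^sub>F w in nhds q. w \<in> ?\<Omega> \<and> ?F w \<in> W" using ev[OF that] by simp
    then show "\<exists>T. open T \<and> q \<in> T \<and> T \<subseteq> {q \<in> ?\<Omega>. ?F q \<in> W}"
      unfolding eventually_nhds by blast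
  qed
  have "continuous_map (top_of_set ?\<Omega>) (Proj_topology p) ?F"
    unfolding continuous_map_def
  proof (intro conjI allI impI)
    have "?F q \<in> Proj p" if q: "q \<in> ?\<Omega>" for q
    proof -
      obtain \<zeta> where \<zeta>: "0 < Im (\<zeta> q)" "\<forall>\<^sub>F w in nhds q. 0 < Im (\<zeta> w) \<longrightarrow> ?F w = proj_class p (develop (\<zeta> w))"
        using loc[OF q] by blast
      have "?F q = proj_class p (develop (\<zeta> q))" using eventually_nhds_x_imp_x[OF \<zeta>(2)] \<zeta>(1) by simp
      then show ?thesis using develop_props(1)[OF \<zeta>(1)] by (auto simp: Proj_def)
    qed
    then show "?F \<in> topspace (top_of_set ?\<Omega>) \<rightarrow> topspace (Proj_topology p)" by (auto simp: topspace_Proj_topology)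
    fix W assume "openin (Proj_topology p) W"
    from op[OF this] show "openin (top_of_set ?\<Omega>) {q \<in> topspace (top_of_set ?\<Omega>). ?F q \<in> W}"
      by (simp add: open_openin_trans openin_open_eq) (metis (no_types, lifting) mem_Collect_eq open_subset subsetI)
  qed
  moreover have "(\<lambda>q. \<phi> (?F q)) holomorphic_on {q \<in> ?\<Omega>. ?F q \<in> W}"
    if W: "openin (Proj_topology p) W" and \<phi>: "Proj_holomorphic_function p W \<phi>" for W \<phi>
    unfolding holomorphic_on_open[OF op[OF W]]
  proof
    fix q assume q: "q \<in> {q \<in> ?\<Omega>. ?F q \<in> W}"
    then obtain \<zeta> where \<zeta>: "\<zeta> field_differentiable at q" "0 < Im (\<zeta> q)" "\<forall>\<^sub>F w in nhds q. 0 < Im (\<zeta> w) \<longrightarrow> ?F w = proj_class p (develop (\<zeta> w))"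
      using loc by blast
    have "proj_class p (develop (\<zeta> q)) \<in> W" using eventually_nhds_x_imp_x[OF \<zeta>(3)] \<zeta>(2) q by simp
    from field_differentiable_compose[OF \<zeta>(1) proj_function_differentiable[OF W \<phi> \<zeta>(2) this]]
    obtain D where D: "((\<lambda>w. \<phi> (proj_class p (develop (\<zeta> w)))) has_field_derivative D) (at q)"
      unfolding field_differentiable_def o_def by blast
    have "\<forall>\<^sub>F z in nhds (\<zeta> q). 0 < Im z"
      using \<zeta>(2) by (intro eventually_nhds_in_open[of "{z. 0 < Im z}", simplified] open_halfspace_Im_gt) auto
    from eventually_nhds_compose[OF field_differentiable_imp_continuous_at[OF \<zeta>(1)] this]
    have "\<forall>\<^sub>F w in nhds q. 0 < Im (\<zeta> w)" .
    with \<zeta>(3) have "\<forall>\<^sub>F w in nhds q. \<phi> (?F w) = \<phi> (proj_class p (develop (\<zeta> w)))" by eventually_elim simp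
    then show "\<exists>D. ((\<lambda>q. \<phi> (?F q)) has_field_derivative D) (at q)"
      using D by (subst DERIV_cong_ev[OF refl _ refl]) auto
  qed
  ultimately show ?thesis unfolding holomorphic_into_Proj_def by blast
qed

end

theorem corollary1p1:
  fixes A :: "'m::t2_space chart set" and p :: "complex \<Rightarrow> 'm" and g :: nat
    and X Xs :: "metric set" and h hs :: metric
  assumes "closed_oriented_surface A"
    and "surface_genus TYPE('m) g" and "g \<ge> 2"
    and "universal_cover A p"
    and "(X, Xs) \<in> Teich p \<times> Teich p"
    and "h \<in> X" and "hs \<in> Xs" and "\<exists>b. is_labourie p h hs b"
  shows "holomorphic_into_Proj p {q. 0 < norm q \<and> norm q < 1}
           (\<lambda>q. complex_landslide p q (h, hs))"
proof -
  obtain b where b: "is_labourie p h hs b" using assms(8) by blast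
  have A: "oriented_smooth_atlas A" using assms(1) by (simp add: closed_oriented_surface_def)
  have X: "X \<in> Teich p" using assms(5) by simp
  obtain \<tau> \<omega> \<sigma> \<kappa> where d: "deck_frame \<tau> \<omega> \<sigma> p \<kappa>" and h: "h = (\<lambda>x u v. \<tau> x u \<bullet> \<tau> x v)" "hs = (\<lambda>x u v. \<sigma> x u \<bullet> \<sigma> x v)"
    by (rule deck_frame_exists[OF A assms(4) X assms(6) b])
  show ?thesis unfolding h by (rule deck_frame.holomorphic_into_Proj_landslide[OF d])
qed

end
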